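(* For every $n\ge1$, the group $\mathrm{Diff}(S^1\times S^n)$ acts transitively on the set of smoothly embedded non-separating $n$-spheres in $S^1\times S^n$. Moreover, every smoothly embedded non-separating $n$-sphere in $S^1\times S^n$ is a fiber of a smooth fiber bundle $S^1\times S^n\to S^1$. *)

theory Defs
  imports "HOL-Analysis.Analysis"
begin

fun iter_pd :: "'a::euclidean_space list \<Rightarrow> ('a \<Rightarrow> 'b::real_normed_vector) \<Rightarrow> 'a \<Rightarrow> 'b" where
  "iter_pd [] f = f"
| "iter_pd (v # vs) f = (\<lambda>x. vector_derivative (\<lambda>t. iter_pd vs f (x + t *\<^sub>R v)) (at 0))"

definition smooth_on :: "'a::euclidean_space set \<Rightarrow> ('a \<Rightarrow> 'b::real_normed_vector) \<Rightarrow> bool" where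
  "smooth_on U f \<longleftrightarrow> open U \<and>
     (\<forall>vs. set vs \<subseteq> Basis \<longrightarrow>
        continuous_on U (iter_pd vs f) \<and>
        (\<forall>v\<in>Basis. \<forall>x\<in>U.
           ((\<lambda>t. iter_pd vs f (x + t *\<^sub>R v)) has_vector_derivative iter_pd (v # vs) f x) (at 0)))"

definition smooth_map_on :: "'a::euclidean_space set \<Rightarrow> ('a \<Rightarrow> 'b::real_normed_vector) \<Rightarrow> bool" where
  "smooth_map_on S f \<longleftrightarrow>
     (\<forall>x\<in>S. \<exists>U g. x \<in> U \<and> smooth_on U g \<and> (\<forall>y\<in>S \<inter> U. g y = f y))"

definition diffeomorphism_betw ::
  "'a::euclidean_space set \<Rightarrow> 'b::euclidean_space set \<Rightarrow> ('a \<Rightarrow> 'b) \<Rightarrow> bool" where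
  "diffeomorphism_betw S T f \<longleftrightarrow>
     smooth_map_on S f \<and> f ` S = T \<and>
     (\<exists>g. smooth_map_on T g \<and> g ` T = S \<and> (\<forall>x\<in>S. g (f x) = x) \<and> (\<forall>y\<in>T. f (g y) = y))"

abbreviation circle :: "complex set" where
  "circle \<equiv> sphere 0 1"

text \<open>The unit sphere S^n in R^(n+1), where n+1 = CARD('n).\<close>
abbreviation unit_sphere :: "(real ^ 'n::finite) set" where
  "unit_sphere \<equiv> sphere 0 1"

abbreviation S1_times_Sn :: "(complex \<times> (real ^ 'n::finite)) set" where
  "S1_times_Sn \<equiv> circle \<times> unit_sphere"

text \<open>A smooth embedding of the unit sphere S^n into a subset N of a Euclidean space:
  smooth, injective, a homeomorphism onto its image, and an immersion (the differential of
  any local smooth extension is injective on the tangent space {v. v \<bullet> x = 0}).\<close>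
definition smooth_sphere_embedding ::
  "(real ^ 'n::finite \<Rightarrow> 'b::euclidean_space) \<Rightarrow> 'b set \<Rightarrow> bool" where
  "smooth_sphere_embedding e N \<longleftrightarrow>
     smooth_map_on unit_sphere e \<and> e ` unit_sphere \<subseteq> N \<and> inj_on e unit_sphere \<and>
     homeomorphic_map (top_of_set unit_sphere) (top_of_set (e ` unit_sphere)) e \<and>
     (\<forall>x\<in>unit_sphere. \<forall>U g. x \<in> U \<and> smooth_on U g \<and> (\<forall>y\<in>unit_sphere \<inter> U. g y = e y) \<longrightarrow>
        (\<forall>v. v \<bullet> x = 0 \<and> frechet_derivative g (at x) v = 0 \<longrightarrow> v = 0))"

definition nonsep_spheres :: "(complex \<times> (real ^ 'n::finite)) set set" where
  "nonsep_spheres = {\<Sigma>. \<exists>e :: real ^ 'n \<Rightarrow> complex \<times> (real ^ 'n). smooth_sphere_embedding e S1_times_Sn \<and> \<Sigma> = e ` unit_sphere \<and>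
                          connected (S1_times_Sn - \<Sigma>)}"

text \<open>p : M \<rightarrow> S^1 is a smooth fiber bundle: smooth, surjective and smoothly locally trivial.
  Since all fibers of a locally trivial bundle over a connected base are diffeomorphic, the
  typical fiber of a trivialisation near a point z can be taken to be the fiber over z.\<close>
definition smooth_fiber_bundle_circle ::
  "'a::euclidean_space set \<Rightarrow> ('a \<Rightarrow> complex) \<Rightarrow> bool" where
  "smooth_fiber_bundle_circle M p \<longleftrightarrow>
     smooth_map_on M p \<and> p ` M = circle \<and>
     (\<forall>z\<in>circle. \<exists>V \<Phi>. openin (top_of_set circle) V \<and> z \<in> V \<and>
        diffeomorphism_betw {x\<in>M. p x \<in> V} (V \<times> {x\<in>M. p x = z}) \<Phi> \<and>
        (\<forall>x\<in>M. p x \<in> V \<longrightarrow> fst (\<Phi> x) = p x))"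

end

theory Submission
  imports Defs
begin

text \<open>
  The space \<open>X - {0}\<close> with \<open>X = real ^ 'n\<close> covers \<open>S\<^sup>1 \<times> S\<^sup>n\<close> with the dilations by powers of some \<open>c > 1\<close>
  as deck group.  An embedded sphere lifts to \<open>X - {0}\<close>: for \<open>n \<ge> 2\<close> because the sphere is simply
  connected, for \<open>n = 1\<close> after an automorphism of the torus that makes the first component
  null-homotopic.  By Jordan-Brouwer the lift \<open>S\<close> bounds a bounded domain \<open>A\<close>, and \<open>0\<close> lies in \<open>A\<close> because
  the sphere is non-separating.  It remains to see that the region between \<open>S\<close> and its translate
  \<open>c S\<close> is a product; its parametrisation then descends to a diffeomorphism that carries
  \<open>{1} \<times> S\<^sup>n\<close> to the given sphere, and both claims follow.

  Whether \<open>S\<close> itself bounds a smooth ball is irrelevant.  For large \<open>L\<close>, the region between \<open>S\<close> and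
  \<open>L S\<close> is the exterior of \<open>S\<close> within a large round ball, followed by the interior of \<open>L S\<close> without
  a small round ball.  After squeezing, these two pieces are round annuli with a small hole into
  which the complementary piece is plugged, and moving the two holes past each other turns the
  composition into a standard annulus.  Hence the regions between \<open>S\<close> and
  \<open>c ^ k S\<close> and between \<open>S\<close> and \<open>c ^ (k + 1) S\<close> are products for large \<open>k\<close>, and comparing the two gives the
  region between \<open>c ^ k S\<close> and \<open>c ^ (k + 1) S\<close>.
\<close>

subsection \<open>Smooth functions\<close>

text \<open>The obstacle is the smooth Schoenflies question: for \<open>CARD('n) = 4\<close> it is
  unknown whether the domain bounded by a smooth sphere is a smooth ball, so no parametrisation of
  \<open>A\<close> is at hand. What holds in every dimension is the disc lemma: an orientation
  preserving embedding becomes the identity near a point after a compactly supported diffeomorphism.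
  It turns each side of the sphere into a piece that can be cut out and plugged in elsewhere. Since
  such diffeomorphisms preserve orientation, Jacobians are kept positive throughout.

  Maps are glued from pieces, so every construction keeps exact formulas on open sets:
  parametrisations equal \<open>E\<close> near the unit sphere, and the model is the identity near 0
  and near infinity. The final \<open>T\<close> satisfies
  \<open>T (s *\<^sub>R y) = c *\<^sub>R T y\<close> near the unit sphere, and this equivariance
  makes the quotient map smooth across the seam.

  There must be room for two holes between the sphere and its dilate, so the exchange of holes is
  available for large factors \<open>L\<close> only; hence the detour through two consecutive large
  powers of \<open>c\<close>.\<close>

primrec Ck :: "nat \<Rightarrow> 'a::euclidean_space set \<Rightarrow> ('a \<Rightarrow> 'b::real_normed_vector) \<Rightarrow> bool" where
  "Ck 0 U f = continuous_on U f"
| "Ck (Suc k) U f = ((\<forall>x\<in>U. f differentiable (at x)) \<and>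
     (\<forall>v\<in>Basis. Ck k U (\<lambda>x. frechet_derivative f (at x) v)))"

lemma frechet_cong_open:
  assumes "open U" "x \<in> U" "\<And>y. y \<in> U \<Longrightarrow> f y = g y"
  shows "frechet_derivative f (at x) = frechet_derivative g (at x)"
proof -
  have "(f has_derivative D) (at x) \<longleftrightarrow> (g has_derivative D) (at x)" for D
    using has_derivative_transform_within_open[OF _ assms(1,2), where f=f and g=g and f'=D] has_derivative_transform_within_open[OF _ assms(1,2), where f=g and g=f and f'=D] assms(3) by metis
  then show ?thesis by (simp add: frechet_derivative_def)
qed

lemma differentiable_cong_open:
  assumes "open U" "x \<in> U" "\<And>y. y \<in> U \<Longrightarrow> f y = g y" "f differentiable (at x)"
  shows "g differentiable (at x)"
proof -
  obtain D where "(f has_derivative D) (at x)" using assms(4) by (auto simp: differentiable_def)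
  from has_derivative_transform_within_open[OF this assms(1,2)] assms(3)
  show ?thesis by (auto simp: differentiable_def)
qed

lemma Ck_cong:
  assumes "open U" "\<And>x. x \<in> U \<Longrightarrow> f x = g x" "Ck k U f"
  shows "Ck k U g"
  using assms(2,3)
proof (induction k arbitrary: f g)
  case 0
  then show ?case by (metis Ck.simps(1) continuous_on_cong)
next
  case (Suc k)
  have eq: "frechet_derivative f (at x) = frechet_derivative g (at x)" if "x \<in> U" for x
    using frechet_cong_open[OF \<open>open U\<close> that] Suc.prems by blast
  have "Ck k U (\<lambda>x. frechet_derivative g (at x) v)" if "v \<in> Basis" for v
    by (rule Suc.IH[of "\<lambda>x. frechet_derivative f (at x) v"]) (use eq Suc.prems that in auto)
  moreover have "g differentiable (at x)" if "x \<in> U" for x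
    using differentiable_cong_open[OF \<open>open U\<close> that, of f g] Suc.prems that by auto
  ultimately show ?case by simp
qed

lemma Ck_I:
  assumes "open U" "\<And>x. x \<in> U \<Longrightarrow> (f has_derivative f' x) (at x)"
    "\<And>v. v \<in> Basis \<Longrightarrow> Ck k U (\<lambda>x. f' x v)"
  shows "Ck (Suc k) U f"
proof -
  have "frechet_derivative f (at x) = f' x" if "x \<in> U" for x
    using frechet_derivative_at[OF assms(2)[OF that]] by simp
  then have "Ck k U (\<lambda>x. frechet_derivative f (at x) v)" if "v \<in> Basis" for v
    using Ck_cong[OF \<open>open U\<close> _ assms(3)[OF that]] by simp
  then show ?thesis using assms(2) by (auto simp: differentiable_def)
qed

lemma Ck_Suc_imp: "Ck (Suc k) U f \<Longrightarrow> Ck k U f"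
proof (induction k arbitrary: f)
  case 0
  then show ?case
    by (simp add: continuous_at_imp_continuous_on differentiable_imp_continuous_within)
next
  case (Suc k)
  then show ?case by (metis Ck.simps(2))
qed

lemma Ck_has_derivative:
  assumes "Ck (Suc k) U f" "x \<in> U"
  shows "(f has_derivative frechet_derivative f (at x)) (at x)"
  using assms by (simp add: frechet_derivative_works)

lemma Ck_subset: "Ck k U f \<Longrightarrow> V \<subseteq> U \<Longrightarrow> Ck k V f"
  by (induction k arbitrary: f) (auto intro: continuous_on_subset)

lemma Ck_const: "open U \<Longrightarrow> Ck k U (\<lambda>x. c)"
proof (induction k arbitrary: c)
  case (Suc k)
  show ?case by (rule Ck_I[where f' = "\<lambda>x v. 0"]) (use Suc in auto)
qed auto

lemma Ck_linear:
  assumes "bounded_linear h" "open U" "Ck k U f"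
  shows "Ck k U (\<lambda>x. h (f x))"
  using assms(3)
proof (induction k arbitrary: f)
  case 0
  then show ?case using assms(1) by (simp add: bounded_linear.continuous_on)
next
  case (Suc k)
  show ?case
  proof (rule Ck_I[where f' = "\<lambda>x v. h (frechet_derivative f (at x) v)"])
    show "((\<lambda>x. h (f x)) has_derivative (\<lambda>v. h (frechet_derivative f (at x) v))) (at x)"
      if "x \<in> U" for x
      using bounded_linear.has_derivative[OF assms(1) Ck_has_derivative[OF Suc.prems that]] .
  qed (use Suc assms in auto)
qed

lemma Ck_id: "open U \<Longrightarrow> Ck k U (\<lambda>x. x)"
proof (cases k)
  case (Suc j)
  assume "open U"
  show ?thesis unfolding Suc
    by (rule Ck_I[where f' = "\<lambda>x v. v"]) (use \<open>open U\<close> in \<open>auto intro: Ck_const\<close>)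
qed auto

lemma Ck_add:
  assumes "open U" "Ck k U f" "Ck k U g"
  shows "Ck k U (\<lambda>x. f x + g x)"
  using assms(2,3)
proof (induction k arbitrary: f g)
  case 0
  then show ?case by (simp add: continuous_on_add)
next
  case (Suc k)
  show ?case
  proof (rule Ck_I[where f' = "\<lambda>x v. frechet_derivative f (at x) v + frechet_derivative g (at x) v"])
    show "((\<lambda>x. f x + g x) has_derivative
        (\<lambda>v. frechet_derivative f (at x) v + frechet_derivative g (at x) v)) (at x)" if "x \<in> U" for x
      by (intro has_derivative_add Ck_has_derivative[OF Suc.prems(1) that] Ck_has_derivative[OF Suc.prems(2) that])
  qed (use Suc assms in auto)
qed

lemma Ck_sum:
  assumes "open U" "finite I" "\<And>i. i \<in> I \<Longrightarrow> Ck k U (f i)"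
  shows "Ck k U (\<lambda>x. \<Sum>i\<in>I. f i x)"
  using assms(2,3) by (induction I rule: finite_induct) (auto intro: Ck_const Ck_add assms(1))

lemma Ck_bilinear:
  assumes "bounded_bilinear h" "open U" "Ck k U f" "Ck k U g"
  shows "Ck k U (\<lambda>x. h (f x) (g x))"
  using assms(3,4)
proof (induction k arbitrary: f g)
  case 0
  then show ?case using assms(1) by (simp add: bounded_bilinear.continuous_on)
next
  case (Suc k)
  show ?case
  proof (rule Ck_I[where f' = "\<lambda>x v. h (f x) (frechet_derivative g (at x) v) + h (frechet_derivative f (at x) v) (g x)"])
    show "((\<lambda>x. h (f x) (g x)) has_derivative
        (\<lambda>v. h (f x) (frechet_derivative g (at x) v) + h (frechet_derivative f (at x) v) (g x))) (at x)"
      if "x \<in> U" for x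
      by (intro bounded_bilinear.FDERIV[OF assms(1)] Ck_has_derivative[OF Suc.prems(1) that] Ck_has_derivative[OF Suc.prems(2) that])
    show "Ck k U (\<lambda>x. h (f x) (frechet_derivative g (at x) v) + h (frechet_derivative f (at x) v) (g x))"
      if "v \<in> Basis" for v
      using Suc that by (intro Ck_add \<open>open U\<close> Suc.IH Ck_Suc_imp[OF Suc.prems(1)] Ck_Suc_imp[OF Suc.prems(2)]) auto
  qed (use assms in auto)
qed

lemma linear_eq_basis_sum:
  fixes L :: "'a::euclidean_space \<Rightarrow> 'b::real_normed_vector"
  assumes "linear L"
  shows "L v = (\<Sum>b\<in>Basis. (v \<bullet> b) *\<^sub>R L b)"
proof -
  have "L v = L (\<Sum>b\<in>Basis. (v \<bullet> b) *\<^sub>R b)" by (simp add: euclidean_representation)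
  also have "\<dots> = (\<Sum>b\<in>Basis. (v \<bullet> b) *\<^sub>R L b)"
    using assms by (simp add: linear_sum linear_scale)
  finally show ?thesis .
qed

text \<open>\<open>Ck\<close> controls the derivatives of \<open>g\<close> in basis directions only,
  whereas the chain rule differentiates \<open>g\<close> in the direction \<open>?f x v\<close>,
  which moves with \<open>x\<close>. Expanding this direction in the basis gives a sum of products
  to which the induction hypothesis applies.\<close>

lemma Ck_compose:
  fixes f :: "'a::euclidean_space \<Rightarrow> 'b::euclidean_space" and g :: "'b \<Rightarrow> 'c::real_normed_vector"
  assumes "open U" "open V" "Ck k U f" "Ck k V g" "f ` U \<subseteq> V"
  shows "Ck k U (\<lambda>x. g (f x))"
  using assms(3-5)
proof (induction k arbitrary: f g)
  case 0
  then show ?case by (metis Ck.simps(1) continuous_on_compose2)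
next
  case (Suc k)
  let ?f = "\<lambda>x. frechet_derivative f (at x)" and ?g = "\<lambda>x. frechet_derivative g (at x)"
  have lin: "linear (?g (f x))" if "x \<in> U" for x
    using Ck_has_derivative[OF Suc.prems(2)] that Suc.prems(3)
    by (meson has_derivative_linear image_subset_iff)
  show ?case
  proof (rule Ck_I[where f' = "\<lambda>x v. ?g (f x) (?f x v)"])
    show "((\<lambda>x. g (f x)) has_derivative (\<lambda>v. ?g (f x) (?f x v))) (at x)" if "x \<in> U" for x
      using has_derivative_compose[OF Ck_has_derivative[OF Suc.prems(1) that]
          Ck_has_derivative[OF Suc.prems(2), of "f x"]] that Suc.prems(3) by auto
    show "Ck k U (\<lambda>x. ?g (f x) (?f x v))" if v: "v \<in> Basis" for v
    proof (rule Ck_cong[OF \<open>open U\<close>])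
      show "(\<Sum>b\<in>Basis. (?f x v \<bullet> b) *\<^sub>R ?g (f x) b) = ?g (f x) (?f x v)" if "x \<in> U" for x
        using linear_eq_basis_sum[OF lin[OF that], of "?f x v"] by simp
      show "Ck k U (\<lambda>x. \<Sum>b\<in>Basis. (?f x v \<bullet> b) *\<^sub>R ?g (f x) b)"
      proof (intro Ck_sum Ck_bilinear[OF bounded_bilinear_scaleR] \<open>open U\<close> finite_Basis)
        fix b :: 'b assume b: "b \<in> Basis"
        show "Ck k U (\<lambda>x. ?f x v \<bullet> b)"
          using Suc.prems(1) v by (intro Ck_linear[OF bounded_linear_inner_left] \<open>open U\<close>) auto
        show "Ck k U (\<lambda>x. ?g (f x) b)"
          using Suc.prems b by (intro Suc.IH Ck_Suc_imp[OF Suc.prems(1)]) auto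
      qed
    qed
  qed fact
qed

lemma Ck_local:
  assumes "\<And>x. x \<in> U \<Longrightarrow> \<exists>V. open V \<and> x \<in> V \<and> Ck k V f"
  shows "Ck k U f"
  using assms
proof (induction k arbitrary: f)
  case 0
  then show ?case
    by simp (metis continuous_at_imp_continuous_on continuous_on_eq_continuous_at)
next
  case (Suc k)
  have "f differentiable (at x)" if "x \<in> U" for x
    using Suc.prems[OF that] by auto
  moreover have "Ck k U (\<lambda>x. frechet_derivative f (at x) v)" if "v \<in> Basis" for v
    by (rule Suc.IH) (use Suc.prems that in fastforce)
  ultimately show ?case by simp
qed

text \<open>The increment is telescoped one coordinate at a time.\<close>

lemma continuous_partials_imp_has_derivative:
  fixes f :: "'a::euclidean_space \<Rightarrow> 'b::real_normed_vector"
  assumes U: "open U" and x: "x \<in> U"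
    and D: "\<And>b y. b \<in> Basis \<Longrightarrow> y \<in> U \<Longrightarrow>
        ((\<lambda>t. f (y + t *\<^sub>R b)) has_vector_derivative D b y) (at 0)"
    and cont: "\<And>b. b \<in> Basis \<Longrightarrow> continuous_on U (D b)"
  shows "(f has_derivative (\<lambda>h. \<Sum>b\<in>Basis. (h \<bullet> b) *\<^sub>R D b x)) (at x)"
proof -
  have main: "\<exists>d>0. \<forall>h. norm h < d \<longrightarrow>
      norm (f (x + h) - f x - (\<Sum>b\<in>Basis. (h \<bullet> b) *\<^sub>R D b x)) \<le> e * norm h" if e: "e > 0" for e
  proof -
    define N where "N = real (DIM('a))"
    have N: "N > 0" by (simp add: N_def)
    have "\<exists>d>0. \<forall>y. dist y x < d \<longrightarrow> y \<in> U \<and> (\<forall>b\<in>Basis. norm (D b y - D b x) \<le> e / N)"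
    proof -
      have "\<forall>\<^sub>F y in nhds x. \<forall>b\<in>Basis. norm (D b y - D b x) \<le> e / N"
      proof (rule eventually_ball_finite)
        show "\<forall>b\<in>Basis. \<forall>\<^sub>F y in nhds x. norm (D b y - D b x) \<le> e / N"
        proof
          fix b :: 'a assume b: "b \<in> Basis"
          have "isCont (D b) x" using cont[OF b] U x continuous_on_eq_continuous_at by blast
          then have "(D b \<longlongrightarrow> D b x) (nhds x)"
            by (simp add: isCont_def tendsto_at_iff_tendsto_nhds)
          then have "\<forall>\<^sub>F y in nhds x. dist (D b y) (D b x) < e / N"
            using e N by (intro tendstoD) auto
          then show "\<forall>\<^sub>F y in nhds x. norm (D b y - D b x) \<le> e / N"
            by eventually_elim (simp add: dist_norm)
        qed
      qed simp
      moreover have "\<forall>\<^sub>F y in nhds x. y \<in> U" using U x by (rule eventually_nhds_in_open)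
      ultimately have "\<forall>\<^sub>F y in nhds x. y \<in> U \<and> (\<forall>b\<in>Basis. norm (D b y - D b x) \<le> e / N)"
        by eventually_elim auto
      then show ?thesis by (simp add: eventually_nhds_metric)
    qed
    then obtain d where d: "d > 0"
      "\<And>y. dist y x < d \<Longrightarrow> y \<in> U" "\<And>y b. dist y x < d \<Longrightarrow> b \<in> Basis \<Longrightarrow> norm (D b y - D b x) \<le> e / N"
      by blast
    have step: "norm (f (x + (\<Sum>b\<in>S. (h \<bullet> b) *\<^sub>R b)) - f x - (\<Sum>b\<in>S. (h \<bullet> b) *\<^sub>R D b x))
        \<le> real (card S) * (e / N * norm h)" if "S \<subseteq> Basis" "norm h < d" for S h
    proof -
      have "finite S" using that(1) finite_Basis finite_subset by blast
      then show ?thesis using that(1)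
      proof (induction S)
        case (insert c S)
        then have c: "c \<in> Basis" and S: "S \<subseteq> Basis" by auto
        define p where "p = x + (\<Sum>b\<in>S. (h \<bullet> b) *\<^sub>R b)"
        have inner_S: "(\<Sum>b\<in>S. (h \<bullet> b) *\<^sub>R b) \<bullet> i = (if i \<in> S then h \<bullet> i else 0)" if "i \<in> Basis" for i
        proof -
          have "(\<Sum>b\<in>S. (h \<bullet> b) *\<^sub>R b) \<bullet> i = (\<Sum>b\<in>S. if b = i then h \<bullet> b else 0)"
            using S that by (auto simp: inner_sum_left inner_Basis intro!: sum.cong)
          also have "\<dots> = (if i \<in> S then h \<bullet> i else 0)"
            using insert.hyps(1) by simp
          finally show ?thesis .
        qed
        have near: "dist (p + t *\<^sub>R c) x < d" if "\<bar>t\<bar> \<le> \<bar>h \<bullet> c\<bar>" for t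
        proof -
          have "norm ((\<Sum>b\<in>S. (h \<bullet> b) *\<^sub>R b) + t *\<^sub>R c) \<le> norm h"
          proof (rule norm_le_componentwise)
            fix i :: 'a assume i: "i \<in> Basis"
            show "\<bar>((\<Sum>b\<in>S. (h \<bullet> b) *\<^sub>R b) + t *\<^sub>R c) \<bullet> i\<bar> \<le> \<bar>h \<bullet> i\<bar>"
              using inner_S[OF i] insert.hyps(2) that i c by (auto simp: inner_add_left inner_Basis)
          qed
          then show ?thesis using \<open>norm h < d\<close> by (simp add: p_def dist_norm algebra_simps)
        qed
        define g where "g = (\<lambda>t. f (p + t *\<^sub>R c) - t *\<^sub>R D c x)"
        define J where "J = {- \<bar>h \<bullet> c\<bar>..\<bar>h \<bullet> c\<bar>}"
        have der: "(g has_derivative (\<lambda>s. s *\<^sub>R (D c (p + t *\<^sub>R c) - D c x))) (at t within J)"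
          if "t \<in> J" for t
        proof -
          have tU: "p + t *\<^sub>R c \<in> U" using near[of t] that d(2) by (auto simp: J_def)
          have "((\<lambda>s. f ((p + t *\<^sub>R c) + s *\<^sub>R c)) has_vector_derivative D c (p + t *\<^sub>R c)) (at 0)"
            by (rule D[OF c tU])
          then have "((\<lambda>s. f ((p + t *\<^sub>R c) + s *\<^sub>R c)) \<circ> (\<lambda>u. u - t) has_vector_derivative 1 *\<^sub>R D c (p + t *\<^sub>R c)) (at t)"
            by (intro vector_diff_chain_at) (auto intro!: derivative_eq_intros)
          then have "((\<lambda>s. f (p + s *\<^sub>R c)) has_vector_derivative D c (p + t *\<^sub>R c)) (at t)"
            by (simp add: o_def algebra_simps)
          then have "(g has_vector_derivative D c (p + t *\<^sub>R c) - D c x) (at t)"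
            unfolding g_def by (auto intro!: derivative_eq_intros)
          then show ?thesis
            by (auto simp: has_vector_derivative_def intro: has_derivative_at_withinI)
        qed
        have "norm (g (h \<bullet> c) - g 0) \<le> e / N * norm (h \<bullet> c - 0)"
        proof (rule differentiable_bound[of J g "\<lambda>t s. s *\<^sub>R (D c (p + t *\<^sub>R c) - D c x)"])
          show "convex J" by (simp add: J_def)
          show "(g has_derivative (\<lambda>s. s *\<^sub>R (D c (p + t *\<^sub>R c) - D c x))) (at t within J)" if "t \<in> J" for t
            using der[OF that] .
          show "onorm (\<lambda>s. s *\<^sub>R (D c (p + t *\<^sub>R c) - D c x)) \<le> e / N" if "t \<in> J" for t
          proof (rule onorm_le)
            fix s :: real
            have "norm (D c (p + t *\<^sub>R c) - D c x) \<le> e / N"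
              using near[of t] that d(3) c by (auto simp: J_def)
            then have "\<bar>s\<bar> * norm (D c (p + t *\<^sub>R c) - D c x) \<le> \<bar>s\<bar> * (e / N)"
              by (rule mult_left_mono) simp
            then show "norm (s *\<^sub>R (D c (p + t *\<^sub>R c) - D c x)) \<le> e / N * norm s"
              by (simp add: mult.commute)
          qed
        qed (auto simp: J_def)
        also have "\<dots> \<le> e / N * norm h"
          using e N c by (intro mult_left_mono) (auto simp: Basis_le_norm)
        finally have 1: "norm (f (p + (h \<bullet> c) *\<^sub>R c) - f p - (h \<bullet> c) *\<^sub>R D c x) \<le> e / N * norm h"
          by (simp add: g_def algebra_simps)
        have 2: "norm (f p - f x - (\<Sum>b\<in>S. (h \<bullet> b) *\<^sub>R D b x)) \<le> real (card S) * (e / N * norm h)"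
          using insert.IH S by (simp add: p_def)
        have "f (x + (\<Sum>b\<in>insert c S. (h \<bullet> b) *\<^sub>R b)) - f x - (\<Sum>b\<in>insert c S. (h \<bullet> b) *\<^sub>R D b x)
          = (f (p + (h \<bullet> c) *\<^sub>R c) - f p - (h \<bullet> c) *\<^sub>R D c x) + (f p - f x - (\<Sum>b\<in>S. (h \<bullet> b) *\<^sub>R D b x))"
          using insert.hyps by (simp add: p_def algebra_simps)
        then show ?case
          using norm_triangle_mono[OF 1 2] insert.hyps by (simp add: algebra_simps add_divide_distrib)
      qed simp
    qed
    show ?thesis
    proof (intro exI conjI allI impI)
      show "d > 0" by fact
      fix h :: 'a assume "norm h < d"
      from step[OF subset_refl this]
      show "norm (f (x + h) - f x - (\<Sum>b\<in>Basis. (h \<bullet> b) *\<^sub>R D b x)) \<le> e * norm h"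
        using N by (simp add: euclidean_representation N_def)
    qed
  qed
  show ?thesis unfolding has_derivative_at_alt
  proof (intro conjI allI impI)
    show "bounded_linear (\<lambda>h. \<Sum>b\<in>Basis. (h \<bullet> b) *\<^sub>R D b x)"
      by (intro bounded_linear_sum bounded_linear_scaleR_const bounded_linear_inner_left_comp bounded_linear_ident)
    fix e :: real assume "0 < e"
    from main[OF this] obtain d where d: "d > 0" "\<And>h. norm h < d \<Longrightarrow>
      norm (f (x + h) - f x - (\<Sum>b\<in>Basis. (h \<bullet> b) *\<^sub>R D b x)) \<le> e * norm h" by blast
    show "\<exists>d>0. \<forall>y. norm (y - x) < d \<longrightarrow>
        norm (f y - f x - (\<Sum>b\<in>Basis. ((y - x) \<bullet> b) *\<^sub>R D b x)) \<le> e * norm (y - x)"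
      using d(1) d(2)[of "y - x" for y] by (auto intro!: exI[of _ d])
  qed
qed

section \<open>Iterated partial derivatives and iterated total derivatives\<close>

lemma iter_pd_append: "iter_pd (vs @ [b]) f = iter_pd vs (iter_pd [b] f)"
  by (induction vs) auto

lemma iter_pd_cong:
  assumes "open U" "\<And>y. y \<in> U \<Longrightarrow> f y = g y" "x \<in> U"
  shows "iter_pd vs f x = iter_pd vs g x"
  using assms(3)
proof (induction vs arbitrary: x)
  case Nil
  then show ?case using assms by simp
next
  case (Cons v vs)
  have "\<forall>\<^sub>F t in nhds 0. x + t *\<^sub>R v \<in> U"
  proof -
    have "((\<lambda>t. x + t *\<^sub>R v) \<longlongrightarrow> x + 0 *\<^sub>R v) (nhds 0)" by (intro tendsto_intros filterlim_ident)
    then show ?thesis using assms(1) Cons.prems by (auto dest: topological_tendstoD)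
  qed
  then have ev: "\<forall>\<^sub>F t in nhds 0. iter_pd vs f (x + t *\<^sub>R v) = iter_pd vs g (x + t *\<^sub>R v)"
    by eventually_elim (rule Cons.IH)
  have "((\<lambda>t. iter_pd vs f (x + t *\<^sub>R v)) has_vector_derivative D) (at 0)
     \<longleftrightarrow> ((\<lambda>t. iter_pd vs g (x + t *\<^sub>R v)) has_vector_derivative D) (at 0)" for D
    by (rule has_vector_derivative_cong_ev) (use ev Cons.IH[OF Cons.prems] in \<open>auto elim: eventually_mono\<close>)
  then show ?case by (simp add: vector_derivative_def)
qed

text \<open>The head of the list is the outermost derivative, so the derivative taken first is
  appended at the end of the list.\<close>

lemma smooth_on_partial:
  assumes "smooth_on U f" "b \<in> Basis"
  shows "smooth_on U (iter_pd [b] f)"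
proof -
  have "continuous_on U (iter_pd (vs @ [b]) f) \<and> (\<forall>v\<in>Basis. \<forall>x\<in>U.
      ((\<lambda>t. iter_pd (vs @ [b]) f (x + t *\<^sub>R v)) has_vector_derivative iter_pd (v # (vs @ [b])) f x) (at 0))"
    if "set vs \<subseteq> Basis" for vs
  proof -
    have "set (vs @ [b]) \<subseteq> Basis" using that assms(2) by simp
    then show ?thesis using assms(1) unfolding smooth_on_def by blast
  qed
  moreover have "open U" using assms(1) by (simp add: smooth_on_def)
  ultimately show ?thesis
    unfolding smooth_on_def by (metis iter_pd_append append_Cons)
qed

lemma has_vector_derivative_direction:
  assumes "(f has_derivative D) (at (x::'a::real_normed_vector))"
  shows "((\<lambda>t. f (x + t *\<^sub>R v)) has_vector_derivative D v) (at 0)"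
proof -
  have "((\<lambda>t. x + t *\<^sub>R v) has_derivative (\<lambda>t. t *\<^sub>R v)) (at 0)"
    by (auto intro!: derivative_eq_intros)
  from has_derivative_compose[OF this, of f D] assms
  have "((\<lambda>t. f (x + t *\<^sub>R v)) has_derivative (\<lambda>t. D (t *\<^sub>R v))) (at 0)" by simp
  moreover have "linear D" using assms by (simp add: has_derivative_linear)
  ultimately show ?thesis by (simp add: has_vector_derivative_def linear_scale)
qed

lemma smooth_on_imp_Ck: "smooth_on U f \<Longrightarrow> Ck k U f"
proof (induction k arbitrary: f)
  case 0
  then show ?case unfolding smooth_on_def by (metis Ck.simps(1) empty_subsetI iter_pd.simps(1) list.set(1))
next
  case (Suc k)
  then have sm: "smooth_on U f" by simp
  have op: "open U" using sm by (simp add: smooth_on_def)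
  show ?case
  proof (rule Ck_I[where f' = "\<lambda>x h. \<Sum>b\<in>Basis. (h \<bullet> b) *\<^sub>R iter_pd [b] f x"])
    show "(f has_derivative (\<lambda>h. \<Sum>b\<in>Basis. (h \<bullet> b) *\<^sub>R iter_pd [b] f x)) (at x)" if "x \<in> U" for x
    proof (rule continuous_partials_imp_has_derivative[OF op that])
      show "((\<lambda>t. f (y + t *\<^sub>R b)) has_vector_derivative iter_pd [b] f y) (at 0)"
        if "b \<in> Basis" "y \<in> U" for b y
        using sm that unfolding smooth_on_def by (metis empty_subsetI iter_pd.simps(1) list.set(1))
      show "continuous_on U (iter_pd [b] f)" if "b \<in> Basis" for b
        using sm that unfolding smooth_on_def
        by (metis insert_subset empty_subsetI list.set(1) list.simps(15))
    qed
    show "Ck k U (\<lambda>x. \<Sum>b\<in>Basis. (v \<bullet> b) *\<^sub>R iter_pd [b] f x)" for v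
      by (intro Ck_sum Ck_linear[OF bounded_linear_scaleR_right] op finite_Basis Suc.IH smooth_on_partial sm)
  qed fact
qed

text \<open>\<open>iter_pd\<close> is a total function with unknown values off \<open>U\<close>, so
  it is compared with a \<open>g\<close> that agrees with it on \<open>U\<close> only. As
  \<open>U\<close> is open, the next partial derivative at a point of \<open>U\<close> sees nothing
  else.\<close>

lemma Ck_imp_iter_pd:
  assumes "open U" "\<And>k. Ck k U f" "set vs \<subseteq> Basis"
  shows "\<exists>g. (\<forall>k. Ck k U g) \<and> (\<forall>x\<in>U. iter_pd vs f x = g x)"
  using assms(2,3)
proof (induction vs arbitrary: f)
  case Nil
  then show ?case by auto
next
  case (Cons v vs)
  have vs: "set vs \<subseteq> Basis" using Cons.prems(2) by simp
  obtain g where g: "\<And>k. Ck k U g" "\<And>x. x \<in> U \<Longrightarrow> iter_pd vs f x = g x"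
    using Cons.IH[OF Cons.prems(1) vs] by blast
  let ?h = "\<lambda>x. frechet_derivative g (at x) v"
  have "Ck k U ?h" for k using g(1)[of "Suc k"] Cons.prems by simp
  moreover have "iter_pd (v # vs) f x = ?h x" if "x \<in> U" for x
  proof -
    have "iter_pd (v # vs) f x = iter_pd [v] (iter_pd vs f) x" by simp
    also have "\<dots> = iter_pd [v] g x" by (rule iter_pd_cong[OF assms(1) _ that]) (rule g(2))
    also have "\<dots> = ?h x"
      using has_vector_derivative_direction[OF Ck_has_derivative[OF g(1)[of "Suc 0"] that], of v]
      by (simp add: vector_derivative_at)
    finally show ?thesis .
  qed
  ultimately show ?case by blast
qed

text \<open>The bridge to the given definition. Total differentiability at each order makes product
  rule, chain rule and inverse functions accessible by induction on the order, which derivatives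
  along coordinate lines do not.\<close>

lemma smooth_on_iff_Ck: "smooth_on U f \<longleftrightarrow> open U \<and> (\<forall>k. Ck k U f)"
proof
  assume "smooth_on U f"
  then show "open U \<and> (\<forall>k. Ck k U f)" using smooth_on_imp_Ck by (auto simp: smooth_on_def)
next
  assume r: "open U \<and> (\<forall>k. Ck k U f)"
  then have U: "open U" by simp
  have "continuous_on U (iter_pd vs f) \<and> (\<forall>v\<in>Basis. \<forall>x\<in>U.
      ((\<lambda>t. iter_pd vs f (x + t *\<^sub>R v)) has_vector_derivative iter_pd (v # vs) f x) (at 0))"
    if vs: "set vs \<subseteq> Basis" for vs
  proof -
    obtain g where g: "\<And>k. Ck k U g" "\<And>x. x \<in> U \<Longrightarrow> iter_pd vs f x = g x"
      using Ck_imp_iter_pd[OF U _ vs, of f] r by blast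
    have "continuous_on U g" using g(1)[of 0] by simp
    then have "continuous_on U (iter_pd vs f)" using g(2) by (metis continuous_on_cong)
    moreover have "((\<lambda>t. iter_pd vs f (x + t *\<^sub>R v)) has_vector_derivative iter_pd (v # vs) f x) (at 0)"
      if x: "x \<in> U" for v x
    proof -
      have "(iter_pd vs f has_derivative frechet_derivative g (at x)) (at x)"
        using has_derivative_transform_within_open[OF Ck_has_derivative[OF g(1)[of "Suc 0"] x] U x] g(2) by simp
      from has_vector_derivative_direction[OF this, of v]
      show ?thesis by (simp add: vector_derivative_at)
    qed
    ultimately show ?thesis by blast
  qed
  then show "smooth_on U f" using U unfolding smooth_on_def by blast
qed

section \<open>Closure rules for smooth functions\<close>

named_theorems smooth_intros

lemma smooth_on_open: "smooth_on U f \<Longrightarrow> open U"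
  by (simp add: smooth_on_def)

lemma smooth_onI: "open U \<Longrightarrow> (\<And>k. Ck k U f) \<Longrightarrow> smooth_on U f"
  by (simp add: smooth_on_iff_Ck)

lemma smooth_onD: "smooth_on U f \<Longrightarrow> Ck k U f"
  by (simp add: smooth_on_iff_Ck)

lemma smooth_on_subset: "smooth_on U f \<Longrightarrow> open V \<Longrightarrow> V \<subseteq> U \<Longrightarrow> smooth_on V f"
  by (metis smooth_on_iff_Ck Ck_subset)

lemma smooth_on_cong:
  "smooth_on U f \<Longrightarrow> (\<And>x. x \<in> U \<Longrightarrow> f x = g x) \<Longrightarrow> smooth_on U g"
  using Ck_cong[of U f g] by (auto simp: smooth_on_iff_Ck)

lemma smooth_on_local:
  assumes "\<And>x. x \<in> U \<Longrightarrow> \<exists>V. x \<in> V \<and> smooth_on V f" "open U"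
  shows "smooth_on U f"
proof (rule smooth_onI)
  show "Ck k U f" for k
    by (rule Ck_local) (use assms in \<open>metis smooth_on_iff_Ck\<close>)
qed fact

lemma smooth_on_imp_continuous_on: "smooth_on U f \<Longrightarrow> continuous_on U f"
  using smooth_onD[of U f 0] by simp

lemma smooth_on_has_derivative:
  "smooth_on U f \<Longrightarrow> x \<in> U \<Longrightarrow> (f has_derivative frechet_derivative f (at x)) (at x)"
  using Ck_has_derivative smooth_onD by blast

lemma smooth_on_const [smooth_intros]: "open U \<Longrightarrow> smooth_on U (\<lambda>x. c)"
  by (simp add: smooth_onI Ck_const)

lemma smooth_on_ident [smooth_intros]: "open U \<Longrightarrow> smooth_on U (\<lambda>x. x)"
  by (simp add: smooth_onI Ck_id)

lemma smooth_on_linear: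
  "bounded_linear h \<Longrightarrow> smooth_on U f \<Longrightarrow> smooth_on U (\<lambda>x. h (f x))"
  by (simp add: smooth_on_iff_Ck Ck_linear)

lemma smooth_on_bilinear:
  "bounded_bilinear h \<Longrightarrow> smooth_on U f \<Longrightarrow> smooth_on U g \<Longrightarrow> smooth_on U (\<lambda>x. h (f x) (g x))"
  by (simp add: smooth_on_iff_Ck Ck_bilinear)

lemma smooth_on_add [smooth_intros]:
  "smooth_on U f \<Longrightarrow> smooth_on U g \<Longrightarrow> smooth_on U (\<lambda>x. f x + g x)"
  by (simp add: smooth_on_iff_Ck Ck_add)

lemmas smooth_on_uminus [smooth_intros] = smooth_on_linear[OF bounded_linear_minus[OF bounded_linear_ident]]
lemmas smooth_on_scaleR [smooth_intros] = smooth_on_bilinear[OF bounded_bilinear_scaleR]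
lemmas smooth_on_mult [smooth_intros] = smooth_on_bilinear[OF bounded_bilinear_mult]
lemmas smooth_on_inner [smooth_intros] = smooth_on_bilinear[OF bounded_bilinear_inner]
lemmas smooth_on_vec_nth [smooth_intros] = smooth_on_linear[OF bounded_linear_vec_nth]
lemmas smooth_on_fst [smooth_intros] = smooth_on_linear[OF bounded_linear_fst]
lemmas smooth_on_snd [smooth_intros] = smooth_on_linear[OF bounded_linear_snd]
lemmas smooth_on_Re [smooth_intros] = smooth_on_linear[OF bounded_linear_Re]
lemmas smooth_on_Im [smooth_intros] = smooth_on_linear[OF bounded_linear_Im]
lemmas smooth_on_cnj [smooth_intros] = smooth_on_linear[OF bounded_linear_cnj]
lemmas smooth_on_of_real [smooth_intros] = smooth_on_linear[OF bounded_linear_of_real]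

lemma smooth_on_diff [smooth_intros]:
  "smooth_on U f \<Longrightarrow> smooth_on U g \<Longrightarrow> smooth_on U (\<lambda>x. f x - g x)"
  using smooth_on_add[of U f "\<lambda>x. - g x"] smooth_on_uminus[of U g] by simp

lemma smooth_on_sum [smooth_intros]:
  "open U \<Longrightarrow> (\<And>i. i \<in> I \<Longrightarrow> smooth_on U (f i)) \<Longrightarrow> smooth_on U (\<lambda>x. \<Sum>i\<in>I. f i x)"
  by (induction I rule: infinite_finite_induct) (auto intro: smooth_intros)

lemma smooth_on_prod [smooth_intros]:
  fixes f :: "'i \<Rightarrow> 'a::euclidean_space \<Rightarrow> real"
  shows "open U \<Longrightarrow> (\<And>i. i \<in> I \<Longrightarrow> smooth_on U (f i)) \<Longrightarrow> smooth_on U (\<lambda>x. \<Prod>i\<in>I. f i x)"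
  by (induction I rule: infinite_finite_induct) (auto intro: smooth_intros)

lemma smooth_on_power [smooth_intros]:
  fixes f :: "'a::euclidean_space \<Rightarrow> 'b::real_normed_algebra_1"
  shows "smooth_on U f \<Longrightarrow> smooth_on U (\<lambda>x. f x ^ n)"
  by (induction n) (auto intro: smooth_intros smooth_on_open)

lemma smooth_on_vec_lambda [smooth_intros]:
  fixes f :: "'a::euclidean_space \<Rightarrow> 'n::finite \<Rightarrow> real"
  assumes "open U" "\<And>i. smooth_on U (\<lambda>x. f x i)"
  shows "smooth_on U (\<lambda>x. \<chi> i. f x i)"
proof -
  have "(\<chi> i. f x i) = (\<Sum>i\<in>UNIV. f x i *\<^sub>R axis i 1)" for x
    by (simp add: vec_eq_iff axis_def if_distrib sum.If_cases cong: if_cong)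
  then show ?thesis using assms by (auto intro!: smooth_intros)
qed

lemma smooth_on_Pair [smooth_intros]:
  assumes "smooth_on U f" "smooth_on U g"
  shows "smooth_on U (\<lambda>x. (f x, g x))"
proof -
  have "bounded_linear (\<lambda>a. (a, 0))" "bounded_linear (\<lambda>b. (0, b))"
    by (auto intro!: bounded_linear_Pair)
  then have "smooth_on U (\<lambda>x. (f x, 0) + (0, g x))"
    using assms by (intro smooth_on_add smooth_on_linear[where h = "\<lambda>a. (a, 0)"] smooth_on_linear[where h = "\<lambda>a. (0, a)"])
  then show ?thesis by simp
qed

lemma smooth_on_compose:
  fixes f :: "'a::euclidean_space \<Rightarrow> 'b::euclidean_space" and g :: "'b \<Rightarrow> 'c::real_normed_vector"
  assumes "smooth_on U f" "smooth_on V g" "f ` U \<subseteq> V"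
  shows "smooth_on U (\<lambda>x. g (f x))"
  using assms Ck_compose[of U V _ f g] by (simp add: smooth_on_iff_Ck)

lemma smooth_on_frechet_derivative:
  assumes "smooth_on U f"
  shows "smooth_on U (\<lambda>x. frechet_derivative f (at x) v)"
proof -
  have op: "open U" using assms by (rule smooth_on_open)
  have 1: "smooth_on U (\<lambda>x. frechet_derivative f (at x) b)" if "b \<in> Basis" for b
    using smooth_onD[OF assms, of "Suc k" for k] that op by (intro smooth_onI) auto
  have "smooth_on U (\<lambda>x. \<Sum>b\<in>Basis. (v \<bullet> b) *\<^sub>R frechet_derivative f (at x) b)"
    using op 1 by (intro smooth_intros) auto
  then show ?thesis
  proof (rule smooth_on_cong)
    fix x assume "x \<in> U"
    then have "linear (frechet_derivative f (at x))"
      using smooth_on_has_derivative[OF assms] has_derivative_linear by blast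
    then show "(\<Sum>b\<in>Basis. (v \<bullet> b) *\<^sub>R frechet_derivative f (at x) b) = frechet_derivative f (at x) v"
      using linear_eq_basis_sum by metis
  qed
qed

lemma Ck_real_I:
  fixes f :: "real \<Rightarrow> 'b::real_normed_vector"
  assumes "open U" "\<And>x. x \<in> U \<Longrightarrow> (f has_vector_derivative f' x) (at x)" "Ck k U f'"
  shows "Ck (Suc k) U f"
  by (rule Ck_I[where f' = "\<lambda>x v. v *\<^sub>R f' x"])
    (use assms in \<open>auto simp: has_vector_derivative_def intro: Ck_linear[OF bounded_linear_scaleR_right]\<close>)

lemma Ck_exp: "Ck k UNIV (exp :: real \<Rightarrow> real)"
proof (induction k)
  case (Suc k)
  show ?case
    by (rule Ck_real_I[OF _ _ Suc]) (auto simp flip: has_real_derivative_iff_has_vector_derivative intro!: derivative_eq_intros)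
qed (simp add: continuous_on_exp)

lemma Ck_sin_cos: "Ck k UNIV (sin :: real \<Rightarrow> real) \<and> Ck k UNIV (cos :: real \<Rightarrow> real)"
proof (induction k)
  case (Suc k)
  have "Ck (Suc k) UNIV (sin :: real \<Rightarrow> real)"
    by (rule Ck_real_I[where f' = cos]) (use Suc in \<open>auto simp flip: has_real_derivative_iff_has_vector_derivative intro!: derivative_eq_intros\<close>)
  moreover have "Ck k UNIV (\<lambda>x::real. - sin x)"
    using Suc by (intro Ck_linear[OF bounded_linear_minus[OF bounded_linear_ident]]) auto
  then have "Ck (Suc k) UNIV (cos :: real \<Rightarrow> real)"
    by (intro Ck_real_I[where f' = "\<lambda>x. - sin x"]) (auto simp flip: has_real_derivative_iff_has_vector_derivative intro!: derivative_eq_intros)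
  ultimately show ?case by blast
qed (auto intro: continuous_intros)

text \<open>The derivative is a polynomial in \<open>inverse\<close> itself, so order
  \<open>k\<close> implies order \<open>k + 1\<close>.\<close>

lemma Ck_inverse: "Ck k (- {0}) (inverse :: real \<Rightarrow> real)"
proof (induction k)
  case (Suc k)
  have op: "open (- {0 :: real})" by auto
  have "Ck k (- {0}) (\<lambda>x::real. - (inverse x * inverse x))"
    using Suc by (intro Ck_linear[OF bounded_linear_minus[OF bounded_linear_ident]] Ck_bilinear[OF bounded_bilinear_mult] op)
  then show ?case
    by (intro Ck_real_I[where f' = "\<lambda>x. - (inverse x * inverse x)"] op)
       (auto simp: power2_eq_square simp flip: has_real_derivative_iff_has_vector_derivative intro!: derivative_eq_intros)
qed (auto intro: continuous_intros)

lemma smooth_on_inverse [smooth_intros]: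
  fixes f :: "'a::euclidean_space \<Rightarrow> real"
  assumes "smooth_on U f" "\<And>x. x \<in> U \<Longrightarrow> f x \<noteq> 0"
  shows "smooth_on U (\<lambda>x. inverse (f x))"
  by (rule smooth_on_compose[OF assms(1), of "- {0}" inverse])
     (use assms(2) in \<open>auto intro!: smooth_onI Ck_inverse\<close>)

lemma smooth_on_divide [smooth_intros]:
  fixes f :: "'a::euclidean_space \<Rightarrow> real"
  assumes "smooth_on U f" "smooth_on U g" "\<And>x. x \<in> U \<Longrightarrow> g x \<noteq> 0"
  shows "smooth_on U (\<lambda>x. f x / g x)"
  unfolding divide_inverse using assms by (intro smooth_intros) auto

lemma smooth_on_exp [smooth_intros]:
  fixes f :: "'a::euclidean_space \<Rightarrow> real"
  assumes "smooth_on U f"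
  shows "smooth_on U (\<lambda>x. exp (f x))"
  by (rule smooth_on_compose[OF assms, of UNIV exp]) (auto intro: smooth_onI Ck_exp)

lemma smooth_on_sin [smooth_intros]:
  fixes f :: "'a::euclidean_space \<Rightarrow> real"
  assumes "smooth_on U f"
  shows "smooth_on U (\<lambda>x. sin (f x))"
  by (rule smooth_on_compose[OF assms, of UNIV sin]) (auto intro: smooth_onI simp: Ck_sin_cos)

lemma smooth_on_cos [smooth_intros]:
  fixes f :: "'a::euclidean_space \<Rightarrow> real"
  assumes "smooth_on U f"
  shows "smooth_on U (\<lambda>x. cos (f x))"
  by (rule smooth_on_compose[OF assms, of UNIV cos]) (auto intro: smooth_onI simp: Ck_sin_cos)

lemma smooth_on_real_I:
  fixes f :: "real \<Rightarrow> 'b::real_normed_vector"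
  assumes "smooth_on U f'" "\<And>x. x \<in> U \<Longrightarrow> (f has_vector_derivative f' x) (at x)"
  shows "smooth_on U f"
proof (rule smooth_onI)
  show op: "open U" using assms(1) by (rule smooth_on_open)
  show "Ck k U f" for k
    by (rule Ck_Suc_imp, rule Ck_real_I[OF op assms(2)]) (auto intro: smooth_onD assms(1))
qed

lemma smooth_on_ln [smooth_intros]:
  fixes f :: "'a::euclidean_space \<Rightarrow> real"
  assumes "smooth_on U f" "\<And>x. x \<in> U \<Longrightarrow> f x > 0"
  shows "smooth_on U (\<lambda>x. ln (f x))"
proof (rule smooth_on_compose[OF assms(1)])
  show "smooth_on {0<..} (ln :: real \<Rightarrow> real)"
    by (rule smooth_on_real_I[where f' = inverse])
       (auto intro!: smooth_intros derivative_eq_intros simp: divide_inverse simp flip: has_real_derivative_iff_has_vector_derivative)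
qed (use assms(2) in auto)

lemma smooth_on_arctan [smooth_intros]:
  fixes f :: "'a::euclidean_space \<Rightarrow> real"
  assumes "smooth_on U f"
  shows "smooth_on U (\<lambda>x. arctan (f x))"
proof (rule smooth_on_compose[OF assms(1)])
  have "1 + x\<^sup>2 \<noteq> 0" for x :: real by (metis add_pos_nonneg less_numeral_extra(1) less_irrefl zero_le_power2)
  then have "smooth_on UNIV (\<lambda>x::real. inverse (1 + x\<^sup>2))"
    by (intro smooth_intros) auto
  then show "smooth_on UNIV (arctan :: real \<Rightarrow> real)"
    by (rule smooth_on_real_I) (auto intro!: derivative_eq_intros simp flip: has_real_derivative_iff_has_vector_derivative)
qed auto

lemma smooth_on_norm [smooth_intros]:
  fixes f :: "'a::euclidean_space \<Rightarrow> 'b::euclidean_space"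
  assumes "smooth_on U f" "\<And>x. x \<in> U \<Longrightarrow> f x \<noteq> 0"
  shows "smooth_on U (\<lambda>x. norm (f x))"
proof -
  \<comment> \<open>Away from zero the norm is the square root of the inner square, expressed
    through \<open>exp\<close> and \<open>ln\<close>.\<close>
  have "smooth_on U (\<lambda>x. exp (inverse 2 * ln (f x \<bullet> f x)))"
    using assms by (intro smooth_intros smooth_on_open[OF assms(1)]) auto
  then show ?thesis
  proof (rule smooth_on_cong)
    fix x assume "x \<in> U"
    then have "norm (f x) > 0" using assms(2) by auto
    then show "exp (inverse 2 * ln (f x \<bullet> f x)) = norm (f x)"
      by (simp add: dot_square_norm ln_realpow)
  qed
qed

lemma smooth_on_det [smooth_intros]:
  fixes F :: "'a::euclidean_space \<Rightarrow> 'n::finite \<Rightarrow> 'n \<Rightarrow> real"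
  assumes "open U" "\<And>i j. smooth_on U (\<lambda>x. F x i j)"
  shows "smooth_on U (\<lambda>x. det (\<chi> i j. F x i j))"
  unfolding det_def using assms by (auto intro!: smooth_intros)

subsection \<open>A smooth step function\<close>

text \<open>The classical flat function \<open>exp (- 1 / x)\<close>, here divided by powers of
  \<open>x\<close>: the derivative of a member is a linear combination of members, so smoothness
  follows by induction for all \<open>n\<close> simultaneously.\<close>

definition flat :: "nat \<Rightarrow> real \<Rightarrow> real" where
  "flat n x = (if x > 0 then exp (- 1 / x) / x ^ n else 0)"

lemma flat_tendsto_0: "(flat n \<longlongrightarrow> 0) (at 0)"
proof -
  have "((\<lambda>x. x ^ n / exp x) \<longlongrightarrow> (0::real)) at_top" by (rule tendsto_power_div_exp_0)
  then have "((\<lambda>x. inverse x ^ n / exp (inverse x)) \<longlongrightarrow> (0::real)) (at_right 0)"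
    using filterlim_compose[OF _ filterlim_inverse_at_top_right] by fastforce
  then have "(flat n \<longlongrightarrow> 0) (at_right 0)"
  proof (rule Lim_transform_eventually)
    show "\<forall>\<^sub>F x in at_right 0. inverse x ^ n / exp (inverse x) = flat n x"
      unfolding eventually_at_filter
      by (rule always_eventually) (auto simp: flat_def exp_minus field_simps)
  qed
  moreover have "(flat n \<longlongrightarrow> 0) (at_left 0)"
  proof (rule Lim_transform_eventually)
    show "((\<lambda>x::real. 0::real) \<longlongrightarrow> 0) (at_left 0)" by simp
    show "\<forall>\<^sub>F x in at_left 0. 0 = flat n x"
      unfolding eventually_at_filter by (rule always_eventually) (auto simp: flat_def)
  qed
  ultimately show ?thesis by (simp add: filterlim_split_at)
qed

lemma flat_deriv: "(flat n has_vector_derivative (flat (n + 2) x - real n * flat (n + 1) x)) (at x)"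
proof -
  consider "x < 0" | "x = 0" | "x > 0" by linarith
  then show ?thesis
  proof cases
    case 1
    have "((\<lambda>_. 0) has_vector_derivative 0) (at x)" by simp
    then have "(flat n has_vector_derivative 0) (at x)"
      by (rule has_vector_derivative_transform_within_open[where S = "{..<0}"]) (use 1 in \<open>auto simp: flat_def\<close>)
    then show ?thesis using 1 by (simp add: flat_def)
  next
    case 2
    \<comment> \<open>At 0 the difference quotient of \<open>flat n\<close> is
      \<open>flat (n + 1)\<close>, which tends to 0.\<close>
    have "((\<lambda>h. (flat n (0 + h) - flat n 0) / h) \<longlongrightarrow> 0) (at 0)"
    proof (rule Lim_transform_eventually[OF flat_tendsto_0[of "n + 1"]])
      show "\<forall>\<^sub>F x in at 0. flat (n + 1) x = (flat n (0 + x) - flat n 0) / x"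
        unfolding eventually_at_filter by (rule always_eventually) (auto simp: flat_def)
    qed
    then have "(flat n has_real_derivative 0) (at 0)" by (simp add: DERIV_def)
    then show ?thesis using 2
      by (simp add: flat_def has_real_derivative_iff_has_vector_derivative)
  next
    case 3
    have "((\<lambda>x. exp (- 1 / x) / x ^ n) has_real_derivative
        (exp (- 1 / x) * (1 / x\<^sup>2) * x ^ n - exp (- 1 / x) * (real n * x ^ (n - 1))) / (x ^ n * x ^ n)) (at x)"
      using 3 by (auto intro!: derivative_eq_intros simp: power2_eq_square)
    also have "(exp (- 1 / x) * (1 / x\<^sup>2) * x ^ n - exp (- 1 / x) * (real n * x ^ (n - 1))) / (x ^ n * x ^ n)
        = flat (n + 2) x - real n * flat (n + 1) x"
      using 3 by (cases n) (auto simp: flat_def field_simps power2_eq_square)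
    finally have "((\<lambda>x. exp (- 1 / x) / x ^ n) has_vector_derivative flat (n + 2) x - real n * flat (n + 1) x) (at x)"
      by (simp add: has_real_derivative_iff_has_vector_derivative)
    then show ?thesis
      by (rule has_vector_derivative_transform_within_open[where S = "{0<..}"]) (use 3 in \<open>auto simp: flat_def\<close>)
  qed
qed

lemma Ck_flat: "Ck k UNIV (flat n)"
proof (induction k arbitrary: n)
  case 0
  show ?case
    using flat_deriv by (auto simp: continuous_on_eq_continuous_at intro: has_vector_derivative_continuous)
next
  case (Suc k)
  have "Ck k UNIV (\<lambda>x. flat (n + 2) x + - (real n * flat (n + 1) x))"
    by (intro Ck_add Ck_linear[OF bounded_linear_minus[OF bounded_linear_ident]]
        Ck_linear[OF bounded_linear_mult_right] Suc) auto
  then show ?case by (intro Ck_real_I[OF _ flat_deriv]) auto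
qed

definition step :: "real \<Rightarrow> real" where
  "step t = flat 0 t / (flat 0 t + flat 0 (1 - t))"

lemma flat0_nonneg: "flat 0 t \<ge> 0" and flat0_pos: "t > 0 \<Longrightarrow> flat 0 t > 0"
  by (auto simp: flat_def)

lemma flat0_sum_pos: "flat 0 t + flat 0 (1 - t) > 0"
  using flat0_nonneg[of t] flat0_nonneg[of "1 - t"] flat0_pos[of t] flat0_pos[of "1 - t"]
  by (cases "t > 0") auto

lemma flat0_mono: "s \<le> t \<Longrightarrow> flat 0 s \<le> flat 0 t"
  by (auto simp: flat_def field_simps)

lemma step_mono: "s \<le> t \<Longrightarrow> step s \<le> step t"
proof -
  assume "s \<le> t"
  then have a: "flat 0 s \<le> flat 0 t" "flat 0 (1 - t) \<le> flat 0 (1 - s)" by (auto intro: flat0_mono)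
  then have "flat 0 s * flat 0 (1 - t) \<le> flat 0 t * flat 0 (1 - s)"
    by (intro mult_mono flat0_nonneg)
  then show ?thesis
    using flat0_sum_pos[of s] flat0_sum_pos[of t] by (simp add: step_def divide_simps algebra_simps)
qed

lemma step_0: "t \<le> 0 \<Longrightarrow> step t = 0" and step_1: "t \<ge> 1 \<Longrightarrow> step t = 1"
  by (auto simp: step_def flat_def)

lemma step_bounds: "0 \<le> step t" "step t \<le> 1"
  using flat0_nonneg[of t] flat0_nonneg[of "1 - t"] flat0_sum_pos[of t]
  by (auto simp: step_def divide_simps)

lemma smooth_on_step [smooth_intros]:
  fixes f :: "'a::euclidean_space \<Rightarrow> real"
  assumes "smooth_on U f"
  shows "smooth_on U (\<lambda>x. step (f x))"
proof (rule smooth_on_compose[OF assms(1)])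
  have f: "smooth_on UNIV (flat 0)" by (simp add: smooth_onI Ck_flat)
  have "smooth_on UNIV (\<lambda>t. flat 0 (1 - t))"
    by (rule smooth_on_compose[OF _ f]) (auto intro!: smooth_intros)
  with f show "smooth_on UNIV step"
    unfolding step_def[abs_def] using flat0_sum_pos by (intro smooth_intros) (auto simp: less_le)
qed auto

subsection \<open>Smooth embeddings between open sets of the same dimension\<close>

definition jac :: "(real ^ 'n::finite \<Rightarrow> real ^ 'n) \<Rightarrow> real ^ 'n \<Rightarrow> real" where
  "jac f x = det (matrix (frechet_derivative f (at x)))"

text \<open>Because the dimensions agree, such a map is a diffeomorphism onto an open set: the image
  is open by invariance of domain and the inverse is again of this kind.\<close>

definition emb :: "(real ^ 'n::finite) set \<Rightarrow> (real ^ 'n \<Rightarrow> real ^ 'n) \<Rightarrow> bool" where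
  "emb U f \<longleftrightarrow> smooth_on U f \<and> inj_on f U \<and> (\<forall>x\<in>U. jac f x \<noteq> 0)"

lemma embD:
  assumes "emb U f"
  shows "open U" "smooth_on U f" "inj_on f U" "\<And>x. x \<in> U \<Longrightarrow> jac f x \<noteq> 0" "continuous_on U f"
  using assms smooth_on_open smooth_on_imp_continuous_on by (auto simp: emb_def)

lemma jac_nonzero_iff:
  assumes "linear (frechet_derivative f (at x))"
  shows "jac f x \<noteq> 0 \<longleftrightarrow> inj (frechet_derivative f (at x))"
  unfolding jac_def using assms
  by (metis det_nz_iff_inj matrix_vector_mul(1) matrix_works)

lemma jac_nonzeroI:
  assumes "smooth_on U f" "x \<in> U" "\<And>v. frechet_derivative f (at x) v = 0 \<Longrightarrow> v = 0"
  shows "jac f x \<noteq> 0"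
proof -
  have "linear (frechet_derivative f (at x))"
    using smooth_on_has_derivative[OF assms(1,2)] has_derivative_linear by blast
  then show ?thesis using assms(3) by (simp add: jac_nonzero_iff linear_injective_0)
qed

lemma jac_compose:
  assumes "f differentiable (at x)" "g differentiable (at (f x))"
  shows "jac (\<lambda>x. g (f x)) x = jac g (f x) * jac f x"
proof -
  let ?f = "frechet_derivative f (at x)" and ?g = "frechet_derivative g (at (f x))"
  have f: "(f has_derivative ?f) (at x)" and g: "(g has_derivative ?g) (at (f x))"
    using assms by (auto simp: frechet_derivative_works)
  then have "frechet_derivative (\<lambda>x. g (f x)) (at x) = ?g \<circ> ?f"
    using frechet_derivative_at[OF has_derivative_compose[OF f g]] by (simp add: o_def)
  then show ?thesis
    using f g by (simp add: jac_def matrix_compose has_derivative_linear det_mul)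
qed

lemma smooth_on_differentiable: "smooth_on U f \<Longrightarrow> x \<in> U \<Longrightarrow> f differentiable (at x)"
  using smooth_on_has_derivative differentiable_def by blast

lemma jac_cong:
  assumes "open U" "x \<in> U" "\<And>y. y \<in> U \<Longrightarrow> f y = g y"
  shows "jac f x = jac g x"
  unfolding jac_def using frechet_cong_open[OF assms] by simp

lemma jac_id [simp]: "jac (\<lambda>x. x) x = 1"
  by (simp add: jac_def matrix_id_mat_1[unfolded id_def])

lemma smooth_on_jac:
  assumes "smooth_on U f"
  shows "smooth_on U (jac f)"
  unfolding jac_def[abs_def] matrix_def
  using assms by (intro smooth_intros smooth_on_frechet_derivative smooth_on_open[OF assms])

lemma emb_image_open:
  assumes "emb U f" "open V" "V \<subseteq> U"
  shows "open (f ` V)"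
  using assms embD[OF assms(1)] by (intro invariance_of_domain) (auto intro: continuous_on_subset inj_on_subset)

lemma emb_subset: "emb U f \<Longrightarrow> open V \<Longrightarrow> V \<subseteq> U \<Longrightarrow> emb V f"
  unfolding emb_def by (auto intro: smooth_on_subset inj_on_subset)

lemma emb_cong:
  assumes "emb U f" "\<And>x. x \<in> U \<Longrightarrow> f x = g x"
  shows "emb U g"
  using assms jac_cong[OF embD(1)[OF assms(1)], of _ f g] unfolding emb_def
  by (auto intro: smooth_on_cong simp: inj_on_def)

text \<open>The gluing device for all maps defined by cases: being a smooth immersion is local, so
  only injectivity has to be checked globally.\<close>

lemma emb_localI:
  assumes "open U" "inj_on f U"
    "\<And>x. x \<in> U \<Longrightarrow> \<exists>V g. x \<in> V \<and> emb V g \<and> (\<forall>y\<in>V. f y = g y)"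
  shows "emb U f"
proof -
  have "\<exists>V. x \<in> V \<and> emb V f" if "x \<in> U" for x
    using assms(3)[OF that] emb_cong by metis
  then show ?thesis using assms(1,2) unfolding emb_def by (auto intro!: smooth_on_local)
qed

lemma emb_compose:
  assumes "emb U f" "emb V g" "f ` U \<subseteq> V"
  shows "emb U (\<lambda>x. g (f x))"
proof -
  have "jac (\<lambda>x. g (f x)) x \<noteq> 0" if "x \<in> U" for x
  proof -
    have "f x \<in> V" using assms(3) that by blast
    then have "jac (\<lambda>x. g (f x)) x = jac g (f x) * jac f x"
      using embD(2)[OF assms(1)] embD(2)[OF assms(2)] that
      by (intro jac_compose smooth_on_differentiable[where U = U] smooth_on_differentiable[where U = V])
    then show ?thesis using embD(4)[OF assms(1) that] embD(4)[OF assms(2) \<open>f x \<in> V\<close>] by simp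
  qed
  moreover have "inj_on (\<lambda>x. g (f x)) U"
    using assms embD(3)[OF assms(1)] embD(3)[OF assms(2)]
    by (auto simp: inj_on_def) (metis image_subset_iff)
  ultimately show ?thesis
    using assms smooth_on_compose[of U f V g] unfolding emb_def by auto
qed

lemma emb_id: "open U \<Longrightarrow> emb U (\<lambda>x. x)"
  by (simp add: emb_def smooth_intros)

text \<open>The inverse derivative is written out by Cramer's rule so that its dependence on
  \<open>x\<close> is visibly smooth.\<close>

lemma has_derivative_emb_inverse:
  assumes "emb U f" "x \<in> U"
  shows "(inv_into U f has_derivative
    (\<lambda>w. \<chi> k. det (\<chi> i j. if j = k then w $ i else frechet_derivative f (at x) (axis j 1) $ i) / jac f x)) (at (f x))"
    (is "(_ has_derivative ?g) _")
proof (rule has_derivative_inverse_strong[where f = f and S = U and x = x])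
  let ?f = "frechet_derivative f (at x)"
  note e = embD[OF assms(1)]
  show "open U" "x \<in> U" "continuous_on U f" using e assms(2) by auto
  show "inv_into U f (f y) = y" if "y \<in> U" for y using e(3) that by simp
  show d: "(f has_derivative ?f) (at x)" using smooth_on_has_derivative e(2) assms(2) by blast
  have lin: "linear ?f" using d has_derivative_linear by blast
  have "?f (?g w) = w" for w
  proof -
    have "det (matrix ?f) \<noteq> 0" using e(4)[OF assms(2)] by (simp add: jac_def)
    moreover have "?g w = (\<chi> k. det (\<chi> i j. if j = k then w $ i else matrix ?f $ i $ j) / det (matrix ?f))"
      by (simp add: jac_def matrix_def cong: if_cong)
    ultimately have "matrix ?f *v ?g w = w" using cramer by blast
    then show ?thesis using lin by (simp add: matrix_works)
  qed
  then show "?f \<circ> ?g = id" by auto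
qed

text \<open>A bootstrap: the derivative of the inverse is a smooth function composed with the
  inverse, so if the inverse is of order \<open>k\<close>, its derivative is too, and the order
  rises by one.\<close>

lemma emb_inverse:
  assumes "emb U f"
  shows "emb (f ` U) (inv_into U f)"
proof -
  let ?g = "inv_into U f"
  note e = embD[OF assms]
  have op: "open (f ` U)" using emb_image_open[OF assms e(1)] by simp
  define D where "D = (\<lambda>y w. \<chi> k. det (\<chi> i j. if j = k then w $ i else frechet_derivative f (at (?g y)) (axis j 1) $ i) / jac f (?g y))"
  have der: "(?g has_derivative D y) (at y)" if "y \<in> f ` U" for y
  proof -
    from that obtain x where x: "x \<in> U" "y = f x" by blast
    have gx: "?g (f x) = x" using e(3) x(1) by simp
    show ?thesis unfolding D_def x(2) gx by (rule has_derivative_emb_inverse[OF assms x(1)])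
  qed
  have H: "smooth_on U (\<lambda>x. \<chi> k. det (\<chi> i j. if j = k then w $ i else frechet_derivative f (at x) (axis j 1) $ i) / jac f x)" for w
  proof (intro smooth_intros e(1) smooth_on_jac e(2) e(4))
    fix i j k
    show "smooth_on U (\<lambda>x. if j = k then w $ i else frechet_derivative f (at x) (axis j 1) $ i)"
      using e(1,2) by (cases "j = k") (auto intro!: smooth_intros smooth_on_frechet_derivative)
  qed
  have Ckg: "Ck k (f ` U) ?g" for k
  proof (induction k)
    case 0
    show ?case using has_derivative_continuous[OF der] by (auto intro!: continuous_at_imp_continuous_on)
  next
    case (Suc k)
    show ?case
    proof (rule Ck_I[OF op der])
      fix w :: "real ^ 'a"
      show "Ck k (f ` U) (\<lambda>y. D y w)"
        unfolding D_def
        by (rule Ck_compose[OF op e(1) Suc smooth_onD[OF H[of w]]]) (auto simp: e(3))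
    qed
  qed
  have sm: "smooth_on (f ` U) ?g" using op Ckg by (simp add: smooth_onI)
  have "jac ?g y \<noteq> 0" if "y \<in> f ` U" for y
  proof -
    from that obtain x where x: "x \<in> U" "y = f x" by blast
    have "jac ?g (f x) * jac f x = jac (\<lambda>x. ?g (f x)) x"
      using x e(2) sm by (intro jac_compose[symmetric] smooth_on_differentiable) auto
    also have "\<dots> = jac (\<lambda>x. x) x" by (rule jac_cong[OF e(1) x(1)]) (simp add: e(3))
    finally show ?thesis using x by auto
  qed
  moreover have "inj_on ?g (f ` U)" by (simp add: inj_on_inv_into)
  ultimately show ?thesis using sm by (simp add: emb_def)
qed

lemma smooth_on_deriv_close:
  fixes f :: "'a::euclidean_space \<Rightarrow> 'b::real_normed_vector"
  assumes "smooth_on U f" "x \<in> U" "e > 0"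
  obtains d where "d > 0" "ball x d \<subseteq> U"
    "\<And>y v. dist x y < d \<Longrightarrow> norm (frechet_derivative f (at y) v - frechet_derivative f (at x) v) \<le> e * norm v"
proof -
  let ?f = "\<lambda>x. frechet_derivative f (at x)"
  have op: "open U" using assms(1) smooth_on_open by blast
  have lin: "linear (?f y)" if "y \<in> U" for y
    using smooth_on_has_derivative[OF assms(1) that] has_derivative_linear by blast
  define N where "N = real (DIM('a))"
  have N: "N > 0" by (simp add: N_def)
  have "\<forall>\<^sub>F y in nhds x. \<forall>b\<in>Basis. dist (?f y b) (?f x b) < e / N"
  proof (rule eventually_ball_finite)
    show "\<forall>b\<in>Basis. \<forall>\<^sub>F y in nhds x. dist (?f y b) (?f x b) < e / N"
    proof
      fix b :: 'a
      have "continuous_on U (\<lambda>y. ?f y b)"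
        using smooth_on_frechet_derivative[OF assms(1)] smooth_on_imp_continuous_on by blast
      then have "isCont (\<lambda>y. ?f y b) x" using op assms(2) continuous_on_eq_continuous_at by blast
      then have "((\<lambda>y. ?f y b) \<longlongrightarrow> ?f x b) (nhds x)"
        using tendsto_at_iff_tendsto_nhds[of "\<lambda>y. ?f y b" x] by (simp add: isCont_def)
      then show "\<forall>\<^sub>F y in nhds x. dist (?f y b) (?f x b) < e / N"
        using assms(3) N by (intro tendstoD) auto
    qed
  qed simp
  moreover have "\<forall>\<^sub>F y in nhds x. y \<in> U" using op assms(2) by (rule eventually_nhds_in_open)
  ultimately have "\<forall>\<^sub>F y in nhds x. y \<in> U \<and> (\<forall>b\<in>Basis. dist (?f y b) (?f x b) < e / N)"
    by (rule eventually_conj[OF _ , rotated])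
  then obtain d where d: "d > 0" "\<And>y. dist y x < d \<Longrightarrow> y \<in> U \<and> (\<forall>b\<in>Basis. dist (?f y b) (?f x b) < e / N)"
    unfolding eventually_nhds_metric by blast
  show ?thesis
  proof
    show "d > 0" by fact
    show "ball x d \<subseteq> U" using d(2) by (auto simp: dist_commute)
    fix y v assume y: "dist x y < d"
    have yU: "y \<in> U" and yb: "\<And>b. b \<in> Basis \<Longrightarrow> norm (?f y b - ?f x b) \<le> e / N"
      using d(2)[of y] y by (auto simp: dist_commute dist_norm norm_minus_commute intro!: less_imp_le)
    have "linear (\<lambda>v. ?f y v - ?f x v)" using lin[OF yU] lin[OF assms(2)] by (rule linear_compose_sub)
    then have "?f y v - ?f x v = (\<Sum>b\<in>Basis. (v \<bullet> b) *\<^sub>R (?f y b - ?f x b))"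
      by (rule linear_eq_basis_sum)
    also have "norm \<dots> \<le> (\<Sum>b\<in>(Basis :: 'a set). norm v * (e / N))"
    proof (rule sum_norm_le)
      fix b :: 'a assume b: "b \<in> Basis"
      have "\<bar>v \<bullet> b\<bar> * norm (?f y b - ?f x b) \<le> norm v * (e / N)"
        by (rule mult_mono[OF Basis_le_norm[OF b] yb[OF b]]) auto
      then show "norm ((v \<bullet> b) *\<^sub>R (?f y b - ?f x b)) \<le> norm v * (e / N)" by simp
    qed
    also have "\<dots> = e * norm v" using N by (simp add: N_def)
    finally show "norm (?f y v - ?f x v) \<le> e * norm v" .
  qed
qed

lemma emb_locally_injective:
  assumes "smooth_on U f" "x \<in> U" "jac f x \<noteq> 0"
  obtains r where "r > 0" "ball x r \<subseteq> U" "emb (ball x r) f"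
proof -
  let ?f = "\<lambda>x. frechet_derivative f (at x)"
  have op: "open U" using assms(1) smooth_on_open by blast
  have der: "(f has_derivative ?f y) (at y)" if "y \<in> U" for y
    using smooth_on_has_derivative[OF assms(1) that] .
  have lin: "linear (?f y)" if "y \<in> U" for y using der[OF that] has_derivative_linear by blast
  obtain g where g: "linear g" "g \<circ> ?f x = id"
    using linear_injective_left_inverse[OF lin[OF assms(2)]] assms jac_nonzero_iff[OF lin[OF assms(2)]] by auto
  have small: "\<exists>d>0. \<forall>y. dist x y < d \<longrightarrow> onorm (\<lambda>v. ?f y v - ?f x v) < e" if e0: "e > 0" for e
  proof -
    obtain d where d: "d > 0" "\<And>y v. dist x y < d \<Longrightarrow> norm (?f y v - ?f x v) \<le> e / 2 * norm v"
      by (rule smooth_on_deriv_close[OF assms(1,2) half_gt_zero[OF e0]]) blast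
    have "onorm (\<lambda>v. ?f y v - ?f x v) < e" if "dist x y < d" for y
      by (rule le_less_trans[OF onorm_le[OF d(2)[OF that]]]) (use e0 in simp)
    then show ?thesis using d(1) by blast
  qed
  have blg: "bounded_linear g" using g(1) by (simp add: linear_conv_bounded_linear)
  obtain r where r: "r > 0" "ball x r \<subseteq> U" "inj_on f (ball x r)"
    using has_derivative_locally_injective[OF assms(2) op blg g(2) der small] by auto
  have "open (U \<inter> jac f -` (- {0}))"
    using smooth_on_imp_continuous_on[OF smooth_on_jac[OF assms(1)]] op
    by (intro continuous_open_preimage) auto
  moreover have "x \<in> U \<inter> jac f -` (- {0})" using assms by auto
  ultimately obtain s where s: "s > 0" "ball x s \<subseteq> U \<inter> jac f -` (- {0})"
    using open_contains_ball by blast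
  show ?thesis
  proof
    show "min r s > 0" using r s by simp
    show sub: "ball x (min r s) \<subseteq> U" using r by (auto simp: subset_iff)
    show "emb (ball x (min r s)) f"
      unfolding emb_def
    proof (intro conjI ballI)
      show "smooth_on (ball x (min r s)) f" using smooth_on_subset[OF assms(1) _ sub] by simp
      show "inj_on f (ball x (min r s))" using r(3) by (rule inj_on_subset) (auto simp: subset_iff)
      show "jac f y \<noteq> 0" if "y \<in> ball x (min r s)" for y using s(2) that by (auto simp: subset_iff)
    qed
  qed
qed

lemma jac_sign_const:
  assumes "smooth_on U f" "connected U" "\<And>x. x \<in> U \<Longrightarrow> jac f x \<noteq> 0" "x \<in> U" "y \<in> U" "jac f x > 0"
  shows "jac f y > 0"
proof (rule ccontr)
  assume "\<not> jac f y > 0"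
  then have "jac f y \<le> 0" by simp
  moreover have "connected (jac f ` U)"
    using smooth_on_imp_continuous_on[OF smooth_on_jac[OF assms(1)]] assms(2) connected_continuous_image by blast
  ultimately have "0 \<in> jac f ` U"
    using connectedD_interval[of "jac f ` U" "jac f y" "jac f x" 0] assms by auto
  then show False using assms(3) by auto
qed

subsection \<open>Compactly supported diffeomorphisms\<close>

text \<open>These maps stand in for the end maps of compactly supported isotopies: they form a group
  under composition, extend by the identity, and preserve orientation.\<close>

definition cdiff :: "(real ^ 'n::finite) set \<Rightarrow> (real ^ 'n \<Rightarrow> real ^ 'n) \<Rightarrow> bool" where
  "cdiff U f \<longleftrightarrow> emb UNIV f \<and> surj f \<and> (\<exists>K. compact K \<and> K \<subseteq> U \<and> (\<forall>x. x \<notin> K \<longrightarrow> f x = x))"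

lemma cdiffE:
  assumes "cdiff U f"
  obtains K where "compact K" "K \<subseteq> U" "\<And>x. x \<notin> K \<Longrightarrow> f x = x"
  using assms by (auto simp: cdiff_def)

lemma cdiff_emb: "cdiff U f \<Longrightarrow> emb UNIV f"
  and cdiff_bij: "cdiff U f \<Longrightarrow> bij f"
  by (auto simp: cdiff_def emb_def bij_def)

lemma cdiff_id: "cdiff U (\<lambda>x. x)"
  unfolding cdiff_def by (auto intro!: emb_id exI[of _ "{}"])

lemma cdiff_compose:
  assumes "cdiff U f" "cdiff U g"
  shows "cdiff U (\<lambda>x. g (f x))"
proof -
  obtain K L where K: "compact K" "K \<subseteq> U" "\<And>x. x \<notin> K \<Longrightarrow> f x = x"
    and L: "compact L" "L \<subseteq> U" "\<And>x. x \<notin> L \<Longrightarrow> g x = x"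
    using cdiffE assms by metis
  have "\<exists>K. compact K \<and> K \<subseteq> U \<and> (\<forall>x. x \<notin> K \<longrightarrow> g (f x) = x)"
    by (rule exI[of _ "K \<union> L"]) (use K L in auto)
  moreover have "emb UNIV (\<lambda>x. g (f x))"
    using emb_compose[OF cdiff_emb[OF assms(1)] cdiff_emb[OF assms(2)]] by simp
  moreover have "surj (\<lambda>x. g (f x))"
    using comp_surj[of f g] assms by (auto simp: cdiff_def o_def)
  ultimately show ?thesis by (simp add: cdiff_def)
qed

lemma cdiff_inv:
  assumes "cdiff U f"
  shows "cdiff U (inv f)"
proof -
  obtain K where K: "compact K" "K \<subseteq> U" "\<And>x. x \<notin> K \<Longrightarrow> f x = x"
    using cdiffE assms by metis
  have b: "bij f" using assms by (rule cdiff_bij)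
  have "inv f x = x" if "x \<notin> K" for x
    using K(3)[OF that] b by (metis bij_inv_eq_iff)
  moreover have "emb UNIV (inv f)"
    using emb_inverse[OF cdiff_emb[OF assms]] bij_is_surj[OF b] by simp
  moreover have "surj (inv f)" using b by (simp add: bij_imp_bij_inv bij_is_surj)
  ultimately show ?thesis using K by (auto simp: cdiff_def)
qed

text \<open>A bijection that fixes every point off \<open>K\<close> maps \<open>K\<close> to itself,
  hence also every set that contains \<open>K\<close>.\<close>

lemma cdiff_maps:
  assumes "cdiff U f" "U \<subseteq> V"
  shows "f x \<in> V \<longleftrightarrow> x \<in> V"
proof -
  obtain K where K: "compact K" "K \<subseteq> U" "\<And>x. x \<notin> K \<Longrightarrow> f x = x"
    using cdiffE assms(1) by metis
  have inj: "inj f" using cdiff_bij[OF assms(1)] by (rule bij_is_inj)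
  have "f x \<in> K \<longleftrightarrow> x \<in> K"
  proof
    assume "x \<in> K" show "f x \<in> K"
    proof (rule ccontr)
      assume "f x \<notin> K"
      then have "f (f x) = f x" using K(3) by blast
      then have "f x = x" using inj by (simp add: inj_eq)
      then show False using \<open>x \<in> K\<close> \<open>f x \<notin> K\<close> by simp
    qed
  qed (use K(3) in metis)
  then show ?thesis using K(2,3) assms(2) by (metis subsetD)
qed

text \<open>The Jacobian is 1 off the compact support and has no zero on the connected whole
  space.\<close>

lemma cdiff_jac_pos:
  assumes "cdiff U f"
  shows "jac f x > 0"
proof -
  obtain K where K: "compact K" "\<And>x. x \<notin> K \<Longrightarrow> f x = x"
    using cdiffE assms by metis
  have "K \<noteq> UNIV" using K(1) not_compact_UNIV by auto
  then obtain p where p: "p \<notin> K" by blast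
  have "jac f p = jac (\<lambda>x. x) p"
    by (rule jac_cong[of "- K"]) (use K p in \<open>auto simp: compact_imp_closed open_Compl\<close>)
  then show ?thesis
    using jac_sign_const[of UNIV f p x] cdiff_emb[OF assms] by (auto simp: emb_def)
qed

text \<open>The source of all explicit compactly supported diffeomorphisms below. A displacement
  that is a strict contraction gives injectivity directly, surjectivity by the Banach fixed point
  theorem for \<open>x \<mapsto> y - h x\<close>, and an invertible derivative because the
  derivative of \<open>h\<close> has norm at most \<open>c < 1\<close>.\<close>

lemma cdiff_perturbation:
  fixes h :: "real ^ 'n::finite \<Rightarrow> real ^ 'n"
  assumes h: "smooth_on UNIV h" and K: "compact K" "K \<subseteq> U" "\<And>x. x \<notin> K \<Longrightarrow> h x = 0"
    and c: "c < 1" "\<And>x y. norm (h x - h y) \<le> c * norm (x - y)"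
  shows "cdiff U (\<lambda>x. x + h x)"
proof -
  have c0: "0 \<le> c"
  proof -
    obtain b :: "real ^ 'n" where "b \<in> Basis" using nonempty_Basis by blast
    have "0 \<le> c * norm (b - 0)" using c(2)[of b 0] norm_ge_zero order_trans by blast
    then show ?thesis using \<open>b \<in> Basis\<close> by simp
  qed
  have "inj (\<lambda>x. x + h x)"
  proof (rule injI)
    fix x y assume "x + h x = y + h y"
    then have "x - y = h y - h x" by (simp add: algebra_simps)
    then have "norm (x - y) \<le> c * norm (x - y)" using c(2)[of y x] by (simp add: norm_minus_commute)
    then have "(1 - c) * norm (x - y) \<le> 0" by (simp add: algebra_simps)
    then show "x = y" using c(1) by (simp add: mult_le_0_iff)
  qed
  moreover have "surj (\<lambda>x. x + h x)"
    unfolding surj_def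
  proof
    fix y
    have "\<exists>!x\<in>UNIV. y - h x = x"
      by (rule Banach_fix[of UNIV c]) (use c c0 in \<open>auto simp: complete_UNIV dist_norm norm_minus_commute\<close>)
    then obtain x where "y - h x = x" by blast
    then have "y = x + h x" by (simp add: algebra_simps)
    then show "\<exists>x. y = x + h x" ..
  qed
  moreover have sm: "smooth_on UNIV (\<lambda>x. x + h x)" using h by (intro smooth_intros) auto
  moreover have "jac (\<lambda>x. x + h x) x \<noteq> 0" for x
  proof (rule jac_nonzeroI[OF sm])
    fix v assume 0: "frechet_derivative (\<lambda>x. x + h x) (at x) v = 0"
    let ?h = "frechet_derivative h (at x)"
    have dh: "(h has_derivative ?h) (at x)" using smooth_on_has_derivative[OF h] by simp
    then have d: "((\<lambda>x. x + h x) has_derivative (\<lambda>v. v + ?h v)) (at x)"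
      by (intro derivative_intros)
    have "v + ?h v = 0" using 0 fun_cong[OF frechet_derivative_at[OF d], of v] by simp
    moreover have "norm (?h v) \<le> c * norm v"
    proof (cases "v = 0")
      case True
      then show ?thesis using has_derivative_linear[OF dh] by (simp add: linear_0)
    next
      case False
      show ?thesis
      proof (rule field_le_epsilon)
        fix e :: real assume e: "e > 0"
        have "0 < e / norm v" using e False by simp
        then obtain d where d: "d > 0" "\<And>y. norm (y - x) < d \<Longrightarrow> norm (h y - h x - ?h (y - x)) \<le> e / norm v * norm (y - x)"
          using dh unfolding has_derivative_at_alt by blast
        \<comment> \<open>The Lipschitz bound passes to the derivative: for this step length the
          difference quotient along \<open>v\<close> differs from the derivative by at most
          \<open>e\<close>.\<close>
        define t where "t = d / (2 * norm v)"
        have t: "t > 0" "norm (t *\<^sub>R v) < d" using d(1) False by (auto simp: t_def)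
        have "norm (h (x + t *\<^sub>R v) - h x - ?h (t *\<^sub>R v)) \<le> e / norm v * norm (t *\<^sub>R v)"
          using d(2)[of "x + t *\<^sub>R v"] t(2) by simp
        also have "\<dots> = t * e" using t(1) False by simp
        finally have 1: "norm (h (x + t *\<^sub>R v) - h x - ?h (t *\<^sub>R v)) \<le> t * e" .
        have 2: "norm (h (x + t *\<^sub>R v) - h x) \<le> c * (t * norm v)" using c(2)[of "x + t *\<^sub>R v" x] t(1) by simp
        have "norm (?h (t *\<^sub>R v)) \<le> c * (t * norm v) + t * e"
          using 1 2 norm_triangle_ineq4[of "h (x + t *\<^sub>R v) - h x" "h (x + t *\<^sub>R v) - h x - ?h (t *\<^sub>R v)"] by simp
        then have "t * norm (?h v) \<le> t * (c * norm v + e)"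
          using t(1) has_derivative_linear[OF dh] by (simp add: linear_scale algebra_simps)
        then show "norm (?h v) \<le> c * norm v + e" using t(1) by simp
      qed
    qed
    ultimately have "norm v \<le> c * norm v" by (metis add_eq_0_iff norm_minus_cancel)
    then have "(1 - c) * norm v \<le> 0" by (simp add: algebra_simps)
    then show "v = 0" using c(1) by (simp add: mult_le_0_iff)
  qed simp
  ultimately show ?thesis
    using K by (auto simp: cdiff_def emb_def)
qed

lemma smooth_compact_support_lipschitz:
  fixes h :: "'a::euclidean_space \<Rightarrow> 'b::real_normed_vector"
  assumes h: "smooth_on UNIV h" and K: "compact K" "\<And>x. x \<notin> K \<Longrightarrow> h x = 0"
  obtains B where "B > 0" "\<And>x y. norm (h x - h y) \<le> B * norm (x - y)"
proof -
  let ?h = "\<lambda>x. frechet_derivative h (at x)"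
  have der: "(h has_derivative ?h x) (at x)" for x using smooth_on_has_derivative[OF h] by simp
  have off: "?h x = (\<lambda>v. 0)" if "x \<notin> K" for x
  proof -
    have "?h x = frechet_derivative (\<lambda>x. 0) (at x)"
      by (rule frechet_cong_open[of "- K"]) (use K that in \<open>auto simp: compact_imp_closed open_Compl\<close>)
    then show ?thesis by simp
  qed
  have "\<exists>C. \<forall>x. norm (?h x b) \<le> C" for b
  proof -
    have "continuous_on K (\<lambda>x. ?h x b)"
      using smooth_on_imp_continuous_on[OF smooth_on_frechet_derivative[OF h]] continuous_on_subset by blast
    then have "bounded ((\<lambda>x. ?h x b) ` K)"
      using K(1) compact_continuous_image compact_imp_bounded by blast
    then obtain C where C: "\<And>x. x \<in> K \<Longrightarrow> norm (?h x b) \<le> C" by (auto simp: bounded_iff)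
    have "norm (?h x b) \<le> max C 0" for x
      using C[of x] off[of x] by (cases "x \<in> K") auto
    then show ?thesis by blast
  qed
  then obtain C where C: "\<And>x b. norm (?h x b) \<le> C b" by metis
  \<comment> \<open>Each \<open>C b\<close> bounds the derivative in one basis direction; the
    summand 1 makes \<open>B\<close> strictly positive.\<close>
  define B where "B = (\<Sum>b\<in>(Basis :: 'a set). C b) + 1"
  have C0: "C b \<ge> 0" for b using C[of 0 b] norm_ge_zero order_trans by blast
  then have B: "B > 0" by (simp add: B_def sum_nonneg add_nonneg_pos)
  have "norm (h x - h y) \<le> B * norm (x - y)" for x y
  proof (rule differentiable_bound[of UNIV h ?h])
    show "(h has_derivative ?h x) (at x within UNIV)" for x using der by simp
    show "onorm (?h x) \<le> B" for x
    proof (rule onorm_le)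
      fix v
      have "?h x v = (\<Sum>b\<in>Basis. (v \<bullet> b) *\<^sub>R ?h x b)"
        using linear_eq_basis_sum has_derivative_linear[OF der] by blast
      also have "norm \<dots> \<le> (\<Sum>b\<in>(Basis :: 'a set). norm v * C b)"
      proof (rule sum_norm_le)
        fix b :: 'a assume b: "b \<in> Basis"
        have "\<bar>v \<bullet> b\<bar> * norm (?h x b) \<le> norm v * C b"
          by (rule mult_mono[OF Basis_le_norm[OF b] C]) auto
        then show "norm ((v \<bullet> b) *\<^sub>R ?h x b) \<le> norm v * C b" by simp
      qed
      also have "\<dots> = (B - 1) * norm v" by (simp add: B_def sum_distrib_left mult.commute)
      also have "\<dots> \<le> B * norm v" by (intro mult_right_mono) auto
      finally show "norm (?h x v) \<le> B * norm v" .
    qed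
  qed auto
  then show thesis using B that by blast
qed

text \<open>The squared norm keeps the function smooth at the origin. The support is the ball of
  radius \<open>sqrt 2\<close>; the radius 2 used later is a convenient bound.\<close>

definition cutoff :: "'a::euclidean_space \<Rightarrow> real" where
  "cutoff x = step (2 - x \<bullet> x)"

lemma smooth_on_cutoff [smooth_intros]:
  fixes f :: "'a::euclidean_space \<Rightarrow> 'b::euclidean_space"
  shows "smooth_on U f \<Longrightarrow> smooth_on U (\<lambda>x. cutoff (f x))"
  unfolding cutoff_def by (intro smooth_intros) (auto intro: smooth_on_open)

lemma cutoff_1: "norm x \<le> 1 \<Longrightarrow> cutoff x = 1"
  by (simp add: cutoff_def step_1 dot_square_norm power_le_one)

lemma cutoff_0: "norm x \<ge> 2 \<Longrightarrow> cutoff x = 0"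
proof -
  assume "norm x \<ge> 2"
  then have "2 * 2 \<le> norm x * norm x" by (intro mult_mono) auto
  then show ?thesis by (simp add: cutoff_def step_0 dot_square_norm power2_eq_square)
qed

lemma cutoff_bounds: "0 \<le> cutoff x" "cutoff x \<le> 1"
  by (auto simp: cutoff_def step_bounds)

lemma cutoff_lipschitz:
  obtains B where "B > 0" "\<And>x y :: 'a::euclidean_space. \<bar>cutoff x - cutoff y\<bar> \<le> B * norm (x - y)"
proof -
  have "smooth_on UNIV (cutoff :: 'a \<Rightarrow> real)" by (intro smooth_intros) auto
  from smooth_compact_support_lipschitz[OF this, of "cball 0 2"] show ?thesis
    using that by (auto simp: cutoff_0)
qed

lemma compact_cutoff_support: "r > 0 \<Longrightarrow> x \<notin> cball p (2 * r) \<Longrightarrow> cutoff ((1 / r) *\<^sub>R (x - p)) = 0"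
proof (rule cutoff_0)
  assume r: "r > 0" "x \<notin> cball p (2 * r)"
  have "norm ((1 / r) *\<^sub>R (x - p)) = norm (x - p) / r" using r(1) by (simp only: norm_scaleR) simp
  also have "\<dots> \<ge> 2" using r by (simp add: dist_norm norm_minus_commute field_simps)
  finally show "2 \<le> norm ((1 / r) *\<^sub>R (x - p))" .
qed

lemma small_translation:
  fixes p :: "real ^ 'n::finite"
  assumes "open U" "p \<in> U"
  obtains d where "d > 0" "\<And>q. dist p q < d \<Longrightarrow> \<exists>z. cdiff U z \<and> z p = q"
proof -
  obtain R where R: "R > 0" "cball p R \<subseteq> U" using assms open_contains_cball by blast
  define r where "r = R / 2"
  have r: "r > 0" "cball p (2 * r) \<subseteq> U" using R by (auto simp: r_def)
  obtain B where B: "B > 0" "\<And>x y :: real ^ 'n. \<bar>cutoff x - cutoff y\<bar> \<le> B * norm (x - y)"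
    using cutoff_lipschitz by blast
  show ?thesis
  proof
    \<comment> \<open>The cutoff rescaled to radius \<open>r\<close> has Lipschitz constant
      \<open>B / r\<close>, so moving \<open>p\<close> by less than \<open>r / (2 * B)\<close> keeps
      the displacement 1/2-Lipschitz.\<close>
    show "r / (2 * B) > 0" using r B by simp
    fix q assume q: "dist p q < r / (2 * B)"
    define h where "h = (\<lambda>x. cutoff ((1 / r) *\<^sub>R (x - p)) *\<^sub>R (q - p))"
    have "cdiff U (\<lambda>x. x + h x)"
    proof (rule cdiff_perturbation)
      show "smooth_on UNIV h" unfolding h_def by (intro smooth_intros) auto
      show "compact (cball p (2 * r))" "cball p (2 * r) \<subseteq> U" using r by auto
      show "h x = 0" if "x \<notin> cball p (2 * r)" for x
        using compact_cutoff_support[OF r(1) that] by (simp add: h_def)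
      show "norm (h x - h y) \<le> 1 / 2 * norm (x - y)" for x y
      proof -
        have "norm (h x - h y) = \<bar>cutoff ((1 / r) *\<^sub>R (x - p)) - cutoff ((1 / r) *\<^sub>R (y - p))\<bar> * norm (q - p)"
          by (simp add: h_def flip: scaleR_left_diff_distrib)
        also have "\<dots> \<le> (B * norm ((1 / r) *\<^sub>R (x - p) - (1 / r) *\<^sub>R (y - p))) * (r / (2 * B))"
          using q B r by (intro mult_mono B) (auto simp: dist_norm norm_minus_commute)
        also have "(1 / r) *\<^sub>R (x - p) - (1 / r) *\<^sub>R (y - p) = (1 / r) *\<^sub>R (x - y)"
          by (simp add: scaleR_diff_right)
        also have "(B * norm ((1 / r) *\<^sub>R (x - y))) * (r / (2 * B)) = 1 / 2 * norm (x - y)"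
          using r B by simp
        finally show ?thesis .
      qed
    qed simp
    moreover have "p + h p = q" by (simp add: h_def cutoff_1)
    ultimately show "\<exists>z. cdiff U z \<and> z p = q" by blast
  qed
qed

text \<open>The orbits are open because small translations can be realised, and a connected set is
  not a union of several disjoint open orbits.\<close>

lemma cdiff_transitive:
  fixes p q :: "real ^ 'n::finite"
  assumes "open U" "connected U" "p \<in> U" "q \<in> U"
  shows "\<exists>z. cdiff U z \<and> z p = q"
proof (rule connected_equivalence_relation[where R = "\<lambda>p q. \<exists>z. cdiff U z \<and> z p = q" and S = U])
  fix x y :: "real ^ 'n" assume "\<exists>z. cdiff U z \<and> z x = y"
  then obtain z where z: "cdiff U z" "z x = y" by blast
  then have "inv z y = x" using cdiff_bij by (metis bij_inv_eq_iff)
  then show "\<exists>z. cdiff U z \<and> z y = x" using cdiff_inv[OF z(1)] by blast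
next
  fix x y w :: "real ^ 'n" assume "\<exists>z. cdiff U z \<and> z x = y" "\<exists>z. cdiff U z \<and> z y = w"
  then show "\<exists>z. cdiff U z \<and> z x = w" using cdiff_compose by blast
next
  fix a assume "a \<in> U"
  obtain d where d: "d > 0" "\<And>q. dist a q < d \<Longrightarrow> \<exists>z. cdiff U z \<and> z a = q"
    using small_translation[OF assms(1) \<open>a \<in> U\<close>] by blast
  show "\<exists>T. openin (top_of_set U) T \<and> a \<in> T \<and> (\<forall>x\<in>T. \<exists>z. cdiff U z \<and> z a = x)"
    by (rule exI[of _ "U \<inter> ball a d"]) (use d \<open>a \<in> U\<close> in \<open>auto simp: openin_open_Int\<close>)
qed (use assms in auto)

subsection \<open>Matrices of positive determinant\<close>

definition GL :: "(real ^ 'n ^ 'n::finite) set" where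
  "GL = {A. det A \<noteq> 0}"

lemma connected_component_GL_mult:
  assumes "connected_component GL A A'" "connected_component GL B B'"
  shows "connected_component GL (A ** B) (A' ** B')"
proof -
  obtain S where S: "connected S" "S \<subseteq> GL" "A \<in> S" "A' \<in> S" using assms(1) by (auto simp: connected_component_def)
  obtain T where T: "connected T" "T \<subseteq> GL" "B \<in> T" "B' \<in> T" using assms(2) by (auto simp: connected_component_def)
  have "continuous_on S (\<lambda>X. X ** B)" "continuous_on T (\<lambda>X. A' ** X)"
    unfolding matrix_matrix_mult_def by (intro continuous_intros)+
  then have "connected ((\<lambda>X. X ** B) ` S)" "connected ((\<lambda>X. A' ** X) ` T)"
    using S(1) T(1) connected_continuous_image by blast+
  moreover have "(\<lambda>X. X ** B) ` S \<subseteq> GL" "(\<lambda>X. A' ** X) ` T \<subseteq> GL"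
    using S T by (auto simp: GL_def det_mul)
  ultimately have "connected_component GL (A ** B) (A' ** B)" "connected_component GL (A' ** B) (A' ** B')"
    using S T unfolding connected_component_def by blast+
  then show ?thesis by (rule connected_component_trans)
qed

text \<open>The Householder matrix of the hyperplane orthogonal to \<open>u\<close>. These matrices
  represent the component of negative determinant because, for unit \<open>u\<close> and dimension
  at least 2, they form a connected family.\<close>

definition reflection :: "real ^ 'n \<Rightarrow> real ^ 'n ^ 'n::finite" where
  "reflection u = (\<chi> i j. (if i = j then 1 else 0) - 2 * u $ i * u $ j)"

lemma reflection_involution:
  assumes "norm u = 1"
  shows "reflection u ** reflection u = mat 1"
proof -
  have uu: "(\<Sum>k\<in>UNIV. u $ k * u $ k) = 1"
    using assms by (simp add: norm_eq_1 inner_vec_def)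
  have "(\<Sum>k\<in>UNIV. ((if i = k then 1 else 0) - 2 * u $ i * u $ k) * ((if k = j then 1 else 0) - 2 * u $ k * u $ j))
     = (if i = j then 1 else 0)" for i j
  proof -
    have "(\<Sum>k\<in>UNIV. ((if i = k then 1 else 0) - 2 * u $ i * u $ k) * ((if k = j then 1 else 0) - 2 * u $ k * u $ j))
      = (\<Sum>k\<in>UNIV. (if i = k then (if k = j then 1 else 0) - 2 * u $ k * u $ j else 0)
         - (if k = j then 2 * u $ i * u $ k else 0) + 4 * u $ i * u $ j * (u $ k * u $ k))"
      by (rule sum.cong) (auto simp: algebra_simps)
    also have "\<dots> = ((if i = j then 1 else 0) - 2 * u $ i * u $ j) - 2 * u $ i * u $ j + 4 * u $ i * u $ j * (\<Sum>k\<in>UNIV. u $ k * u $ k)"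
      by (simp add: sum.distrib sum_subtractf sum.delta sum.delta' sum_distrib_left)
    also have "\<dots> = (if i = j then 1 else 0)" by (simp add: uu)
    finally show ?thesis .
  qed
  then show ?thesis by (simp add: reflection_def matrix_matrix_mult_def mat_def vec_eq_iff)
qed

lemma connected_component_reflection:
  fixes u v :: "real ^ 'n::finite"
  assumes "CARD('n) \<ge> 2" "norm u = 1" "norm v = 1"
  shows "connected_component GL (reflection u) (reflection v)"
proof -
  have "connected (reflection ` sphere (0 :: real ^ 'n) 1)"
    by (intro connected_continuous_image connected_sphere, unfold reflection_def, intro continuous_intros)
       (use assms in auto)
  moreover have "reflection w \<in> GL" if "norm w = 1" for w :: "real ^ 'n"
  proof -
    have "det (reflection w) * det (reflection w) = 1"
      using reflection_involution[OF that] by (metis det_I det_mul)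
    then show ?thesis by (auto simp: GL_def)
  qed
  then have "reflection ` sphere (0 :: real ^ 'n) 1 \<subseteq> GL" by auto
  ultimately show ?thesis using assms unfolding connected_component_def by force
qed

text \<open>The matrices that can be joined to the identity or to a fixed reflection are closed
  under products, so elementary matrices suffice. That the two alternatives exclude each other is a
  matter of the determinant and comes later.\<close>

lemma GL_components:
  fixes A :: "real ^ 'n ^ 'n::finite"
  assumes card: "CARD('n) \<ge> 2" and e: "norm e = 1"
  shows "det A \<noteq> 0 \<longrightarrow> connected_component GL A (mat 1) \<or> connected_component GL A (reflection e)"
proof (rule induct_matrix_elementary[where P = "\<lambda>A. det A \<noteq> 0 \<longrightarrow> connected_component GL A (mat 1) \<or> connected_component GL A (reflection e)"])
  have mult: "connected_component GL (A ** B) (mat 1) \<or> connected_component GL (A ** B) (reflection e)"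
    if "connected_component GL A (mat 1) \<or> connected_component GL A (reflection e)"
      "connected_component GL B (mat 1) \<or> connected_component GL B (reflection e)" for A B :: "real ^ 'n ^ 'n"
    using that connected_component_GL_mult[of A _ B _] reflection_involution[OF e]
    by (metis matrix_mul_lid matrix_mul_rid)
  show "det (A ** B) \<noteq> 0 \<longrightarrow> connected_component GL (A ** B) (mat 1) \<or> connected_component GL (A ** B) (reflection e)"
    if "det A \<noteq> 0 \<longrightarrow> connected_component GL A (mat 1) \<or> connected_component GL A (reflection e)"
      "det B \<noteq> 0 \<longrightarrow> connected_component GL B (mat 1) \<or> connected_component GL B (reflection e)" for A B :: "real ^ 'n ^ 'n"
    using mult[of A B] that by (auto simp: det_mul)
  show "det A \<noteq> 0 \<longrightarrow> connected_component GL A (mat 1) \<or> connected_component GL A (reflection e)"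
    if "row i A = 0" for A :: "real ^ 'n ^ 'n" and i
    using det_zero_row that by blast
  show "det A \<noteq> 0 \<longrightarrow> connected_component GL A (mat 1) \<or> connected_component GL A (reflection e)"
    if diag: "\<And>i j. i \<noteq> j \<Longrightarrow> A $ i $ j = 0" for A :: "real ^ 'n ^ 'n"
  proof
    assume nz: "det A \<noteq> 0"
    have entry: "A $ i $ i \<noteq> 0" for i
      using nz det_diagonal[OF diag] by (auto simp: prod_zero_iff)
    define D :: "'n \<Rightarrow> real \<Rightarrow> real ^ 'n ^ 'n" where "D = (\<lambda>k t. \<chi> i j. if i = j then (if i = k then t else 1) else 0)"
    have detD: "det (D k t) = t" for k t
    proof -
      have "det (D k t) = (\<Prod>i\<in>UNIV. D k t $ i $ i)" by (rule det_diagonal) (simp add: D_def)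
      also have "\<dots> = t" by (simp add: D_def prod.delta)
      finally show ?thesis .
    qed
    have contD: "continuous_on S (D k)" for S k
      unfolding D_def
    proof (intro continuous_on_vec_lambda)
      fix i j show "continuous_on S (\<lambda>t. if i = j then if i = k then t else 1 else 0)"
        by (cases "i = j"; cases "i = k") auto
    qed
    have one: "connected_component GL (D k t) (mat 1) \<or> connected_component GL (D k t) (reflection e)" if "t \<noteq> 0" for k t
    proof (cases "t > 0")
      case True
      have "D k 1 = mat 1" by (simp add: D_def mat_def vec_eq_iff)
      moreover have "connected (D k ` {0<..})" by (intro connected_continuous_image contD) auto
      moreover have "D k ` {0<..} \<subseteq> GL" by (auto simp: GL_def detD)
      ultimately have "connected_component GL (D k t) (mat 1)"
        unfolding connected_component_def using True by (metis greaterThan_iff image_eqI zero_less_one)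
      then show ?thesis ..
    next
      case False
      have "D k (-1) = reflection (axis k 1)" by (auto simp: D_def reflection_def vec_eq_iff axis_def)
      moreover have "connected (D k ` {..<0})" by (intro connected_continuous_image contD) auto
      moreover have "D k ` {..<0} \<subseteq> GL" by (auto simp: GL_def detD)
      moreover have "t < 0" "(-1::real) < 0" using False that by auto
      ultimately have "connected_component GL (D k t) (reflection (axis k 1))"
        unfolding connected_component_def by (metis lessThan_iff image_eqI)
      moreover have "connected_component GL (reflection (axis k 1)) (reflection e)"
        by (rule connected_component_reflection[OF card _ e]) simp
      ultimately show ?thesis using connected_component_trans by blast
    qed
    \<comment> \<open>A diagonal matrix is built up one entry at a time, as a product of the
      matrices \<open>D k t\<close>.\<close>
    define E :: "'n set \<Rightarrow> real ^ 'n ^ 'n" where "E = (\<lambda>I. \<chi> i j. if i = j then (if i \<in> I then A $ i $ i else 1) else 0)"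
    have "connected_component GL (E I) (mat 1) \<or> connected_component GL (E I) (reflection e)" for I
      using finite[of I]
    proof (induction I rule: finite_induct)
      case empty
      have "E {} = mat 1" by (simp add: E_def mat_def vec_eq_iff)
      then show ?case by (simp add: GL_def)
    next
      case (insert k I)
      have "D k (A $ k $ k) ** E I = E (insert k I)"
      proof -
        have "(D k (A $ k $ k) ** E I) $ i $ j = E (insert k I) $ i $ j" for i j
        proof -
          have "(D k (A $ k $ k) ** E I) $ i $ j = (\<Sum>l\<in>UNIV. D k (A $ k $ k) $ i $ l * E I $ l $ j)"
            by (simp add: matrix_matrix_mult_def)
          also have "\<dots> = (\<Sum>l\<in>UNIV. if l = i then (if i = k then A $ k $ k else 1) * E I $ i $ j else 0)"
            by (rule sum.cong) (auto simp: D_def)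
          also have "\<dots> = (if i = k then A $ k $ k else 1) * E I $ i $ j" by simp
          also have "\<dots> = E (insert k I) $ i $ j" using insert.hyps by (simp add: E_def)
          finally show ?thesis .
        qed
        then show ?thesis by (simp add: vec_eq_iff)
      qed
      then show ?case using mult[OF one[OF entry, of k k] insert.IH] by simp
    qed
    from this[of UNIV] have "connected_component GL (E UNIV) (mat 1) \<or> connected_component GL (E UNIV) (reflection e)" .
    moreover have "E UNIV = A" using diag by (auto simp: E_def vec_eq_iff)
    ultimately show "connected_component GL A (mat 1) \<or> connected_component GL A (reflection e)" by simp
  qed
  show "det ((\<chi> i j. mat 1 $ i $ Transposition.transpose m n j) :: real ^ 'n ^ 'n) \<noteq> 0 \<longrightarrow>
      connected_component GL (\<chi> i j. mat 1 $ i $ Transposition.transpose m n j) (mat 1 :: real ^ 'n ^ 'n) \<or>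
      connected_component GL (\<chi> i j. mat 1 $ i $ Transposition.transpose m n j) (reflection e)"
    if "m \<noteq> n" for m n :: 'n
  proof -
    \<comment> \<open>Exchanging the coordinates \<open>m\<close> and \<open>n\<close> is the
      reflection in the hyperplane orthogonal to this unit vector.\<close>
    define u :: "real ^ 'n" where "u = (1 / sqrt 2) *\<^sub>R (axis m 1 - axis n 1)"
    have "(axis m 1 - axis n 1 :: real ^ 'n) \<bullet> (axis m 1 - axis n 1) = 2"
      using that by (simp add: inner_diff_left inner_diff_right inner_axis_axis)
    then have "norm (axis m 1 - axis n 1 :: real ^ 'n) = sqrt 2" by (simp add: norm_eq_sqrt_inner)
    then have nu: "norm u = 1" by (simp add: u_def)
    have "2 * u $ i * u $ j = (axis m 1 - axis n 1 :: real ^ 'n) $ i * (axis m 1 - axis n 1 :: real ^ 'n) $ j" for i j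
      by (simp add: u_def)
    then have "(\<chi> i j. mat 1 $ i $ Transposition.transpose m n j) = reflection u"
      using that by (auto simp: reflection_def vec_eq_iff mat_def axis_def Transposition.transpose_def)
    then show ?thesis using connected_component_reflection[OF card nu e] by simp
  qed
  show "det (\<chi> i j. if i = m \<and> j = n then c else of_bool (i = j)) \<noteq> 0 \<longrightarrow>
      connected_component GL (\<chi> i j. if i = m \<and> j = n then c else of_bool (i = j)) (mat 1 :: real ^ 'n ^ 'n) \<or>
      connected_component GL (\<chi> i j. if i = m \<and> j = n then c else of_bool (i = j)) (reflection e)"
    if "m \<noteq> n" for m n :: 'n and c :: real
  proof -
    \<comment> \<open>A shear is joined to the identity by letting its off-diagonal entry go to 0;
      the determinant stays 1.\<close>
    define M :: "real \<Rightarrow> real ^ 'n ^ 'n" where "M = (\<lambda>c. \<chi> i j. if i = m \<and> j = n then c else of_bool (i = j))"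
    have "M c = (\<chi> k. if k = m then row m (mat 1) + c *s row n (mat 1) else row k (mat 1))" for c
      using that by (auto simp: M_def vec_eq_iff row_def mat_def)
    then have "det (M c) = 1" for c using det_row_operation[OF that, of "mat 1 :: real ^ 'n ^ 'n" c] by simp
    then have "range M \<subseteq> GL" by (auto simp: GL_def)
    moreover have "connected (range M)"
    proof (intro connected_continuous_image)
      show "continuous_on UNIV M" unfolding M_def
      proof (intro continuous_on_vec_lambda)
        fix i j show "continuous_on UNIV (\<lambda>c. if i = m \<and> j = n then c else of_bool (i = j))"
          by (cases "i = m \<and> j = n") auto
      qed
    qed simp
    moreover have "M 0 = mat 1" using that by (auto simp: M_def mat_def vec_eq_iff)
    ultimately have "connected_component GL (M c) (mat 1)"
      unfolding connected_component_def by (metis rangeI)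
    then show ?thesis by (simp add: M_def)
  qed
qed

text \<open>A connected set of invertible matrices containing \<open>A\<close> and a reflection
  would have determinants of both signs, hence a zero determinant.\<close>

lemma GL_pos_connected:
  fixes A :: "real ^ 'n ^ 'n::finite"
  assumes card: "CARD('n) \<ge> 2" and "det A > 0"
  shows "connected_component GL A (mat 1)"
proof (rule ccontr)
  fix k :: 'n
  assume "\<not> connected_component GL A (mat 1)"
  then have "connected_component GL A (reflection (axis k 1))"
    using GL_components[OF card, of "axis k 1" A] assms(2) by simp
  then obtain S where S: "connected S" "S \<subseteq> GL" "A \<in> S" "reflection (axis k 1) \<in> S"
    by (auto simp: connected_component_def)
  have "det (reflection (axis k 1 :: real ^ 'n)) = (\<Prod>i\<in>UNIV. reflection (axis k 1) $ i $ i)"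
    by (rule det_diagonal) (auto simp: reflection_def axis_def)
  also have "\<dots> = (\<Prod>i\<in>UNIV. if i = k then -1 else 1)"
    by (rule prod.cong) (auto simp: reflection_def axis_def)
  also have "\<dots> = -1" by simp
  finally have "det (reflection (axis k 1 :: real ^ 'n)) = -1" .
  moreover have "connected (det ` S)"
    by (intro connected_continuous_image S, unfold det_def, intro continuous_intros)
  ultimately have "0 \<in> det ` S"
    using connectedD_interval[of "det ` S" "-1" "det A" 0] S assms(2) by force
  then show False using S(2) by (auto simp: GL_def)
qed

section \<open>Prescribed germs of compactly supported diffeomorphisms\<close>

lemma frechet_derivative_eqI: "(f has_derivative D) (at x) \<Longrightarrow> frechet_derivative f (at x) = D"
  using frechet_derivative_at by metis

text \<open>One \<open>e\<close> serves every neighbourhood \<open>U\<close>, because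
  \<open>cutoff (x / r)\<close> times \<open>x\<close> has the same Lipschitz constant for all
  \<open>r\<close>: rescaling by \<open>r\<close> cancels.\<close>

lemma small_linear_germ:
  "\<exists>e>0. \<forall>U (H :: real ^ 'n::finite \<Rightarrow> real ^ 'n). open U \<longrightarrow> 0 \<in> U \<longrightarrow> linear H \<longrightarrow> (\<forall>x. norm (H x) \<le> e * norm x) \<longrightarrow>
    (\<exists>z r. cdiff U z \<and> r > 0 \<and> (\<forall>x. norm x \<le> r \<longrightarrow> z x = x + H x))"
proof -
  have "smooth_on UNIV (\<lambda>x :: real ^ 'n. cutoff x *\<^sub>R x)" by (intro smooth_intros) auto
  from smooth_compact_support_lipschitz[OF this, of "cball 0 2"]
  obtain B where B: "B > 0" "\<And>x y :: real ^ 'n. norm (cutoff x *\<^sub>R x - cutoff y *\<^sub>R y) \<le> B * norm (x - y)"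
    by (auto simp: cutoff_0)
  show ?thesis
  proof (intro exI[of _ "1 / (2 * B)"] conjI allI impI)
    show "1 / (2 * B) > 0" using B by simp
    fix U :: "(real ^ 'n) set" and H :: "real ^ 'n \<Rightarrow> real ^ 'n"
    assume U: "open U" "0 \<in> U" and H: "linear H" "\<forall>x. norm (H x) \<le> 1 / (2 * B) * norm x"
    obtain R where R: "R > 0" "cball 0 R \<subseteq> U" using U open_contains_cball by blast
    define r where "r = R / 2"
    have r: "r > 0" "cball 0 (2 * r) \<subseteq> U" using R by (auto simp: r_def)
    define h where "h = (\<lambda>x. H (cutoff ((1 / r) *\<^sub>R (x - 0)) *\<^sub>R x))"
    have "cdiff U (\<lambda>x. x + h x)"
    proof (rule cdiff_perturbation)
      show "smooth_on UNIV h" unfolding h_def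
        by (rule smooth_on_linear[OF linear_linear[THEN iffD2, OF H(1)]], intro smooth_intros) auto
      show "compact (cball 0 (2 * r) :: (real ^ 'n) set)" "cball 0 (2 * r) \<subseteq> U" using r by auto
      show "h x = 0" if "x \<notin> cball 0 (2 * r)" for x
        using compact_cutoff_support[OF r(1) that] H(1) by (simp add: h_def linear_0)
      show "norm (h x - h y) \<le> 1 / 2 * norm (x - y)" for x y
      proof -
        let ?x = "(1 / r) *\<^sub>R x" and ?y = "(1 / r) *\<^sub>R y"
        have "h x - h y = H (r *\<^sub>R (cutoff ?x *\<^sub>R ?x - cutoff ?y *\<^sub>R ?y))"
          using r H(1) by (simp add: h_def linear_diff scaleR_diff_right)
        then have "norm (h x - h y) \<le> 1 / (2 * B) * norm (r *\<^sub>R (cutoff ?x *\<^sub>R ?x - cutoff ?y *\<^sub>R ?y))"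
          using spec[OF H(2)] by (simp only:)
        also have "\<dots> = r / (2 * B) * norm (cutoff ?x *\<^sub>R ?x - cutoff ?y *\<^sub>R ?y)" using r by simp
        also have "\<dots> \<le> r / (2 * B) * (B * norm (?x - ?y))"
          using r B by (intro mult_left_mono B(2)) auto
        also have "?x - ?y = (1 / r) *\<^sub>R (x - y)" by (simp add: scaleR_diff_right)
        also have "r / (2 * B) * (B * norm ((1 / r) *\<^sub>R (x - y))) = 1 / 2 * norm (x - y)" using r B by simp
        finally show ?thesis .
      qed
    qed simp
    moreover have "x + h x = x + H x" if "norm x \<le> r" for x
      using that r by (simp add: h_def cutoff_1)
    ultimately show "\<exists>z r. cdiff U z \<and> r > 0 \<and> (\<forall>x. norm x \<le> r \<longrightarrow> z x = x + H x)"
      using r(1) by blast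
  qed
qed

lemma norm_matrix_vector_bound:
  fixes A :: "real ^ 'n::finite ^ 'm::finite"
  shows "norm (A *v x) \<le> norm A * real CARD('n) * norm x"
proof -
  have "A *v x = (\<Sum>i\<in>UNIV. x $ i *s column i A)" by (rule matrix_mult_sum)
  also have "norm \<dots> \<le> (\<Sum>i\<in>(UNIV :: 'n set). norm A * norm x)"
  proof (rule sum_norm_le)
    fix i :: 'n
    have "norm (column i A) \<le> norm A"
      unfolding norm_vec_def[of "column i A"] norm_vec_def[of A]
      by (rule L2_set_mono) (auto simp: column_def component_le_norm_cart)
    moreover have "\<bar>x $ i\<bar> \<le> norm x" by (rule component_le_norm_cart)
    ultimately show "norm (x $ i *s column i A) \<le> norm A * norm x"
      by (simp add: scalar_mult_eq_scaleR mult.commute mult_mono)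
  qed
  also have "\<dots> = norm A * real CARD('n) * norm x" by simp
  finally show ?thesis .
qed

text \<open>Two matrices are related if a diffeomorphism supported in \<open>U\<close> carries the
  germ of one to the germ of the other. Small linear germs make the classes open, and a connected
  set of invertible matrices joins \<open>A\<close> to the identity.\<close>

lemma linear_germ:
  fixes A :: "real ^ 'n ^ 'n::finite"
  assumes card: "CARD('n) \<ge> 2" and A: "det A > 0" and U: "open U" "0 \<in> U"
  obtains z r where "cdiff U z" "r > 0" "\<And>x. norm x < r \<Longrightarrow> z (A *v x) = x"
proof -
  define R where "R = (\<lambda>A B :: real ^ 'n ^ 'n. \<exists>z r. cdiff U z \<and> r > 0 \<and> (\<forall>x. norm x < r \<longrightarrow> z (A *v x) = B *v x))"
  obtain S where S: "connected S" "S \<subseteq> GL" "A \<in> S" "mat 1 \<in> S"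
    using GL_pos_connected[OF card A] by (auto simp: connected_component_def)
  have "R A (mat 1)"
  proof (rule connected_equivalence_relation[OF S(1) S(3,4), where R = R])
    fix X Y assume "R X Y"
    then obtain z r where z: "cdiff U z" "r > 0" "\<And>x. norm x < r \<Longrightarrow> z (X *v x) = Y *v x" by (auto simp: R_def)
    then have "inv z (Y *v x) = X *v x" if "norm x < r" for x
      using that cdiff_bij[OF z(1)] by (metis bij_inv_eq_iff)
    then show "R Y X" using cdiff_inv[OF z(1)] z(2) by (auto simp: R_def)
  next
    fix X Y Z assume "R X Y" "R Y Z"
    then obtain z r z' r' where z: "cdiff U z" "r > 0" "\<And>x. norm x < r \<Longrightarrow> z (X *v x) = Y *v x"
      and z': "cdiff U z'" "r' > 0" "\<And>x. norm x < r' \<Longrightarrow> z' (Y *v x) = Z *v x" by (auto simp: R_def)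
    have "cdiff U (\<lambda>x. z' (z x)) \<and> min r r' > 0 \<and> (\<forall>x. norm x < min r r' \<longrightarrow> z' (z (X *v x)) = Z *v x)"
      using cdiff_compose[OF z(1) z'(1)] z z' by auto
    then show "R X Z" unfolding R_def by blast
  next
    fix X assume X: "X \<in> S"
    then have "invertible X" using S(2) by (auto simp: GL_def invertible_det_nz)
    then obtain X' where X': "X' ** X = mat 1" by (auto simp: invertible_def)
    obtain e where e: "e > 0" "\<And>U (H :: real ^ 'n \<Rightarrow> real ^ 'n). open U \<Longrightarrow> 0 \<in> U \<Longrightarrow> linear H \<Longrightarrow> (\<forall>x. norm (H x) \<le> e * norm x) \<Longrightarrow>
      (\<exists>z r. cdiff U z \<and> r > 0 \<and> (\<forall>x. norm x \<le> r \<longrightarrow> z x = x + H x))"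
      using small_linear_germ by metis
    define N where "N = real CARD('n)"
    have N: "N > 0" by (simp add: N_def)
    \<comment> \<open>The bound on \<open>H\<close> below loses a factor \<open>N\<close> twice and
      the norm of \<open>X'\<close> once; the summand 1 keeps the denominator positive.\<close>
    define d where "d = e / (N * N * (norm X' + 1))"
    have d: "d > 0" using e N by (simp add: d_def add_nonneg_pos)
    have near: "R X Y" if Y: "dist X Y < d" for Y
    proof -
      \<comment> \<open>As \<open>X'\<close> inverts \<open>X\<close>, the map
        \<open>x + H x\<close> takes \<open>X *v x\<close> to \<open>Y *v x\<close>.\<close>
      define H where "H = (\<lambda>x. (Y - X) *v (X' *v x))"
      have lin: "linear H" unfolding H_def
        by (auto simp: linear_iff matrix_vector_right_distrib matrix_vector_mult_scaleR)
      have bound: "norm (H x) \<le> e * norm x" for x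
      proof -
        have "norm (H x) \<le> norm (Y - X) * N * norm (X' *v x)"
          unfolding H_def N_def by (rule norm_matrix_vector_bound)
        also have "\<dots> \<le> d * N * (norm X' * N * norm x)"
          using Y d N norm_matrix_vector_bound[of X' x]
          by (intro mult_mono) (auto simp: dist_norm norm_minus_commute N_def)
        also have "\<dots> = e * norm x * (norm X' / (norm X' + 1))"
          using N by (simp add: d_def)
        also have "\<dots> \<le> e * norm x * 1"
          using e by (intro mult_left_mono) (auto simp: divide_simps add_nonneg_pos)
        finally show ?thesis by simp
      qed
      obtain z r where z: "cdiff U z" "r > 0" "\<And>x. norm x \<le> r \<Longrightarrow> z x = x + H x"
        using e(2)[OF U lin] bound by metis
      define r' where "r' = r / (norm X * N + 1)"
      have r': "r' > 0" using z(2) N by (simp add: r'_def add_nonneg_pos)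
      have "z (X *v x) = Y *v x" if x: "norm x < r'" for x
      proof -
        have "norm (X *v x) \<le> norm X * N * norm x" unfolding N_def by (rule norm_matrix_vector_bound)
        also have "\<dots> \<le> (norm X * N + 1) * r'" using x N by (intro mult_mono) auto
        also have "\<dots> = r" using N by (simp add: r'_def add_nonneg_eq_0_iff)
        finally have "z (X *v x) = X *v x + H (X *v x)" by (rule z(3))
        also have "H (X *v x) = (Y - X) *v x"
          unfolding H_def by (simp add: matrix_vector_mul_assoc X')
        finally show ?thesis by (simp add: matrix_vector_mult_diff_rdistrib)
      qed
      then show ?thesis using z(1) r' by (auto simp: R_def)
    qed
    show "\<exists>T. openin (top_of_set S) T \<and> X \<in> T \<and> (\<forall>x\<in>T. R X x)"
      by (rule exI[of _ "S \<inter> ball X d"]) (use d near X in \<open>auto simp: openin_open_Int\<close>)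
  qed
  then show ?thesis using that by (auto simp: R_def)
qed

text \<open>The difference of \<open>g\<close> and the identity has vanishing derivative at 0, hence
  an arbitrarily small Lipschitz constant on small balls. Cutting it off on a ball of comparable
  radius keeps it a contraction.\<close>

lemma nonlinear_germ:
  fixes g :: "real ^ 'n::finite \<Rightarrow> real ^ 'n"
  assumes g: "smooth_on V g" "0 \<in> V" "g 0 = 0" "\<And>v. frechet_derivative g (at 0) v = v" and U: "open U" "0 \<in> U"
  obtains z r where "cdiff U z" "r > 0" "\<And>x. norm x < r \<Longrightarrow> z x = g x"
proof -
  define k where "k = (\<lambda>x. g x - x)"
  have V: "open V" using g(1) smooth_on_open by blast
  have sk: "smooth_on V k" unfolding k_def using g(1) V by (intro smooth_intros)
  have dk: "frechet_derivative k (at x) v = frechet_derivative g (at x) v - v" if "x \<in> V" for x v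
  proof -
    have "(k has_derivative (\<lambda>v. frechet_derivative g (at x) v - v)) (at x)"
      unfolding k_def by (intro derivative_intros smooth_on_has_derivative[OF g(1) that])
    from frechet_derivative_eqI[OF this] show ?thesis by simp
  qed
  obtain B where B: "B > 0" "\<And>x y :: real ^ 'n. \<bar>cutoff x - cutoff y\<bar> \<le> B * norm (x - y)"
    using cutoff_lipschitz by blast
  \<comment> \<open>On the ball of radius \<open>2 * r\<close> the difference \<open>k\<close> is at
    most \<open>2 * e * r\<close>, while the cutoff has Lipschitz constant \<open>B / r\<close>. The
    product rule gives the constant \<open>e + 2 * B * e\<close>, which this choice makes
    1/2.\<close>
  define e where "e = 1 / (2 * (2 * B + 1))"
  have e: "e > 0" "e * (2 * B + 1) = 1 / 2" using B by (auto simp: e_def)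
  obtain d where d: "d > 0" "ball 0 d \<subseteq> V"
    "\<And>y v. dist 0 y < d \<Longrightarrow> norm (frechet_derivative k (at y) v - frechet_derivative k (at 0) v) \<le> e * norm v"
    by (rule smooth_on_deriv_close[OF sk g(2) e(1)]) blast
  obtain d' where d': "d' > 0" "ball 0 d' \<subseteq> U" using U open_contains_ball by blast
  define r where "r = min d d' / 4"
  have r: "r > 0" "cball 0 (2 * r) \<subseteq> ball 0 d" "cball 0 (2 * r) \<subseteq> U" "2 * r < d"
    using d d' by (auto simp: r_def subset_iff)
  have kl: "norm (k x - k y) \<le> e * norm (x - y)" if "x \<in> ball 0 d" "y \<in> ball 0 d" for x y
  proof (rule differentiable_bound[of "ball 0 d" k "\<lambda>x. frechet_derivative k (at x)"])
    show "(k has_derivative frechet_derivative k (at x)) (at x within ball 0 d)" if "x \<in> ball 0 d" for x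
      using smooth_on_has_derivative[OF sk] d(2) that has_derivative_at_withinI by blast
    show "onorm (frechet_derivative k (at x)) \<le> e" if "x \<in> ball 0 d" for x
    proof (rule onorm_le)
      fix v
      show "norm (frechet_derivative k (at x) v) \<le> e * norm v"
        using d(3)[of x v] that dk[OF g(2), of v] g(4) by simp
    qed
  qed (use that in auto)
  have k0: "k 0 = 0" using g(3) by (simp add: k_def)
  define c where "c = (\<lambda>x :: real ^ 'n. cutoff ((1 / r) *\<^sub>R (x - 0)))"
  have c_lip: "\<bar>c x - c y\<bar> \<le> B / r * norm (x - y)" for x y
  proof -
    have "\<bar>c x - c y\<bar> \<le> B * norm ((1 / r) *\<^sub>R (x - 0) - (1 / r) *\<^sub>R (y - 0))" unfolding c_def by (rule B(2))
    also have "(1 / r) *\<^sub>R (x - 0) - (1 / r) *\<^sub>R (y - 0) = (1 / r) *\<^sub>R (x - y)" by (simp add: scaleR_diff_right)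
    also have "B * norm ((1 / r) *\<^sub>R (x - y)) = B / r * norm (x - y)" using r by simp
    finally show ?thesis .
  qed
  have c0: "c x = 0" if "x \<notin> cball 0 (2 * r)" for x
    unfolding c_def by (rule compact_cutoff_support[OF r(1) that])
  have cb: "0 \<le> c x" "c x \<le> 1" for x by (auto simp: c_def cutoff_bounds)
  define h where "h = (\<lambda>x. if x \<in> V then c x *\<^sub>R k x else 0)"
  have k_small: "norm (k y) \<le> 2 * e * r" if "y \<in> cball 0 (2 * r)" for y
  proof -
    have "norm (k y) \<le> e * norm y" using kl[of y 0] that r(4) d(1) k0 by auto
    also have "\<dots> \<le> e * (2 * r)" using that e by (intro mult_left_mono) auto
    finally show ?thesis by simp
  qed
  \<comment> \<open>The product rule is arranged so that \<open>k\<close> is evaluated only in the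
    ball where it is controlled; a point outside enters through its vanishing cutoff alone.\<close>
  have in1: "norm (h x - h y) \<le> 1 / 2 * norm (x - y)" if y: "y \<in> cball 0 (2 * r)" for x y
  proof -
    have yV: "y \<in> V" "y \<in> ball 0 d" using subsetD[OF r(2) y] d(2) by blast+
    have hy: "h y = c y *\<^sub>R k y" using yV by (simp add: h_def)
    have 2: "norm ((c x - c y) *\<^sub>R k y) \<le> 2 * B * e * norm (x - y)"
    proof -
      have "norm ((c x - c y) *\<^sub>R k y) \<le> (B / r * norm (x - y)) * (2 * e * r)"
        unfolding norm_scaleR using B r by (intro mult_mono c_lip k_small y) auto
      then show ?thesis using r by (simp add: algebra_simps)
    qed
    have 1: "norm (c x *\<^sub>R (if x \<in> cball 0 (2 * r) then k x - k y else 0)) \<le> e * norm (x - y)"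
    proof (cases "x \<in> cball 0 (2 * r)")
      case True
      then have "norm (k x - k y) \<le> e * norm (x - y)" using kl[of x y] yV r(2) by blast
      then have "c x * norm (k x - k y) \<le> 1 * (e * norm (x - y))"
        using cb[of x] by (intro mult_mono) auto
      then show ?thesis using True cb[of x] by simp
    qed (use e in simp)
    have "h x - h y = c x *\<^sub>R (if x \<in> cball 0 (2 * r) then k x - k y else 0) + (c x - c y) *\<^sub>R k y"
    proof (cases "x \<in> cball 0 (2 * r)")
      case True
      then have "x \<in> V" using r(2) d(2) by blast
      then show ?thesis using True hy by (simp add: h_def algebra_simps)
    next
      case False
      then show ?thesis using hy c0[OF False] by (simp add: h_def)
    qed
    then have "norm (h x - h y) \<le> e * norm (x - y) + 2 * B * e * norm (x - y)"
      using norm_triangle_mono[OF 1 2] by simp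
    also have "\<dots> = (e * (2 * B + 1)) * norm (x - y)" by (simp add: algebra_simps)
    finally show ?thesis unfolding e(2) .
  qed
  have h0: "h x = 0" if "x \<notin> cball 0 (2 * r)" for x using c0[OF that] by (simp add: h_def)
  have "cdiff U (\<lambda>x. x + h x)"
  proof (rule cdiff_perturbation)
    show "smooth_on UNIV h"
    proof (rule smooth_on_local)
      fix x :: "real ^ 'n"
      show "\<exists>W. x \<in> W \<and> smooth_on W h"
      proof (cases "x \<in> V")
        case True
        have "smooth_on V (\<lambda>x. c x *\<^sub>R k x)" unfolding c_def using V by (intro smooth_intros sk)
        then have "smooth_on V h" by (rule smooth_on_cong) (simp add: h_def)
        then show ?thesis using True by blast
      next
        case False
        then have "x \<in> - cball 0 (2 * r)" using r(2) d(2) by blast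
        moreover have "smooth_on (- cball 0 (2 * r)) h"
          by (rule smooth_on_cong[OF smooth_on_const[of _ 0]]) (use h0 in auto)
        ultimately show ?thesis by blast
      qed
    qed simp
    show "compact (cball 0 (2 * r) :: (real ^ 'n) set)" "cball 0 (2 * r) \<subseteq> U" using r by auto
    show "norm (h x - h y) \<le> 1 / 2 * norm (x - y)" for x y
    proof (cases "y \<in> cball 0 (2 * r)")
      case False
      show ?thesis
      proof (cases "x \<in> cball 0 (2 * r)")
        case True
        then show ?thesis using in1[OF True, of y] by (simp add: norm_minus_commute)
      next
        case False
        then show ?thesis using h0 \<open>y \<notin> _\<close> by simp
      qed
    qed (rule in1)
  qed (use h0 in auto)
  moreover have "x + h x = g x" if "norm x < r" for x
  proof -
    have "x \<in> ball 0 d" using that r(4) r(1) by simp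
    then have "x \<in> V" using d(2) by blast
    moreover have "c x = 1" unfolding c_def using that r(1) by (intro cutoff_1) simp
    ultimately show ?thesis by (simp add: h_def k_def)
  qed
  ultimately show ?thesis using that r(1) by blast
qed

text \<open>First the base point is corrected, then the derivative, then the higher order terms.\<close>

lemma disc_lemma:
  fixes g :: "real ^ 'n::finite \<Rightarrow> real ^ 'n"
  assumes card: "CARD('n) \<ge> 2" and U: "open U" "connected U" "0 \<in> U"
    and g: "emb V g" "0 \<in> V" "g 0 \<in> U" "jac g 0 > 0"
  obtains z a where "cdiff U z" "a > 0" "ball 0 a \<subseteq> V" "\<And>y. norm y < a \<Longrightarrow> z (g y) = y"
proof -
  obtain z1 where z1: "cdiff U z1" "z1 (g 0) = 0" using cdiff_transitive[OF U(1,2) g(3) U(3)] by blast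
  define g1 where "g1 = (\<lambda>y. z1 (g y))"
  have eg1: "emb V g1" unfolding g1_def using emb_compose[OF g(1) cdiff_emb[OF z1(1)]] by simp
  have dg: "g differentiable (at 0)" using smooth_on_differentiable[OF embD(2)[OF g(1)] g(2)] .
  have dz: "z differentiable (at x)" if "cdiff U z" for z x
    using smooth_on_differentiable[OF embD(2)[OF cdiff_emb[OF that]]] by simp
  have jg1: "jac g1 0 > 0"
    unfolding g1_def using jac_compose[OF dg dz[OF z1(1)]] cdiff_jac_pos[OF z1(1)] g(4) by simp
  define A where "A = matrix (frechet_derivative g1 (at 0))"
  have g1': "(g1 has_derivative (\<lambda>v. A *v v)) (at 0)"
  proof -
    have d: "(g1 has_derivative frechet_derivative g1 (at 0)) (at 0)"
      using smooth_on_has_derivative[OF embD(2)[OF eg1] g(2)] .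
    moreover have "frechet_derivative g1 (at 0) = (\<lambda>v. A *v v)"
      unfolding A_def using has_derivative_linear[OF d] by (simp add: matrix_works fun_eq_iff)
    ultimately show ?thesis by simp
  qed
  \<comment> \<open>Orientation enters here: compactly supported diffeomorphisms have positive
    Jacobian, so only a derivative of positive determinant can be undone by one.\<close>
  have "det A > 0" using jg1 by (simp add: jac_def A_def)
  then obtain z2 r2 where z2: "cdiff U z2" "r2 > 0" "\<And>x. norm x < r2 \<Longrightarrow> z2 (A *v x) = x"
    using linear_germ[OF card _ U(1,3)] by metis
  define g2 where "g2 = (\<lambda>y. z2 (g1 y))"
  have eg2: "emb V g2" unfolding g2_def using emb_compose[OF eg1 cdiff_emb[OF z2(1)]] by simp
  have g10: "g1 0 = 0" using z1 by (simp add: g1_def)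
  have z20: "z2 0 = 0" using z2(3)[of 0] z2(2) by simp
  have dg2: "frechet_derivative g2 (at 0) v = v" for v
  proof -
    let ?z = "frechet_derivative z2 (at 0)"
    have z2': "(z2 has_derivative ?z) (at 0)" using dz[OF z2(1)] by (simp add: frechet_derivative_works)
    have "((\<lambda>x. z2 (A *v x)) has_derivative (\<lambda>v. ?z (A *v v))) (at 0)"
      by (rule has_derivative_compose[where f = "\<lambda>x. A *v x" and g = z2])
         (use z2' in \<open>auto intro: bounded_linear_imp_has_derivative matrix_vector_mul_bounded_linear\<close>)
    then have "((\<lambda>x. x) has_derivative (\<lambda>v. ?z (A *v v))) (at 0)"
      by (rule has_derivative_transform_within_open[OF _ open_ball[of 0 r2]]) (use z2 in auto)
    then have id: "(\<lambda>v. ?z (A *v v)) = (\<lambda>v. v)"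
      using has_derivative_unique has_derivative_ident by blast
    have "(g2 has_derivative (\<lambda>v. ?z (A *v v))) (at 0)"
      unfolding g2_def by (rule has_derivative_compose[OF g1']) (use z2' g10 in simp)
    then have "(g2 has_derivative (\<lambda>v. v)) (at 0)" unfolding id .
    from frechet_derivative_eqI[OF this] show ?thesis by simp
  qed
  obtain z3 r3 where z3: "cdiff U z3" "r3 > 0" "\<And>x. norm x < r3 \<Longrightarrow> z3 x = g2 x"
    using nonlinear_germ[OF embD(2)[OF eg2] g(2) _ dg2 U(1,3)] g10 z20 by (metis g2_def)
  obtain rV where rV: "rV > 0" "ball 0 rV \<subseteq> V" using embD(1)[OF g(1)] g(2) open_contains_ball by blast
  show ?thesis
  proof
    show "cdiff U (\<lambda>x. inv z3 (z2 (z1 x)))"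
      by (rule cdiff_compose[OF cdiff_compose[OF z1(1) z2(1)] cdiff_inv[OF z3(1)]])
    show "min r3 rV > 0" using z3 rV by simp
    show "ball 0 (min r3 rV) \<subseteq> V" using rV by (auto simp: subset_iff)
    show "inv z3 (z2 (z1 (g y))) = y" if "norm y < min r3 rV" for y
    proof -
      have "z2 (z1 (g y)) = z3 y" using z3(3)[of y] that by (simp add: g2_def g1_def)
      then show ?thesis using bij_is_inj[OF cdiff_bij[OF z3(1)]] by simp
    qed
  qed
qed

text \<open>A single perturbation can only shrink by a limited factor. It maps the ball of radius
  \<open>r\<close> to a smaller concentric one, so it can be iterated until the image is tiny; then
  the origin is moved to \<open>c\<close>.\<close>

lemma squeeze_ball:
  fixes c :: "real ^ 'n::finite"
  assumes r: "0 < r" "r < 1" and c: "norm c < 1" and w: "w > 0"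
  obtains d where "cdiff (ball 0 1) d" "d ` cball 0 r \<subseteq> ball c w"
proof -
  define R where "R = (1 + r) / 2"
  have R: "r < R" "R < 1" "0 < R" using r by (auto simp: R_def)
  have rR: "r\<^sup>2 < R\<^sup>2" using R r by (intro power_strict_mono) auto
  define p where "p = (\<lambda>x :: real ^ 'n. step ((R\<^sup>2 - x \<bullet> x) / (R\<^sup>2 - r\<^sup>2)))"
  have p1: "p x = 1" if "norm x \<le> r" for x
  proof -
    have "x \<bullet> x \<le> r\<^sup>2" using that by (simp add: dot_square_norm power_mono)
    then show ?thesis using rR by (auto simp: p_def intro!: step_1)
  qed
  have p0: "p x = 0" if "x \<notin> cball 0 R" for x
  proof -
    have "R\<^sup>2 \<le> x \<bullet> x" using that R by (simp add: dot_square_norm power_mono)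
    then show ?thesis using rR by (auto simp: p_def intro!: step_0 divide_nonpos_pos)
  qed
  have sp: "smooth_on UNIV (\<lambda>x. p x *\<^sub>R x)" unfolding p_def using rR by (intro smooth_intros) auto
  obtain B where B: "B > 0" "\<And>x y. norm (p x *\<^sub>R x - p y *\<^sub>R y) \<le> B * norm (x - y)"
    by (rule smooth_compact_support_lipschitz[OF sp, of "cball 0 R"]) (use p0 in auto)
  define e where "e = min (1 / 2) (1 / (2 * B))"
  have e: "0 < e" "e \<le> 1 / 2" "e * B \<le> 1 / 2"
  proof -
    show "0 < e" "e \<le> 1 / 2" using B by (auto simp: e_def)
    have "e * B \<le> 1 / (2 * B) * B" using B by (intro mult_right_mono) (auto simp: e_def)
    then show "e * B \<le> 1 / 2" using B by simp
  qed
  define f where "f = (\<lambda>x. x + - (e *\<^sub>R (p x *\<^sub>R x)))"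
  have f: "cdiff (ball 0 1) f"
    unfolding f_def
  proof (rule cdiff_perturbation)
    show "smooth_on UNIV (\<lambda>x. - (e *\<^sub>R (p x *\<^sub>R x)))" by (intro smooth_intros sp) auto
    show "compact (cball 0 R :: (real ^ 'n) set)" "cball 0 R \<subseteq> (ball 0 1 :: (real ^ 'n) set)" using R by auto
    show "- (e *\<^sub>R p x *\<^sub>R x) = 0" if "x \<notin> cball 0 R" for x using p0[OF that] by simp
    show "norm (- (e *\<^sub>R p x *\<^sub>R x) - - (e *\<^sub>R p y *\<^sub>R y)) \<le> 1 / 2 * norm (x - y)" for x y
    proof -
      have "- (e *\<^sub>R p x *\<^sub>R x) - - (e *\<^sub>R p y *\<^sub>R y) = - (e *\<^sub>R (p x *\<^sub>R x - p y *\<^sub>R y))"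
        by (simp add: scaleR_diff_right)
      then have "norm (- (e *\<^sub>R p x *\<^sub>R x) - - (e *\<^sub>R p y *\<^sub>R y)) = e * norm (p x *\<^sub>R x - p y *\<^sub>R y)"
        using e by simp
      also have "\<dots> \<le> e * (B * norm (x - y))" using e by (intro mult_left_mono B) auto
      also have "\<dots> = e * B * norm (x - y)" by simp
      also have "\<dots> \<le> 1 / 2 * norm (x - y)" using e by (intro mult_right_mono) auto
      finally show ?thesis .
    qed
  qed simp
  have fr: "f x = (1 - e) *\<^sub>R x" if "norm x \<le> r" for x
    using p1[OF that] by (simp add: f_def algebra_simps)
  have fn: "cdiff (ball 0 1) (f ^^ n) \<and> (\<forall>x. norm x \<le> r \<longrightarrow> (f ^^ n) x = (1 - e) ^ n *\<^sub>R x)" for n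
  proof (induction n)
    case 0
    then show ?case using cdiff_id by (auto simp: id_def)
  next
    case (Suc n)
    have "f ((1 - e) ^ n *\<^sub>R x) = (1 - e) ^ Suc n *\<^sub>R x" if "norm x \<le> r" for x
    proof -
      have "norm ((1 - e) ^ n *\<^sub>R x) \<le> 1 * norm x"
        using e by (simp only: norm_scaleR) (intro mult_right_mono, auto simp: abs_le_iff power_le_one)
      then show ?thesis using fr[of "(1 - e) ^ n *\<^sub>R x"] that by simp
    qed
    then show ?case using Suc cdiff_compose[of _ "f ^^ n" f] f by (auto simp: o_def)
  qed
  obtain t where t: "cdiff (ball 0 1) t" "t 0 = c"
    using cdiff_transitive[of "ball 0 1" 0 c] c by auto
  have "isCont t 0"
    using embD(5)[OF cdiff_emb[OF t(1)]] by (simp add: continuous_on_eq_continuous_at)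
  then obtain s where s: "s > 0" "\<And>x. dist x 0 < s \<Longrightarrow> dist (t x) (t 0) < w"
    using w unfolding continuous_at_eps_delta by (metis dist_commute)
  obtain n where n: "(1 - e) ^ n < s / r"
    using real_arch_pow_inv[of "s / r" "1 - e"] s r e by auto
  show ?thesis
  proof
    show "cdiff (ball 0 1) (\<lambda>x. t ((f ^^ n) x))" using cdiff_compose fn t(1) by blast
    show "(\<lambda>x. t ((f ^^ n) x)) ` cball 0 r \<subseteq> ball c w"
    proof clarsimp
      fix x :: "real ^ 'n" assume x: "norm x \<le> r"
      have "norm ((f ^^ n) x) = (1 - e) ^ n * norm x" using fn[of n] x e by simp
      also have "\<dots> \<le> (1 - e) ^ n * r" using x e by (intro mult_left_mono) auto
      also have "\<dots> < s" using n r by (simp add: field_simps)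
      finally show "dist c (t ((f ^^ n) x)) < w" using s(2)[of "(f ^^ n) x"] t(2) by (simp add: dist_commute)
    qed
  qed
qed

subsection \<open>Annuli, inversion and radial maps\<close>

definition ann :: "real \<Rightarrow> real \<Rightarrow> 'a::real_normed_vector set" where
  "ann a b = {y. a < norm y \<and> norm y < b}"

lemma ann_iff [simp]: "y \<in> ann a b \<longleftrightarrow> a < norm y \<and> norm y < b"
  by (simp add: ann_def)

lemma open_ann [simp, intro]: "open (ann a b)"
  unfolding ann_def by (intro open_Collect_conj open_Collect_less continuous_intros)

lemma compact_closed_annulus: "compact {y :: 'a::euclidean_space. a \<le> norm y \<and> norm y \<le> b}"
proof -
  have "closed {y :: 'a. a \<le> norm y \<and> norm y \<le> b}"
    by (intro closed_Collect_conj closed_Collect_le continuous_intros)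
  then have "compact (cball 0 b \<inter> {y :: 'a. a \<le> norm y \<and> norm y \<le> b})"
    by (rule compact_Int_closed[OF compact_cball])
  moreover have "cball 0 b \<inter> {y :: 'a. a \<le> norm y \<and> norm y \<le> b} = {y. a \<le> norm y \<and> norm y \<le> b}" by auto
  ultimately show ?thesis by simp
qed

lemma avoid_sphere:
  fixes C :: "'a::euclidean_space set"
  assumes "compact C" "\<And>y. y \<in> C \<Longrightarrow> norm y \<noteq> s"
  obtains d where "d > 0" "\<And>y. \<bar>norm y - s\<bar> < d \<Longrightarrow> y \<notin> C"
proof -
  have "compact (norm ` C)" by (intro compact_continuous_image continuous_intros assms(1))
  then have "open (- (norm ` C))" by (simp add: compact_imp_closed open_Compl)
  moreover have "s \<in> - (norm ` C)" using assms(2) by auto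
  ultimately obtain d where d: "d > 0" "ball s d \<subseteq> - (norm ` C)" using open_contains_ball by blast
  show ?thesis by (rule that[OF d(1)]) (use d(2) in \<open>auto simp: dist_real_def subset_iff abs_minus_commute\<close>)
qed

text \<open>Because \<open>inverse 0 = 0\<close>, the origin is fixed and the map is an involution
  of the whole space, though continuous only off the origin.\<close>

definition inversion :: "'a::euclidean_space \<Rightarrow> 'a" where
  "inversion y = inverse (y \<bullet> y) *\<^sub>R y"

lemma inversion_0 [simp]: "inversion 0 = 0"
  by (simp add: inversion_def)

lemma norm_inversion [simp]: "norm (inversion y) = inverse (norm y)"
  by (cases "y = 0") (simp_all add: inversion_def dot_square_norm power2_eq_square)

lemma inversion_inversion [simp]: "inversion (inversion y) = y"
  by (cases "y = 0") (simp_all add: inversion_def)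

lemma inversion_eq_0 [simp]: "inversion y = 0 \<longleftrightarrow> y = 0"
  by (metis inversion_0 inversion_inversion)

lemma inj_inversion: "inj_on inversion S"
  by (metis inj_onI inversion_inversion)

lemma smooth_on_inversion: "smooth_on (- {0}) inversion"
  unfolding inversion_def[abs_def] by (intro smooth_intros) auto

lemma emb_inversion: "emb (- {0 :: real ^ 'n::finite}) inversion"
  unfolding emb_def
proof (intro conjI ballI)
  fix x :: "real ^ 'n" assume x: "x \<in> - {0}"
  have d: "inversion differentiable (at y)" if "y \<noteq> 0" for y :: "real ^ 'n"
    by (rule smooth_on_differentiable[OF smooth_on_inversion]) (use that in auto)
  have "jac (\<lambda>y. inversion (inversion y)) x = jac inversion (inversion x) * jac inversion x"
    using x by (intro jac_compose d) auto
  then show "jac inversion x \<noteq> 0" by auto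
qed (auto intro: inj_inversion smooth_on_inversion)

lemma connected_punctured: "CARD('n) \<ge> 2 \<Longrightarrow> connected (- {0 :: real ^ 'n::finite})"
  by (rule connected_punctured_universe) simp

text \<open>Conjugation by the inversion involves its Jacobian at two points. A constant sign on the
  connected punctured space makes that product positive without determining the sign.\<close>

lemma jac_inversion_sign:
  fixes x y :: "real ^ 'n::finite"
  assumes "CARD('n) \<ge> 2" "x \<noteq> 0" "y \<noteq> 0"
  shows "jac inversion x * jac inversion y > 0"
proof -
  have nz: "jac inversion z \<noteq> 0" if "z \<noteq> 0" for z :: "real ^ 'n"
    using embD(4)[OF emb_inversion] that by auto
  have pos: "jac inversion b > 0" if "jac inversion a > 0" "a \<noteq> 0" "b \<noteq> 0" for a b :: "real ^ 'n"
    by (rule jac_sign_const[OF smooth_on_inversion connected_punctured[OF assms(1)], of a])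
       (use that nz in auto)
  show ?thesis
    using pos[of x y] pos[of y x] nz[OF assms(2)] nz[OF assms(3)] assms(2,3)
    by (smt (verit) mult_pos_pos mult_neg_neg)
qed

section \<open>Radial profiles and maps along rays\<close>

definition radial :: "(real \<Rightarrow> real) \<Rightarrow> bool" where
  "radial f \<longleftrightarrow> smooth_on {0<..} f \<and> (\<forall>t>0. f t > 0 \<and> (\<exists>D>0. (f has_real_derivative D) (at t)))"

lemma radialE:
  assumes "radial f" "t > 0"
  obtains D where "D > 0" "(f has_real_derivative D) (at t)"
  using assms unfolding radial_def by blast

lemma radial_affine:
  assumes "m > 0" "k \<ge> 0"
  shows "radial (\<lambda>t. k + m * t)"
proof -
  have "((\<lambda>t. k + m * t) has_real_derivative m) (at t)" for t
    by (auto intro!: derivative_eq_intros)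
  then show ?thesis
    unfolding radial_def using assms
    by (auto intro!: smooth_intros add_nonneg_pos)
qed

lemma radial_mult: "m > 0 \<Longrightarrow> radial (\<lambda>t. m * t)"
  using radial_affine[of m 0] by simp

lemma step_deriv:
  assumes "p < q"
  obtains D where "((\<lambda>t. step ((t - p) / (q - p))) has_real_derivative D) (at t)" "D \<ge> 0" "t \<notin> {p..q} \<Longrightarrow> D = 0"
proof -
  let ?s = "\<lambda>t. step ((t - p) / (q - p))"
  have "smooth_on UNIV ?s" using assms by (intro smooth_intros) auto
  then have "?s differentiable (at t)" by (rule smooth_on_differentiable) simp
  then obtain D where D: "(?s has_real_derivative D) (at t)"
    using real_differentiable_def by blast
  have "mono ?s" using assms by (intro monoI step_mono divide_right_mono) auto
  then have "D \<ge> 0" using mono_on_imp_deriv_nonneg[of UNIV ?s D t] D by (auto simp: mono_on_def monoD)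
  moreover have "D = 0" if nt: "t \<notin> {p..q}"
  proof -
    consider "t < p" | "t > q" using nt by force
    then have "(?s has_real_derivative 0) (at t)"
    proof cases
      case 1
      show ?thesis
        by (rule has_field_derivative_transform_within_open[OF DERIV_const[of 0] open_lessThan[of p]])
           (use 1 assms in \<open>auto simp: step_0 divide_nonpos_pos\<close>)
    next
      case 2
      show ?thesis
        by (rule has_field_derivative_transform_within_open[OF DERIV_const[of 1] open_greaterThan[of q]])
           (use 2 assms in \<open>auto simp: step_1\<close>)
    qed
    then show ?thesis using D DERIV_unique by blast
  qed
  ultimately show ?thesis using D that by blast
qed

text \<open>Switching from \<open>f\<close> up to a larger \<open>g\<close> keeps the derivative positive.\<close>

lemma radial_blend:
  assumes f: "radial f" and g: "radial g" and "p < q" and fg: "\<And>t. p \<le> t \<Longrightarrow> t \<le> q \<Longrightarrow> f t \<le> g t"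
  obtains h where "radial h" "\<And>t. t \<le> p \<Longrightarrow> h t = f t" "\<And>t. t \<ge> q \<Longrightarrow> h t = g t"
proof -
  let ?s = "\<lambda>t. step ((t - p) / (q - p))"
  define h where "h = (\<lambda>t. (1 - ?s t) * f t + ?s t * g t)"
  have "radial h" unfolding radial_def
  proof (intro conjI allI impI)
    show "smooth_on {0<..} h"
      unfolding h_def using f g assms(3) by (intro smooth_intros) (auto simp: radial_def)
    fix t :: real assume t: "t > 0"
    have s: "0 \<le> ?s t" "?s t \<le> 1" by (auto simp: step_bounds)
    have pos: "(1 - ?s t) * a + ?s t * b > 0" if "a > 0" "b > 0" for a b :: real
    proof (cases "?s t = 1")
      case False
      then have "(1 - ?s t) * a > 0" using s that by simp
      then show ?thesis using s that by (simp add: add_pos_nonneg)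
    qed (use that in simp)
    show "h t > 0" unfolding h_def using f g t by (intro pos) (auto simp: radial_def)
    obtain F where F: "F > 0" "(f has_real_derivative F) (at t)" using f t by (auto simp: radial_def)
    obtain G where G: "G > 0" "(g has_real_derivative G) (at t)" using g t by (auto simp: radial_def)
    obtain D where D: "(?s has_real_derivative D) (at t)" "D \<ge> 0" "t \<notin> {p..q} \<Longrightarrow> D = 0"
      using step_deriv[OF assms(3)] by blast
    have "(h has_real_derivative ((0 - D) * f t + F * (1 - ?s t)) + (D * g t + G * ?s t)) (at t)"
      unfolding h_def by (intro derivative_intros D F G)
    moreover have "D * (g t - f t) \<ge> 0"
      using D fg[of t] by (cases "t \<in> {p..q}") auto
    then have "((0 - D) * f t + F * (1 - ?s t)) + (D * g t + G * ?s t) > 0"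
      using pos[OF F(1) G(1)] by (simp add: algebra_simps)
    ultimately show "\<exists>D>0. (h has_real_derivative D) (at t)" by blast
  qed
  moreover have "h t = f t" if "t \<le> p" for t
    using that assms(3) by (simp add: h_def step_0 divide_nonpos_pos)
  moreover have "h t = g t" if "t \<ge> q" for t
    using that assms(3) by (simp add: h_def step_1)
  ultimately show ?thesis using that by blast
qed

text \<open>Blending only switches upwards, so descending from slope \<open>k1\<close> to slope
  \<open>k2\<close> takes two blends. The intermediate line \<open>l\<close> passes through
  \<open>(p', k1 * p')\<close> and \<open>(q', k2 * q')\<close>; its slope \<open>m\<close> is
  positive and smaller than both, so \<open>l\<close> lies above the old profile before
  \<open>p'\<close> and below the new one after \<open>q'\<close>.\<close>

lemma radial_down:
  assumes f: "radial f" and p: "0 < p" "p < p'" "p' < q'" "q' < q"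
    and k: "0 < k2" "k2 < k1" "k1 * p' < k2 * q'" and fk: "\<And>t. p \<le> t \<Longrightarrow> t \<le> p' \<Longrightarrow> f t = k1 * t"
  obtains h where "radial h" "\<And>t. t \<le> p \<Longrightarrow> h t = f t" "\<And>t. t \<ge> q \<Longrightarrow> h t = k2 * t"
proof -
  define m where "m = (k2 * q' - k1 * p') / (q' - p')"
  have m: "m > 0" "m * (q' - p') = k2 * q' - k1 * p'" using p k by (auto simp: m_def)
  have "m * (q' - p') < k1 * (q' - p')" "m * (q' - p') < k2 * (q' - p')"
    unfolding m(2) using p k by (simp_all add: algebra_simps)
  then have mk: "m < k1" "m < k2" using p by auto
  define l where "l = (\<lambda>t. (k1 - m) * p' + m * t)"
  have lr: "radial l" unfolding l_def using m mk p by (intro radial_affine) auto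
  have l1: "k1 * t \<le> l t" if "t \<le> p'" for t
  proof -
    have "(k1 - m) * t \<le> (k1 - m) * p'" using that mk by (intro mult_left_mono) auto
    then show ?thesis by (simp add: l_def algebra_simps)
  qed
  have l2: "l t \<le> k2 * t" if "t \<ge> q'" for t
  proof -
    have "(k2 - m) * q' \<le> (k2 - m) * t" using that mk by (intro mult_left_mono) auto
    then show ?thesis using m(2) by (simp add: l_def algebra_simps)
  qed
  obtain h1 where h1: "radial h1" "\<And>t. t \<le> p \<Longrightarrow> h1 t = f t" "\<And>t. t \<ge> p' \<Longrightarrow> h1 t = l t"
    by (rule radial_blend[OF f lr p(2)]) (use fk l1 in auto)
  have "h1 t \<le> k2 * t" if "q' \<le> t" for t using h1(3) l2 that p by auto
  then obtain h2 where h2: "radial h2" "\<And>t. t \<le> q' \<Longrightarrow> h2 t = h1 t" "\<And>t. t \<ge> q \<Longrightarrow> h2 t = k2 * t"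
    using radial_blend[OF h1(1) radial_mult[OF k(1)] p(4)] by metis
  show ?thesis by (rule that[OF h2(1)]) (use h1 h2 p in auto)
qed

lemma radial_strict_mono:
  assumes "radial f" "0 < s" "s < t"
  shows "f s < f t"
proof (rule DERIV_pos_imp_increasing[OF assms(3)])
  fix x assume "s \<le> x" "x \<le> t"
  then have "x > 0" using assms(2) by simp
  then show "\<exists>y. (f has_real_derivative y) (at x) \<and> 0 < y" using assms(1) unfolding radial_def by blast
qed

lemma radial_convex:
  assumes f: "radial f" and g: "radial g" and l: "0 \<le> l" "l \<le> 1"
  shows "radial (\<lambda>t. (1 - l) * f t + l * g t)"
proof -
  have pos: "(1 - l) * a + l * b > 0" if "a > 0" "b > 0" for a b :: real
  proof (cases "l = 1")
    case False
    then have "(1 - l) * a > 0" using l that by simp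
    then show ?thesis using l that by (simp add: add_pos_nonneg)
  qed (use that in simp)
  show ?thesis unfolding radial_def
  proof (intro conjI allI impI)
    show "smooth_on {0<..} (\<lambda>t. (1 - l) * f t + l * g t)"
      using f g by (intro smooth_intros) (auto simp: radial_def)
    fix t :: real assume t: "t > 0"
    show "(1 - l) * f t + l * g t > 0" using f g t by (intro pos) (auto simp: radial_def)
    obtain F where F: "F > 0" "(f has_real_derivative F) (at t)" using f t by (auto simp: radial_def)
    obtain G where G: "G > 0" "(g has_real_derivative G) (at t)" using g t by (auto simp: radial_def)
    have "((\<lambda>t. (1 - l) * f t + l * g t) has_real_derivative (1 - l) * F + l * G) (at t)"
      by (auto intro!: derivative_eq_intros F G)
    then show "\<exists>D>0. ((\<lambda>t. (1 - l) * f t + l * g t) has_real_derivative D) (at t)"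
      using pos[OF F(1) G(1)] by blast
  qed
qed

text \<open>The weight \<open>lam\<close> depends on the direction only, so on each ray the map is a
  convex combination of two increasing profiles and hence increasing. Since the map preserves rays,
  injectivity and the Jacobian reduce to this one-dimensional fact.\<close>

lemma emb_radial:
  fixes lam :: "real ^ 'n::finite \<Rightarrow> real"
  assumes f: "radial f" and g: "radial g" and lam: "smooth_on (- {0}) lam" "\<And>y. 0 \<le> lam y" "\<And>y. lam y \<le> 1"
    "\<And>s y. s > 0 \<Longrightarrow> lam (s *\<^sub>R y) = lam y"
  defines "r \<equiv> \<lambda>y. (1 - lam y) * f (norm y) + lam y * g (norm y)"
  shows "emb (- {0}) (\<lambda>y. (r y / norm y) *\<^sub>R y)"
    and "\<And>y. y \<noteq> 0 \<Longrightarrow> r y > 0"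
proof -
  have rad: "radial (\<lambda>t. (1 - lam y) * f t + lam y * g t)" for y
    using radial_convex[OF f g lam(2,3)] .
  show rpos: "r y > 0" if "y \<noteq> 0" for y using rad[of y] that by (auto simp: radial_def r_def)
  define h where "h = (\<lambda>y. (r y / norm y) *\<^sub>R y)"
  have nh: "norm (h y) = r y" if "y \<noteq> 0" for y using rpos[OF that] that by (simp add: h_def)
  have sn: "smooth_on (- {0}) (\<lambda>y :: real ^ 'n. norm y)" by (intro smooth_intros) auto
  have fs: "smooth_on (- {0}) (\<lambda>y :: real ^ 'n. k (norm y))" if "radial k" for k
  proof (rule smooth_on_compose[OF sn])
    show "smooth_on {0<..} k" using that by (simp add: radial_def)
  qed auto
  have smr: "smooth_on (- {0}) (\<lambda>y. r y / norm y)"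
    unfolding r_def by (intro smooth_intros lam(1) fs f g) auto
  have sm: "smooth_on (- {0}) h" unfolding h_def by (intro smooth_intros smr) auto
  have hs: "h (s *\<^sub>R y) = (((1 - lam y) * f (s * norm y) + lam y * g (s * norm y)) / norm y) *\<^sub>R y" if "s > 0" for s y
    using that lam(4)[OF that] by (simp add: h_def r_def)
  have "inj_on h (- {0})"
  proof (rule inj_onI)
    fix x y assume x: "x \<in> - {0}" and y: "y \<in> - {0}" and eq: "h x = h y"
    have "r x = r y" using eq nh x y by (metis ComplD singleton_iff)
    moreover have "(r x / norm x) *\<^sub>R x = (r y / norm y) *\<^sub>R y" using eq by (simp add: h_def)
    ultimately have "r y *\<^sub>R ((1 / norm x) *\<^sub>R x) = r y *\<^sub>R ((1 / norm y) *\<^sub>R y)" by simp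
    moreover have "r y \<noteq> 0" using rpos[of y] y by simp
    ultimately have "(1 / norm x) *\<^sub>R x = (1 / norm y) *\<^sub>R y" by (simp only: scaleR_cancel_left) simp
    then have "norm x *\<^sub>R (1 / norm x) *\<^sub>R x = norm x *\<^sub>R (1 / norm y) *\<^sub>R y" by simp
    then have xy: "x = (norm x / norm y) *\<^sub>R y" using x by simp
    then have "lam x = lam y" using lam(4)[of "norm x / norm y" y] x y by simp
    then have "(1 - lam y) * f (norm x) + lam y * g (norm x) = (1 - lam y) * f (norm y) + lam y * g (norm y)"
      using \<open>r x = r y\<close> by (simp add: r_def)
    then have "norm x = norm y"
      using radial_strict_mono[OF rad[of y], of "norm x" "norm y"] radial_strict_mono[OF rad[of y], of "norm y" "norm x"] x y
      by (cases "norm x" "norm y" rule: linorder_cases) auto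
    then show "x = y" using xy y by simp
  qed
  moreover have "jac h y \<noteq> 0" if y: "y \<in> - {0}" for y
  proof (rule jac_nonzeroI[OF sm y])
    \<comment> \<open>The product rule forces \<open>v\<close> to be a multiple of \<open>y\<close>,
      and along \<open>y\<close> the derivative is the positive slope \<open>D\<close> of the
      profile.\<close>
    fix v assume v: "frechet_derivative h (at y) v = 0"
    define \<phi> where "\<phi> = (\<lambda>y. r y / norm y)"
    have d\<phi>: "(\<phi> has_derivative frechet_derivative \<phi> (at y)) (at y)"
      using smooth_on_has_derivative[OF smr y] by (simp add: \<phi>_def)
    have "(h has_derivative (\<lambda>v. \<phi> y *\<^sub>R v + frechet_derivative \<phi> (at y) v *\<^sub>R y)) (at y)"
      using has_derivative_scaleR[OF d\<phi> has_derivative_ident] by (simp add: h_def \<phi>_def)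
    from frechet_derivative_eqI[OF this] v
    have e0: "\<phi> y *\<^sub>R v + frechet_derivative \<phi> (at y) v *\<^sub>R y = 0" by simp
    have \<phi>0: "\<phi> y > 0" using rpos[of y] y by (simp add: \<phi>_def)
    define c where "c = - frechet_derivative \<phi> (at y) v / \<phi> y"
    have "\<phi> y *\<^sub>R (v - c *\<^sub>R y) = 0" using e0 \<phi>0 by (simp add: c_def algebra_simps)
    then have vc: "v = c *\<^sub>R y" using \<phi>0 by simp
    have dh: "(h has_derivative frechet_derivative h (at y)) (at y)" using smooth_on_has_derivative[OF sm y] .
    obtain D where D: "D > 0" "((\<lambda>t. (1 - lam y) * f t + lam y * g t) has_real_derivative D) (at (norm y))"
      by (rule radialE[OF rad[of y], of "norm y"]) (use y in auto)
    have "((\<lambda>t. h (y + t *\<^sub>R y)) has_vector_derivative frechet_derivative h (at y) y) (at 0)"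
      by (rule has_vector_derivative_direction[OF dh])
    moreover have "((\<lambda>t. h (y + t *\<^sub>R y)) has_vector_derivative D *\<^sub>R y) (at 0)"
    proof -
      have bl: "bounded_linear (\<lambda>s. (s / norm y) *\<^sub>R y)"
        by (intro bounded_linear_scaleR_const bounded_linear_divide)
      have "((\<lambda>t. (1 - lam y) * f ((1 + t) * norm y) + lam y * g ((1 + t) * norm y)) has_vector_derivative D * norm y) (at 0)"
        unfolding has_real_derivative_iff_has_vector_derivative[symmetric]
        by (rule DERIV_chain2[where f = "\<lambda>t. (1 - lam y) * f t + lam y * g t" and g = "\<lambda>t. (1 + t) * norm y"])
           (use D in \<open>auto intro!: derivative_eq_intros\<close>)
      from bounded_linear.has_vector_derivative[OF bl this]
      have "((\<lambda>t. (((1 - lam y) * f ((1 + t) * norm y) + lam y * g ((1 + t) * norm y)) / norm y) *\<^sub>R y) has_vector_derivative D *\<^sub>R y) (at 0)"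
        using y by simp
      then show ?thesis
      proof (rule has_vector_derivative_transform_within_open[where S = "{-1<..}"])
        fix t :: real assume "t \<in> {-1<..}"
        then show "(((1 - lam y) * f ((1 + t) * norm y) + lam y * g ((1 + t) * norm y)) / norm y) *\<^sub>R y = h (y + t *\<^sub>R y)"
          using hs[of "1 + t" y] by (simp add: scaleR_left_distrib)
      qed auto
    qed
    ultimately have Dy: "frechet_derivative h (at y) y = D *\<^sub>R y" by (rule vector_derivative_unique_at)
    have "frechet_derivative h (at y) v = c *\<^sub>R (D *\<^sub>R y)"
      unfolding vc using has_derivative_linear[OF dh] Dy by (simp add: linear_scale)
    then have "c = 0" using v D y by auto
    then show "v = 0" using vc by simp
  qed
  ultimately show "emb (- {0}) (\<lambda>y. (r y / norm y) *\<^sub>R y)" using sm unfolding emb_def h_def by blast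
qed

lemma inversion_eq_iff [simp]: "inversion x = inversion y \<longleftrightarrow> x = y"
  by (metis inversion_inversion)

subsection \<open>A collar with a hole\<close>

text \<open>The part of \<open>\<Omega>\<close> not covered by the collar is squeezed into a small hole \<open>Q\<close>; by the
  disc lemma the resulting parametrisation can be made standard near the origin.\<close>

lemma half_model:
  fixes E :: "real ^ 'n::finite \<Rightarrow> real ^ 'n"
  assumes card: "CARD('n) \<ge> 2" and O: "open \<Omega>" "connected \<Omega>" "0 \<in> \<Omega>" and e: "0 < \<epsilon>" "\<epsilon> < 1"
    and E: "emb (ann (1 - \<epsilon>) (1 + \<epsilon>)) E" "\<And>y. y \<in> ann (1 - \<epsilon>) (1 + \<epsilon>) \<Longrightarrow> jac E y > 0"
    and EO: "E ` ann (1 - \<epsilon>) 1 \<subseteq> \<Omega>" "E ` sphere 0 1 \<inter> \<Omega> = {}"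
    and c: "norm c < 1" "0 < w" "w \<le> norm c"
  obtains J Q a \<eta> where "compact Q" "Q \<subseteq> ball c w" "Q \<subseteq> ball 0 1" "emb (ball 0 1 - Q) J"
    "a > 0" "\<And>y. norm y < a \<Longrightarrow> y \<notin> Q \<and> norm y < 1 \<and> J y = y"
    "0 < \<eta>" "\<eta> \<le> \<epsilon>" "\<And>y. y \<in> ann (1 - \<eta>) 1 \<Longrightarrow> y \<notin> Q \<and> J y = E y" "J ` (ball 0 1 - Q) \<subseteq> \<Omega>"
proof -
  define r where "r = 1 - \<epsilon> / 2"
  have r: "0 < r" "r < 1" using e by (auto simp: r_def)
  obtain d where d: "cdiff (ball 0 1) d" "d ` cball 0 r \<subseteq> ball c w"
    by (rule squeeze_ball[OF r c(1,2)]) blast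
  define Q where "Q = d ` cball 0 r"
  have bd: "bij d" using d(1) by (rule cdiff_bij)
  have cQ: "compact Q" unfolding Q_def
    using embD(5)[OF cdiff_emb[OF d(1)]] by (intro compact_continuous_image) (auto intro: continuous_on_subset)
  have Q1: "Q \<subseteq> ball 0 1" unfolding Q_def using cdiff_maps[OF d(1) subset_refl] r by auto
  \<comment> \<open>Undoing the squeeze carries the ball minus \<open>Q\<close> into the annulus
    between \<open>r\<close> and 1, where the collar map is defined.\<close>
  define J1 where "J1 = (\<lambda>y. E (inv d y))"
  have oV: "open (ball 0 1 - Q)" using cQ by (intro open_Diff compact_imp_closed) auto
  have invd: "cdiff (ball 0 1) (inv d)" using d(1) by (rule cdiff_inv)
  have inv_ann: "inv d y \<in> ann r 1" if "y \<in> ball 0 1 - Q" for y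
  proof -
    have "inv d y \<in> ball 0 1" using cdiff_maps[OF invd subset_refl] that by simp
    moreover have "inv d y \<notin> cball 0 r"
    proof
      assume "inv d y \<in> cball 0 r"
      then have "d (inv d y) \<in> Q" by (simp add: Q_def)
      then show False using that bd by (simp add: bij_is_surj surj_f_inv_f)
    qed
    ultimately show ?thesis by auto
  qed
  have sub: "ann r 1 \<subseteq> ann (1 - \<epsilon>) (1 + \<epsilon>)" "ann r 1 \<subseteq> ann (1 - \<epsilon>) 1"
    using e by (auto simp: r_def)
  have invsub: "inv d ` (ball 0 1 - Q) \<subseteq> ann (1 - \<epsilon>) (1 + \<epsilon>)" using inv_ann sub(1) by blast
  have eJ1: "emb (ball 0 1 - Q) J1"
    unfolding J1_def by (rule emb_compose[OF emb_subset[OF cdiff_emb[OF invd] oV] E(1) invsub]) simp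
  have J1O: "J1 ` (ball 0 1 - Q) \<subseteq> \<Omega>" using inv_ann sub(2) EO(1) by (force simp: J1_def)
  have 0: "0 \<in> ball 0 1 - Q"
  proof -
    have "0 \<notin> ball c w" using c(3) by simp
    then show ?thesis using d(2) by (auto simp: Q_def)
  qed
  have jac0: "jac J1 0 > 0"
  proof -
    have i0: "inv d 0 \<in> ann (1 - \<epsilon>) (1 + \<epsilon>)" using invsub 0 by blast
    have "jac J1 0 = jac E (inv d 0) * jac (inv d) 0" unfolding J1_def
      by (rule jac_compose; rule smooth_on_differentiable[OF embD(2)])
         (use cdiff_emb[OF invd] E(1) i0 in auto)
    then show ?thesis using E(2)[OF i0] cdiff_jac_pos[OF invd, of 0] by simp
  qed
  obtain z a where z: "cdiff \<Omega> z" "a > 0" "ball 0 a \<subseteq> ball 0 1 - Q" "\<And>y. norm y < a \<Longrightarrow> z (J1 y) = y"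
    by (rule disc_lemma[OF card O eJ1 0 _ jac0]) (use J1O 0 in blast)+
  define J where "J = (\<lambda>y. z (J1 y))"
  have "emb (ball 0 1 - Q) J" unfolding J_def by (rule emb_compose[OF eJ1 cdiff_emb[OF z(1)]]) simp
  moreover have "J ` (ball 0 1 - Q) \<subseteq> \<Omega>"
    using J1O cdiff_maps[OF z(1) subset_refl] by (auto simp: J_def)
  moreover obtain L where L: "compact L" "L \<subseteq> ball 0 1" "\<And>x. x \<notin> L \<Longrightarrow> inv d x = x"
    using cdiffE[OF invd] by metis
  obtain K where K: "compact K" "K \<subseteq> \<Omega>" "\<And>x. x \<notin> K \<Longrightarrow> z x = x"
    using cdiffE[OF z(1)] by metis
  obtain d1 where d1: "d1 > 0" "\<And>y. \<bar>norm y - 1\<bar> < d1 \<Longrightarrow> y \<notin> L \<union> Q"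
    by (rule avoid_sphere[of "L \<union> Q" 1]) (use L(1,2) cQ Q1 in auto)
  define C where "C = {y. r \<le> norm y \<and> norm y \<le> 1 + \<epsilon> / 2} \<inter> E -` K"
  have "compact C"
  proof -
    have "continuous_on {y. r \<le> norm y \<and> norm y \<le> 1 + \<epsilon> / 2} E"
      using embD(5)[OF E(1)] by (rule continuous_on_subset) (use e in \<open>auto simp: r_def\<close>)
    then have "closed C" unfolding C_def
      using compact_imp_closed[OF compact_closed_annulus] compact_imp_closed[OF K(1)] by (rule continuous_closed_preimage)
    then have "compact ({y. r \<le> norm y \<and> norm y \<le> 1 + \<epsilon> / 2} \<inter> C)"
      by (rule compact_Int_closed[OF compact_closed_annulus])
    then show ?thesis by (simp add: C_def Int_absorb1 inf.left_idem)
  qed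
  obtain d2 where d2: "d2 > 0" "\<And>y. \<bar>norm y - 1\<bar> < d2 \<Longrightarrow> y \<notin> C"
  proof (rule avoid_sphere[OF \<open>compact C\<close>, of 1])
    fix y assume "y \<in> C"
    then have "E y \<in> \<Omega>" using K(2) by (auto simp: C_def)
    moreover have "E y \<in> E ` sphere 0 1" if "norm y = 1" using that by simp
    ultimately show "norm y \<noteq> 1" using EO(2) by blast
  qed blast
  define \<eta> where "\<eta> = min (\<epsilon> / 2) (min d1 d2)"
  have "J y = E y \<and> y \<notin> Q" if y: "y \<in> ann (1 - \<eta>) 1" for y
  proof -
    have y1: "\<bar>norm y - 1\<bar> < d1" "\<bar>norm y - 1\<bar> < d2" "r \<le> norm y" "norm y \<le> 1 + \<epsilon> / 2"
      using y e by (auto simp: \<eta>_def r_def)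
    have "J1 y = E y" using d1(2)[OF y1(1)] L(3) by (simp add: J1_def)
    moreover have "E y \<notin> K" using d2(2)[OF y1(2)] y1(3,4) by (auto simp: C_def)
    ultimately show ?thesis using K(3) d1(2)[OF y1(1)] by (simp add: J_def)
  qed
  moreover have "0 < \<eta>" "\<eta> \<le> \<epsilon>" using e d1 d2 by (auto simp: \<eta>_def)
  moreover have "y \<notin> Q \<and> norm y < 1 \<and> J y = y" if "norm y < a" for y
    using z(3,4) that by (auto simp: J_def)
  ultimately show ?thesis using that[of Q J a \<eta>] cQ Q1 d(2) z(2) by (auto simp: Q_def)
qed

text \<open>The lifted sphere with an orientation preserving two-sided collar: \<open>A\<close> is
  the bounded side, which contains the origin, and \<open>B\<close> the unbounded one.\<close>

locale collar =
  fixes E :: "real ^ 'n::finite \<Rightarrow> real ^ 'n" and \<epsilon> :: real and A B :: "(real ^ 'n) set"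
  assumes card: "CARD('n) \<ge> 2"
    and eps: "0 < \<epsilon>" "\<epsilon> < 1"
    and emb_E: "emb (ann (1 - \<epsilon>) (1 + \<epsilon>)) E"
    and jac_E: "y \<in> ann (1 - \<epsilon>) (1 + \<epsilon>) \<Longrightarrow> jac E y > 0"
    and E_nonzero: "y \<in> ann (1 - \<epsilon>) (1 + \<epsilon>) \<Longrightarrow> E y \<noteq> 0"
    and open_A: "open A" and open_B: "open B"
    and connected_A: "connected A" and connected_B: "connected B"
    and AB: "A \<inter> B = {}" and A_sphere: "A \<inter> E ` sphere 0 1 = {}" and B_sphere: "B \<inter> E ` sphere 0 1 = {}"
    and cover: "A \<union> E ` sphere 0 1 \<union> B = UNIV"
    and zero_A: "0 \<in> A" and bounded_A: "bounded A"
    and E_inner: "E ` ann (1 - \<epsilon>) 1 \<subseteq> A" and E_outer: "E ` ann 1 (1 + \<epsilon>) \<subseteq> B"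
begin

lemma compact_sphere_image: "compact (E ` sphere 0 1)"
  using embD(5)[OF emb_E] eps by (intro compact_continuous_image) (auto intro: continuous_on_subset)

lemma large_in_B: obtains R where "R > 0" "\<And>y. norm y > R \<Longrightarrow> y \<in> B"
proof -
  have "bounded (A \<union> E ` sphere 0 1)" using bounded_A compact_sphere_image compact_imp_bounded by auto
  from bounded_pos[THEN iffD1, OF this]
  obtain R where R: "R > 0" "\<And>y. y \<in> A \<union> E ` sphere 0 1 \<Longrightarrow> norm y \<le> R" by blast
  show ?thesis
  proof (rule that[OF R(1)])
    fix y :: "real ^ 'n" assume "norm y > R"
    then have "y \<notin> A \<union> E ` sphere 0 1" using R(2)[of y] by linarith
    then show "y \<in> B" using cover by blast
  qed
qed

lemma zero_notin_B: "0 \<notin> B" using AB zero_A by auto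

text \<open>The half with a hole is built twice, once for \<open>A\<close> and once, after
  inversion, for \<open>B\<close>; the result is one map on the complement of two holes. Its image
  is everything except a piece of \<open>A\<close> and a piece of \<open>B\<close>. The holes are
  centred on opposite rays so that they can later pass each other.\<close>

lemma model:
  assumes e0: "norm e0 = 1"
  obtains J Q Q' a \<eta> where "compact Q" "compact Q'" "Q \<subseteq> ball ((1 / 2) *\<^sub>R e0) (1 / 4)"
    "0 \<notin> Q'" "inversion ` Q' \<subseteq> ball (- (1 / 2) *\<^sub>R e0) (1 / 4)" "emb (- (Q \<union> Q')) J"
    "0 < a" "a < 1" "\<And>y. norm y < a \<Longrightarrow> y \<notin> Q \<union> Q' \<and> J y = y"
    "\<And>y. norm y > 1 / a \<Longrightarrow> y \<notin> Q \<union> Q' \<and> J y = y"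
    "0 < \<eta>" "\<eta> \<le> \<epsilon>" "\<And>y. y \<in> ann (1 - \<eta>) (1 + \<eta>) \<Longrightarrow> y \<notin> Q \<union> Q' \<and> J y = E y"
    "\<And>y. norm y < 1 \<Longrightarrow> y \<notin> Q \<Longrightarrow> J y \<in> A" "\<And>y. norm y > 1 \<Longrightarrow> y \<notin> Q' \<Longrightarrow> J y \<in> B"
proof -
  obtain J1 Q a1 \<eta>1 where J1: "compact Q" "Q \<subseteq> ball ((1 / 2) *\<^sub>R e0) (1 / 4)" "Q \<subseteq> ball 0 1"
    "emb (ball 0 1 - Q) J1" "a1 > 0" "\<And>y. norm y < a1 \<Longrightarrow> y \<notin> Q \<and> norm y < 1 \<and> J1 y = y"
    "0 < \<eta>1" "\<eta>1 \<le> \<epsilon>" "\<And>y. y \<in> ann (1 - \<eta>1) 1 \<Longrightarrow> y \<notin> Q \<and> J1 y = E y" "J1 ` (ball 0 1 - Q) \<subseteq> A"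
    by (rule half_model[OF card open_A connected_A zero_A eps emb_E jac_E E_inner, of "(1 / 2) *\<^sub>R e0" "1 / 4"])
       (use A_sphere e0 in auto)
  \<comment> \<open>The outer side seen from infinity; the origin is added as the image of the point
    at infinity.\<close>
  define A2 where "A2 = insert 0 (inversion ` B)"
  define E2 where "E2 = (\<lambda>y. inversion (E (inversion y)))"
  have emb_i: "emb U inversion" if "open U" "0 \<notin> U" for U :: "(real ^ 'n) set"
    by (rule emb_subset[OF emb_inversion that(1)]) (use that(2) in auto)
  obtain R where R: "R > 0" "\<And>y. norm y > R \<Longrightarrow> y \<in> B" using large_in_B by blast
  have oiB: "open (inversion ` B)"
    by (rule emb_image_open[OF emb_i[OF open_B zero_notin_B] open_B subset_refl])
  have ballA2: "ball 0 (inverse R) \<subseteq> A2"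
  proof
    fix y :: "real ^ 'n" assume y: "y \<in> ball 0 (inverse R)"
    show "y \<in> A2"
    proof (cases "y = 0")
      case False
      then have "norm (inversion y) > R" using y R(1) by (simp add: field_simps)
      then have "inversion (inversion y) \<in> inversion ` B" using R(2) by blast
      then show ?thesis by (simp add: A2_def)
    qed (simp add: A2_def)
  qed
  have "A2 = inversion ` B \<union> ball 0 (inverse R)" using ballA2 R(1) by (auto simp: A2_def)
  then have oA2: "open A2" using oiB by auto
  have cA2: "connected A2"
  proof (rule connected_intermediate_closure)
    show "connected (inversion ` B)"
      by (intro connected_continuous_image connected_B embD(5)[OF emb_i[OF open_B zero_notin_B]])
    show "inversion ` B \<subseteq> A2" by (auto simp: A2_def)
    have "0 \<in> closure (inversion ` B)"
      unfolding closure_approachable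
    proof (intro allI impI)
      fix e :: real assume "e > 0"
      obtain b :: "real ^ 'n" where b: "norm b = min e (inverse R) / 2"
        using vector_choose_size[of "min e (inverse R) / 2"] R(1) \<open>e > 0\<close> by auto
      have "inverse R > 0" using R(1) by simp
      then have nb: "0 < norm b" "norm b < inverse R" "norm b < e"
        unfolding b using \<open>e > 0\<close> by (auto simp: min_def)
      then have "b \<in> A2" "b \<noteq> 0" using ballA2 by (auto simp: subset_iff)
      then show "\<exists>y\<in>inversion ` B. dist y 0 < e"
        using nb(3) by (intro bexI[of _ b]) (auto simp: A2_def)
    qed
    then show "A2 \<subseteq> closure (inversion ` B)" using closure_subset[of "inversion ` B"] by (simp add: A2_def)
  qed
  \<comment> \<open>Halving suffices for the inverted annulus to stay inside the collar:
    \<open>(1 + \<epsilon>) * (1 - \<epsilon> / 2) > 1\<close> and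
    \<open>(1 - \<epsilon>) * (1 + \<epsilon> / 2) < 1\<close>.\<close>
  define \<epsilon>2 where "\<epsilon>2 = \<epsilon> / 2"
  have e2: "0 < \<epsilon>2" "\<epsilon>2 < 1" "\<epsilon>2 \<le> \<epsilon>" using eps by (auto simp: \<epsilon>2_def)
  have inv1: "inverse (1 - \<epsilon>2) < 1 + \<epsilon>" "1 - \<epsilon> < inverse (1 + \<epsilon>2)"
  proof -
    have ee: "\<epsilon> * \<epsilon> < \<epsilon>" "0 < \<epsilon> * \<epsilon>" using eps by simp_all
    have eq: "(1 + \<epsilon>) * (1 - \<epsilon>2) = 1 + (\<epsilon> - \<epsilon> * \<epsilon>) / 2" "(1 - \<epsilon>) * (1 + \<epsilon>2) = 1 - (\<epsilon> + \<epsilon> * \<epsilon>) / 2"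
      by (simp_all add: \<epsilon>2_def field_simps)
    have "1 < (1 + \<epsilon>) * (1 - \<epsilon>2)" "(1 - \<epsilon>) * (1 + \<epsilon>2) < 1"
      unfolding eq using ee(1) add_pos_pos[OF eps(1) ee(2)] by auto
    then show "inverse (1 - \<epsilon>2) < 1 + \<epsilon>" "1 - \<epsilon> < inverse (1 + \<epsilon>2)"
      using e2 by (simp_all add: divide_simps)
  qed
  have norm_i: "1 < norm (inversion y)" if "norm y < 1" "y \<noteq> 0" for y :: "real ^ 'n"
    using that by (simp add: one_less_inverse)
  have norm_i': "norm (inversion y) < 1" if "norm y > 1" for y :: "real ^ 'n"
    using that inverse_less_1_iff[of "norm y"] by (simp)
  have iann: "inversion y \<in> ann (1 - \<epsilon>) (1 + \<epsilon>)" if "y \<in> ann (1 - \<epsilon>2) (1 + \<epsilon>2)" for y :: "real ^ 'n"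
  proof -
    have pos: "0 < 1 - \<epsilon>2" "0 < norm y" using that e2 by auto
    have "inverse (norm y) < inverse (1 - \<epsilon>2)" using that pos by (intro less_imp_inverse_less) auto
    moreover have "inverse (1 + \<epsilon>2) < inverse (norm y)" using that pos by (intro less_imp_inverse_less) auto
    ultimately show ?thesis using inv1 by simp
  qed
  have nz: "y \<noteq> 0" if "y \<in> ann (1 - \<epsilon>2) (1 + \<epsilon>2)" for y :: "real ^ 'n" using that e2 by auto
  have emb_E2: "emb (ann (1 - \<epsilon>2) (1 + \<epsilon>2)) E2" unfolding E2_def
  proof (rule emb_compose[OF emb_compose[OF emb_i emb_E]])
    show "emb (- {0 :: real ^ 'n}) inversion" by (rule emb_inversion)
    show "(\<lambda>x. E (inversion x)) ` ann (1 - \<epsilon>2) (1 + \<epsilon>2) \<subseteq> - {0}"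
      by (rule image_subsetI) (simp add: E_nonzero[OF iann] del: ann_iff)
    show "(0 :: real ^ 'n) \<notin> ann (1 - \<epsilon>2) (1 + \<epsilon>2)" using nz by blast
    show "inversion ` (ann (1 - \<epsilon>2) (1 + \<epsilon>2) :: (real ^ 'n) set) \<subseteq> ann (1 - \<epsilon>) (1 + \<epsilon>)"
      by (rule image_subsetI) (rule iann)
  qed simp
  have jac_E2: "jac E2 y > 0" if y: "y \<in> ann (1 - \<epsilon>2) (1 + \<epsilon>2)" for y
  proof -
    have iy: "inversion y \<in> ann (1 - \<epsilon>) (1 + \<epsilon>)" using iann[OF y] .
    have dE: "E differentiable (at (inversion y))"
      by (rule smooth_on_differentiable[OF embD(2)[OF emb_E] iy])
    have di: "inversion differentiable (at x)" if "x \<noteq> 0" for x :: "real ^ 'n"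
      by (rule smooth_on_differentiable[OF smooth_on_inversion]) (use that in auto)
    have dEi: "(\<lambda>y. E (inversion y)) differentiable (at y)"
      using differentiable_chain_at[OF di[OF nz[OF y]] dE] by (simp add: o_def)
    have "jac E2 y = jac inversion (E (inversion y)) * (jac E (inversion y) * jac inversion y)"
      unfolding E2_def
      using jac_compose[OF dEi di[OF E_nonzero[OF iy]]] jac_compose[OF di[OF nz[OF y]] dE] by simp
    also have "\<dots> = (jac inversion (E (inversion y)) * jac inversion y) * jac E (inversion y)" by simp
    \<comment> \<open>The two inversions contribute Jacobians of equal sign, so conjugation
      preserves the orientation of the collar.\<close>
    also have "\<dots> > 0"
      using jac_inversion_sign[OF card E_nonzero[OF iy] nz[OF y]] jac_E[OF iy] by (rule mult_pos_pos)
    finally show ?thesis .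
  qed
  have E2A2: "E2 ` ann (1 - \<epsilon>2) 1 \<subseteq> A2"
  proof clarify
    fix y :: "real ^ 'n" assume y: "y \<in> ann (1 - \<epsilon>2) 1"
    then have "y \<in> ann (1 - \<epsilon>2) (1 + \<epsilon>2)" using e2 by auto
    then have "inversion y \<in> ann 1 (1 + \<epsilon>)" using iann[of y] norm_i[of y] nz[of y] y by auto
    then have "E (inversion y) \<in> B" using E_outer by blast
    then show "E2 y \<in> A2" by (simp add: E2_def A2_def)
  qed
  have E2s: "E2 ` sphere 0 1 \<inter> A2 = {}"
  proof -
    have "E2 y \<notin> A2" if "norm y = 1" for y
    proof
      assume "E2 y \<in> A2"
      moreover have s: "norm (inversion y) = 1" using that by simp
      then have "E (inversion y) \<noteq> 0" using E_nonzero[of "inversion y"] eps by simp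
      ultimately have "inversion (E (inversion y)) \<in> inversion ` B" by (simp add: A2_def E2_def)
      then have "E (inversion y) \<in> B" by auto
      then show False using B_sphere s by auto
    qed
    then show ?thesis by auto
  qed
  obtain J2 Q2 a2 \<eta>2 where J2: "compact Q2" "Q2 \<subseteq> ball (- (1 / 2) *\<^sub>R e0) (1 / 4)" "Q2 \<subseteq> ball 0 1"
    "emb (ball 0 1 - Q2) J2" "a2 > 0" "\<And>y. norm y < a2 \<Longrightarrow> y \<notin> Q2 \<and> norm y < 1 \<and> J2 y = y"
    "0 < \<eta>2" "\<eta>2 \<le> \<epsilon>2" "\<And>y. y \<in> ann (1 - \<eta>2) 1 \<Longrightarrow> y \<notin> Q2 \<and> J2 y = E2 y" "J2 ` (ball 0 1 - Q2) \<subseteq> A2"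
    by (rule half_model[OF card oA2 cA2 _ e2(1,2) emb_E2 jac_E2 E2A2 E2s, of "- (1 / 2) *\<^sub>R e0" "1 / 4"])
       (use e0 in \<open>auto simp: A2_def\<close>)
  define Q' where "Q' = inversion ` Q2"
  have Q20: "0 \<notin> Q2" using J2(5) J2(6)[of 0] by auto
  have cQ': "compact Q'" unfolding Q'_def
  proof (rule compact_continuous_image[OF _ J2(1)])
    show "continuous_on Q2 inversion"
      by (rule continuous_on_subset[OF smooth_on_imp_continuous_on[OF smooth_on_inversion]]) (use Q20 in auto)
  qed
  have Q'iff: "y \<in> Q' \<longleftrightarrow> inversion y \<in> Q2" for y
    unfolding Q'_def by (metis image_iff inversion_inversion)
  have Q'1: "norm y > 1" if "y \<in> Q'" for y
  proof -
    have "inversion y \<in> ball 0 1" "inversion y \<noteq> 0" using that J2(3) Q20 Q'iff[of y] by auto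
    then show ?thesis using norm_i[of "inversion y"] by simp
  qed
  have Q1: "norm y < 1" if "y \<in> Q" for y using J1(3) that by auto
  define J where "J = (\<lambda>y. if norm y < 1 then J1 y else if norm y > 1 then inversion (J2 (inversion y)) else E y)"
  have oJ: "open (- (Q \<union> Q'))"
    using J1(1) cQ' by (intro open_Compl closed_Un compact_imp_closed)
  have J_in: "J y \<in> A" if "norm y < 1" "y \<notin> Q" for y using J1(10) that by (auto simp: J_def)
  have J2_out: "inversion y \<in> ball 0 1 - Q2 - {0}" if "norm y > 1" "y \<notin> Q'" for y
  proof -
    have "y \<noteq> 0" using that(1) by auto
    then show ?thesis using norm_i'[OF that(1)] that(2) Q'iff[of y] by simp
  qed
  have J2nz: "J2 y \<noteq> 0" if "y \<in> ball 0 1 - Q2 - {0}" for y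
  proof
    assume "J2 y = 0"
    moreover have "J2 0 = 0" "0 \<in> ball 0 1 - Q2" using J2(5) J2(6)[of 0] by auto
    ultimately have "y = 0" using embD(3)[OF J2(4)] that by (metis DiffD1 inj_onD)
    then show False using that by simp
  qed
  have J_out: "J y \<in> B" if "norm y > 1" "y \<notin> Q'" for y
  proof -
    have "J2 (inversion y) \<in> A2 - {0}" using J2(10) J2_out[OF that] J2nz by blast
    then have "inversion (J2 (inversion y)) \<in> B"
      unfolding A2_def using inversion_inversion by (metis DiffE imageE insertE singletonI)
    then show ?thesis using that by (simp add: J_def)
  qed
  have J_mid: "J y = E y" "J y \<in> E ` sphere 0 1" if "norm y = 1" for y using that by (auto simp: J_def)
  \<comment> \<open>Half of \<open>\<eta>2\<close> because the outer part is seen through the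
    inversion: \<open>(1 - \<eta>2) * (1 + \<eta>2 / 2) < 1\<close>.\<close>
  define \<eta> where "\<eta> = min \<eta>1 (\<eta>2 / 2)"
  have eta: "0 < \<eta>" "\<eta> \<le> \<epsilon>" "\<eta> \<le> \<eta>1" "\<eta> < 1" using J1(7,8) J2(7,8) e2 eps by (auto simp: \<eta>_def)
  have J_col: "y \<notin> Q \<union> Q' \<and> J y = E y" if y: "y \<in> ann (1 - \<eta>) (1 + \<eta>)" for y
  proof -
    consider "norm y < 1" | "norm y = 1" | "norm y > 1" by linarith
    then show ?thesis
    proof cases
      case 1
      then show ?thesis using J1(9)[of y] y eta Q'1[of y] by (auto simp: J_def)
    next
      case 2
      then show ?thesis using Q1[of y] Q'1[of y] by (auto simp: J_def)
    next
      case 3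
      have "1 - \<eta>2 < inverse (norm y)"
      proof -
        have "norm y < 1 + \<eta>2 / 2" using y by (auto simp: \<eta>_def)
        then have "(1 - \<eta>2) * norm y \<le> (1 - \<eta>2) * (1 + \<eta>2 / 2)"
          using J2(8) e2 by (intro mult_left_mono) auto
        also have "\<dots> < 1" using add_pos_pos[OF J2(7) mult_pos_pos[OF J2(7) J2(7)]] by (simp add: algebra_simps)
        finally have "(1 - \<eta>2) * norm y < 1" .
        moreover have "0 < norm y" using 3 by linarith
        ultimately show ?thesis using pos_less_divide_eq[of "norm y" "1 - \<eta>2" 1] by (simp only: inverse_eq_divide)
      qed
      then have "inversion y \<in> ann (1 - \<eta>2) 1" using norm_i'[OF 3] by simp
      then have "inversion y \<notin> Q2 \<and> J2 (inversion y) = E2 (inversion y)" by (rule J2(9))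
      then show ?thesis using 3 Q'iff[of y] Q1[of y] by (auto simp: J_def E2_def)
    qed
  qed
  have embJ: "emb (- (Q \<union> Q')) J"
  proof (rule emb_localI[OF oJ])
    show "inj_on J (- (Q \<union> Q'))"
    proof (rule inj_onI)
      fix x y assume x: "x \<in> - (Q \<union> Q')" and y: "y \<in> - (Q \<union> Q')" and eq: "J x = J y"
      have loc: "(norm u < 1 \<longleftrightarrow> J u \<in> A) \<and> (norm u > 1 \<longleftrightarrow> J u \<in> B)" if "u \<in> - (Q \<union> Q')" for u
        using J_in[of u] J_out[of u] J_mid[of u] that AB A_sphere B_sphere
        by (cases "norm u" "1 :: real" rule: linorder_cases) auto
      consider "norm x < 1" "norm y < 1" | "norm x > 1" "norm y > 1" | "norm x = 1" "norm y = 1"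
        using loc[OF x] loc[OF y] eq by (metis linorder_neqE_linordered_idom)
      then show "x = y"
      proof cases
        case 1
        then show ?thesis using eq x y inj_onD[OF embD(3)[OF J1(4)], of x y] by (auto simp: J_def)
      next
        case 2
        then have "inversion (J2 (inversion x)) = inversion (J2 (inversion y))" using eq by (simp add: J_def)
        then have "J2 (inversion x) = J2 (inversion y)" by simp
        then have "inversion x = inversion y"
          using inj_onD[OF embD(3)[OF J2(4)], of "inversion x" "inversion y"] J2_out[of x] J2_out[of y] 2 x y by auto
        then show ?thesis by simp
      next
        case 3
        then show ?thesis using eq inj_onD[OF embD(3)[OF emb_E], of x y] eps by (auto simp: J_def)
      qed
    qed
    fix x assume x: "x \<in> - (Q \<union> Q')"
    consider "norm x < 1" | "norm x > 1" | "norm x = 1" by linarith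
    then show "\<exists>V g. x \<in> V \<and> emb V g \<and> (\<forall>y\<in>V. J y = g y)"
    proof cases
      case 1
      then show ?thesis using x J1(4) by (intro exI[of _ "ball 0 1 - Q"] exI[of _ J1]) (auto simp: J_def)
    next
      case 2
      define V where "V = {y :: real ^ 'n. norm y > 1} - Q'"
      have oV: "open V" unfolding V_def using cQ'
        by (intro open_Diff compact_imp_closed open_Collect_less continuous_intros)
      have V0: "0 \<notin> V" by (simp add: V_def)
      have "emb V (\<lambda>y. inversion (J2 (inversion y)))"
      proof (rule emb_compose[OF emb_compose[OF emb_i[OF oV V0] J2(4)] emb_inversion])
        show "inversion ` V \<subseteq> ball 0 1 - Q2" using J2_out by (force simp: V_def)
        show "(\<lambda>x. J2 (inversion x)) ` V \<subseteq> - {0}" using J2nz J2_out by (force simp: V_def)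
      qed
      then show ?thesis using 2 x
        by (intro exI[of _ V] exI[of _ "\<lambda>y. inversion (J2 (inversion y))"]) (auto simp: J_def V_def)
    next
      case 3
      have "emb (ann (1 - \<eta>) (1 + \<eta>)) E" by (rule emb_subset[OF emb_E]) (use eta in auto)
      then show ?thesis using 3 eta J_col
        by (intro exI[of _ "ann (1 - \<eta>) (1 + \<eta>)"] exI[of _ E]) auto
    qed
  qed
  define a where "a = min a1 (min a2 (1 / 2))"
  have a: "0 < a" "a < 1" "a \<le> a1" "a \<le> a2" using J1(5) J2(5) by (auto simp: a_def)
  show ?thesis
  proof (rule that[of Q Q' J a \<eta>])
    show "inversion ` Q' \<subseteq> ball (- (1 / 2) *\<^sub>R e0) (1 / 4)"
    proof (rule image_subsetI)
      fix y assume "y \<in> Q'"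
      then show "inversion y \<in> ball (- (1 / 2) *\<^sub>R e0) (1 / 4)" using J2(2) Q'iff[of y] by blast
    qed
    show "y \<notin> Q \<union> Q' \<and> J y = y" if "norm y < a" for y
      using J1(6)[of y] that a Q'1[of y] by (auto simp: J_def)
    show "y \<notin> Q \<union> Q' \<and> J y = y" if "norm y > 1 / a" for y
    proof -
      have "1 / a > 1" using a by simp
      then have y1: "norm y > 1" using that by simp
      have "norm (inversion y) < a2"
      proof -
        have "1 < a * norm y" using that a(1) by (simp add: pos_divide_less_eq mult.commute)
        moreover have "0 < norm y" using y1 by linarith
        ultimately have "inverse (norm y) < a"
          using pos_divide_less_eq[of "norm y" 1 a] by (simp only: inverse_eq_divide)
        then show ?thesis using a(4) by simp
      qed
      then have "inversion y \<notin> Q2 \<and> J2 (inversion y) = inversion y" using J2(6) by blast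
      then show ?thesis using y1 Q'iff[of y] Q1[of y] by (auto simp: J_def)
    qed
    show "0 \<notin> Q'" using Q'1[of 0] by auto
  qed (use J1 cQ' embJ a eta J_col J_in J_out in auto)
qed

end

section \<open>Moving the two holes past each other\<close>

lemma emb_scaleR: "c \<noteq> 0 \<Longrightarrow> emb UNIV (\<lambda>y :: real ^ 'n::finite. c *\<^sub>R y)"
proof -
  assume c: "c \<noteq> 0"
  have sm: "smooth_on UNIV (\<lambda>y :: real ^ 'n. c *\<^sub>R y)" by (intro smooth_intros) auto
  have d: "frechet_derivative (\<lambda>y :: real ^ 'n. c *\<^sub>R y) (at x) = (\<lambda>v. c *\<^sub>R v)" for x
    by (rule frechet_derivative_eqI) (auto intro!: derivative_eq_intros)
  have "jac (\<lambda>y :: real ^ 'n. c *\<^sub>R y) x \<noteq> 0" for x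
    by (rule jac_nonzeroI[OF sm]) (use c d in auto)
  then show ?thesis using c sm by (auto simp: emb_def inj_on_def)
qed

text \<open>\<open>\<rho>S\<close> acts along the rays through the inner hole, at radius about one half, and \<open>\<rho>N\<close> along those
  through the outer hole.\<close>

lemma radial_pair:
  fixes b L :: real
  assumes b: "0 < b" "b \<le> 1 / 16" and L: "b * L > 16"
  obtains \<rho>S \<rho>N where "radial \<rho>S" "radial \<rho>N"
    "\<And>t. t \<le> 17 / 16 * b \<Longrightarrow> \<rho>S t = t / b" "\<And>t. t \<le> 17 / 16 * b \<Longrightarrow> \<rho>N t = t / b"
    "\<And>t. t \<ge> 31 / 32 * (b * L) \<Longrightarrow> \<rho>S t = t / b" "\<And>t. t \<ge> 31 / 32 * (b * L) \<Longrightarrow> \<rho>N t = t / b"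
    "\<And>t. 1 / 4 \<le> t \<Longrightarrow> t \<le> 3 / 4 \<Longrightarrow> \<rho>S t = L * t"
    "\<And>t. 4 / 3 \<le> t \<Longrightarrow> t \<le> 4 \<Longrightarrow> \<rho>N t = t"
proof -
  have ib: "1 / b > 0" using b by simp
  have Lb: "1 / b < L" using b L by (simp add: field_simps)
  then have L0: "L > 0" using ib by linarith
  have le: "1 / b * t \<le> L * t" if "t \<ge> 0" for t using Lb that by (intro mult_right_mono) auto
  \<comment> \<open>The profile through the inner hole rises from slope \<open>1 / b\<close> to
    slope \<open>L\<close> before radius 1/4 and descends to \<open>1 / b\<close> after radius 3/4.
    The descent is possible since \<open>L * (7 / 8)\<close> is less than
    \<open>1 / b * (15 / 16 * (b * L))\<close>.\<close>
  obtain f1 where f1: "radial f1" "\<And>t. t \<le> 2 * b \<Longrightarrow> f1 t = 1 / b * t" "\<And>t. t \<ge> 1 / 4 \<Longrightarrow> f1 t = L * t"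
    by (rule radial_blend[OF radial_mult[OF ib] radial_mult[OF L0], of "2 * b" "1 / 4"]) (use b le in auto)
  obtain f2 where f2: "radial f2" "\<And>t. t \<le> 3 / 4 \<Longrightarrow> f2 t = f1 t" "\<And>t. t \<ge> 31 / 32 * (b * L) \<Longrightarrow> f2 t = 1 / b * t"
    by (rule radial_down[OF f1(1), of "3 / 4" "7 / 8" "15 / 16 * (b * L)" "31 / 32 * (b * L)" "1 / b" L])
       (use f1(3) b L Lb L0 in auto)
  \<comment> \<open>The profile through the outer hole does the opposite: down to slope 1 before
    radius 4/3, possible since 9/8 is less than 5/4, and up again after radius 4.\<close>
  obtain g1 where g1: "radial g1" "\<And>t. t \<le> 17 / 16 * b \<Longrightarrow> g1 t = 1 / b * t" "\<And>t. t \<ge> 4 / 3 \<Longrightarrow> g1 t = 1 * t"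
    by (rule radial_down[OF radial_mult[OF ib], of "17 / 16 * b" "9 / 8 * b" "5 / 4" "4 / 3" 1 "1 / b"])
       (use b in auto)
  have le1: "g1 t \<le> 1 / b * t" if "4 \<le> t" for t
  proof -
    have "1 * t \<le> 1 / b * t" using b that by (intro mult_right_mono) auto
    then show ?thesis using g1(3)[of t] that by simp
  qed
  obtain g2 where g2: "radial g2" "\<And>t. t \<le> 4 \<Longrightarrow> g2 t = g1 t" "\<And>t. t \<ge> b * L / 2 \<Longrightarrow> g2 t = 1 / b * t"
    by (rule radial_blend[OF g1(1) radial_mult[OF ib], of 4 "b * L / 2"]) (use L le1 in auto)
  show ?thesis
  proof (rule that[OF f2(1) g2(1)])
    show "f2 t = t / b" "g2 t = t / b" if "t \<le> 17 / 16 * b" for t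
      using that f2(2)[of t] f1(2)[of t] g2(2)[of t] g1(2)[of t] b by auto
    show "f2 t = t / b" "g2 t = t / b" if "t \<ge> 31 / 32 * (b * L)" for t
      using that f2(3)[of t] g2(3)[of t] L by auto
    show "f2 t = L * t" if "1 / 4 \<le> t" "t \<le> 3 / 4" for t using that f2(2)[of t] f1(3)[of t] by auto
    show "g2 t = t" if "4 / 3 \<le> t" "t \<le> 4" for t using that g2(2)[of t] g1(3)[of t] by auto
  qed
qed

text \<open>The two holes lie in different directions, so they can be moved independently of each
  other along rays.\<close>

lemma hole_shuffle:
  fixes e0 :: "real ^ 'n::finite"
  assumes b: "0 < b" "b \<le> 1 / 16" and L: "b * L > 16" and e0: "norm e0 = 1"
  obtains h where "emb (- {0}) h" "\<And>y. y \<noteq> 0 \<Longrightarrow> h y \<noteq> 0"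
    "\<And>y. norm y \<le> 17 / 16 * b \<Longrightarrow> h y = (1 / b) *\<^sub>R y"
    "\<And>y. norm y \<ge> 31 / 32 * (b * L) \<Longrightarrow> h y = (1 / b) *\<^sub>R y"
    "\<And>y. 1 / 4 < norm y \<Longrightarrow> norm y < 3 / 4 \<Longrightarrow> y \<bullet> e0 > norm y / 3 \<Longrightarrow> h y = L *\<^sub>R y"
    "\<And>y. 4 / 3 < norm y \<Longrightarrow> norm y < 4 \<Longrightarrow> y \<bullet> e0 < - norm y / 3 \<Longrightarrow> h y = y"
    "\<And>y \<eta>. 0 < \<eta> \<Longrightarrow> \<eta> \<le> 1 / 32 \<Longrightarrow> y \<in> ann (b * (1 - \<eta>)) (b * L * (1 + \<eta>)) \<Longrightarrow> h y \<in> ann (1 - \<eta>) (L * (1 + \<eta>))"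
proof -
  obtain \<rho>S \<rho>N where R: "radial \<rho>S" "radial \<rho>N"
    "\<And>t. t \<le> 17 / 16 * b \<Longrightarrow> \<rho>S t = t / b" "\<And>t. t \<le> 17 / 16 * b \<Longrightarrow> \<rho>N t = t / b"
    "\<And>t. t \<ge> 31 / 32 * (b * L) \<Longrightarrow> \<rho>S t = t / b" "\<And>t. t \<ge> 31 / 32 * (b * L) \<Longrightarrow> \<rho>N t = t / b"
    "\<And>t. 1 / 4 \<le> t \<Longrightarrow> t \<le> 3 / 4 \<Longrightarrow> \<rho>S t = L * t"
    "\<And>t. 4 / 3 \<le> t \<Longrightarrow> t \<le> 4 \<Longrightarrow> \<rho>N t = t"
    by (rule radial_pair[OF b L]) blast
  \<comment> \<open>The weight is a function of the cosine of the angle to \<open>e0\<close>: it is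
    0 when the cosine is at least 1/3 and 1 when it is at most -1/3.\<close>
  define lam where "lam = (\<lambda>y. step ((1 / 3 - (y \<bullet> e0) / norm y) * (3 / 2)))"
  define r where "r = (\<lambda>y. (1 - lam y) * \<rho>S (norm y) + lam y * \<rho>N (norm y))"
  have lam: "smooth_on (- {0}) lam" "\<And>y. 0 \<le> lam y" "\<And>y. lam y \<le> 1" "\<And>s y. s > 0 \<Longrightarrow> lam (s *\<^sub>R y) = lam y"
    unfolding lam_def by (auto simp: step_bounds intro!: smooth_intros)
  have lam0: "lam y = 0" if "y \<bullet> e0 > norm y / 3" "y \<noteq> 0" for y
    using that by (auto simp: lam_def field_simps intro!: step_0)
  have lam1: "lam y = 1" if "y \<bullet> e0 < - norm y / 3" "y \<noteq> 0" for y
    using that by (auto simp: lam_def field_simps intro!: step_1)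
  define h where "h = (\<lambda>y. (r y / norm y) *\<^sub>R y)"
  have embh: "emb (- {0}) h" and rpos: "\<And>y. y \<noteq> 0 \<Longrightarrow> r y > 0"
    using emb_radial[OF R(1,2) lam] unfolding h_def r_def by blast+
  have hr: "h y = c *\<^sub>R y" if "r y = c * norm y" for y c
    using that by (cases "y = 0") (auto simp: h_def)
  show ?thesis
  proof (rule that[OF embh])
    show "h y \<noteq> 0" if "y \<noteq> 0" for y using rpos[OF that] that by (simp add: h_def)
    have "r y = 1 / b * norm y" if "norm y \<le> 17 / 16 * b" for y
      using R(3,4)[OF that] by (simp add: r_def field_simps)
    then show "h y = (1 / b) *\<^sub>R y" if "norm y \<le> 17 / 16 * b" for y using hr that by blast
    have "r y = 1 / b * norm y" if "norm y \<ge> 31 / 32 * (b * L)" for y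
      using R(5,6)[OF that] by (simp add: r_def field_simps)
    then show "h y = (1 / b) *\<^sub>R y" if "norm y \<ge> 31 / 32 * (b * L)" for y using hr that by blast
    show "h y = L *\<^sub>R y" if y: "1 / 4 < norm y" "norm y < 3 / 4" "y \<bullet> e0 > norm y / 3" for y
    proof -
      have "y \<noteq> 0" using y(1) by auto
      then show ?thesis using hr[of y L] lam0[OF y(3)] R(7)[of "norm y"] y by (simp add: r_def)
    qed
    show "h y = y" if y: "4 / 3 < norm y" "norm y < 4" "y \<bullet> e0 < - norm y / 3" for y
    proof -
      have "y \<noteq> 0" using y(1) by auto
      then show ?thesis using hr[of y 1] lam1[OF y(3)] R(8)[of "norm y"] y by (simp add: r_def)
    qed
    show "h y \<in> ann (1 - \<eta>) (L * (1 + \<eta>))"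
      if e: "0 < \<eta>" "\<eta> \<le> 1 / 32" and y: "y \<in> ann (b * (1 - \<eta>)) (b * L * (1 + \<eta>))" for y \<eta>
    proof -
      \<comment> \<open>The profile on the ray through \<open>y\<close>. It increases, and both
        profiles agree at the two bounding radii, so the annulus is mapped into the annulus whatever
        the weight is.\<close>
      define k where "k = (\<lambda>t. (1 - lam y) * \<rho>S t + lam y * \<rho>N t)"
      have k: "radial k" unfolding k_def by (rule radial_convex[OF R(1,2) lam(2,3)])
      have p1: "0 < b * (1 - \<eta>)" "b * (1 - \<eta>) \<le> 17 / 16 * b" using b e by (auto simp: algebra_simps)
      have "b * L * (31 / 32) \<le> b * L * (1 + \<eta>)" using L e by (intro mult_left_mono) auto
      then have p2: "31 / 32 * (b * L) \<le> b * L * (1 + \<eta>)" by (simp only: mult.commute)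
      have y0: "norm y > 0" using y p1(1) by (simp del: zero_less_norm_iff)
      have "k (b * (1 - \<eta>)) < k (norm y)" "k (norm y) < k (b * L * (1 + \<eta>))"
        using y p1(1) y0 by (auto intro!: radial_strict_mono[OF k])
      moreover have "k (b * (1 - \<eta>)) = 1 - \<eta>"
      proof -
        have "\<rho>S (b * (1 - \<eta>)) = 1 - \<eta>" "\<rho>N (b * (1 - \<eta>)) = 1 - \<eta>" using R(3,4)[OF p1(2)] b by auto
        then show ?thesis unfolding k_def by (simp only:) (simp add: algebra_simps)
      qed
      moreover have "k (b * L * (1 + \<eta>)) = L * (1 + \<eta>)"
      proof -
        have "\<rho>S (b * L * (1 + \<eta>)) = L * (1 + \<eta>)" "\<rho>N (b * L * (1 + \<eta>)) = L * (1 + \<eta>)"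
          using R(5,6)[OF p2] b by auto
        then show ?thesis unfolding k_def by (simp only:) (simp add: algebra_simps)
      qed
      moreover have "norm (h y) = k (norm y)"
        using rpos[of y] y0 by (simp add: h_def k_def r_def)
      ultimately show ?thesis by simp
    qed
  qed
qed

context collar
begin

text \<open>Cobordisms of spheres commute: the region between the sphere and its dilate by \<open>L\<close> is
  composed of an outer and an inner half, and in the opposite order these two halves make up
  a round annulus.  The map \<open>\<Theta>\<close> interchanges the two holes.\<close>

lemma swindle:
  obtains L0 where "L0 > 1" "\<And>L. L \<ge> L0 \<Longrightarrow> \<exists>\<eta> \<Theta>. 0 < \<eta> \<and> \<eta> \<le> \<epsilon> \<and> emb (ann (1 - \<eta>) (L * (1 + \<eta>))) \<Theta> \<and>
    (\<forall>y\<in>ann (1 - \<eta>) (1 + \<eta>). \<Theta> y = E y \<and> \<Theta> (L *\<^sub>R y) = L *\<^sub>R E y)"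
proof -
  obtain k :: 'n where True by blast
  define e0 :: "real ^ 'n" where "e0 = axis k 1"
  have e0: "norm e0 = 1" by (simp add: e0_def)
  obtain J Q Q' a \<eta>0 where M: "compact Q" "compact Q'" "Q \<subseteq> ball ((1 / 2) *\<^sub>R e0) (1 / 4)"
    "0 \<notin> Q'" "inversion ` Q' \<subseteq> ball (- (1 / 2) *\<^sub>R e0) (1 / 4)" "emb (- (Q \<union> Q')) J"
    "0 < a" "a < 1" "\<And>y. norm y < a \<Longrightarrow> y \<notin> Q \<union> Q' \<and> J y = y"
    "\<And>y. norm y > 1 / a \<Longrightarrow> y \<notin> Q \<union> Q' \<and> J y = y"
    "0 < \<eta>0" "\<eta>0 \<le> \<epsilon>" "\<And>y. y \<in> ann (1 - \<eta>0) (1 + \<eta>0) \<Longrightarrow> y \<notin> Q \<union> Q' \<and> J y = E y"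
    "\<And>y. norm y < 1 \<Longrightarrow> y \<notin> Q \<Longrightarrow> J y \<in> A" "\<And>y. norm y > 1 \<Longrightarrow> y \<notin> Q' \<Longrightarrow> J y \<in> B"
    by (rule model[OF e0]) blast
  define D where "D = - (Q \<union> Q')"
  have embJ: "emb D J" using M(6) by (simp add: D_def)
  \<comment> \<open>A hole within distance 1/4 of \<open>e / 2\<close> lies in a narrow cone about
    \<open>e\<close>: the inner product with \<open>e\<close> exceeds 1/4, which is more than a
    third of the norm.\<close>
  have ball_half: "1 / 4 < norm y \<and> norm y < 3 / 4 \<and> y \<bullet> e > norm y / 3" if "y \<in> ball ((1 / 2) *\<^sub>R e) (1 / 4)" "norm e = 1" for y e :: "real ^ 'n"
  proof -
    define v where "v = y - (1 / 2) *\<^sub>R e"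
    have v: "norm v < 1 / 4" using that(1) by (simp add: v_def dist_norm norm_minus_commute)
    have y: "y = (1 / 2) *\<^sub>R e + v" by (simp add: v_def)
    have he: "norm ((1 / 2) *\<^sub>R e) = 1 / 2" using that(2) by simp
    have 1: "norm y < 3 / 4" using norm_triangle_ineq[of "(1 / 2) *\<^sub>R e" v] v he unfolding y by linarith
    have 2: "norm y > 1 / 4" using norm_diff_ineq[of "(1 / 2) *\<^sub>R e" v] v he unfolding y by linarith
    have "y \<bullet> e = 1 / 2 + v \<bullet> e" using that(2) by (simp add: y inner_add_left norm_eq_1)
    moreover have "\<bar>v \<bullet> e\<bar> \<le> norm v" using Cauchy_Schwarz_ineq2[of v e] that(2) by simp
    ultimately have "y \<bullet> e > 1 / 4" using v by linarith
    then show ?thesis using 1 2 by auto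
  qed
  \<comment> \<open>Open neighbourhoods of the holes, cut out by the very conditions under which the
    shuffle is a dilation by \<open>L\<close> or the identity. The bounds of \<open>Qp'\<close> are
    those of \<open>Qp\<close> under inversion.\<close>
  define Qp where "Qp = {y. 1 / 4 < norm y \<and> norm y < 3 / 4 \<and> y \<bullet> e0 > norm y / 3}"
  define Qp' where "Qp' = {y. 4 / 3 < norm y \<and> norm y < 4 \<and> y \<bullet> e0 < - norm y / 3}"
  have oQp: "open Qp" unfolding Qp_def
    by (intro open_Collect_conj open_Collect_less continuous_intros) auto
  have oQp': "open Qp'" unfolding Qp'_def
    by (intro open_Collect_conj open_Collect_less continuous_intros) auto
  have QQp: "Q \<subseteq> Qp" using M(3) ball_half[OF _ e0] by (auto simp: Qp_def)
  have QQp': "Q' \<subseteq> Qp'"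
  proof
    fix y assume y: "y \<in> Q'"
    then have y0: "y \<noteq> 0" using M(4) by auto
    have "inversion y \<in> ball ((1 / 2) *\<^sub>R (- e0)) (1 / 4)" using M(5) y by auto
    from ball_half[OF this] e0
    have i: "1 / 4 < inverse (norm y)" "inverse (norm y) < 3 / 4" "inversion y \<bullet> (- e0) > inverse (norm y) / 3" by auto
    have ny: "norm y > 0" using y0 by simp
    have "norm y < 4" using i(1) ny by (simp add: field_simps)
    moreover have "4 / 3 < norm y" using i(2) ny by (simp add: field_simps)
    moreover have "y \<bullet> e0 < - norm y / 3"
    proof -
      have "inverse (norm y) / 3 < - (inverse (norm y * norm y) * (y \<bullet> e0))"
        using i(3) by (simp add: inversion_def dot_square_norm power2_eq_square)
      then have lt: "norm y * norm y * (inverse (norm y) / 3) < norm y * norm y * (- (inverse (norm y * norm y) * (y \<bullet> e0)))"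
        using ny by (intro mult_strict_left_mono) auto
      have e1: "norm y * norm y * (inverse (norm y) / 3) = norm y / 3" using y0 by (simp add: field_simps)
      have e2: "norm y * norm y * (- (inverse (norm y * norm y) * (y \<bullet> e0))) = - (y \<bullet> e0)"
        using y0 by (simp add: field_simps)
      show ?thesis using lt unfolding e1 e2 by simp
    qed
    ultimately show "y \<in> Qp'" by (simp add: Qp'_def)
  qed
  \<comment> \<open>The inner radius at which the composition starts. It is at most
    \<open>a / 2\<close>, so that \<open>J\<close> is the identity around radius \<open>b\<close>,
    and at most 1/16, as the shuffle requires.\<close>
  define b where "b = min a (1 / 8) / 2"
  have b: "0 < b" "b \<le> 1 / 16" "b < a" using M(7) by (auto simp: b_def)
  \<comment> \<open>For \<open>L \<ge> L0\<close> the product \<open>b * L\<close> is at least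
    \<open>2 / a + 17\<close>: above 16, as the shuffle requires, and above \<open>1 / a\<close>,
    beyond which \<open>J\<close> is the identity.\<close>
  define L0 where "L0 = (2 / a + 17) / b"
  define \<eta> where "\<eta> = min \<eta>0 (1 / 64)"
  have eta: "0 < \<eta>" "\<eta> \<le> 1 / 64" "\<eta> \<le> \<eta>0" "\<eta> \<le> \<epsilon>" using M(11,12) by (auto simp: \<eta>_def)
  have "2 / a > 0" using M(7) by simp
  then have "b < 2 / a + 17" using b by linarith
  then have "L0 > 1" using b(1) by (simp add: L0_def pos_less_divide_eq)
  moreover have "\<exists>\<eta> \<Theta>. 0 < \<eta> \<and> \<eta> \<le> \<epsilon> \<and> emb (ann (1 - \<eta>) (L * (1 + \<eta>))) \<Theta> \<and>
    (\<forall>y\<in>ann (1 - \<eta>) (1 + \<eta>). \<Theta> y = E y \<and> \<Theta> (L *\<^sub>R y) = L *\<^sub>R E y)" if "L \<ge> L0" for L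
  proof -
    have "b * L0 \<le> b * L" using that b by (intro mult_left_mono) auto
    then have bL: "b * L \<ge> 2 / a + 17" using b by (simp add: L0_def)
    have a2: "2 / a > 2" "1 / a > 1" "2 / a = 2 * (1 / a)" using M(7,8) by (simp_all add: field_simps)
    have bL16: "b * L > 16" using bL a2 by linarith
    have L1: "L > 16"
    proof -
      have "L > 0" using zero_less_mult_pos[of b L] bL16 b(1) by linarith
      then have "b * L \<le> 1 * L" using b by (intro mult_right_mono) auto
      then show ?thesis using bL16 by simp
    qed
    have bLa: "b * L > 1 / a" using bL a2 by linarith
    have baL: "b * L < a * L" using b L1 by simp
    have bL_L: "b * L \<le> L / 16" using b L1 mult_right_mono[of b "1 / 16" L] by simp
    obtain h where h: "emb (- {0}) h" "\<And>y. y \<noteq> 0 \<Longrightarrow> h y \<noteq> 0"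
      "\<And>y. norm y \<le> 17 / 16 * b \<Longrightarrow> h y = (1 / b) *\<^sub>R y"
      "\<And>y. norm y \<ge> 31 / 32 * (b * L) \<Longrightarrow> h y = (1 / b) *\<^sub>R y"
      "\<And>y. 1 / 4 < norm y \<Longrightarrow> norm y < 3 / 4 \<Longrightarrow> y \<bullet> e0 > norm y / 3 \<Longrightarrow> h y = L *\<^sub>R y"
      "\<And>y. 4 / 3 < norm y \<Longrightarrow> norm y < 4 \<Longrightarrow> y \<bullet> e0 < - norm y / 3 \<Longrightarrow> h y = y"
      "\<And>y \<eta>. 0 < \<eta> \<Longrightarrow> \<eta> \<le> 1 / 32 \<Longrightarrow> y \<in> ann (b * (1 - \<eta>)) (b * L * (1 + \<eta>)) \<Longrightarrow> h y \<in> ann (1 - \<eta>) (L * (1 + \<eta>))"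
      by (rule hole_shuffle[OF b(1,2) bL16 e0]) blast
    have hQ: "h y = L *\<^sub>R y" if "y \<in> Qp" for y using h(5) that by (simp add: Qp_def)
    have hQ': "h y = y" if "y \<in> Qp'" for y using h(6) that by (simp add: Qp'_def)
    have J_id: "y \<in> D \<and> J y = y" if "norm y < a \<or> norm y > 1 / a" for y
      using M(9)[of y] M(10)[of y] that by (auto simp: D_def)
    have injJ: "inj_on J D" using embD(3)[OF embJ] .
    have J_fix: "J y = y" if "y \<in> D" "norm (J y) < a \<or> norm (J y) > 1 / a" for y
    proof -
      have "J (J y) = J y" "J y \<in> D" using J_id[OF that(2)] by auto
      then show ?thesis using injJ that(1) by (meson inj_onD)
    qed
    have nJ: "norm (J y) < s \<longleftrightarrow> norm y < s" if "y \<in> D" "s \<le> a \<or> s > 1 / a" for y s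
    proof (cases "s \<le> a")
      case True
      then show ?thesis using J_fix[OF that(1)] J_id[of y] by auto
    next
      case False
      then have s: "s > 1 / a" using that(2) by simp
      show ?thesis
      proof
        assume l: "norm (J y) < s" show "norm y < s"
        proof (rule ccontr)
          assume "\<not> norm y < s"
          then have "J y = y" using J_id[of y] s by auto
          then show False using l \<open>\<not> norm y < s\<close> by simp
        qed
      next
        assume l: "norm y < s" show "norm (J y) < s"
        proof (rule ccontr)
          assume "\<not> norm (J y) < s"
          then have "J y = y" using J_fix[OF that(1)] s by auto
          then show False using l \<open>\<not> norm (J y) < s\<close> by simp
        qed
      qed
    qed
    \<comment> \<open>The two halves in the order in which they fill the region between the sphere
      and its dilate: the outer half with hole \<open>Q'\<close>, then the dilated inner half. Both
      formulas are the identity around the seam at radius \<open>b * L\<close>, since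
      \<open>1 / a < b * L < a * L\<close>.\<close>
    define JW where "JW = (\<lambda>u. if norm u < b * L then J u else L *\<^sub>R J ((1 / L) *\<^sub>R u))"
    define DW :: "(real ^ 'n) set" where "DW = ann (1 - \<eta>) (L * (1 + \<eta>)) - Q' - (\<lambda>y. L *\<^sub>R y) ` Q"
    have nQ: "1 / 4 < norm y" "norm y < 3 / 4" if "y \<in> Q" for y using QQp that by (auto simp: Qp_def)
    have nQ': "4 / 3 < norm y" "norm y < 4" if "y \<in> Q'" for y using QQp' that by (auto simp: Qp'_def)
    have DW1: "u \<in> D" if "u \<in> DW" for u
      using that nQ[of u] eta by (auto simp: DW_def D_def)
    have DW2: "(1 / L) *\<^sub>R u \<in> D" if u: "u \<in> DW" for u
    proof -
      have "(1 / L) *\<^sub>R u \<notin> Q"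
      proof
        assume "(1 / L) *\<^sub>R u \<in> Q"
        then have "L *\<^sub>R ((1 / L) *\<^sub>R u) \<in> (\<lambda>y. L *\<^sub>R y) ` Q" by (rule imageI)
        then show False using u L1 by (simp add: DW_def)
      qed
      moreover have "norm ((1 / L) *\<^sub>R u) < 1 + \<eta>" using u L1 by (simp add: DW_def field_simps)
      then have "(1 / L) *\<^sub>R u \<notin> Q'" using nQ'[of "(1 / L) *\<^sub>R u"] eta by auto
      ultimately show ?thesis by (simp add: D_def)
    qed
    have oDW: "open DW"
    proof -
      have "compact ((\<lambda>y. L *\<^sub>R y) ` Q)" by (rule compact_scaling[OF M(1)])
      then show ?thesis unfolding DW_def using M(2) by (intro open_Diff open_ann compact_imp_closed)
    qed
    \<comment> \<open>The seam is respected by both formulas, so the images of the two halves do not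
      overlap.\<close>
    have JW_lt: "norm (JW u) < b * L \<longleftrightarrow> norm u < b * L" if u: "u \<in> DW" for u
    proof (cases "norm u < b * L")
      case True
      then show ?thesis using nJ[OF DW1[OF u], of "b * L"] bLa by (simp add: JW_def)
    next
      case False
      have "\<not> norm ((1 / L) *\<^sub>R u) < b" using False L1 by (simp add: field_simps)
      then have "\<not> norm (J ((1 / L) *\<^sub>R u)) < b" using nJ[OF DW2[OF u], of b] b(3) by simp
      then have "b * L \<le> norm (J ((1 / L) *\<^sub>R u)) * L" using L1 by (intro mult_right_mono) auto
      then show ?thesis using False L1 by (simp add: JW_def mult.commute)
    qed
    have embL: "emb U (\<lambda>u. L *\<^sub>R J ((1 / L) *\<^sub>R u))" if "open U" "\<And>u. u \<in> U \<Longrightarrow> (1 / L) *\<^sub>R u \<in> D" for U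
    proof (rule emb_compose[OF emb_compose[OF emb_subset[OF emb_scaleR] embJ] emb_scaleR])
      show "(\<lambda>y. (1 / L) *\<^sub>R y) ` U \<subseteq> D" using that(2) by auto
    qed (use L1 that in auto)
    have embJW: "emb DW JW"
    proof (rule emb_localI[OF oDW])
      show "inj_on JW DW"
      proof (rule inj_onI)
        fix u v assume u: "u \<in> DW" and v: "v \<in> DW" and eq: "JW u = JW v"
        show "u = v"
        proof (cases "norm u < b * L")
          case True
          then have "norm v < b * L" using JW_lt[OF u] JW_lt[OF v] eq by simp
          then show ?thesis using True eq inj_onD[OF injJ _ DW1[OF u] DW1[OF v]] by (simp add: JW_def)
        next
          case False
          then have "\<not> norm v < b * L" using JW_lt[OF u] JW_lt[OF v] eq by simp
          then have "J ((1 / L) *\<^sub>R u) = J ((1 / L) *\<^sub>R v)" using False eq L1 by (simp add: JW_def)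
          then have "(1 / L) *\<^sub>R u = (1 / L) *\<^sub>R v" using inj_onD[OF injJ _ DW2[OF u] DW2[OF v]] by simp
          then show ?thesis using L1 by simp
        qed
      qed
      fix u assume u: "u \<in> DW"
      consider "norm u < b * L" | "norm u > b * L" | "norm u = b * L" by linarith
      then show "\<exists>V g. u \<in> V \<and> emb V g \<and> (\<forall>y\<in>V. JW y = g y)"
      proof cases
        case 1
        have "emb (D \<inter> ball 0 (b * L)) J"
          by (rule emb_subset[OF embJ]) (use embD(1)[OF embJ] in auto)
        then show ?thesis using 1 DW1[OF u]
          by (intro exI[of _ "D \<inter> ball 0 (b * L)"] exI[of _ J]) (auto simp: JW_def)
      next
        case 2
        define V where "V = DW \<inter> {y. norm y > b * L}"
        have "open V" unfolding V_def by (intro open_Int oDW open_Collect_less continuous_intros)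
        then have "emb V (\<lambda>u. L *\<^sub>R J ((1 / L) *\<^sub>R u))" by (rule embL) (use DW2 in \<open>auto simp: V_def\<close>)
        then show ?thesis using 2 u
          by (intro exI[of _ V] exI[of _ "\<lambda>u. L *\<^sub>R J ((1 / L) *\<^sub>R u)"]) (auto simp: JW_def V_def)
      next
        case 3
        have "JW y = y" if y: "y \<in> ann (1 / a) (a * L)" for y
        proof (cases "norm y < b * L")
          case True
          then show ?thesis using y J_id[of y] by (simp add: JW_def)
        next
          case False
          have "norm ((1 / L) *\<^sub>R y) < a" using y L1 by (simp add: field_simps)
          then have "J ((1 / L) *\<^sub>R y) = (1 / L) *\<^sub>R y" using J_id by blast
          then show ?thesis using False L1 by (simp add: JW_def)
        qed
        moreover have "u \<in> ann (1 / a) (a * L)" using 3 baL bLa by simp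
        ultimately show ?thesis
          by (intro exI[of _ "ann (1 / a) (a * L)"] exI[of _ "\<lambda>y. y"]) (auto intro: emb_id)
      qed
    qed
    \<comment> \<open>Now space is viewed in the first order, as the image of \<open>J\<close> with
      its two missing pieces put back.\<close>
    define I where "I = inv_into D J"
    have I: "I (J y) = y" if "y \<in> D" for y using injJ that by (simp add: I_def)
    \<comment> \<open>On the image of \<open>J\<close> the holes are shuffled and the halves
      reassembled in the other order. The missing piece of \<open>A\<close> is carried along with
      its hole, which is dilated by \<open>L\<close>; the missing piece of \<open>B\<close> stays
      where it is.\<close>
    define T where "T = (\<lambda>z. if z \<in> J ` D then JW (h (I z)) else if z \<in> A then L *\<^sub>R z else z)"
    define Z :: "(real ^ 'n) set" where "Z = ann (b * (1 - \<eta>)) (b * L * (1 + \<eta>))"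
    have b1: "b * (1 - \<eta>) < b" using b eta by simp
    have bL1: "b * L * (1 + \<eta>) > b * L" using bL16 eta mult_strict_left_mono[of 1 "1 + \<eta>" "b * L"] by simp
    have yZ: "y \<in> Z" if y: "y \<in> D" "J y \<in> Z" for y
    proof -
      have "norm y < b * L * (1 + \<eta>)"
        using nJ[OF y(1), of "b * L * (1 + \<eta>)"] y(2) bL1 bLa by (simp add: Z_def)
      moreover have "b * (1 - \<eta>) < norm y"
      proof (rule ccontr)
        assume "\<not> b * (1 - \<eta>) < norm y"
        then have "norm y < a" using b1 b(3) by linarith
        then have "J y = y" using J_id[of y] by blast
        then show False using y(2) \<open>\<not> b * (1 - \<eta>) < norm y\<close> by (simp add: Z_def)
      qed
      ultimately show ?thesis by (simp add: Z_def)
    qed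
    have Z0: "z \<noteq> 0" if "z \<in> Z" for z
    proof -
      have "0 < b * (1 - \<eta>)" using b eta by simp
      then show ?thesis using that by (auto simp: Z_def)
    qed
    have injh: "x = y" if "h x = h y" "x \<noteq> 0" "y \<noteq> 0" for x y
      using inj_onD[OF embD(3)[OF h(1)] that(1)] that by auto
    have hDW: "h y \<in> DW" if y: "y \<in> D" "y \<in> Z" for y
    proof -
      have y0: "y \<noteq> 0" using Z0[OF y(2)] .
      have "h y \<in> ann (1 - \<eta>) (L * (1 + \<eta>))" using h(7)[of \<eta> y] eta y(2) by (auto simp: Z_def)
      moreover have "h y \<notin> Q'"
      proof
        assume q: "h y \<in> Q'"
        then have "h (h y) = h y" using hQ' QQp' by blast
        then have "h y = y" using injh h(2)[OF y0] y0 by blast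
        then show False using q y(1) by (simp add: D_def)
      qed
      moreover have "h y \<notin> (\<lambda>y. L *\<^sub>R y) ` Q"
      proof
        assume "h y \<in> (\<lambda>y. L *\<^sub>R y) ` Q"
        then obtain q where q: "q \<in> Q" "h y = L *\<^sub>R q" by blast
        then have "h q = h y" using hQ QQp by auto
        moreover have "q \<noteq> 0" using nQ(1)[OF q(1)] by auto
        ultimately have "q = y" using injh y0 by blast
        then show False using q y(1) by (simp add: D_def)
      qed
      ultimately show ?thesis by (simp add: DW_def)
    qed
    have J_side: "J y \<in> A" if "y \<in> D" "norm y < 1" for y using M(14) that by (simp add: D_def)
    have J_side': "J y \<in> B" if "y \<in> D" "norm y > 1" for y using M(15) that by (simp add: D_def)
    have sphere_D: "y \<in> D \<and> J y = E y" if "norm y = 1" for y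
      using M(13)[of y] M(11) that by (auto simp: D_def)
    have side: "norm y < 1" if "y \<in> D" "J y \<in> A" for y
      using that J_side'[of y] sphere_D[of y] AB A_sphere
      by (cases "norm y" "1 :: real" rule: linorder_cases) auto
    have side': "norm y > 1" if "y \<in> D" "J y \<in> B" for y
      using that J_side[of y] sphere_D[of y] AB B_sphere
      by (cases "norm y" "1 :: real" rule: linorder_cases) auto
    \<comment> \<open>Missed points avoid the regions near 0 and infinity where \<open>J\<close> is
      the identity. Dilated by \<open>L\<close>, such a point lands beyond the seam at
      \<open>b * L\<close>; undilated, it stays before it. Together with \<open>JW_lt\<close> this
      separates all cases of injectivity.\<close>
    have out: "b < norm z" "norm z < b * L" if "z \<notin> J ` D" for z
    proof -
      have n: "\<not> (norm z < a \<or> norm z > 1 / a)"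
      proof
        assume "norm z < a \<or> norm z > 1 / a"
        then have "z = J z" "z \<in> D" using J_id by auto
        then show False using that by blast
      qed
      then show "b < norm z" "norm z < b * L" using b(3) bLa by linarith+
    qed
    have embT: "emb Z T"
    proof (rule emb_localI)
      show "open Z" by (simp add: Z_def)
      show "inj_on T Z"
      proof (rule inj_onI)
        fix z w assume z: "z \<in> Z" and w: "w \<in> Z" and eq: "T z = T w"
        have key: False if z: "z \<in> Z" "z \<in> J ` D" and w: "w \<in> Z" "w \<notin> J ` D" and eq: "T z = T w" for z w
        proof -
          obtain y where y: "y \<in> D" "z = J y" using z(2) by blast
          define u where "u = h y"
          have u: "u \<in> DW" unfolding u_def using y z yZ by (intro hDW) auto
          have Tz: "T z = JW u" using y I by (simp add: T_def u_def)
          show False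
          proof (cases "w \<in> A")
            case True
            then have e: "JW u = L *\<^sub>R w" using eq Tz w by (simp add: T_def)
            have "b * L < norm (JW u)" using out(1)[OF w(2)] L1 unfolding e by (simp add: mult.commute)
            then have "\<not> norm u < b * L" using JW_lt[OF u] by simp
            then have "w = J ((1 / L) *\<^sub>R u)" using e L1 by (simp add: JW_def)
            then show False using DW2[OF u] w(2) by blast
          next
            case False
            then have e: "JW u = w" using eq Tz w by (simp add: T_def)
            then have "norm u < b * L" using out(2)[OF w(2)] JW_lt[OF u] by simp
            then have "w = J u" using e by (simp add: JW_def)
            then show False using DW1[OF u] w(2) by blast
          qed
        qed
        consider "z \<in> J ` D" "w \<in> J ` D" | "z \<notin> J ` D" "w \<notin> J ` D" "z \<in> A \<longleftrightarrow> w \<in> A"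
          | "z \<notin> J ` D" "w \<notin> J ` D" "z \<in> A" "w \<notin> A" | "z \<notin> J ` D" "w \<notin> J ` D" "z \<notin> A" "w \<in> A"
          using key[of z w] key[of w z] z w eq by metis
        then show "z = w"
        proof cases
          case 1
          then obtain y x where y: "y \<in> D" "z = J y" and x: "x \<in> D" "w = J x" by blast
          have "JW (h y) = JW (h x)" using eq y x I by (simp add: T_def)
          then have "h y = h x"
            using inj_onD[OF embD(3)[OF embJW]] hDW[OF y(1)] hDW[OF x(1)] yZ[of y] yZ[of x] y x z w by blast
          then have "y = x" using injh yZ[of y] yZ[of x] Z0 y x z w by blast
          then show ?thesis using y x by simp
        next
          case 2
          then show ?thesis using eq L1 by (auto simp: T_def split: if_splits)
        next
          case 3
          then have "w = L *\<^sub>R z" using eq by (simp add: T_def)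
          then have "norm w = L * norm z" using L1 by simp
          also have "\<dots> > L * b" using out(1)[OF 3(1)] L1 by simp
          finally show ?thesis using out(2)[OF 3(2)] by (simp add: mult.commute)
        next
          case 4
          then have "z = L *\<^sub>R w" using eq by (simp add: T_def)
          then have "norm z = L * norm w" using L1 by simp
          also have "\<dots> > L * b" using out(1)[OF 4(2)] L1 by simp
          finally show ?thesis using out(2)[OF 4(1)] by (simp add: mult.commute)
        qed
      qed
      fix z assume z: "z \<in> Z"
      consider "z \<in> J ` D" | "z \<notin> J ` D" "z \<in> A" | "z \<notin> J ` D" "z \<in> B"
      proof -
        have "E ` sphere 0 1 \<subseteq> J ` D" using sphere_D by (metis (no_types, lifting) image_subsetI mem_sphere_0 rev_image_eqI)
        then show ?thesis using cover that by blast
      qed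
      then show "\<exists>V g. z \<in> V \<and> emb V g \<and> (\<forall>y\<in>V. T y = g y)"
      proof cases
        case 1
        have oJD: "open (J ` D)" by (rule emb_image_open[OF embJ embD(1)[OF embJ] subset_refl])
        have oV: "open (Z \<inter> J ` D)" using oJD by (simp add: Z_def open_Int)
        have eI: "emb (Z \<inter> J ` D) I" unfolding I_def
          by (rule emb_subset[OF emb_inverse[OF embJ] oV]) auto
        have IZ: "I w \<in> D \<and> I w \<in> Z" if "w \<in> Z \<inter> J ` D" for w
          using that I yZ by auto
        have "emb (Z \<inter> J ` D) (\<lambda>z. JW (h (I z)))"
        proof (rule emb_compose[OF emb_compose[OF eI h(1)] embJW])
          show "I ` (Z \<inter> J ` D) \<subseteq> - {0}" using IZ Z0 by fast
          show "(\<lambda>x. h (I x)) ` (Z \<inter> J ` D) \<subseteq> DW" using IZ hDW by blast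
        qed
        then show ?thesis using 1 z
          by (intro exI[of _ "Z \<inter> J ` D"] exI[of _ "\<lambda>z. JW (h (I z))"]) (auto simp: T_def)
      next
        case 2
        \<comment> \<open>A point of \<open>A\<close> outside this compact image is either missed by
          \<open>J\<close> or comes from \<open>Qp\<close>, where the shuffle is dilation by
          \<open>L\<close>. So \<open>T\<close> is that dilation on a whole neighbourhood of the
          missing piece.\<close>
        define V where "V = A - J ` (cball 0 1 - Qp)"
        have subD: "cball 0 1 - Qp \<subseteq> D" using QQp nQ' by (force simp: D_def)
        have "compact (J ` (cball 0 1 - Qp))"
          using embD(5)[OF embJ] subD oQp by (intro compact_continuous_image compact_diff) (auto intro: continuous_on_subset)
        then have "open V" unfolding V_def using open_A by (intro open_Diff compact_imp_closed)
        then have "emb V (\<lambda>z. L *\<^sub>R z)" using L1 by (intro emb_subset[OF emb_scaleR]) auto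
        moreover have "T w = L *\<^sub>R w" if w: "w \<in> V" for w
        proof (cases "w \<in> J ` D")
          case True
          then obtain y where y: "y \<in> D" "w = J y" by blast
          have "norm y < 1" using side[OF y(1)] y(2) w by (simp add: V_def)
          then have yQ: "y \<in> Qp" using w y(2) by (auto simp: V_def)
          then have "norm (L *\<^sub>R y) > L / 4" using L1 by (simp add: Qp_def)
          then have "\<not> norm (L *\<^sub>R y) < b * L" using bL_L L1 by linarith
          then have "JW (L *\<^sub>R y) = L *\<^sub>R J y" using L1 by (simp add: JW_def)
          then show ?thesis using True y I hQ[OF yQ] by (simp add: T_def)
        next
          case False
          then show ?thesis using w by (simp add: T_def V_def)
        qed
        moreover have "z \<in> V" using 2 subD by (auto simp: V_def)
        ultimately show ?thesis by (intro exI[of _ V] exI[of _ "\<lambda>z. L *\<^sub>R z"]) auto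
      next
        case 3
        \<comment> \<open>The same device on the outer side, where the shuffle is the identity near
          the hole. The bound \<open>2 / a\<close> makes the excluded set compact; beyond
          \<open>1 / a\<close> the map \<open>J\<close> misses nothing.\<close>
        define C where "C = {y :: real ^ 'n. 1 \<le> norm y \<and> norm y \<le> 2 / a} - Qp'"
        define V where "V = B - J ` C - {y. norm y \<ge> 2 / a}"
        have subD: "C \<subseteq> D" using QQp' nQ by (force simp: D_def C_def)
        have "compact C" unfolding C_def by (intro compact_diff compact_closed_annulus oQp')
        then have "compact (J ` C)"
          using embD(5)[OF embJ] subD by (intro compact_continuous_image) (auto intro: continuous_on_subset)
        then have "closed (J ` C)" by (rule compact_imp_closed)
        moreover have "closed {y :: real ^ 'n. norm y \<ge> 2 / a}" by (intro closed_Collect_le continuous_intros)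
        ultimately have "open V" unfolding V_def using open_B by (intro open_Diff)
        then have "emb V (\<lambda>z. z)" by (rule emb_id)
        moreover have "T w = w" if w: "w \<in> V" for w
        proof (cases "w \<in> J ` D")
          case True
          then obtain y where y: "y \<in> D" "w = J y" by blast
          have y1: "norm y > 1" using side'[OF y(1)] y(2) w by (simp add: V_def)
          have "norm y < 2 / a"
          proof (rule ccontr)
            assume n: "\<not> norm y < 2 / a"
            then have "norm y > 1 / a" using a2 by linarith
            then have "J y = y" using J_id[of y] by blast
            then show False using n w y(2) by (simp add: V_def)
          qed
          then have yQ: "y \<in> Qp'" using y1 w y(2) by (auto simp: V_def C_def)
          then have "norm y < b * L" using bL16 by (simp add: Qp'_def)
          then show ?thesis using True y I hQ'[OF yQ] by (simp add: T_def JW_def)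
        next
          case False
          then show ?thesis using w AB by (auto simp: T_def V_def)
        qed
        moreover have "z \<in> V"
        proof -
          have "\<not> norm z > 1 / a" using 3(1) J_id[of z] by (metis image_eqI)
          then have "\<not> 2 / a \<le> norm z" using a2 by linarith
          moreover have "z \<notin> J ` C" using 3(1) subD by blast
          ultimately show ?thesis using 3(2) by (simp add: V_def)
        qed
        ultimately show ?thesis by (intro exI[of _ V] exI[of _ "\<lambda>z. z"]) auto
      qed
    qed
    \<comment> \<open>Rescaling by \<open>b\<close> turns the round annulus \<open>Z\<close> into
      one that starts at the unit sphere.\<close>
    define \<Theta> where "\<Theta> = (\<lambda>u. T (b *\<^sub>R u))"
    have "emb (ann (1 - \<eta>) (L * (1 + \<eta>))) \<Theta>" unfolding \<Theta>_def
    proof (rule emb_compose[OF emb_subset[OF emb_scaleR] embT])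
      show "(\<lambda>y. b *\<^sub>R y) ` ann (1 - \<eta>) (L * (1 + \<eta>)) \<subseteq> Z" using b by (auto simp: Z_def mult.assoc)
    qed (use b in auto)
    moreover have "\<Theta> y = E y \<and> \<Theta> (L *\<^sub>R y) = L *\<^sub>R E y" if y: "y \<in> ann (1 - \<eta>) (1 + \<eta>)" for y
    proof
      have Jy: "J y = E y" using M(13)[of y] y eta by auto
      have yn: "1 - 1 / 64 < norm y" "norm y < 1 + 1 / 64" using y eta by auto
      have n1: "norm (b *\<^sub>R y) \<le> 17 / 16 * b"
      proof -
        have "norm (b *\<^sub>R y) = norm y * b" using b by simp
        also have "\<dots> \<le> 17 / 16 * b" using yn b by (intro mult_right_mono) auto
        finally show ?thesis .
      qed
      have "norm (b *\<^sub>R y) < a"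
      proof -
        have "17 / 16 * b < 2 * b" using b by simp
        also have "\<dots> \<le> a" by (simp add: b_def)
        finally show ?thesis using n1 by simp
      qed
      then have 1: "b *\<^sub>R y \<in> D" "J (b *\<^sub>R y) = b *\<^sub>R y" using J_id by blast+
      then have "I (b *\<^sub>R y) = b *\<^sub>R y" using I by metis
      moreover have "h (b *\<^sub>R y) = y" using h(3)[OF n1] b by simp
      moreover have "b *\<^sub>R y \<in> J ` D" using 1 by (metis imageI)
      moreover have "JW y = J y" using yn bL16 by (simp add: JW_def)
      ultimately show "\<Theta> y = E y" using Jy by (simp add: \<Theta>_def T_def)
      define z where "z = b *\<^sub>R (L *\<^sub>R y)"
      have nz: "norm z \<ge> 31 / 32 * (b * L)"
      proof -
        have "norm z = norm y * (b * L)" using b L1 by (simp add: z_def)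
        moreover have "31 / 32 * (b * L) \<le> norm y * (b * L)" using yn bL16 by (intro mult_right_mono) auto
        ultimately show ?thesis by simp
      qed
      then have "norm z > 1 / a" using bL a2 by linarith
      then have 2: "z \<in> D" "J z = z" using J_id by blast+
      then have "I z = z" using I by metis
      moreover have "h z = L *\<^sub>R y" using h(4)[OF nz] b by (simp add: z_def)
      moreover have "z \<in> J ` D" using 2 by (metis imageI)
      moreover have "JW (L *\<^sub>R y) = L *\<^sub>R J y"
      proof -
        have "norm (L *\<^sub>R y) = norm y * L" using L1 by simp
        moreover have "L / 16 \<le> norm y * L" using yn mult_right_mono[of "1 / 16" "norm y" L] L1 by simp
        ultimately have "\<not> norm (L *\<^sub>R y) < b * L" using bL_L by linarith
        then show ?thesis using L1 by (simp add: JW_def)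
      qed
      ultimately show "\<Theta> (L *\<^sub>R y) = L *\<^sub>R E y" using Jy by (simp add: \<Theta>_def T_def z_def)
    qed
    ultimately show ?thesis using eta(1,4) by blast
  qed
  ultimately show ?thesis using that by blast
qed

end

subsection \<open>Cancellation\<close>

lemma connected_ann: "CARD('n) \<ge> 2 \<Longrightarrow> connected (ann a b :: (real ^ 'n::finite) set)"
  using connected_annulus(1)[where a = "0 :: real ^ 'n" and ?r1.0 = a and ?r2.0 = b] by (simp add: ann_def)

lemma connected_in_open_cover:
  assumes "connected S" "open U" "open V" "U \<inter> V = {}" "S \<subseteq> U \<union> V" "x \<in> S" "x \<in> U"
  shows "S \<subseteq> U"
proof -
  have "U \<inter> S = {} \<or> V \<inter> S = {}"
    by (rule connectedD[OF assms(1-3)]) (use assms(4,5) in auto)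
  then show ?thesis using assms(5-7) by blast
qed

text \<open>The disjointness of translates expresses that the covering map is injective on the
  lifted sphere. It is required for positive powers only, since the others follow by
  symmetry.\<close>

locale deck = collar E \<epsilon> A B for E :: "real ^ 'n::finite \<Rightarrow> real ^ 'n" and \<epsilon> A B +
  fixes c :: real
  assumes c1: "c > 1"
    and disjoint_translates: "\<And>k y z. k > 0 \<Longrightarrow> norm y = 1 \<Longrightarrow> norm z = 1 \<Longrightarrow> c ^ k *\<^sub>R E y \<noteq> E z"
begin

abbreviation S where "S \<equiv> E ` sphere 0 1"

lemma connected_S: "connected S"
proof (rule connected_continuous_image)
  show "continuous_on (sphere 0 1) E"
    using embD(5)[OF emb_E] by (rule continuous_on_subset) (use eps in auto)
  show "connected (sphere (0 :: real ^ 'n) 1)" using card by (intro connected_sphere) simp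
qed

lemma pt: obtains e :: "real ^ 'n" where "norm e = 1"
  using vector_choose_size[of 1] by (metis zero_le_one)

lemma disjoint_S: "k > 0 \<Longrightarrow> y \<in> S \<Longrightarrow> c ^ k *\<^sub>R y \<notin> S"
  using disjoint_translates by auto

lemma c_pow_pos: "c ^ k > 0" using c1 by simp

lemma c_pow_gt1: "k > 0 \<Longrightarrow> c ^ k > 1" using c1 by (simp add: one_less_power)

text \<open>An annulus beyond the largest norm on \<open>S\<close> is connected, avoids
  \<open>S\<close>, and reaches points so large that they are known to lie in
  \<open>B\<close>.\<close>

lemma outside_in_B:
  assumes "\<And>z. z \<in> S \<Longrightarrow> norm z < norm y"
  shows "y \<in> B"
proof -
  obtain R where R: "R > 0" "\<And>y. norm y > R \<Longrightarrow> y \<in> B" using large_in_B by blast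
  have ne: "S \<noteq> {}" using pt by (metis empty_iff imageI mem_sphere_0)
  obtain z0 where z0: "z0 \<in> S" "\<And>z. z \<in> S \<Longrightarrow> norm z \<le> norm z0"
    using continuous_attains_sup[OF compact_sphere_image ne, of norm] by (auto intro: continuous_intros)
  obtain z :: "real ^ 'n" where z: "norm z = R + 1 + norm y"
    using vector_choose_size[of "R + 1 + norm y"] R(1) by auto
  define U where "U = (ann (norm z0) (R + 2 + norm y) :: (real ^ 'n) set)"
  have "U \<subseteq> B"
  proof (rule connected_in_open_cover[of U B A z])
    show "connected U" unfolding U_def by (rule connected_ann[OF card])
    have "R < norm z" using z R(1) by (simp add: add_pos_nonneg)
    then have "z \<in> B" by (rule R(2))
    then show "z \<in> B" .
    have "norm z0 < norm y" using assms z0(1) by blast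
    then show "z \<in> U" using z R(1) by (simp add: U_def)
    have "x \<in> B \<union> A" if "x \<in> U" for x
    proof -
      have "x \<notin> S" using z0(2)[of x] that by (auto simp: U_def)
      then show ?thesis using cover by blast
    qed
    then show "U \<subseteq> B \<union> A" by blast
  qed (use open_A open_B AB in auto)
  moreover have "y \<in> U" using assms[OF z0(1)] R(1) by (simp add: U_def)
  ultimately show ?thesis by blast
qed

lemma S_subset_closure_A: "S \<subseteq> closure A"
proof (rule image_subsetI)
  fix y :: "real ^ 'n" assume "y \<in> sphere 0 1"
  then have y: "norm y = 1" by simp
  show "E y \<in> closure A"
    unfolding closure_approachable
  proof (intro allI impI)
    fix e :: real assume e: "e > 0"
    have "isCont E y"
      using embD(5)[OF emb_E] y eps by (simp add: continuous_on_eq_continuous_at)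
    then obtain d where d: "d > 0" "\<And>x. dist x y < d \<Longrightarrow> dist (E x) (E y) < e"
      using e unfolding continuous_at_eps_delta by (metis dist_commute)
    define t where "t = min d \<epsilon> / 2"
    have t: "0 < t" "t < d" "t < \<epsilon>" using d(1) eps by (auto simp: t_def)
    define x where "x = (1 - t) *\<^sub>R y"
    have "norm x = 1 - t" using t eps y by (simp add: x_def)
    then have "E x \<in> A" using t E_inner by auto
    moreover have "dist x y = t" using y t by (simp add: x_def dist_norm algebra_simps)
    ultimately show "\<exists>y'\<in>A. dist y' (E y) < e" using d(2)[of x] t by auto
  qed
qed

text \<open>The dilate of \<open>X\<close> by \<open>s\<close>, encoded as a preimage so that
  openness, disjointness and coverings transfer at once.\<close>

definition scaled :: "real \<Rightarrow> (real ^ 'n) set \<Rightarrow> (real ^ 'n) set" where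
  "scaled s X = {y. (1 / s) *\<^sub>R y \<in> X}"

lemma open_scaled: "s > 0 \<Longrightarrow> open X \<Longrightarrow> open (scaled s X)"
proof -
  assume "s > 0" "open X"
  have "open ((\<lambda>y. (1 / s) *\<^sub>R y) -` X)"
    by (rule open_vimage[OF \<open>open X\<close>]) (intro continuous_intros)
  then show ?thesis by (simp add: scaled_def vimage_def)
qed

text \<open>The translate is connected and misses \<open>S\<close>, so it lies on one side, and its
  point of largest norm lies in \<open>B\<close>.\<close>

lemma translate_S_in_B:
  assumes "k > 0" "y \<in> S"
  shows "c ^ k *\<^sub>R y \<in> B"
proof -
  have ne: "S \<noteq> {}" using assms(2) by blast
  obtain z0 where z0: "z0 \<in> S" "\<And>z. z \<in> S \<Longrightarrow> norm z \<le> norm z0"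
    using continuous_attains_sup[OF compact_sphere_image ne, of norm] by (auto intro: continuous_intros)
  have z00: "norm z0 > 0"
  proof -
    obtain e where "norm e = 1" "E e = z0" using z0(1) by auto
    then show ?thesis using E_nonzero[of e] eps by auto
  qed
  have "(\<lambda>y. c ^ k *\<^sub>R y) ` S \<subseteq> B"
  proof (rule connected_in_open_cover[of _ B A "c ^ k *\<^sub>R z0"])
    show "connected ((\<lambda>y. c ^ k *\<^sub>R y) ` S)"
      by (rule connected_continuous_image[OF _ connected_S]) (intro continuous_intros)
    show "(\<lambda>y. c ^ k *\<^sub>R y) ` S \<subseteq> B \<union> A" using disjoint_S[OF assms(1)] cover by blast
    show "c ^ k *\<^sub>R z0 \<in> B"
    proof (rule outside_in_B)
      fix z assume "z \<in> S"
      then have "norm z \<le> norm z0" by (rule z0(2))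
      also have "\<dots> < c ^ k * norm z0" using c_pow_gt1[OF assms(1)] z00 by simp
      also have "\<dots> = norm (c ^ k *\<^sub>R z0)" using c_pow_pos[of k] by simp
      finally show "norm z < norm (c ^ k *\<^sub>R z0)" .
    qed
  qed (use z0(1) open_A open_B AB in auto)
  then show ?thesis using assms(2) by blast
qed

lemma not_B_iff: "y \<notin> B \<longleftrightarrow> y \<in> A \<union> S"
  using cover AB B_sphere by blast

lemma not_A_iff: "y \<notin> A \<longleftrightarrow> y \<in> B \<union> S"
  using cover AB A_sphere by blast

text \<open>The closed inner side is connected, misses the translate of \<open>S\<close>, and shares
  the origin with the dilated inner side.\<close>

lemma A_S_in_scaled_A:
  assumes "k > 0" "y \<in> A \<union> S"
  shows "y \<in> scaled (c ^ k) A"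
proof -
  have c0: "c ^ k > 0" by (rule c_pow_pos)
  have "A \<union> S \<subseteq> scaled (c ^ k) A"
  proof (rule connected_in_open_cover[of _ _ "scaled (c ^ k) B" 0])
    show "connected (A \<union> S)"
      by (rule connected_intermediate_closure[OF connected_A]) (use S_subset_closure_A closure_subset in auto)
    show "open (scaled (c ^ k) A)" "open (scaled (c ^ k) B)" using open_scaled[OF c0] open_A open_B by auto
    show "scaled (c ^ k) A \<inter> scaled (c ^ k) B = {}" using AB by (auto simp: scaled_def)
    show "A \<union> S \<subseteq> scaled (c ^ k) A \<union> scaled (c ^ k) B"
    proof
      fix z assume z: "z \<in> A \<union> S"
      have "(1 / c ^ k) *\<^sub>R z \<notin> S"
      proof
        assume "(1 / c ^ k) *\<^sub>R z \<in> S"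
        then have "c ^ k *\<^sub>R (1 / c ^ k) *\<^sub>R z \<in> B" by (rule translate_S_in_B[OF assms(1)])
        moreover have "c ^ k *\<^sub>R (1 / c ^ k) *\<^sub>R z = z" using c1 by simp
        ultimately show False using z not_B_iff by auto
      qed
      then show "z \<in> scaled (c ^ k) A \<union> scaled (c ^ k) B"
        using cover by (auto simp: scaled_def)
    qed
  qed (use zero_A in \<open>auto simp: scaled_def\<close>)
  then show ?thesis using assms(2) by blast
qed

lemma scaled_B_S_in_B:
  assumes "k > 0" "(1 / c ^ k) *\<^sub>R y \<in> B \<union> S"
  shows "y \<in> B"
  using A_S_in_scaled_A[OF assms(1), of y] assms(2) not_B_iff[of y] AB A_sphere
  by (auto simp: scaled_def)

text \<open>Connectedness puts the image inside the region. For the converse, the image together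
  with the complement of the region is both open and closed, hence the whole space.\<close>

lemma image_between:
  assumes k: "k > 0" and s: "s > 1" and e: "0 < \<eta>" "\<eta> \<le> \<epsilon>" and T': "emb (ann (1 - \<eta>) (s * (1 + \<eta>))) T"
    and ends: "\<And>y. y \<in> ann (1 - \<eta>) (1 + \<eta>) \<Longrightarrow> T y = E y \<and> T (s *\<^sub>R y) = c ^ k *\<^sub>R E y"
  shows "T ` ann 1 s = B \<inter> scaled (c ^ k) A"
proof -
  define L where "L = c ^ k"
  have L: "L > 1" using c_pow_gt1[OF k] by (simp add: L_def)
  let ?D = "ann (1 - \<eta>) (s * (1 + \<eta>)) :: (real ^ 'n) set"
  have sub: "ann 1 s \<subseteq> ?D"
  proof -
    have "s \<le> s * (1 + \<eta>)" using s e by simp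
    then have "norm x < s * (1 + \<eta>)" if "norm x < s" for x :: "real ^ 'n" using that by linarith
    then show ?thesis using e by auto
  qed
  have ends1: "T y = E y" "T (s *\<^sub>R y) = L *\<^sub>R E y" if "y \<in> ann (1 - \<eta>) (1 + \<eta>)" for y
    using ends[OF that] by (auto simp: L_def)
  define I where "I = T ` ann 1 s"
  have cI: "connected I" unfolding I_def
    using embD(5)[OF T'] sub connected_ann[OF card]
    by (intro connected_continuous_image) (auto intro: continuous_on_subset)
  have inT: "x = y" if "T x = T y" "x \<in> ?D" "y \<in> ?D" for x y
    using inj_onD[OF embD(3)[OF T']] that by blast
  have sphereD: "y \<in> ?D" "s *\<^sub>R y \<in> ?D" "y \<in> ann (1 - \<eta>) (1 + \<eta>)" if "norm y = 1" for y :: "real ^ 'n"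
  proof -
    have "s < s * (1 + \<eta>)" using s e by simp
    then show "y \<in> ?D" "s *\<^sub>R y \<in> ?D" "y \<in> ann (1 - \<eta>) (1 + \<eta>)" using that e s by (auto intro: less_trans)
  qed
  have IS: "x \<notin> S" if xI: "x \<in> I" for x
  proof
    assume "x \<in> S"
    then obtain y where y: "norm y = 1" "x = E y" by auto
    obtain z where z: "z \<in> ann 1 s" "x = T z" using xI unfolding I_def by blast
    have "T y = T z" using y z ends1(1)[OF sphereD(3)[OF y(1)]] by simp
    then have "y = z" using inT sphereD(1)[OF y(1)] z(1) sub by blast
    then show False using y z by simp
  qed
  have IS': "(1 / L) *\<^sub>R x \<notin> S" if xI: "x \<in> I" for x
  proof
    assume "(1 / L) *\<^sub>R x \<in> S"
    then obtain y where y: "norm y = 1" "(1 / L) *\<^sub>R x = E y" by auto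
    then have x: "x = L *\<^sub>R E y" using L by (simp flip: y(2))
    obtain z where z: "z \<in> ann 1 s" "x = T z" using xI unfolding I_def by blast
    have "T (s *\<^sub>R y) = T z" using x z ends1(2)[OF sphereD(3)[OF y(1)]] by simp
    then have "s *\<^sub>R y = z" using inT sphereD(2)[OF y(1)] z(1) sub by blast
    then show False using y z s by auto
  qed
  obtain e0 :: "real ^ 'n" where e0: "norm e0 = 1" using pt by blast
  \<comment> \<open>A thickness for which \<open>1 + t\<close> and \<open>s * (1 - t)\<close> both
    lie strictly between 1 and \<open>s\<close>, and both ends stay within the collars.\<close>
  define t where "t = min (\<eta> / 2) (min (1 / 2) ((s - 1) / (2 * s)))"
  have t: "0 < t" "t < \<eta>" "t < 1" "1 + t < s" "s * (1 - t) > 1"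
  proof -
    show "0 < t" using e s by (auto simp: t_def)
    have "t \<le> \<eta> / 2" "t \<le> 1 / 2" by (auto simp: t_def)
    then show "t < \<eta>" "t < 1" using e by linarith+
    have ts: "t \<le> (s - 1) / (2 * s)" by (simp add: t_def)
    have "(s - 1) / (2 * s) < (s - 1) / 1" using s by (intro divide_strict_left_mono) auto
    then show "1 + t < s" using ts by simp
    have "s * t \<le> s * ((s - 1) / (2 * s))" using s ts by (intro mult_left_mono) auto
    also have "\<dots> = (s - 1) / 2" using s by simp
    finally show "s * (1 - t) > 1" using s by (simp add: algebra_simps)
  qed
  have IB: "I \<subseteq> B"
  proof (rule connected_in_open_cover[OF cI open_B open_A])
    let ?p = "(1 + t) *\<^sub>R e0"
    have n: "norm ?p = 1 + t" using e0 t by simp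
    show "T ?p \<in> I" using n t by (auto simp: I_def)
    have "T ?p = E ?p" using n t by (intro ends1) auto
    moreover have "E ?p \<in> B" using E_outer n t e by auto
    ultimately show "T ?p \<in> B" by simp
    show "I \<subseteq> B \<union> A" using IS cover by blast
  qed (use AB in auto)
  have IA: "I \<subseteq> scaled L A"
  proof (rule connected_in_open_cover[OF cI, of _ "scaled L B"])
    let ?p = "(1 - t) *\<^sub>R e0"
    have n: "norm ?p = 1 - t" using e0 t by simp
    have nL: "norm (s *\<^sub>R ?p) = s * (1 - t)" using e0 t s by (simp add: abs_mult)
    have "s * (1 - t) < s" using s t by simp
    then show "T (s *\<^sub>R ?p) \<in> I" using nL t unfolding I_def by (intro imageI) simp
    have "T (s *\<^sub>R ?p) = L *\<^sub>R E ?p" using n t by (intro ends1) auto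
    moreover have "E ?p \<in> A" using E_inner n t e by auto
    ultimately show "T (s *\<^sub>R ?p) \<in> scaled L A" using L by (simp add: scaled_def)
    show "open (scaled L A)" "open (scaled L B)" using open_scaled open_A open_B L by auto
    show "scaled L A \<inter> scaled L B = {}" using AB by (auto simp: scaled_def)
    show "I \<subseteq> scaled L A \<union> scaled L B" using IS' cover unfolding scaled_def by blast
  qed
  define X where "X = I \<union> - B \<union> - scaled L A"
  \<comment> \<open>Passing to the closed annulus adds only \<open>S\<close> and its dilate, which
    already lie in the complement of the region; this shows that \<open>X\<close> is closed.\<close>
  have X_alt: "X = T ` {y. 1 \<le> norm y \<and> norm y \<le> s} \<union> - B \<union> - scaled L A"
  proof -
    have "T y \<in> I \<union> - B \<union> - scaled L A" if y: "1 \<le> norm y" "norm y \<le> s" for y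
    proof -
      consider "y \<in> ann 1 s" | "norm y = 1" | "norm y = s" using y by fastforce
      then show ?thesis
      proof cases
        case 1
        then show ?thesis by (simp add: I_def)
      next
        case 2
        then have "T y \<in> S" using ends1(1)[OF sphereD(3)[OF 2]] by simp
        then show ?thesis using B_sphere by blast
      next
        case 3
        define u where "u = (1 / s) *\<^sub>R y"
        have u: "norm u = 1" "s *\<^sub>R u = y" using 3 s by (auto simp: u_def)
        then have "(1 / L) *\<^sub>R T y = E u" using ends1(2)[OF sphereD(3)[OF u(1)]] L by simp
        then have "(1 / L) *\<^sub>R T y \<in> S" using u(1) by simp
        then have "T y \<notin> scaled L A" unfolding scaled_def using A_sphere by blast
        then show ?thesis by blast
      qed
    qed
    then have "T ` {y. 1 \<le> norm y \<and> norm y \<le> s} \<subseteq> I \<union> - B \<union> - scaled L A" by blast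
    moreover have "I \<subseteq> T ` {y. 1 \<le> norm y \<and> norm y \<le> s}" by (auto simp: I_def)
    ultimately show ?thesis unfolding X_def by blast
  qed
  have "closed X" unfolding X_alt
  proof (intro closed_Un)
    have "compact (T ` {y. 1 \<le> norm y \<and> norm y \<le> s})"
    proof (rule compact_continuous_image[OF _ compact_closed_annulus])
      have LL: "s < s * (1 + \<eta>)" using s e by simp
      have "y \<in> ?D" if "1 \<le> norm y" "norm y \<le> s" for y :: "real ^ 'n"
        unfolding ann_iff using that LL e by linarith
      then show "continuous_on {y. 1 \<le> norm y \<and> norm y \<le> s} T"
        by (intro continuous_on_subset[OF embD(5)[OF T']]) blast
    qed
    then show "closed (T ` {y. 1 \<le> norm y \<and> norm y \<le> s})" by (rule compact_imp_closed)
  qed (use open_B open_scaled[OF _ open_A] L in auto)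
  moreover have "open X"
    unfolding open_subopen[of X]
  proof
    fix x assume x: "x \<in> X"
    have oI: "open I" unfolding I_def by (rule emb_image_open[OF T' open_ann sub])
    consider "x \<in> I" | "x \<in> A" | "x \<in> S" | "x \<in> scaled L B" | "(1 / L) *\<^sub>R x \<in> S"
      using x cover unfolding X_def scaled_def by blast
    then show "\<exists>W. open W \<and> x \<in> W \<and> W \<subseteq> X"
    proof cases
      case 1
      then show ?thesis using oI by (auto simp: X_def intro!: exI[of _ I])
    next
      case 2
      then show ?thesis using open_A AB by (auto simp: X_def intro!: exI[of _ A])
    next
      \<comment> \<open>Near a point of \<open>S\<close> the collar supplies a neighbourhood: its
        inner half lies in \<open>A\<close>, its outer half in the image of \<open>T\<close>. At the
        dilate of \<open>S\<close> the halves exchange their roles.\<close>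
      case 3
      then obtain y where y: "norm y = 1" "x = E y" by auto
      let ?N = "ann (1 - t) (1 + t) :: (real ^ 'n) set"
      have "E ` ?N \<subseteq> X"
      proof (rule image_subsetI)
        fix z assume z: "z \<in> ?N"
        consider "norm z < 1" | "norm z = 1" | "norm z > 1" by linarith
        then show "E z \<in> X"
        proof cases
          case 1
          then have "E z \<in> A" using E_inner z t e by auto
          then show ?thesis using AB by (auto simp: X_def)
        next
          case 2
          then have "E z \<in> S" by simp
          then show ?thesis using B_sphere by (auto simp: X_def)
        next
          case 3
          then have "z \<in> ann 1 s" using z t by auto
          moreover have "T z = E z" using z t by (intro ends1) auto
          ultimately have "E z \<in> I" unfolding I_def by (metis imageI)
          then show ?thesis by (simp add: X_def)
        qed
      qed
      moreover have "open (E ` ?N)" by (rule emb_image_open[OF emb_E]) (use t e in auto)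
      moreover have "x \<in> E ` ?N" using y t by auto
      ultimately show ?thesis by blast
    next
      case 4
      moreover have "open (scaled L B)" using open_scaled open_B L by simp
      moreover have "scaled L B \<subseteq> X" using AB by (auto simp: X_def scaled_def)
      ultimately show ?thesis by blast
    next
      case 5
      then obtain y where y: "norm y = 1" "(1 / L) *\<^sub>R x = E y" by auto
      let ?N = "ann (1 - t) (1 + t) :: (real ^ 'n) set"
      have "E ` ?N \<subseteq> {w. L *\<^sub>R w \<in> X}"
      proof (rule image_subsetI)
        fix z assume z: "z \<in> ?N"
        have TLz: "T (s *\<^sub>R z) = L *\<^sub>R E z" using z t by (intro ends1) auto
        consider "norm z < 1" | "norm z = 1" | "norm z > 1" by linarith
        then show "E z \<in> {w. L *\<^sub>R w \<in> X}"
        proof cases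
          case 1
          have "s * (1 - t) < s * norm z" using z s by simp
          then have "1 < s * norm z" using t by linarith
          then have "s *\<^sub>R z \<in> ann 1 s" using 1 s by simp
          then have "L *\<^sub>R E z \<in> I" unfolding I_def using TLz by (metis imageI)
          then show ?thesis by (simp add: X_def)
        next
          case 2
          then have "E z \<notin> A" using A_sphere by auto
          then show ?thesis using L by (simp add: X_def scaled_def)
        next
          case 3
          then have "E z \<in> B" using E_outer z t e by auto
          then have "E z \<notin> A" using AB by blast
          then show ?thesis using L by (simp add: X_def scaled_def)
        qed
      qed
      then have "scaled L (E ` ?N) \<subseteq> X"
      proof -
        assume a: "E ` ?N \<subseteq> {w. L *\<^sub>R w \<in> X}"
        show ?thesis
        proof
          fix w assume "w \<in> scaled L (E ` ?N)"
          then have "(1 / L) *\<^sub>R w \<in> E ` ?N" by (simp only: scaled_def mem_Collect_eq)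
          then have "(1 / L) *\<^sub>R w \<in> {w. L *\<^sub>R w \<in> X}" using a by blast
          then show "w \<in> X" using L by simp
        qed
      qed
      moreover have "open (scaled L (E ` ?N))"
        by (rule open_scaled[OF _ emb_image_open[OF emb_E]]) (use t e L in auto)
      moreover have "x \<in> scaled L (E ` ?N)"
      proof -
        have "y \<in> ?N" using y(1) t(1) by simp
        then show ?thesis unfolding scaled_def mem_Collect_eq y(2) by blast
      qed
      ultimately show ?thesis by blast
    qed
  qed
  moreover have "0 \<in> X" using zero_notin_B by (simp add: X_def)
  ultimately have "X = UNIV" using clopen[of X] by blast
  then have "B \<inter> scaled L A \<subseteq> I" by (auto simp: X_def)
  then show ?thesis using IB IA unfolding I_def L_def by blast
qed

end

context deck
begin

text \<open>The regions between the sphere and its translates by \<open>c ^ k\<close> and by \<open>c ^ (k + 1)\<close> are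
  both products, hence so is the region between the sphere and its translate by \<open>c\<close>.\<close>

lemma fundamental_region:
  obtains s \<eta> T where "s > 1" "0 < \<eta>" "\<eta> \<le> \<epsilon>" "emb (ann (1 - \<eta>) (s * (1 + \<eta>))) T"
    "\<And>y. y \<in> ann (1 - \<eta>) (1 + \<eta>) \<Longrightarrow> T y = E y \<and> T (s *\<^sub>R y) = c *\<^sub>R E y"
proof -
  obtain L0 where L0: "L0 > 1" "\<And>L. L \<ge> L0 \<Longrightarrow> \<exists>\<eta> \<Theta>. 0 < \<eta> \<and> \<eta> \<le> \<epsilon> \<and> emb (ann (1 - \<eta>) (L * (1 + \<eta>))) \<Theta> \<and>
    (\<forall>y\<in>ann (1 - \<eta>) (1 + \<eta>). \<Theta> y = E y \<and> \<Theta> (L *\<^sub>R y) = L *\<^sub>R E y)"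
    by (rule swindle) blast
  obtain k where k: "c ^ k > L0" using real_arch_pow[OF c1] by blast
  have k0: "k > 0" using k L0(1) by (cases k) auto
  define L1 where "L1 = c ^ k"
  define L2 where "L2 = c ^ Suc k"
  have L12: "L2 = c * L1" by (simp add: L1_def L2_def)
  have L1: "L1 > 1" using k L0(1) by (simp add: L1_def)
  have L2: "L2 > c" "L2 > 1" "L2 \<ge> L0"
  proof -
    have "c * 1 < c * L1" using c1 L1 by (intro mult_strict_left_mono) auto
    then show "L2 > c" by (simp add: L12)
    then show "L2 > 1" using c1 by simp
    have "1 * L1 \<le> c * L1" using c1 L1 by (intro mult_right_mono) auto
    then show "L2 \<ge> L0" using k by (simp add: L12 L1_def)
  qed
  obtain \<eta>1 T1 where T1: "0 < \<eta>1" "\<eta>1 \<le> \<epsilon>" "emb (ann (1 - \<eta>1) (L1 * (1 + \<eta>1))) T1"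
    "\<And>y. y \<in> ann (1 - \<eta>1) (1 + \<eta>1) \<Longrightarrow> T1 y = E y \<and> T1 (L1 *\<^sub>R y) = L1 *\<^sub>R E y"
    using L0(2)[of L1] k unfolding L1_def by fastforce
  obtain \<eta>2 T2 where T2: "0 < \<eta>2" "\<eta>2 \<le> \<epsilon>" "emb (ann (1 - \<eta>2) (L2 * (1 + \<eta>2))) T2"
    "\<And>y. y \<in> ann (1 - \<eta>2) (1 + \<eta>2) \<Longrightarrow> T2 y = E y \<and> T2 (L2 *\<^sub>R y) = L2 *\<^sub>R E y"
    using L0(2)[OF L2(3)] by fastforce
  define \<eta> where "\<eta> = min \<eta>1 \<eta>2"
  have eta: "0 < \<eta>" "\<eta> \<le> \<eta>1" "\<eta> \<le> \<eta>2" "\<eta> \<le> \<epsilon>" using T1 T2 by (auto simp: \<eta>_def)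
  have im1: "T1 ` ann 1 L1 = B \<inter> scaled L1 A" unfolding L1_def
    by (rule image_between[OF k0 _ T1(1,2)]) (use T1(3,4) L1 in \<open>auto simp: L1_def\<close>)
  have im2: "T2 ` ann 1 L2 = B \<inter> scaled L2 A" unfolding L2_def
    by (rule image_between[OF zero_less_Suc _ T2(1,2)]) (use T2(3,4) L2 in \<open>auto simp: L2_def\<close>)
  \<comment> \<open>The region between \<open>S\<close> and \<open>L2\<close> times
    \<open>S\<close>, which \<open>T2\<close> parametrises.\<close>
  define W where "W = B \<inter> scaled L2 A"
  have oW: "open W" unfolding W_def using open_B open_scaled[OF _ open_A] L2 by (intro open_Int) auto
  have cS_W: "c *\<^sub>R y \<in> W" if "y \<in> S" for y
  proof -
    have "c ^ 1 *\<^sub>R y \<in> B" by (rule translate_S_in_B[OF _ that]) simp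
    moreover have "y \<in> scaled L1 A" unfolding L1_def using A_S_in_scaled_A[OF k0] that by blast
    then have "c *\<^sub>R y \<in> scaled L2 A" using c1 by (simp add: scaled_def L12)
    ultimately show ?thesis by (simp add: W_def)
  qed
  have cIm_W: "c *\<^sub>R T1 y \<in> W" if "y \<in> ann 1 L1" for y
  proof -
    have y: "T1 y \<in> B" "T1 y \<in> scaled L1 A" using im1 that by blast+
    then have "c *\<^sub>R T1 y \<in> scaled L2 A" using c1 by (simp add: scaled_def L12)
    moreover have "c *\<^sub>R T1 y \<in> B" using scaled_B_S_in_B[of 1 "c *\<^sub>R T1 y"] y(1) c1 by simp
    ultimately show ?thesis by (simp add: W_def)
  qed
  \<comment> \<open>A whole collar of \<open>c\<close> times \<open>S\<close>, not only its outer
    half, lies in the region \<open>W\<close>; the slack on the inner side is where the cancellation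
    takes place.\<close>
  obtain \<delta> where \<delta>: "0 < \<delta>" "\<delta> \<le> \<eta>" "\<And>y. y \<in> ann (1 - \<delta>) (1 + \<delta>) \<Longrightarrow> c *\<^sub>R E y \<in> W"
  proof -
    define C where "C = {y. 1 - \<eta> / 2 \<le> norm y \<and> norm y \<le> 1 + \<eta> / 2} \<inter> (\<lambda>y. c *\<^sub>R E y) -` (- W)"
    have "continuous_on {y. 1 - \<eta> / 2 \<le> norm y \<and> norm y \<le> 1 + \<eta> / 2} (\<lambda>y. c *\<^sub>R E y)"
      by (intro continuous_intros continuous_on_subset[OF embD(5)[OF emb_E]]) (use eta in auto)
    then have "closed C" unfolding C_def
      by (rule continuous_closed_preimage[OF _ compact_imp_closed[OF compact_closed_annulus]]) (use oW in auto)
    then have "compact ({y. 1 - \<eta> / 2 \<le> norm y \<and> norm y \<le> 1 + \<eta> / 2} \<inter> C)"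
      by (rule compact_Int_closed[OF compact_closed_annulus])
    then have "compact C" by (simp add: C_def Int_absorb1 inf.left_idem)
    moreover have "norm y \<noteq> 1" if "y \<in> C" for y
      using that cS_W[of "E y"] by (auto simp: C_def)
    ultimately obtain d where d: "d > 0" "\<And>y. \<bar>norm y - 1\<bar> < d \<Longrightarrow> y \<notin> C" using avoid_sphere by metis
    show ?thesis
    proof (rule that[of "min d (\<eta> / 2)"])
      show "0 < min d (\<eta> / 2)" "min d (\<eta> / 2) \<le> \<eta>" using d(1) eta by auto
      fix y :: "real ^ 'n" assume y: "y \<in> ann (1 - min d (\<eta> / 2)) (1 + min d (\<eta> / 2))"
      then have "\<bar>norm y - 1\<bar> < d" "1 - \<eta> / 2 \<le> norm y" "norm y \<le> 1 + \<eta> / 2" by auto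
      then show "c *\<^sub>R E y \<in> W" using d(2)[of y] by (auto simp: C_def)
    qed
  qed
  define DA :: "(real ^ 'n) set" where "DA = ann (c * (1 - \<delta>)) L2"
  have \<delta>1: "\<delta> < 1" using \<delta>(2) eta eps by linarith
  have cd: "c * (1 - \<delta>) > 0" "c * (1 - \<delta>) < c" using c1 \<delta>(1) \<delta>1 by auto
  \<comment> \<open>The region between the translates of \<open>S\<close> by \<open>c\<close> and by
    \<open>c ^ (k + 1)\<close>, parametrised through \<open>T1\<close>, with a bit of collar on the
    inside.\<close>
  define P where "P = (\<lambda>y. c *\<^sub>R T1 ((1 / c) *\<^sub>R y))"
  have DA_scale: "(1 / c) *\<^sub>R y \<in> ann (1 - \<delta>) L1" if "y \<in> DA" for y
    using that c1 by (simp add: DA_def L12 field_simps)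
  have L1e: "ann (1 - \<delta>) L1 \<subseteq> (ann (1 - \<eta>1) (L1 * (1 + \<eta>1)) :: (real ^ 'n) set)"
  proof
    fix y :: "real ^ 'n" assume y: "y \<in> ann (1 - \<delta>) L1"
    have "L1 * 1 < L1 * (1 + \<eta>1)" using L1 T1(1) by (intro mult_strict_left_mono) auto
    then show "y \<in> ann (1 - \<eta>1) (L1 * (1 + \<eta>1))" using y \<delta>(2) eta(2) unfolding ann_iff by linarith
  qed
  have embP: "emb DA P" unfolding P_def
  proof (rule emb_compose[OF emb_compose[OF emb_subset[OF emb_scaleR] T1(3)] emb_scaleR])
    show "(\<lambda>y. (1 / c) *\<^sub>R y) ` DA \<subseteq> ann (1 - \<eta>1) (L1 * (1 + \<eta>1))" using DA_scale L1e by blast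
  qed (use c1 in \<open>auto simp: DA_def\<close>)
  have PW: "P y \<in> W" if y: "y \<in> DA" for y
  proof -
    let ?u = "(1 / c) *\<^sub>R y"
    have u: "?u \<in> ann (1 - \<delta>) L1" by (rule DA_scale[OF y])
    show ?thesis
    proof (cases "norm ?u > 1")
      case True
      then have "?u \<in> ann 1 L1" using u by simp
      then show ?thesis unfolding P_def by (rule cIm_W)
    next
      case False
      then have 1: "?u \<in> ann (1 - \<delta>) (1 + \<delta>)" using u \<delta>(1) unfolding ann_iff by linarith
      then have "?u \<in> ann (1 - \<eta>1) (1 + \<eta>1)" using \<delta>(2) eta(2) unfolding ann_iff by linarith
      then have "T1 ?u = E ?u" using T1(4) by blast
      then show ?thesis using \<delta>(3)[OF 1] by (simp add: P_def)
    qed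
  qed
  have D2sub: "ann 1 L2 \<subseteq> (ann (1 - \<eta>2) (L2 * (1 + \<eta>2)) :: (real ^ 'n) set)"
  proof
    fix y :: "real ^ 'n" assume y: "y \<in> ann 1 L2"
    have "L2 * 1 < L2 * (1 + \<eta>2)" using L2 T2(1) by (intro mult_strict_left_mono) auto
    then show "y \<in> ann (1 - \<eta>2) (L2 * (1 + \<eta>2))" using y T2(1) unfolding ann_iff by linarith
  qed
  have embT2: "emb (ann 1 L2) T2" by (rule emb_subset[OF T2(3) open_ann D2sub])
  \<comment> \<open>In the coordinates given by \<open>T2\<close> this becomes an embedding of a
    round annulus into a larger one with the same outer boundary.\<close>
  define G where "G = (\<lambda>y. inv_into (ann 1 L2) T2 (P y))"
  have PI: "P y \<in> T2 ` ann 1 L2" if "y \<in> DA" for y using PW[OF that] im2 by (simp add: W_def)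
  have G_ann: "G y \<in> ann 1 L2" if "y \<in> DA" for y unfolding G_def by (rule inv_into_into[OF PI[OF that]])
  have TG: "T2 (G y) = P y" if "y \<in> DA" for y unfolding G_def by (rule f_inv_into_f[OF PI[OF that]])
  have embG: "emb DA G" unfolding G_def
    by (rule emb_compose[OF embP emb_inverse[OF embT2]]) (use PI in blast)
  \<comment> \<open>Near the outer boundary \<open>T1\<close> and \<open>T2\<close> are both given
    by dilates of \<open>E\<close>, so the two parametrisations agree there.\<close>
  have G_top: "G y = y" if y: "L2 * (1 - \<eta>) < norm y" "y \<in> DA" "1 < norm y" for y
  proof -
    define u where "u = (1 / L2) *\<^sub>R y"
    have yu: "y = L2 *\<^sub>R u" using L2 by (simp add: u_def)
    have nu: "norm y = L2 * norm u" using L2 by (simp add: yu)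
    have "L2 * (1 - \<eta>) < L2 * norm u" "L2 * norm u < L2 * 1" using y nu by (auto simp: DA_def)
    then have "1 - \<eta> < norm u" "norm u < 1" using L2 by (auto simp del: mult_1_right simp: mult_less_cancel_left_pos)
    then have u1: "u \<in> ann (1 - \<eta>1) (1 + \<eta>1)" and u2: "u \<in> ann (1 - \<eta>2) (1 + \<eta>2)"
      using eta unfolding ann_iff by linarith+
    have "(1 / c) *\<^sub>R y = L1 *\<^sub>R u" using c1 by (simp add: yu L12)
    then have "P y = c *\<^sub>R (L1 *\<^sub>R E u)" using T1(4)[OF u1] by (simp add: P_def)
    also have "\<dots> = T2 y" using T2(4)[OF u2] by (simp add: yu L12)
    finally have "T2 (G y) = T2 y" using TG[OF y(2)] by simp
    then show ?thesis
      using inj_onD[OF embD(3)[OF embT2] _ G_ann[OF y(2)], of y] y by (auto simp: DA_def)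
  qed
  \<comment> \<open>Close enough to \<open>L2\<close> for \<open>G\<close> to be the identity around
    radius \<open>s\<close>, and larger than \<open>c\<close>.\<close>
  define s where "s = max (L2 * (1 - \<eta> / 2)) ((c + L2) / 2)"
  have s: "s > c" "s < L2" "s > L2 * (1 - \<eta>)" "s > 1"
  proof -
    have "c < (c + L2) / 2" using L2(1) by simp
    also have "\<dots> \<le> s" by (simp add: s_def)
    finally show "s > c" .
    then show "s > 1" using c1 by linarith
    have "L2 * (1 - \<eta> / 2) < L2" using L2 eta(1) by simp
    then show "s < L2" using L2(1) by (simp add: s_def)
    have "L2 * (1 - \<eta>) < L2 * (1 - \<eta> / 2)" using L2 eta(1) by simp
    then show "s > L2 * (1 - \<eta>)" by (simp add: s_def)
  qed
  define s1 where "s1 = (s + L2) / 2"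
  have s1: "s < s1" "s1 < L2" using s by (auto simp: s1_def)
  define p where "p = c * (1 - \<delta> / 2)"
  define q where "q = s * (1 - \<delta> / 16)"
  have pc: "c * (1 - \<delta>) < p" "0 < p" using c1 \<delta>(1) \<delta>1 by (auto simp: p_def)
  \<comment> \<open>A radial push from radius \<open>s\<close> down to radius \<open>c\<close>: the
    identity below \<open>p\<close>, multiplication by \<open>c / s\<close> above
    \<open>q\<close>.\<close>
  obtain \<rho> where \<rho>: "radial \<rho>" "\<And>t. t \<le> p \<Longrightarrow> \<rho> t = 1 * t" "\<And>t. t \<ge> q \<Longrightarrow> \<rho> t = c / s * t"
  proof (rule radial_down[OF radial_mult[of 1], of p "c * (1 - \<delta> / 4)" "s * (1 - \<delta> / 8)" q "c / s" 1])
    show "p < c * (1 - \<delta> / 4)" using c1 \<delta>(1) by (simp add: p_def)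
    have "c * (1 - \<delta> / 4) < c * (1 - \<delta> / 8)" using c1 \<delta>(1) by simp
    also have "\<dots> < s * (1 - \<delta> / 8)" using s \<delta>1 by simp
    finally show "c * (1 - \<delta> / 4) < s * (1 - \<delta> / 8)" .
    show "s * (1 - \<delta> / 8) < q" using s \<delta>(1) by (simp add: q_def)
    show "1 * (c * (1 - \<delta> / 4)) < c / s * (s * (1 - \<delta> / 8))" using s c1 \<delta>(1) by simp
  qed (use pc s c1 in \<open>auto intro: that\<close>)
  define K where "K = (\<lambda>y :: real ^ 'n. (((1 - 0) * \<rho> (norm y) + 0 * \<rho> (norm y)) / norm y) *\<^sub>R y)"
  have embK: "emb (- {0}) K" unfolding K_def
    by (rule emb_radial(1)[OF \<rho>(1) \<rho>(1), of "\<lambda>y. 0"]) (auto intro: smooth_intros)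
  have normK: "norm (K y) = \<rho> (norm y)" if "y \<noteq> 0" for y
  proof -
    have "\<rho> (norm y) > 0" using \<rho>(1) that unfolding radial_def by simp
    then show ?thesis using that by (simp add: K_def)
  qed
  have K_low: "K y = y" if "norm y \<le> p" for y
    using \<rho>(2)[OF that] by (cases "y = 0") (auto simp: K_def)
  have K_high: "K y = (c / s) *\<^sub>R y" if "norm y \<ge> q" for y
    using \<rho>(3)[OF that] by (cases "y = 0") (auto simp: K_def)
  \<comment> \<open>The radii at which the push may differ from the identity, with an outer
    margin.\<close>
  define C where "C = {y :: real ^ 'n. p \<le> norm y \<and> norm y \<le> s1}"
  have C_DA: "C \<subseteq> DA" using pc s1 by (auto simp: C_def DA_def)
  have cGC: "compact (G ` C)"
    unfolding C_def by (rule compact_continuous_image[OF _ compact_closed_annulus])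
      (use embD(5)[OF embG] C_DA in \<open>auto simp: C_def intro: continuous_on_subset\<close>)
  obtain d where d: "d > 0" "\<And>y. \<bar>norm y - 1\<bar> < d \<Longrightarrow> y \<notin> G ` C"
    using avoid_sphere[OF cGC, of 1] G_ann C_DA by (metis (no_types, lifting) ann_iff image_iff less_irrefl subsetD)
  \<comment> \<open>The final collar must avoid the image of \<open>C\<close> at its inner end. At
    the outer end, radii above \<open>s * (1 - \<theta>)\<close> must lie where \<open>G\<close> is
    the identity and the push is scaling by \<open>c / s\<close>, and
    \<open>s * (1 + \<theta>)\<close> must not exceed \<open>s1\<close>.\<close>
  define \<theta> where "\<theta> = min (min d (\<delta> / 16)) (min ((s1 - s) / s) (min ((s - L2 * (1 - \<eta>)) / s) ((s - c) / s)))"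
  have th: "0 < \<theta>" "\<theta> \<le> d" "\<theta> \<le> \<delta> / 16" "s * (1 + \<theta>) \<le> s1" "L2 * (1 - \<eta>) \<le> s * (1 - \<theta>)" "c \<le> s * (1 - \<theta>)"
  proof -
    show "0 < \<theta>" using d(1) \<delta>(1) s s1 by (auto simp: \<theta>_def)
    show "\<theta> \<le> d" "\<theta> \<le> \<delta> / 16" by (simp_all only: \<theta>_def min_le_iff_disj order_refl simp_thms)
    have "\<theta> \<le> (s1 - s) / s" "\<theta> \<le> (s - L2 * (1 - \<eta>)) / s" "\<theta> \<le> (s - c) / s"
      by (simp_all only: \<theta>_def min_le_iff_disj order_refl simp_thms)
    then have "\<theta> * s \<le> s1 - s" "\<theta> * s \<le> s - L2 * (1 - \<eta>)" "\<theta> * s \<le> s - c"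
      using s by (simp_all add: pos_le_divide_eq)
    then show "s * (1 + \<theta>) \<le> s1" "L2 * (1 - \<eta>) \<le> s * (1 - \<theta>)" "c \<le> s * (1 - \<theta>)" by (simp_all add: algebra_simps)
  qed
  have th1: "\<theta> < 1" using th(3) \<delta>1 by linarith
  have qs: "q \<le> s * (1 - \<theta>)" using s th(3) by (simp add: q_def)
  define DG :: "(real ^ 'n) set" where "DG = ann (c * (1 - \<delta>)) (s * (1 + \<theta>))"
  define Z :: "(real ^ 'n) set" where "Z = ann (1 - \<theta>) (s * (1 + \<theta>))"
  have sth: "s < s * (1 + \<theta>)" "s * (1 + \<theta>) < L2" using s th(1,4) s1 by auto
  have DG_DA: "DG \<subseteq> DA" using sth by (auto simp: DG_def DA_def)
  have DG0: "y \<noteq> 0" if "y \<in> DG" for y using that cd by (auto simp: DG_def)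
  have K_DG: "K y \<in> DG" if y: "y \<in> DG" for y
  proof -
    have y0: "y \<noteq> 0" "norm y > 0" using DG0[OF y] by auto
    have "\<rho> (c * (1 - \<delta>)) < \<rho> (norm y)" using y cd by (intro radial_strict_mono[OF \<rho>(1)]) (auto simp: DG_def)
    moreover have "\<rho> (c * (1 - \<delta>)) = c * (1 - \<delta>)" using \<rho>(2) pc by simp
    moreover have "\<rho> (norm y) < \<rho> (s * (1 + \<theta>))" using y y0 by (intro radial_strict_mono[OF \<rho>(1)]) (auto simp: DG_def)
    moreover have "\<rho> (s * (1 + \<theta>)) = c * (1 + \<theta>)"
    proof -
      have "q \<le> s" using s \<delta>(1) by (simp add: q_def)
      then show ?thesis using \<rho>(3)[of "s * (1 + \<theta>)"] sth s by simp
    qed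
    moreover have "c * (1 + \<theta>) < s * (1 + \<theta>)" using s th(1) by simp
    ultimately show ?thesis unfolding DG_def ann_iff normK[OF y0(1)] by linarith
  qed
  have embGD: "emb DG G" by (rule emb_subset[OF embG _ DG_DA]) (simp add: DG_def)
  have injG: "x = y" if "G x = G y" "x \<in> DA" "y \<in> DA" for x y
    using inj_onD[OF embD(3)[OF embG]] that by blast
  have injK: "x = y" if "K x = K y" "x \<noteq> 0" "y \<noteq> 0" for x y
    using inj_onD[OF embD(3)[OF embK] that(1)] that by auto
  define I where "I = inv_into DG G"
  have I: "I (G y) = y" if "y \<in> DG" for y using embD(3)[OF embGD] that by (simp add: I_def)
  \<comment> \<open>The radial push transported by \<open>G\<close> and extended inwards by the
    identity. It carries the round sphere of radius \<open>s\<close> to the \<open>G\<close>-image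
    of the sphere of radius \<open>c\<close>; \<open>T2\<close> sends that to the translate of
    \<open>S\<close> by \<open>c\<close>, because \<open>T2\<close> cancels the inverse inside
    \<open>G\<close>.\<close>
  define H where "H = (\<lambda>z. if z \<in> G ` DG then G (K (I z)) else z)"
  have H_in: "H z \<in> ann (1 - \<eta>2) (L2 * (1 + \<eta>2))" if z: "z \<in> Z" for z
  proof (cases "z \<in> G ` DG")
    case True
    then obtain y where y: "y \<in> DG" "z = G y" by blast
    then have "H z = G (K y)" using I by (simp add: H_def)
    moreover have "G (K y) \<in> ann 1 L2" using G_ann K_DG[OF y(1)] DG_DA by blast
    ultimately show ?thesis using D2sub by auto
  next
    case False
    have "L2 < L2 * (1 + \<eta>2)" using L2 T2(1) by simp
    moreover have "\<theta> \<le> \<eta>2" using th(1,3) \<delta>(1,2) eta(3) by linarith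
    ultimately show ?thesis using False z sth by (simp add: H_def Z_def)
  qed
  have embH: "emb Z H"
  proof (rule emb_localI)
    show "open Z" by (simp add: Z_def)
    show "inj_on H Z"
    proof (rule inj_onI)
      fix z w assume z: "z \<in> Z" and w: "w \<in> Z" and eq: "H z = H w"
      have HG: "H z \<in> G ` DG \<longleftrightarrow> z \<in> G ` DG" for z using K_DG I by (auto simp: H_def)
      show "z = w"
      proof (cases "z \<in> G ` DG")
        case True
        then have "w \<in> G ` DG" using HG[of z] HG[of w] eq by simp
        with True obtain x y where x: "x \<in> DG" "z = G x" and y: "y \<in> DG" "w = G y" by blast
        then have "G (K x) = G (K y)" using eq I by (simp add: H_def)
        then have "K x = K y" using injG K_DG x y DG_DA by blast
        then show ?thesis using injK DG0 x y by blast
      next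
        case False
        then have "w \<notin> G ` DG" using HG[of z] HG[of w] eq by simp
        then show ?thesis using eq False by (simp add: H_def)
      qed
    qed
    fix z assume z: "z \<in> Z"
    show "\<exists>V g. z \<in> V \<and> emb V g \<and> (\<forall>y\<in>V. H y = g y)"
    proof (cases "z \<in> G ` DG")
      case True
      have "emb (G ` DG) (\<lambda>z. G (K (I z)))"
      proof (rule emb_compose[OF emb_compose[OF _ embK] embGD])
        show "emb (G ` DG) I" unfolding I_def by (rule emb_inverse[OF embGD])
        show "I ` (G ` DG) \<subseteq> - {0}" using I DG0 by auto
        show "(\<lambda>x. K (I x)) ` (G ` DG) \<subseteq> DG" using I K_DG by auto
      qed
      then show ?thesis using True
        by (intro exI[of _ "G ` DG"] exI[of _ "\<lambda>z. G (K (I z))"]) (auto simp: H_def)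
    next
      case False
      define V where "V = Z - G ` C"
      have "open V" unfolding V_def using cGC by (intro open_Diff compact_imp_closed) (auto simp: Z_def)
      then have "emb V (\<lambda>z. z)" by (rule emb_id)
      moreover have "H w = w" if w: "w \<in> V" for w
      proof (cases "w \<in> G ` DG")
        case True
        then obtain y where y: "y \<in> DG" "w = G y" by blast
        then have "y \<notin> C" using w by (auto simp: V_def)
        moreover have "norm y \<le> s1" using y(1) th(4) by (simp add: DG_def)
        ultimately have "norm y \<le> p" by (simp add: C_def)
        then show ?thesis using y I K_low by (simp add: H_def)
      qed (simp add: H_def)
      moreover have "z \<in> V"
      proof -
        have "z \<notin> G ` C"
        proof
          assume "z \<in> G ` C"
          then obtain y where y: "y \<in> C" "z = G y" by blast
          have yDA: "y \<in> DA" using y C_DA by blast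
          have "\<not> norm y < s * (1 + \<theta>)" using y False pc by (auto simp: C_def DG_def)
          then have n: "norm y \<ge> s * (1 + \<theta>)" by simp
          then have "L2 * (1 - \<eta>) < norm y" "1 < norm y" using sth s by linarith+
          then have "G y = y" using G_top yDA by blast
          then show False using z y n by (simp add: Z_def)
        qed
        then show ?thesis using z by (simp add: V_def)
      qed
      ultimately show ?thesis by (intro exI[of _ V] exI[of _ "\<lambda>z. z"]) auto
    qed
  qed
  define T where "T = (\<lambda>z. T2 (H z))"
  have "emb Z T" unfolding T_def by (rule emb_compose[OF embH T2(3)]) (use H_in in blast)
  moreover have "T y = E y \<and> T (s *\<^sub>R y) = c *\<^sub>R E y" if y: "y \<in> ann (1 - \<theta>) (1 + \<theta>)" for y
  proof
    have th2: "\<theta> \<le> \<eta>" "\<theta> \<le> \<delta>" using th(1,3) \<delta>(1,2) by linarith+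
    have y1: "y \<in> ann (1 - \<eta>1) (1 + \<eta>1)" and y2: "y \<in> ann (1 - \<eta>2) (1 + \<eta>2)"
      using y th2 eta unfolding ann_iff by linarith+
    have "\<bar>norm y - 1\<bar> < d" using y th(2) unfolding ann_iff by linarith
    then have yC: "y \<notin> G ` C" by (rule d(2))
    have "H y = y"
    proof (cases "y \<in> G ` DG")
      case True
      then obtain x where x: "x \<in> DG" "y = G x" by blast
      then have "x \<notin> C" using yC by blast
      moreover have "norm x \<le> s1" using x(1) th(4) by (simp add: DG_def)
      ultimately have "norm x \<le> p" by (simp add: C_def)
      then show ?thesis using x I K_low by (simp add: H_def)
    qed (simp add: H_def)
    then show "T y = E y" using T2(4)[OF y2] by (simp add: T_def)
    define z where "z = s *\<^sub>R y"
    have nz: "norm z = s * norm y" using s by (simp add: z_def)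
    have "s * (1 - \<theta>) < s * norm y" "s * norm y < s * (1 + \<theta>)" using y s by auto
    then have z1: "s * (1 - \<theta>) < norm z" "norm z < s * (1 + \<theta>)" using nz by auto
    have "c * (1 - \<delta>) < norm z" using z1 th(6) cd by linarith
    then have zDG: "z \<in> DG" using z1 by (simp add: DG_def)
    have "G z = z"
    proof (rule G_top)
      show "L2 * (1 - \<eta>) < norm z" "1 < norm z" using z1 th(5,6) c1 by linarith+
      show "z \<in> DA" using zDG DG_DA by blast
    qed
    then have zG: "z \<in> G ` DG" "I z = z" using zDG I[OF zDG] by (metis imageI, simp)
    have "K z = (c / s) *\<^sub>R z" using z1 qs by (intro K_high) linarith
    then have "K z = c *\<^sub>R y" using s by (simp add: z_def)
    then have Hz: "H z = G (c *\<^sub>R y)" using zG by (simp add: H_def)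
    have "c *\<^sub>R y \<in> DA"
      using K_DG[OF zDG] DG_DA \<open>K z = c *\<^sub>R y\<close> by auto
    then have "T z = P (c *\<^sub>R y)" using Hz TG by (simp add: T_def)
    also have "\<dots> = c *\<^sub>R E y" using c1 T1(4)[OF y1] by (simp add: P_def)
    finally show "T (s *\<^sub>R y) = c *\<^sub>R E y" by (simp add: z_def)
  qed
  moreover have "\<theta> \<le> \<epsilon>" using th(1,3) \<delta>(1,2) eta(4) by linarith
  ultimately show ?thesis using that[of s \<theta> T] s(4) th(1) by (simp add: Z_def)
qed

end

subsection \<open>The covering of the product by a punctured space\<close>

text \<open>Two maps with the same fibres induce a bijection of their images, and local smooth
  sections make it smooth in both directions. Sections take the place of charts.\<close>

lemma quotient_diffeomorphism:
  fixes q1 q2 :: "'a::euclidean_space \<Rightarrow> 'b::euclidean_space"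
  assumes sm: "smooth_on D q1" "smooth_on D q2" and im: "q1 ` D = M" "q2 ` D = M"
    and sec1: "\<And>y. y \<in> D \<Longrightarrow> \<exists>U \<sigma>. q1 y \<in> U \<and> smooth_on U \<sigma> \<and> (\<forall>m\<in>M \<inter> U. \<sigma> m \<in> D \<and> q1 (\<sigma> m) = m)"
    and sec2: "\<And>y. y \<in> D \<Longrightarrow> \<exists>U \<sigma>. q2 y \<in> U \<and> smooth_on U \<sigma> \<and> (\<forall>m\<in>M \<inter> U. \<sigma> m \<in> D \<and> q2 (\<sigma> m) = m)"
    and ker: "\<And>x y. x \<in> D \<Longrightarrow> y \<in> D \<Longrightarrow> q1 x = q1 y \<longleftrightarrow> q2 x = q2 y"
  obtains F where "diffeomorphism_betw M M F" "\<And>y. y \<in> D \<Longrightarrow> F (q1 y) = q2 y"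
proof -
  have half: "smooth_map_on M F"
    if sm: "smooth_on D q1" "smooth_on D q2" and im: "q1 ` D = M"
      and sec: "\<And>y. y \<in> D \<Longrightarrow> \<exists>U \<sigma>. q1 y \<in> U \<and> smooth_on U \<sigma> \<and> (\<forall>m\<in>M \<inter> U. \<sigma> m \<in> D \<and> q1 (\<sigma> m) = m)"
      and F: "\<And>y. y \<in> D \<Longrightarrow> F (q1 y) = q2 y"
    for q1 q2 :: "'a \<Rightarrow> 'b" and F
    unfolding smooth_map_on_def
  proof
    fix m assume m: "m \<in> M"
    then obtain y where y: "y \<in> D" "m = q1 y" using im by blast
    obtain U \<sigma> where U: "q1 y \<in> U" "smooth_on U \<sigma>" "\<And>m. m \<in> M \<inter> U \<Longrightarrow> \<sigma> m \<in> D \<and> q1 (\<sigma> m) = m"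
      using sec[OF y(1)] by blast
    define W where "W = U \<inter> \<sigma> -` D"
    have oW: "open W" unfolding W_def
      using smooth_on_imp_continuous_on[OF U(2)] smooth_on_open[OF U(2)] smooth_on_open[OF sm(1)]
      by (rule continuous_open_preimage)
    have "smooth_on W (\<lambda>m. q2 (\<sigma> m))"
      by (rule smooth_on_compose[OF smooth_on_subset[OF U(2) oW] sm(2)]) (auto simp: W_def)
    moreover have "m \<in> W" using U(1) U(3)[of m] y m by (simp add: W_def)
    moreover have "q2 (\<sigma> m') = F m'" if "m' \<in> M \<inter> W" for m'
      using U(3)[of m'] F[of "\<sigma> m'"] that by (simp add: W_def)
    ultimately show "\<exists>U g. m \<in> U \<and> smooth_on U g \<and> (\<forall>y\<in>M \<inter> U. g y = F y)" by blast
  qed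
  define F where "F = (\<lambda>m. q2 (SOME y. y \<in> D \<and> q1 y = m))"
  define G where "G = (\<lambda>m. q1 (SOME y. y \<in> D \<and> q2 y = m))"
  have F: "F (q1 y) = q2 y" if "y \<in> D" for y
  proof -
    have "(SOME x. x \<in> D \<and> q1 x = q1 y) \<in> D \<and> q1 (SOME x. x \<in> D \<and> q1 x = q1 y) = q1 y"
      by (rule someI[of _ y]) (use that in simp)
    then show ?thesis using ker that unfolding F_def by blast
  qed
  have G: "G (q2 y) = q1 y" if "y \<in> D" for y
  proof -
    have "(SOME x. x \<in> D \<and> q2 x = q2 y) \<in> D \<and> q2 (SOME x. x \<in> D \<and> q2 x = q2 y) = q2 y"
      by (rule someI[of _ y]) (use that in simp)
    then show ?thesis using ker that unfolding G_def by blast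
  qed
  have "smooth_map_on M F" by (rule half[OF sm im(1) sec1 F])
  moreover have "smooth_map_on M G" by (rule half[OF sm(2,1) im(2) sec2 G])
  moreover have "F ` M = M"
  proof -
    have "F ` M = (\<lambda>y. F (q1 y)) ` D" by (simp add: im(1)[symmetric] image_image)
    also have "\<dots> = q2 ` D" by (rule image_cong) (simp_all add: F)
    finally show ?thesis by (simp add: im)
  qed
  moreover have "G ` M = M"
  proof -
    have "G ` M = (\<lambda>y. G (q2 y)) ` D" by (simp add: im(2)[symmetric] image_image)
    also have "\<dots> = q1 ` D" by (rule image_cong) (simp_all add: G)
    finally show ?thesis by (simp add: im)
  qed
  moreover have "G (F m) = m" if m: "m \<in> M" for m
  proof -
    obtain y where "y \<in> D" "m = q1 y" using m im(1) by blast
    then show ?thesis using F G by simp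
  qed
  moreover have "F (G m) = m" if m: "m \<in> M" for m
  proof -
    obtain y where "y \<in> D" "m = q2 y" using m im(2) by blast
    then show ?thesis using F G by simp
  qed
  ultimately have "diffeomorphism_betw M M F" unfolding diffeomorphism_betw_def by blast
  then show ?thesis using F that by blast
qed

lemma smooth_on_cis [smooth_intros]:
  fixes f :: "'a::euclidean_space \<Rightarrow> real"
  assumes "smooth_on U f"
  shows "smooth_on U (\<lambda>x. cis (f x))"
proof -
  have "smooth_on U (\<lambda>x. of_real (cos (f x)) + of_real (sin (f x)) * \<i>)"
    using assms by (intro smooth_intros smooth_on_open[OF assms])
  then show ?thesis by (rule smooth_on_cong) (simp add: complex_eq_iff)
qed

text \<open>Polar coordinates, with the logarithm of the radius taken modulo \<open>ln s\<close> as
  an angle.\<close>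

definition cover_map :: "real \<Rightarrow> real ^ 'n::finite \<Rightarrow> complex \<times> (real ^ 'n)" where
  "cover_map s y = (cis (2 * pi * (ln (norm y) / ln s)), (1 / norm y) *\<^sub>R y)"

lemma smooth_on_cover_map: "s > 1 \<Longrightarrow> smooth_on (- {0}) (cover_map s)"
  unfolding cover_map_def[abs_def] by (intro smooth_intros) auto

lemma cover_map_in: "y \<noteq> 0 \<Longrightarrow> cover_map s y \<in> S1_times_Sn"
  by (simp add: cover_map_def)

lemma cis_2pi_eq_iff: "cis (2 * pi * a) = cis (2 * pi * b) \<longleftrightarrow> (\<exists>j::int. a = b + of_int j)"
proof -
  have "cis (2 * pi * a) = cis (2 * pi * b) \<longleftrightarrow> exp (\<i> * of_real (2 * pi * a)) = exp (\<i> * of_real (2 * pi * b))"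
    by (simp add: cis_conv_exp)
  also have "\<dots> \<longleftrightarrow> (\<exists>j::int. \<i> * of_real (2 * pi * a) = \<i> * of_real (2 * pi * b) + complex_of_real (of_int (2 * j) * pi) * \<i>)"
    by (rule exp_eq)
  also have "\<dots> \<longleftrightarrow> (\<exists>j::int. a = b + of_int j)"
  proof (rule iff_exI)
    fix j :: int
    have "\<i> * of_real (2 * pi * a) = \<i> * of_real (2 * pi * b) + complex_of_real (of_int (2 * j) * pi) * \<i>
      \<longleftrightarrow> 2 * pi * a = 2 * pi * b + 2 * pi * of_int j"
      by (simp add: complex_eq_iff algebra_simps)
    also have "\<dots> \<longleftrightarrow> 2 * pi * a = 2 * pi * (b + of_int j)" by (simp add: algebra_simps)
    also have "\<dots> \<longleftrightarrow> a = b + of_int j" by simp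
    finally show "(\<i> * of_real (2 * pi * a) = \<i> * of_real (2 * pi * b) + complex_of_real (of_int (2 * j) * pi) * \<i>) = (a = b + of_int j)" .
  qed
  finally show ?thesis .
qed

lemma cover_map_scale:
  assumes "s > 1" "y \<noteq> 0"
  shows "cover_map s (s ^ k *\<^sub>R y) = cover_map s y"
proof -
  have "ln (norm (s ^ k *\<^sub>R y)) / ln s = ln (norm y) / ln s + of_int (int k)"
    using assms by (simp add: ln_mult ln_realpow add_divide_distrib)
  then have "cis (2 * pi * (ln (norm (s ^ k *\<^sub>R y)) / ln s)) = cis (2 * pi * (ln (norm y) / ln s))"
    using cis_2pi_eq_iff by metis
  then show ?thesis using assms by (simp add: cover_map_def)
qed

text \<open>The deck group is infinite cyclic; with natural exponents the two signs become two
  cases.\<close>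

lemma cover_map_eqD:
  assumes "s > 1" "x \<noteq> 0" "y \<noteq> 0" "cover_map s x = cover_map s y"
  obtains k where "x = s ^ k *\<^sub>R y" | k where "y = s ^ k *\<^sub>R x"
proof -
  have dir: "(1 / norm x) *\<^sub>R x = (1 / norm y) *\<^sub>R y" using assms(4) by (simp add: cover_map_def)
  obtain j :: int where j: "ln (norm x) / ln s = ln (norm y) / ln s + of_int j"
    using assms(4) cis_2pi_eq_iff[of "ln (norm x) / ln s" "ln (norm y) / ln s"] by (auto simp: cover_map_def)
  have ls: "ln s > 0" using assms(1) by simp
  have lnj: "ln (norm x) = ln (norm y) + of_int j * ln s" using j ls by (simp add: field_simps)
  have via: "u = s ^ k *\<^sub>R v" if "ln (norm u) = ln (norm v) + real k * ln s" "(1 / norm u) *\<^sub>R u = (1 / norm v) *\<^sub>R v" "u \<noteq> 0" "v \<noteq> 0"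
    for u v :: "real ^ 'a" and k
  proof -
    have "ln (norm u) = ln (norm v * s ^ k)" using that assms(1) by (simp add: ln_mult ln_realpow)
    then have n: "norm u = norm v * s ^ k" using that assms(1) by (subst (asm) ln_inj_iff) auto
    have "u = norm u *\<^sub>R ((1 / norm u) *\<^sub>R u)" using that(3) by simp
    also have "\<dots> = norm u *\<^sub>R ((1 / norm v) *\<^sub>R v)" by (simp only: that(2))
    also have "\<dots> = s ^ k *\<^sub>R v" using n that(4) by simp
    finally show ?thesis .
  qed
  show ?thesis
  proof (cases "j \<ge> 0")
    case True
    then have "ln (norm x) = ln (norm y) + real (nat j) * ln s" using lnj by simp
    then show ?thesis using via[OF _ dir assms(2,3)] that(1) by blast
  next
    case False
    then have "ln (norm y) = ln (norm x) + real (nat (- j)) * ln s" using lnj by simp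
    then show ?thesis using via[OF _ dir[symmetric] assms(3,2)] that(2) by blast
  qed
qed

text \<open>A smooth branch of the angle near \<open>z0\<close>: rotated by the conjugate of
  \<open>z0\<close>, the point \<open>z\<close> lies in the right half plane, where the arctangent
  of the slope is its angle.\<close>

lemma circle_branch:
  assumes "norm z0 = 1" "norm z = 1" "Re (z * cnj z0) > 0" "cis t0 = z0"
  shows "cis (t0 + arctan (Im (z * cnj z0) / Re (z * cnj z0))) = z"
proof -
  define w where "w = z * cnj z0"
  have nw: "norm w = 1" using assms by (simp add: w_def norm_mult)
  have zz: "z0 * cnj z0 = 1" using assms(1) by (simp add: complex_norm_square[symmetric])
  have "w * z0 = z * (z0 * cnj z0)" by (simp add: w_def algebra_simps)
  then have z: "z = z0 * w" using zz by (simp add: mult.commute)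
  have "(Re w)\<^sup>2 + (Im w)\<^sup>2 = 1" using nw by (simp add: cmod_def)
  then have "1 + (Im w / Re w)\<^sup>2 = (1 / Re w)\<^sup>2"
    using assms(3) unfolding w_def[symmetric] by (simp add: field_simps power2_eq_square)
  then have "sqrt (1 + (Im w / Re w)\<^sup>2) = 1 / Re w"
    using assms(3) unfolding w_def[symmetric] by simp
  then have "cis (arctan (Im w / Re w)) = w"
    using assms(3) unfolding w_def[symmetric] by (simp add: complex_eq_iff cos_arctan sin_arctan)
  then have "cis (t0 + arctan (Im w / Re w)) = z0 * w" using assms(4) by (simp only: cis_mult[symmetric])
  then have "cis (t0 + arctan (Im w / Re w)) = z" by (simp only: z[symmetric])
  then show ?thesis by (simp only: w_def)
qed

text \<open>The angle branch is normalised to take at the base point the value prescribed by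
  \<open>y0\<close>, so the section passes through \<open>y0\<close> and stays in \<open>D\<close>
  after shrinking \<open>U\<close>.\<close>

lemma cover_map_section:
  fixes y0 :: "real ^ 'n::finite"
  assumes s: "s > 1" and D: "open D" and y0: "y0 \<in> D" "y0 \<noteq> 0"
  obtains U \<sigma> where "cover_map s y0 \<in> U" "smooth_on U \<sigma>"
    "\<And>m. m \<in> S1_times_Sn \<inter> U \<Longrightarrow> \<sigma> m \<in> D \<and> \<sigma> m \<noteq> 0 \<and> cover_map s (\<sigma> m) = m"
proof -
  define t0 where "t0 = 2 * pi * (ln (norm y0) / ln s)"
  define z0 where "z0 = cis t0"
  define U0 :: "(complex \<times> (real ^ 'n)) set" where "U0 = {m. Re (fst m * cnj z0) > 0 \<and> snd m \<bullet> snd m > 0}"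
  define \<sigma> where "\<sigma> = (\<lambda>m :: complex \<times> (real ^ 'n). exp ((t0 + arctan (Im (fst m * cnj z0) / Re (fst m * cnj z0))) * (ln s / (2 * pi))) *\<^sub>R snd m)"
  have ls: "ln s > 0" using s by simp
  have oU0: "open U0" unfolding U0_def
    by (intro open_Collect_conj open_Collect_less continuous_intros)
  have s\<sigma>: "smooth_on U0 \<sigma>" unfolding \<sigma>_def
  proof (intro smooth_intros oU0)
    show "Re (fst x * cnj z0) \<noteq> 0" if "x \<in> U0" for x using that by (auto simp: U0_def)
  qed
  define U where "U = U0 \<inter> \<sigma> -` D"
  have oU: "open U" unfolding U_def
    by (rule continuous_open_preimage[OF smooth_on_imp_continuous_on[OF s\<sigma>] oU0 D])
  have zz: "z0 * cnj z0 = 1" by (simp add: z0_def complex_norm_square[symmetric])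
  show ?thesis
  proof (rule that)
    show "smooth_on U \<sigma>" by (rule smooth_on_subset[OF s\<sigma> oU]) (simp add: U_def)
    have f: "fst (cover_map s y0) * cnj z0 = 1" using zz by (simp add: cover_map_def z0_def t0_def)
    have "\<sigma> (cover_map s y0) = exp (t0 * (ln s / (2 * pi))) *\<^sub>R ((1 / norm y0) *\<^sub>R y0)"
      unfolding \<sigma>_def f by (simp add: cover_map_def)
    also have "t0 * (ln s / (2 * pi)) = ln (norm y0)" using ls by (simp add: t0_def)
    also have "exp (ln (norm y0)) *\<^sub>R ((1 / norm y0) *\<^sub>R y0) = y0" using y0(2) by simp
    finally have e: "\<sigma> (cover_map s y0) = y0" .
    have "snd (cover_map s y0) \<bullet> snd (cover_map s y0) > 0" using y0(2) by (simp add: cover_map_def)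
    then show "cover_map s y0 \<in> U" using f e y0(1) by (simp only: U_def U0_def Int_iff mem_Collect_eq vimage_eq) simp
    fix m assume m: "m \<in> S1_times_Sn \<inter> U"
    then have m1: "norm (fst m) = 1" "norm (snd m) = 1" "Re (fst m * cnj z0) > 0" by (auto simp: U_def U0_def)
    define r where "r = (t0 + arctan (Im (fst m * cnj z0) / Re (fst m * cnj z0))) * (ln s / (2 * pi))"
    have \<sigma>m: "\<sigma> m = exp r *\<^sub>R snd m" by (simp add: \<sigma>_def r_def)
    have "2 * pi * (ln (norm (\<sigma> m)) / ln s) = t0 + arctan (Im (fst m * cnj z0) / Re (fst m * cnj z0))"
      using ls m1(2) by (simp add: \<sigma>m r_def)
    moreover have "cis (t0 + arctan (Im (fst m * cnj z0) / Re (fst m * cnj z0))) = fst m"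
      by (rule circle_branch[OF _ m1(1,3)]) (simp_all only: z0_def norm_cis)
    ultimately have "cis (2 * pi * (ln (norm (\<sigma> m)) / ln s)) = fst m" by (simp only:)
    moreover have "(1 / norm (\<sigma> m)) *\<^sub>R \<sigma> m = snd m" using m1(2) by (simp add: \<sigma>m)
    ultimately have "cover_map s (\<sigma> m) = m" by (simp add: cover_map_def)
    moreover have "\<sigma> m \<noteq> 0" using m1(2) by (auto simp: \<sigma>m)
    ultimately show "\<sigma> m \<in> D \<and> \<sigma> m \<noteq> 0 \<and> cover_map s (\<sigma> m) = m" using m by (simp add: U_def)
  qed
qed

lemma cover_map_surj:
  fixes m :: "complex \<times> (real ^ 'n::finite)"
  assumes "s > 1" "m \<in> S1_times_Sn"
  obtains y where "1 \<le> norm y" "norm y < s" "cover_map s y = m"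
proof -
  define a where "a = Arg2pi (fst m) / (2 * pi)"
  have n: "norm (fst m) = 1" "norm (snd m) = 1" using assms(2) by auto
  have a: "0 \<le> a" "a < 1" using Arg2pi_ge_0[of "fst m"] Arg2pi_lt_2pi[of "fst m"] by (auto simp: a_def)
  have c: "cis (2 * pi * a) = fst m"
  proof -
    have "fst m = of_real (norm (fst m)) * exp (\<i> * of_real (Arg2pi (fst m)))" by (rule Arg2pi_eq)
    then show ?thesis using n by (simp add: a_def cis_conv_exp)
  qed
  have ls: "ln s > 0" using assms(1) by simp
  define y where "y = exp (a * ln s) *\<^sub>R snd m"
  have ny: "norm y = exp (a * ln s)" using n by (simp add: y_def)
  show ?thesis
  proof (rule that)
    show "1 \<le> norm y" using ny a ls by simp
    have "a * ln s < ln s" using a ls by simp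
    then have "exp (a * ln s) < exp (ln s)" by simp
    then show "norm y < s" using ny assms(1) by simp
    have "ln (norm y) / ln s = a" using ny ls by simp
    then show "cover_map s y = m" using c n ny by (simp add: cover_map_def prod_eq_iff y_def)
  qed
qed

section \<open>Descent to a diffeomorphism of the product\<close>

context deck
begin

text \<open>The round annulus covers the product through \<open>cover_map s\<close>, and also
  through \<open>T\<close> followed by \<open>cover_map c\<close>. Equivariance of \<open>T\<close>
  at the ends makes both maps identify the same points, so they differ by a diffeomorphism.\<close>

lemma diffeomorphism_onto_sphere:
  obtains F :: "complex \<times> (real ^ 'n) \<Rightarrow> complex \<times> (real ^ 'n)"
  where "diffeomorphism_betw S1_times_Sn S1_times_Sn F" "\<And>y. norm y = 1 \<Longrightarrow> F (1, y) = cover_map c (E y)"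
proof -
  obtain s \<eta> T where T: "s > 1" "0 < \<eta>" "\<eta> \<le> \<epsilon>" "emb (ann (1 - \<eta>) (s * (1 + \<eta>))) T"
    "\<And>y. y \<in> ann (1 - \<eta>) (1 + \<eta>) \<Longrightarrow> T y = E y \<and> T (s *\<^sub>R y) = c *\<^sub>R E y"
    by (rule fundamental_region) blast
  have im: "T ` ann 1 s = B \<inter> scaled c A"
    using image_between[of 1, OF _ T(1,2,3,4)] T(5) by simp
  define \<theta> where "\<theta> = min \<eta> ((s - 1) / (2 * s))"
  have th: "0 < \<theta>" "\<theta> \<le> \<eta>" "\<theta> < 1" "1 < s * (1 - \<theta>)" "1 + \<theta> < s"
  proof -
    show "0 < \<theta>" "\<theta> \<le> \<eta>" using T by (auto simp: \<theta>_def)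
    then show "\<theta> < 1" using T(3) eps by linarith
    have tl: "\<theta> \<le> (s - 1) / (2 * s)" by (simp add: \<theta>_def)
    then have "\<theta> * (2 * s) \<le> s - 1" using T(1) by (simp add: pos_le_divide_eq)
    then show "1 < s * (1 - \<theta>)" using T(1) by (simp add: algebra_simps)
    have "(s - 1) / (2 * s) < (s - 1) / 1" using T(1) by (intro divide_strict_left_mono) auto
    then show "1 + \<theta> < s" using tl by simp
  qed
  define D :: "(real ^ 'n) set" where "D = ann (1 - \<theta>) (s * (1 + \<theta>))"
  have oD: "open D" by (simp add: D_def)
  have Dsub: "D \<subseteq> ann (1 - \<eta>) (s * (1 + \<eta>))"
  proof
    fix y assume y: "y \<in> D"
    have "s * (1 + \<theta>) \<le> s * (1 + \<eta>)" using th T by simp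
    then show "y \<in> ann (1 - \<eta>) (s * (1 + \<eta>))" using y th(2) unfolding D_def ann_iff by linarith
  qed
  have eT: "emb D T" by (rule emb_subset[OF T(4) oD Dsub])
  have D0: "y \<noteq> 0" if "y \<in> D" for y using that th by (auto simp: D_def)
  \<comment> \<open>The half-open fundamental domain upstairs, containing \<open>S\<close> but not
    its translate; it corresponds to \<open>1 \<le> norm y < s\<close>.\<close>
  define W0 where "W0 = (B \<union> S) \<inter> scaled c A"
  define D1 where "D1 = {y :: real ^ 'n. 1 \<le> norm y \<and> norm y < s}"
  have D1D: "D1 \<subseteq> D"
  proof
    fix y assume y: "y \<in> D1"
    have "s \<le> s * (1 + \<theta>)" using th T by simp
    then show "y \<in> D" using y th(1) unfolding D_def D1_def ann_iff mem_Collect_eq by linarith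
  qed
  have S_sc: "S \<subseteq> scaled c A" using A_S_in_scaled_A[of 1] by auto
  have T1: "T y = E y" if "norm y = 1" for y using T(5)[of y] that T(2) by simp
  have W0: "T ` D1 = W0"
  proof -
    have "D1 = ann 1 s \<union> sphere 0 1" using T(1) by (auto simp: D1_def)
    then have "T ` D1 = (B \<inter> scaled c A) \<union> T ` sphere 0 1" using im by (simp add: image_Un)
    also have "T ` sphere 0 1 = S" by (rule image_cong) (use T1 in auto)
    finally show ?thesis using S_sc by (auto simp: W0_def)
  qed
  have W0_nz: "w \<noteq> 0" if "w \<in> W0" for w
  proof -
    have "0 \<notin> S" using E_nonzero eps by force
    then show ?thesis using that zero_notin_B by (auto simp: W0_def)
  qed
  \<comment> \<open>Moves a point of \<open>D\<close> into the fundamental annulus without changing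
    its image under either covering; this reduces the comparison of fibres to injectivity.\<close>
  define n where "n = (\<lambda>y :: real ^ 'n. if norm y < 1 then s *\<^sub>R y else if norm y \<ge> s then (1 / s) *\<^sub>R y else y)"
  have q_c: "cover_map c (c *\<^sub>R w) = cover_map c w" if "w \<noteq> 0" for w :: "real ^ 'n"
    using cover_map_scale[OF c1 that, of 1] by simp
  have q_s: "cover_map s (s *\<^sub>R w) = cover_map s w" if "w \<noteq> 0" for w :: "real ^ 'n"
    using cover_map_scale[OF T(1) that, of 1] by simp
  have step: "cover_map c (T (s *\<^sub>R u)) = cover_map c (T u)" if "u \<in> ann (1 - \<eta>) (1 + \<eta>)" for u
  proof -
    have "E u \<noteq> 0" using E_nonzero[of u] that T(3) by auto
    then show ?thesis using T(5)[OF that] q_c by simp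
  qed
  have n: "n y \<in> D1 \<and> cover_map s (n y) = cover_map s y \<and> cover_map c (T (n y)) = cover_map c (T y)" if y: "y \<in> D" for y
  proof -
    have y0: "y \<noteq> 0" using D0[OF y] .
    consider "norm y < 1" | "1 \<le> norm y" "norm y < s" | "norm y \<ge> s" by linarith
    then show ?thesis
    proof cases
      case 1
      have "s * (1 - \<theta>) < s * norm y" "s * norm y < s" using y 1 T(1) by (auto simp: D_def)
      then have "1 \<le> s * norm y" "s * norm y < s" using th(4) by linarith+
      moreover have "norm (s *\<^sub>R y) = s * norm y" using T(1) by simp
      ultimately have "s *\<^sub>R y \<in> D1" by (simp only: D1_def mem_Collect_eq)
      moreover have "y \<in> ann (1 - \<eta>) (1 + \<eta>)" using y 1 th T(2) by (simp add: D_def)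
      ultimately show ?thesis using 1 q_s[OF y0] step by (simp add: n_def)
    next
      case 2
      then show ?thesis by (simp add: n_def D1_def)
    next
      case 3
      define u where "u = (1 / s) *\<^sub>R y"
      have yu: "y = s *\<^sub>R u" "u \<noteq> 0" using T(1) y0 by (auto simp: u_def)
      have nu: "norm u = norm y / s" using T(1) by (simp add: u_def)
      have "norm y < s * (1 + \<theta>)" using y by (simp add: D_def)
      then have "1 \<le> norm u" "norm u < 1 + \<theta>"
        unfolding nu using 3 T(1) by (simp_all add: pos_le_divide_eq pos_divide_less_eq mult.commute)
      then have "u \<in> D1" "u \<in> ann (1 - \<eta>) (1 + \<eta>)" using th T(2) by (auto simp: D1_def)
      moreover have "n y = u" using 3 T(1) by (simp add: n_def u_def)
      ultimately show ?thesis using q_s[OF yu(2)] step yu(1) by simp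
    qed
  qed
  have inj1: "x = y" if "x \<in> D1" "y \<in> D1" "cover_map s x = cover_map s y" for x y
  proof -
    have aux: "v = u" if "u \<in> D1" "v \<in> D1" "u = s ^ k *\<^sub>R v" for u v k
    proof (cases k)
      case (Suc j)
      have "s * 1 \<le> s ^ k * norm v"
      proof (rule mult_mono)
        show "s \<le> s ^ k" using T(1) Suc self_le_power[of s k] by simp
      qed (use that T(1) in \<open>auto simp: D1_def\<close>)
      also have "\<dots> = norm u" using that(3) T(1) by simp
      finally show ?thesis using that(1) by (simp add: D1_def)
    qed (use that in simp)
    have "x \<noteq> 0" "y \<noteq> 0" using that by (auto simp: D1_def)
    from cover_map_eqD[OF T(1) this that(3)] show ?thesis using aux that by metis
  qed
  have injW: "w = w'" if "w \<in> W0" "w' \<in> W0" "cover_map c w = cover_map c w'" for w w'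
  proof -
    have aux: "v = u" if "u \<in> W0" "v \<in> W0" "u = c ^ k *\<^sub>R v" for u v k
    proof (cases k)
      case (Suc j)
      have "(1 / c) *\<^sub>R u = c ^ j *\<^sub>R v" using that(3) Suc c1 by simp
      moreover have "c ^ j *\<^sub>R v \<in> B \<union> S"
      proof (cases "j = 0")
        case True
        then show ?thesis using that(2) by (simp add: W0_def)
      next
        case False
        then have "c ^ j *\<^sub>R v \<in> B"
          using scaled_B_S_in_B[of j "c ^ j *\<^sub>R v"] that(2) c1 by (simp add: W0_def)
        then show ?thesis by blast
      qed
      moreover have "(1 / c) *\<^sub>R u \<in> A" using that(1) by (simp add: W0_def scaled_def)
      ultimately show ?thesis using AB A_sphere by auto
    qed (use that in simp)
    from cover_map_eqD[OF c1 W0_nz[OF that(1)] W0_nz[OF that(2)] that(3)] show ?thesis using aux that by metis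
  qed
  have surjW: "\<exists>w\<in>W0. cover_map c w = m" if m: "m \<in> S1_times_Sn" for m
  proof -
    obtain w where w: "1 \<le> norm w" "cover_map c w = m" using cover_map_surj[OF c1 m] by metis
    then have w0: "w \<noteq> 0" by auto
    obtain R where R: "R > 0" "\<And>y. norm y > R \<Longrightarrow> y \<in> B" using large_in_B by blast
    obtain i where i: "c ^ i > R" using real_arch_pow[OF c1] by blast
    define v where "v = c ^ i *\<^sub>R w"
    have "c ^ i * 1 \<le> c ^ i * norm w" using w(1) c1 by (intro mult_left_mono) auto
    moreover have "norm v = c ^ i * norm w" using c1 by (simp add: v_def)
    ultimately have "norm v > R" using i by linarith
    then have vB: "v \<in> B" by (rule R(2))
    obtain r where r: "r > 0" "ball 0 r \<subseteq> A" using open_A zero_A open_contains_ball by blast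
    obtain k where "c ^ k > norm v / r" using real_arch_pow[OF c1] by blast
    then have "norm ((1 / c ^ k) *\<^sub>R v) < r" using r(1) c1 by (simp add: field_simps)
    then have ex: "(1 / c ^ k) *\<^sub>R v \<in> A" using r(2) by auto
    \<comment> \<open>A representative in \<open>B\<close> is divided by \<open>c\<close> until it
      first lies in \<open>A\<close>; the point just before lies in \<open>W0\<close>.\<close>
    define k0 where "k0 = (LEAST k. (1 / c ^ k) *\<^sub>R v \<in> A)"
    have k0: "(1 / c ^ k0) *\<^sub>R v \<in> A" unfolding k0_def by (rule LeastI[of "\<lambda>k. (1 / c ^ k) *\<^sub>R v \<in> A", OF ex])
    have "k0 \<noteq> 0"
    proof
      assume "k0 = 0"
      then show False using k0 vB AB by auto
    qed
    then obtain j where j: "k0 = Suc j" by (cases k0) auto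
    define u where "u = (1 / c ^ j) *\<^sub>R v"
    have "u \<notin> A" unfolding u_def using not_less_Least[of j "\<lambda>k. (1 / c ^ k) *\<^sub>R v \<in> A"] j by (simp add: k0_def)
    then have "u \<in> B \<union> S" using not_A_iff by blast
    moreover have "u \<in> scaled c A" using k0 j by (simp add: scaled_def u_def)
    ultimately have "u \<in> W0" by (simp add: W0_def)
    moreover have "cover_map c u = m"
    proof -
      have vu: "v = c ^ j *\<^sub>R u" using c1 by (simp add: u_def)
      have "u \<noteq> 0" using W0_nz \<open>u \<in> W0\<close> .
      then have "cover_map c u = cover_map c v" unfolding vu using cover_map_scale[OF c1] by metis
      also have "\<dots> = m" unfolding v_def using cover_map_scale[OF c1 w0] w(2) by metis
      finally show ?thesis .
    qed
    ultimately show ?thesis by blast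
  qed
  have T_nz: "T y \<noteq> 0" if y: "y \<in> D" for y
  proof
    assume 0: "T y = 0"
    consider "norm y < 1" | "y \<in> D1" | "norm y \<ge> s" unfolding D1_def mem_Collect_eq by linarith
    then show False
    proof cases
      case 1
      then have "y \<in> ann (1 - \<eta>) (1 + \<eta>)" using y th T(2) by (simp add: D_def)
      then show False using T(5)[of y] E_nonzero[of y] T(3) 0 by auto
    next
      case 2
      then show False using W0 W0_nz 0 by force
    next
      case 3
      define u where "u = (1 / s) *\<^sub>R y"
      have yu: "y = s *\<^sub>R u" using T(1) by (simp add: u_def)
      have nu: "norm u = norm y / s" using T(1) by (simp add: u_def)
      have "norm y < s * (1 + \<theta>)" using y by (simp add: D_def)
      then have "1 \<le> norm u" "norm u < 1 + \<theta>"
        unfolding nu using 3 T(1) by (simp_all add: pos_le_divide_eq pos_divide_less_eq mult.commute)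
      then have u: "u \<in> ann (1 - \<eta>) (1 + \<eta>)" using th T(2) by auto
      then show False using T(5)[OF u] E_nonzero[of u] T(3) 0 c1 yu by auto
    qed
  qed
  have sm1: "smooth_on D (cover_map s)"
    by (rule smooth_on_subset[OF smooth_on_cover_map[OF T(1)] oD]) (use D0 in auto)
  have sm2: "smooth_on D (\<lambda>y. cover_map c (T y))"
    by (rule smooth_on_compose[OF embD(2)[OF eT] smooth_on_cover_map[OF c1]]) (use T_nz in auto)
  have im1: "cover_map s ` D = S1_times_Sn"
  proof
    show "cover_map s ` D \<subseteq> S1_times_Sn" using D0 cover_map_in by blast
    show "S1_times_Sn \<subseteq> cover_map s ` D"
    proof
      fix m :: "complex \<times> (real ^ 'n)" assume "m \<in> S1_times_Sn"
      then obtain y where "1 \<le> norm y" "norm y < s" "cover_map s y = m" using cover_map_surj[OF T(1)] by metis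
      then show "m \<in> cover_map s ` D" using D1D by (auto simp: D1_def)
    qed
  qed
  have im2: "(\<lambda>y. cover_map c (T y)) ` D = S1_times_Sn"
  proof
    show "(\<lambda>y. cover_map c (T y)) ` D \<subseteq> S1_times_Sn" using T_nz cover_map_in by blast
    show "S1_times_Sn \<subseteq> (\<lambda>y. cover_map c (T y)) ` D"
    proof
      fix m :: "complex \<times> (real ^ 'n)" assume "m \<in> S1_times_Sn"
      then obtain w where w: "w \<in> W0" "cover_map c w = m" using surjW by blast
      then obtain y where "y \<in> D1" "w = T y" using W0 by blast
      then show "m \<in> (\<lambda>y. cover_map c (T y)) ` D" using w D1D by blast
    qed
  qed
  have sec1: "\<exists>U \<sigma>. cover_map s y \<in> U \<and> smooth_on U \<sigma> \<and> (\<forall>m\<in>S1_times_Sn \<inter> U. \<sigma> m \<in> D \<and> cover_map s (\<sigma> m) = m)"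
    if "y \<in> D" for y
    using cover_map_section[OF T(1) oD that D0[OF that]] by metis
  have sec2: "\<exists>U \<sigma>. cover_map c (T y) \<in> U \<and> smooth_on U \<sigma> \<and> (\<forall>m\<in>S1_times_Sn \<inter> U. \<sigma> m \<in> D \<and> cover_map c (T (\<sigma> m)) = m)"
    if y: "y \<in> D" for y
  proof -
    have oTD: "open (T ` D)" by (rule emb_image_open[OF eT oD subset_refl])
    obtain U \<sigma> where U: "cover_map c (T y) \<in> U" "smooth_on U \<sigma>"
      "\<And>m. m \<in> S1_times_Sn \<inter> U \<Longrightarrow> \<sigma> m \<in> T ` D \<and> \<sigma> m \<noteq> 0 \<and> cover_map c (\<sigma> m) = m"
      by (rule cover_map_section[OF c1 oTD imageI[OF y] T_nz[OF y]]) blast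
    define U' where "U' = U \<inter> \<sigma> -` (T ` D)"
    have oU': "open U'" unfolding U'_def
      by (rule continuous_open_preimage[OF smooth_on_imp_continuous_on[OF U(2)] smooth_on_open[OF U(2)] oTD])
    have "smooth_on U' (\<lambda>m. inv_into D T (\<sigma> m))"
      by (rule smooth_on_compose[OF smooth_on_subset[OF U(2) oU'] embD(2)[OF emb_inverse[OF eT]]]) (auto simp: U'_def)
    moreover have "cover_map c (T y) \<in> U'"
      using U(1) U(3)[of "cover_map c (T y)"] cover_map_in[OF T_nz[OF y]] by (auto simp: U'_def)
    moreover have "inv_into D T (\<sigma> m) \<in> D \<and> cover_map c (T (inv_into D T (\<sigma> m))) = m" if "m \<in> S1_times_Sn \<inter> U'" for m
      using U(3)[of m] that by (auto simp: U'_def inv_into_into f_inv_into_f)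
    ultimately show ?thesis by blast
  qed
  have ker: "cover_map s x = cover_map s y \<longleftrightarrow> cover_map c (T x) = cover_map c (T y)" if x: "x \<in> D" and y: "y \<in> D" for x y
  proof -
    have "cover_map s (n x) = cover_map s (n y) \<longleftrightarrow> cover_map c (T (n x)) = cover_map c (T (n y))"
    proof
      assume "cover_map s (n x) = cover_map s (n y)"
      then have "n x = n y" using inj1 n x y by blast
      then show "cover_map c (T (n x)) = cover_map c (T (n y))" by simp
    next
      assume a: "cover_map c (T (n x)) = cover_map c (T (n y))"
      have "T (n x) \<in> W0" "T (n y) \<in> W0" using n x y W0 by blast+
      then have "T (n x) = T (n y)" using injW a by blast
      then have "n x = n y" using inj_onD[OF embD(3)[OF eT]] n x y D1D by blast
      then show "cover_map s (n x) = cover_map s (n y)" by simp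
    qed
    then show ?thesis using n[OF x] n[OF y] by simp
  qed
  obtain F :: "complex \<times> (real ^ 'n) \<Rightarrow> complex \<times> (real ^ 'n)"
    where F: "diffeomorphism_betw S1_times_Sn S1_times_Sn F" "\<And>y. y \<in> D \<Longrightarrow> F (cover_map s y) = cover_map c (T y)"
    by (rule quotient_diffeomorphism[OF sm1 sm2 im1 im2 sec1 sec2 ker]) (assumption | blast)+
  have "F (1, y) = cover_map c (E y)" if "norm y = 1" for y
  proof -
    have "y \<in> D" using that D1D T(1) by (auto simp: D1_def)
    moreover have "cover_map s y = (1, y)" using that by (simp add: cover_map_def)
    ultimately show ?thesis using F(2) T1[OF that] by metis
  qed
  then show ?thesis using F(1) that by blast
qed

end

subsection \<open>Collars of lifted spheres\<close>

text \<open>Rotating \<open>x\<close> to a coordinate axis turns \<open>A\<close> into a matrix with a zero column, so that the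
  determinant becomes linear in that column.\<close>

lemma det_add_rank_one:
  fixes A :: "real ^ 'n ^ 'n::finite"
  assumes "norm x = 1" "A *v x = 0"
  shows "det (\<chi> i j. A $ i $ j + w $ i * x $ j) = (\<Sum>k\<in>UNIV. w $ k * det (\<chi> i j. A $ i $ j + axis k 1 $ i * x $ j))"
proof -
  obtain a :: 'n where "a \<in> UNIV" by blast
  obtain Q where Q: "orthogonal_matrix Q" "Q *v axis a 1 = x"
    using orthogonal_matrix_exists_basis[OF assms(1)] by blast
  have QT: "transpose Q *v x = axis a 1"
    using Q by (metis matrix_vector_mul_assoc matrix_vector_mul_lid orthogonal_matrix)
  have xQ: "(\<Sum>l\<in>UNIV. x $ l * Q $ l $ j) = (if j = a then 1 else 0)" for j
    using arg_cong[OF QT, of "\<lambda>v. v $ j"]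
    by (simp add: matrix_vector_mult_def transpose_def axis_def mult.commute)
  have AQ: "(A ** Q) $ i $ a = 0" for i
  proof -
    have "(A ** Q) *v axis a 1 = 0" using Q(2) assms(2) by (simp add: matrix_vector_mul_assoc[symmetric])
    then have "((A ** Q) *v axis a 1) $ i = 0" by simp
    then show ?thesis by (simp add: matrix_vector_mult_basis column_def)
  qed
  have M: "(\<chi> i j. A $ i $ j + u $ i * x $ j) ** Q = transpose (\<chi> j. if j = a then u else column j (A ** Q))" for u
  proof -
    have "(\<Sum>l\<in>UNIV. (A $ i $ l + u $ i * x $ l) * Q $ l $ j) = (A ** Q) $ i $ j + u $ i * (if j = a then 1 else 0)" for i j
      by (simp add: distrib_right sum.distrib mult.assoc sum_distrib_left[symmetric] xQ matrix_matrix_mult_def del: mult_if_delta)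
    then show ?thesis
      by (auto simp: vec_eq_iff matrix_matrix_mult_def transpose_def column_def AQ[unfolded matrix_matrix_mult_def, simplified])
  qed
  have D: "det (\<chi> i j. A $ i $ j + u $ i * x $ j) * det Q = det (\<chi> j. if j = a then u else column j (A ** Q))" for u
    unfolding det_mul[symmetric] M by (rule det_transpose)
  have "det (\<chi> j. if j = a then w else column j (A ** Q)) = det (\<chi> j. if j = a then (\<Sum>k\<in>UNIV. w $ k *s axis k 1) else column j (A ** Q))"
    by (simp only: basis_expansion)
  also have "\<dots> = (\<Sum>k\<in>UNIV. det (\<chi> j. if j = a then w $ k *s axis k 1 else column j (A ** Q)))"
    by (rule det_linear_row_sum) simp
  also have "\<dots> = (\<Sum>k\<in>UNIV. w $ k * det (\<chi> j. if j = a then axis k 1 else column j (A ** Q)))"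
    by (simp only: det_row_mul)
  finally have "det (\<chi> i j. A $ i $ j + w $ i * x $ j) * det Q = (\<Sum>k\<in>UNIV. w $ k * det (\<chi> i j. A $ i $ j + axis k 1 $ i * x $ j)) * det Q"
    by (simp add: D[symmetric] sum_distrib_right mult.assoc)
  moreover have "det Q \<noteq> 0" using det_orthogonal_matrix[OF Q(1)] by auto
  ultimately show ?thesis by simp
qed

lemma jac_eq_det:
  assumes "(f has_derivative D) (at x)"
  shows "jac f x = det (\<chi> i j. D (axis j 1) $ i)"
  unfolding jac_def frechet_derivative_eqI[OF assms] matrix_def ..

text \<open>Here \<open>\<nu>\<close> is a generalised cross product: by linearity of the
  determinant in the column along \<open>x\<close>, pushing out in a direction \<open>w\<close>
  gives the Jacobian \<open>w \<bullet> \<nu> x\<close>. Taking \<open>w\<close> to be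
  \<open>\<nu> x\<close> itself makes this a positive square, so no choice of side has to be
  made.\<close>

lemma collar_map:
  fixes f :: "real ^ 'n::finite \<Rightarrow> real ^ 'n"
  assumes f: "smooth_on (- {0}) f" and hom: "\<And>y. y \<noteq> 0 \<Longrightarrow> f y = f ((1 / norm y) *\<^sub>R y)"
    and imm: "\<And>x v. norm x = 1 \<Longrightarrow> v \<bullet> x = 0 \<Longrightarrow> frechet_derivative f (at x) v = 0 \<Longrightarrow> v = 0"
  obtains E where "smooth_on (- {0}) E" "\<And>y. norm y = 1 \<Longrightarrow> E y = f y" "\<And>y. norm y = 1 \<Longrightarrow> jac E y > 0"
proof -
  define f' where "f' = (\<lambda>y. frechet_derivative f (at y))"
  define \<nu> :: "real ^ 'n \<Rightarrow> real ^ 'n" where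
    "\<nu> = (\<lambda>y. \<chi> k. det (\<chi> i j. f' y (axis j 1) $ i + axis k 1 $ i * y $ j))"
  define E where "E = (\<lambda>y. f y + (norm y - 1) *\<^sub>R \<nu> y)"
  have op: "open (- {0 :: real ^ 'n})" by auto
  have s\<nu>: "smooth_on (- {0}) \<nu>"
    unfolding \<nu>_def f'_def by (intro smooth_intros smooth_on_frechet_derivative f op)
  have sE: "smooth_on (- {0}) E"
    unfolding E_def by (intro smooth_intros s\<nu> f op) auto
  have "jac E x > 0" if x: "norm x = 1" for x
  proof -
    have x0: "x \<in> - {0}" using x by auto
    have df: "(f has_derivative f' x) (at x)" unfolding f'_def by (rule smooth_on_has_derivative[OF f x0])
    have lin: "linear (f' x)" using df by (rule has_derivative_linear)
    have xx: "x \<bullet> x = 1" using x by (simp add: norm_eq_1)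
    have fx: "f' x x = 0"
    proof -
      have "((\<lambda>t. f (x + t *\<^sub>R x)) has_vector_derivative f' x x) (at 0)"
        by (rule has_vector_derivative_direction[OF df])
      moreover have "((\<lambda>t. f (x + t *\<^sub>R x)) has_vector_derivative 0) (at 0)"
      proof (rule has_vector_derivative_transform_within_open[where S = "{-1<..}" and f = "\<lambda>t. f x"])
        fix t :: real assume t: "t \<in> {-1<..}"
        have e: "x + t *\<^sub>R x = (1 + t) *\<^sub>R x" by (simp add: scaleR_left_distrib)
        have "(1 + t) *\<^sub>R x \<noteq> 0" using t x0 by auto
        from hom[OF this] show "f x = f (x + t *\<^sub>R x)" unfolding e using t x by simp
      qed auto
      ultimately show ?thesis by (rule vector_derivative_unique_at)
    qed
    define A where "A = matrix (f' x)"
    have A: "A *v v = f' x v" for v using lin by (simp add: A_def matrix_works)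
    have Aij: "A $ i $ j = f' x (axis j 1) $ i" for i j by (simp add: A_def matrix_def)
    have Ax: "A *v x = 0" using A fx by simp
    have \<nu>: "\<nu> x $ k = det (\<chi> i j. A $ i $ j + axis k 1 $ i * x $ j)" for k
      by (simp add: \<nu>_def Aij)
    have lin_D: "det (\<chi> i j. A $ i $ j + w $ i * x $ j) = w \<bullet> \<nu> x" for w
      using det_add_rank_one[OF x Ax, of w] by (simp add: inner_vec_def \<nu>)
    have app: "(\<chi> i j. A $ i $ j + w $ i * x $ j) *v v = f' x v + (x \<bullet> v) *\<^sub>R w" for v w
      by (simp add: A[symmetric] vec_eq_iff matrix_vector_mult_def inner_vec_def algebra_simps sum.distrib sum_distrib_left)
    \<comment> \<open>The derivative kills \<open>x\<close>, hence is not onto. Any \<open>w\<close>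
      outside its range gives, by the immersion property, an injective map and so a nonzero value of
      \<open>w \<bullet> \<nu> x\<close>.\<close>
    have nz: "\<nu> x \<noteq> 0"
    proof -
      have "\<exists>w. w \<notin> range (f' x)"
      proof (rule ccontr)
        assume "\<not> ?thesis"
        then have "surj (f' x)" by blast
        then have "inj (f' x)" using linear_surjective_imp_injective[OF lin] by blast
        then show False using fx lin x0 by (metis ComplD injD linear_0 singletonI)
      qed
      then obtain w where w: "w \<notin> range (f' x)" by blast
      have "inj ((*v) (\<chi> i j. A $ i $ j + w $ i * x $ j))"
        unfolding linear_injective_0[OF matrix_vector_mul_linear] app
      proof (intro allI impI)
        fix v assume v: "f' x v + (x \<bullet> v) *\<^sub>R w = 0"
        have "x \<bullet> v = 0"
        proof (rule ccontr)
          assume n: "x \<bullet> v \<noteq> 0"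
          have "f' x v = - ((x \<bullet> v) *\<^sub>R w)" using v by (simp add: eq_neg_iff_add_eq_0)
          then have "f' x ((- (1 / (x \<bullet> v))) *\<^sub>R v) = w"
            using n lin by (simp add: linear_neg linear_scale)
          then show False using w by blast
        qed
        moreover then have "f' x v = 0" using v by simp
        ultimately show "v = 0" using imm[OF x, of v] by (simp add: f'_def inner_commute)
      qed
      then have "det (\<chi> i j. A $ i $ j + w $ i * x $ j) \<noteq> 0"
        using det_nz_iff_inj[OF matrix_vector_mul_linear, of "\<chi> i j. A $ i $ j + w $ i * x $ j"]
        by (simp only: matrix_of_matrix_vector_mul simp_thms)
      then show ?thesis using lin_D by auto
    qed
    have "((\<lambda>y. norm y - 1) has_derivative (\<lambda>v. x \<bullet> v - 0)) (at x)"
      using has_derivative_norm[of x] x0 x by (intro derivative_intros) (simp add: sgn_div_norm inner_commute)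
    moreover have "(\<nu> has_derivative frechet_derivative \<nu> (at x)) (at x)" by (rule smooth_on_has_derivative[OF s\<nu> x0])
    ultimately have "((\<lambda>y. (norm y - 1) *\<^sub>R \<nu> y) has_derivative
        (\<lambda>v. (norm x - 1) *\<^sub>R frechet_derivative \<nu> (at x) v + (x \<bullet> v - 0) *\<^sub>R \<nu> x)) (at x)"
      by (rule has_derivative_scaleR)
    from has_derivative_add[OF df this]
    have "(E has_derivative (\<lambda>v. f' x v + (x \<bullet> v) *\<^sub>R \<nu> x)) (at x)" using x by (simp add: E_def)
    from jac_eq_det[OF this] have "jac E x = det (\<chi> i j. A $ i $ j + \<nu> x $ i * x $ j)"
      by (simp add: Aij inner_axis mult.commute)
    then show ?thesis using lin_D nz by simp
  qed
  then show ?thesis using sE that[of E] by (simp add: E_def)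
qed

section \<open>Thickening the lifted sphere and its two sides\<close>

lemma injective_near_sphere:
  fixes h :: "'a::euclidean_space \<Rightarrow> 'b::metric_space"
  assumes r: "0 < r" "r \<le> 1" and cont: "continuous_on (ann (1 - r) (1 + r)) h" and inj: "inj_on h (sphere 0 1)"
    and loc: "\<And>x. norm x = 1 \<Longrightarrow> \<exists>r>0. inj_on h (ball x r)"
  obtains d where "0 < d" "d < r" "inj_on h (ann (1 - d) (1 + d))"
proof -
  define C where "C = {y :: 'a. 1 - r / 2 \<le> norm y \<and> norm y \<le> 1 + r / 2}"
  \<comment> \<open>Pairs in \<open>W\<close> cannot violate injectivity, by local injectivity along
    the diagonal. The remaining pairs with equal images form the compact set \<open>Z\<close>, which
    contains no pair from the sphere, so \<open>g\<close> is bounded away from 0 on it.\<close>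
  define W where "W = (\<Union>x. \<Union>r\<in>{r. inj_on h (ball x r)}. ball x r \<times> ball x r)"
  define Z where "Z = {z \<in> C \<times> C. h (fst z) = h (snd z)} - W"
  define g where "g = (\<lambda>z :: 'a \<times> 'a. max \<bar>norm (fst z) - 1\<bar> \<bar>norm (snd z) - 1\<bar>)"
  have C: "compact C" unfolding C_def by (rule compact_closed_annulus)
  have oW: "open W" unfolding W_def by (intro open_UN ballI open_Times open_ball)
  have C0: "C \<subseteq> ann (1 - r) (1 + r)" using r by (auto simp: C_def)
  have "continuous_on (C \<times> C) (\<lambda>z. h (fst z))" "continuous_on (C \<times> C) (\<lambda>z. h (snd z))"
    using C0 by (auto intro!: continuous_on_compose2[OF cont] continuous_intros)
  then have "continuous_on (C \<times> C) (\<lambda>z. dist (h (fst z)) (h (snd z)))" by (rule continuous_on_dist)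
  then have "closedin (top_of_set (C \<times> C)) {z \<in> C \<times> C. dist (h (fst z)) (h (snd z)) = 0}"
    by (rule continuous_closedin_preimage_constant)
  then have "compact {z \<in> C \<times> C. h (fst z) = h (snd z)}"
    using closedin_compact[OF compact_Times[OF C C]] by simp
  then have "compact Z" unfolding Z_def using oW by (rule compact_diff)
  then have "compact (g ` Z)"
    unfolding g_def by (intro compact_continuous_image continuous_intros)
  moreover have "0 \<notin> g ` Z"
  proof
    assume "0 \<in> g ` Z"
    then obtain x y where z: "(x, y) \<in> Z" "g (x, y) = 0" by auto
    then have n: "norm x = 1" "norm y = 1" by (auto simp: g_def max_def split: if_splits)
    then have "x = y" using z(1) inj by (auto simp: Z_def inj_on_def)
    moreover obtain r where "r > 0" "inj_on h (ball x r)" using loc[OF n(1)] by blast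
    ultimately have "(x, y) \<in> W" by (force simp: W_def)
    then show False using z(1) by (simp add: Z_def)
  qed
  ultimately have "open (- (g ` Z))" "0 \<in> - (g ` Z)" by (auto simp: compact_imp_closed open_Compl)
  then obtain d where d: "d > 0" "ball 0 d \<subseteq> - (g ` Z)" using open_contains_ball by blast
  define e where "e = min d (r / 2)"
  have e: "0 < e" "e \<le> d" "e \<le> r / 2" using d r by (auto simp: e_def)
  show ?thesis
  proof (rule that)
    show "inj_on h (ann (1 - e) (1 + e))"
    proof (rule inj_onI)
      fix x y assume x: "x \<in> ann (1 - e) (1 + e)" and y: "y \<in> ann (1 - e) (1 + e)" and eq: "h x = h y"
      have "\<bar>g (x, y)\<bar> < d" using x y e by (auto simp: g_def abs_less_iff)
      then have "g (x, y) \<in> ball 0 d" by simp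
      then have "(x, y) \<notin> Z" using d(2) by blast
      moreover have "x \<in> C" "y \<in> C" using x y e r by (auto simp: C_def)
      ultimately have "(x, y) \<in> W" using eq by (auto simp: Z_def)
      then show "x = y" using eq by (auto simp: W_def inj_on_def)
    qed
  qed (use e r in auto)
qed

text \<open>Two norms in an open interval whose endpoints have ratio \<open>c\<close> never differ
  by a nontrivial power of \<open>c\<close>.\<close>

lemma inj_on_cover_map:
  assumes "c > 1" "m > 0"
  shows "inj_on (cover_map c) (ann m (c * m) :: (real ^ 'n::finite) set)"
proof (rule inj_onI)
  fix u v :: "real ^ 'n" assume u: "u \<in> ann m (c * m)" and v: "v \<in> ann m (c * m)" and eq: "cover_map c u = cover_map c v"
  have aux: "u = v" if "u = c ^ k *\<^sub>R v" "u \<in> ann m (c * m)" "v \<in> ann m (c * m)" for u v :: "real ^ 'n" and k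
  proof (cases k)
    case (Suc j)
    have "c * m < c ^ k * norm v"
    proof (rule mult_le_less_imp_less)
      show "c \<le> c ^ k" using assms Suc self_le_power[of c k] by simp
    qed (use that assms in auto)
    also have "\<dots> = norm u" using that(1) assms by simp
    finally show ?thesis using that(2) by simp
  qed (use that in simp)
  have "u \<noteq> 0" "v \<noteq> 0" using u v assms by auto
  from cover_map_eqD[OF assms(1) this eq] show "u = v" using aux u v by metis
qed

lemma thicken_collar:
  fixes E :: "real ^ 'n::finite \<Rightarrow> real ^ 'n"
  assumes c: "c > 1" and E: "smooth_on (- {0}) E"
    and sph: "\<And>y. norm y = 1 \<Longrightarrow> jac E y > 0 \<and> E y \<noteq> 0" and inj: "inj_on (\<lambda>y. cover_map c (E y)) (sphere 0 1)"
  obtains \<epsilon> where "0 < \<epsilon>" "\<epsilon> < 1" "\<And>y. y \<in> ann (1 - \<epsilon>) (1 + \<epsilon>) \<Longrightarrow> jac E y > 0 \<and> E y \<noteq> 0"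
    "inj_on (\<lambda>y. cover_map c (E y)) (ann (1 - \<epsilon>) (1 + \<epsilon>))"
proof -
  have contE: "continuous_on (- {0}) E" using E by (rule smooth_on_imp_continuous_on)
  define C where "C = {y :: real ^ 'n. 1 / 2 \<le> norm y \<and> norm y \<le> 3 / 2} \<inter> {y. E y = 0 \<or> jac E y \<le> 0}"
  have C: "compact {y :: real ^ 'n. 1 / 2 \<le> norm y \<and> norm y \<le> 3 / 2}" by (rule compact_closed_annulus)
  have sub: "{y :: real ^ 'n. 1 / 2 \<le> norm y \<and> norm y \<le> 3 / 2} \<subseteq> - {0}" by auto
  obtain r where r: "r > 0" "\<And>y. \<bar>norm y - 1\<bar> < r \<Longrightarrow> y \<notin> C"
  proof (rule avoid_sphere[of C 1])
    have cj: "continuous_on {y :: real ^ 'n. 1 / 2 \<le> norm y \<and> norm y \<le> 3 / 2} (jac E)"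
      and ce: "continuous_on {y :: real ^ 'n. 1 / 2 \<le> norm y \<and> norm y \<le> 3 / 2} E"
      using smooth_on_imp_continuous_on[OF smooth_on_jac[OF E]] contE sub continuous_on_subset by blast+
    have "closedin (top_of_set {y :: real ^ 'n. 1 / 2 \<le> norm y \<and> norm y \<le> 3 / 2})
        ({y :: real ^ 'n. 1 / 2 \<le> norm y \<and> norm y \<le> 3 / 2} \<inter> E -` {0})"
      "closedin (top_of_set {y :: real ^ 'n. 1 / 2 \<le> norm y \<and> norm y \<le> 3 / 2})
        ({y :: real ^ 'n. 1 / 2 \<le> norm y \<and> norm y \<le> 3 / 2} \<inter> jac E -` {..0})"
      by (intro continuous_closedin_preimage ce cj; simp)+
    from closedin_compact[OF C closedin_Un[OF this]]
    show "compact C" unfolding C_def by (rule back_subst[of compact]) auto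
    show "norm y \<noteq> 1" if "y \<in> C" for y using that sph[of y] by (auto simp: C_def)
  qed blast
  define \<rho> where "\<rho> = min r (1 / 2)"
  have \<rho>: "0 < \<rho>" "\<rho> \<le> 1 / 2" "\<rho> \<le> r" using r by (auto simp: \<rho>_def)
  have good: "jac E y > 0 \<and> E y \<noteq> 0" if "y \<in> ann (1 - \<rho>) (1 + \<rho>)" for y
  proof -
    have "1 - \<rho> < norm y" "norm y < 1 + \<rho>" using that by auto
    then have "1 / 2 \<le> norm y" "norm y \<le> 3 / 2" "\<bar>norm y - 1\<bar> < r" using \<rho> by linarith+
    then show ?thesis using r(2)[of y] unfolding C_def by auto
  qed
  have sub\<rho>: "ann (1 - \<rho>) (1 + \<rho>) \<subseteq> - {0 :: real ^ 'n}" using \<rho> by auto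
  have cont: "continuous_on (ann (1 - \<rho>) (1 + \<rho>)) (\<lambda>y. cover_map c (E y))"
    by (rule continuous_on_compose2[OF smooth_on_imp_continuous_on[OF smooth_on_cover_map[OF c]] continuous_on_subset[OF contE sub\<rho>]])
       (use good in auto)
  have loc: "\<exists>r>0. inj_on (\<lambda>y. cover_map c (E y)) (ball x r)" if x: "norm x = 1" for x
  proof -
    have x0: "x \<in> - {0}" and jx: "jac E x \<noteq> 0" and Ex: "E x \<noteq> 0" using x sph[OF x] by auto
    obtain s where s: "s > 0" "emb (ball x s) E"
      by (rule emb_locally_injective[OF E x0 jx]) blast
    \<comment> \<open>Chosen such that \<open>norm (E x)\<close> lies strictly between
      \<open>m\<close> and \<open>c * m\<close>.\<close>
    define m where "m = 2 * norm (E x) / (1 + c)"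
    have m: "m > 0" using c Ex by (simp add: m_def)
    have "m < norm (E x)" "norm (E x) < c * m" using c Ex by (auto simp: m_def field_simps)
    then have "x \<in> ball x s \<inter> E -` ann m (c * m)" using s by simp
    moreover have "open (ball x s \<inter> E -` ann m (c * m))"
      by (rule continuous_open_preimage[OF embD(5)[OF s(2)]]) auto
    ultimately obtain t where t: "t > 0" "ball x t \<subseteq> ball x s \<inter> E -` ann m (c * m)"
      using open_contains_ball by blast
    have "inj_on E (ball x t)" using embD(3)[OF s(2)] t(2) by (auto intro: inj_on_subset)
    moreover have "inj_on (cover_map c) (E ` ball x t)"
      by (rule inj_on_subset[OF inj_on_cover_map[OF c m]]) (use t(2) in auto)
    ultimately have "inj_on (cover_map c \<circ> E) (ball x t)" by (rule comp_inj_on)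
    then show ?thesis using t(1) by (auto simp: o_def)
  qed
  have \<rho>1: "\<rho> \<le> 1" using \<rho> by simp
  obtain d where d: "0 < d" "d < \<rho>" "inj_on (\<lambda>y. cover_map c (E y)) (ann (1 - d) (1 + d))"
    by (rule injective_near_sphere[OF \<rho>(1) \<rho>1 cont inj loc]) blast+
  show ?thesis
  proof (rule that[OF d(1) _ _ d(3)])
    show "d < 1" using d \<rho> by simp
    show "jac E y > 0 \<and> E y \<noteq> 0" if "y \<in> ann (1 - d) (1 + d)" for y
      by (rule good) (use that d(2) in auto)
  qed
qed

text \<open>Jordan-Brouwer gives at least two complementary components. There are at most two
  because every component comes up to the collar, whose two halves are connected.\<close>

lemma two_sides:
  fixes E :: "real ^ 'n::finite \<Rightarrow> real ^ 'n"
  assumes card: "CARD('n) \<ge> 2" and eps: "0 < \<epsilon>" "\<epsilon> < 1" and E: "emb (ann (1 - \<epsilon>) (1 + \<epsilon>)) E"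
  obtains A B where "open A" "open B" "connected A" "connected B" "A \<inter> B = {}"
    "A \<inter> E ` sphere 0 1 = {}" "B \<inter> E ` sphere 0 1 = {}" "A \<union> E ` sphere 0 1 \<union> B = UNIV"
    "E ` ann (1 - \<epsilon>) 1 \<subseteq> A" "E ` ann 1 (1 + \<epsilon>) \<subseteq> B" "bounded A \<or> bounded B"
proof -
  let ?D = "ann (1 - \<epsilon>) (1 + \<epsilon>) :: (real ^ 'n) set"
  let ?I = "ann (1 - \<epsilon>) 1 :: (real ^ 'n) set" and ?O = "ann 1 (1 + \<epsilon>) :: (real ^ 'n) set"
  define S where "S = E ` sphere 0 1"
  note e = embD[OF E]
  have sD: "sphere 0 1 \<subseteq> ?D" using eps by auto
  have ID: "?I \<subseteq> ?D" and OD: "?O \<subseteq> ?D" using eps by auto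
  have cS: "compact S" unfolding S_def
    by (intro compact_continuous_image continuous_on_subset[OF e(5) sD]) auto
  have oS: "open (- S)" using cS by (simp add: compact_imp_closed open_Compl)
  have off: "E y \<notin> S" if "y \<in> ?D" "norm y \<noteq> 1" for y
  proof
    assume "E y \<in> S"
    then obtain z where z: "norm z = 1" "E y = E z" by (auto simp: S_def)
    moreover have "z \<in> ?D" using z(1) sD by auto
    ultimately have "y = z" using inj_onD[OF e(3)] that(1) by blast
    then show False using that(2) z(1) by simp
  qed
  have hom: "S homeomorphic sphere (0 :: real ^ 'n) 1"
  proof -
    have "sphere (0 :: real ^ 'n) 1 homeomorphic S"
      by (rule homeomorphic_compact[where f = E])
         (auto simp: S_def intro: continuous_on_subset[OF e(5) sD] inj_on_subset[OF e(3) sD])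
    then show ?thesis by (rule homeomorphic_sym[THEN iffD1])
  qed
  have nc: "\<not> connected (- S)" by (rule Jordan_Brouwer_separation[OF hom]) simp
  obtain b :: "real ^ 'n" where b: "norm b = 1" using vector_choose_size[of 1] by auto
  define x0 where "x0 = (1 - \<epsilon> / 2) *\<^sub>R b"
  define x1 where "x1 = (1 + \<epsilon> / 2) *\<^sub>R b"
  have x0: "x0 \<in> ?I" and x1: "x1 \<in> ?O" using eps b by (auto simp: x0_def x1_def)
  define A where "A = connected_component_set (- S) (E x0)"
  define B where "B = connected_component_set (- S) (E x1)"
  have EI: "E ` ?I \<subseteq> - S" and EO: "E ` ?O \<subseteq> - S" using off ID OD by fastforce+
  have "connected (E ` ?I)" "connected (E ` ?O)"
    by (intro connected_continuous_image continuous_on_subset[OF e(5)] connected_ann[OF card] ID OD)+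
  then have IA: "E ` ?I \<subseteq> A" and OB: "E ` ?O \<subseteq> B" unfolding A_def B_def
    using connected_component_maximal[OF imageI[OF x0] _ EI] connected_component_maximal[OF imageI[OF x1] _ EO] by blast+
  \<comment> \<open>The frontier of each component is all of \<open>S\<close>, so the component
    accumulates at \<open>E b\<close> and meets the open image of the collar, off
    \<open>S\<close>.\<close>
  have only: "T = A \<or> T = B" if T: "T \<in> components (- S)" for T
  proof -
    have "frontier T = S" by (rule Jordan_Brouwer_frontier[OF hom T]) (use card in simp)
    then have "E b \<in> closure T" using b by (auto simp: frontier_def S_def)
    moreover have "E b \<in> E ` ?D" using b eps by auto
    moreover have "open (E ` ?D)" by (rule emb_image_open[OF E]) auto
    ultimately have "E ` ?D \<inter> T \<noteq> {}" using open_Int_closure_eq_empty[of "E ` ?D" T] by blast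
    then obtain y where y: "y \<in> ?D" "E y \<in> T" by blast
    have "norm y \<noteq> 1" using y(2) in_components_subset[OF T] by (auto simp: S_def)
    then consider "y \<in> ?I" | "y \<in> ?O" using y(1) by fastforce
    then have "E y \<in> A \<or> E y \<in> B" using IA OB by cases blast+
    moreover obtain t where t: "T = connected_component_set (- S) t" using T by (rule componentsE)
    have "T = connected_component_set (- S) (E y)"
      using y(2) connected_component_eq[of "E y" "- S" t] unfolding t by simp
    ultimately show ?thesis
      using connected_component_eq[of "E y" "- S" "E x0"] connected_component_eq[of "E y" "- S" "E x1"]
      unfolding A_def B_def by argo
  qed
  have cover: "- S = A \<union> B"
  proof
    show "A \<union> B \<subseteq> - S" unfolding A_def B_def using connected_component_subset by blast
    show "- S \<subseteq> A \<union> B"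
      using only Union_components[of "- S"] by blast
  qed
  have AB: "A \<noteq> B"
  proof
    assume "A = B"
    then have "- S = A" using cover by simp
    then show False using nc connected_connected_component[of "- S" "E x0"] by (simp add: A_def)
  qed
  have dis: "A \<inter> B = {}" using AB connected_component_nonoverlap[of "- S" "E x0" "E x1"] unfolding A_def B_def by blast
  have cA: "connected A" and cB: "connected B" by (simp_all add: A_def B_def)
  have oA: "open A" and oB: "open B" using oS by (simp_all add: A_def B_def open_connected_component)
  have "bounded A \<or> bounded B"
  proof -
    obtain R where R: "S \<subseteq> ball 0 R" using compact_imp_bounded[OF cS] bounded_subset_ballD by blast
    have "connected (- ball (0 :: real ^ 'n) R)" by (rule connected_complement_bounded_convex) (use card in auto)
    moreover have "- ball 0 R \<subseteq> A \<union> B" using R cover by blast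
    ultimately have "- ball 0 R \<inter> A = {} \<or> - ball 0 R \<inter> B = {}"
      using connectedD[OF _ oA oB, of "- ball 0 R"] dis by blast
    then have "A \<subseteq> ball 0 R \<or> B \<subseteq> ball 0 R" by blast
    then show ?thesis using bounded_ball bounded_subset by blast
  qed
  then show ?thesis
    using that[OF oA oB cA cB dis _ _ _ IA OB] cover by (auto simp: S_def)
qed

text \<open>Inversion composed with a reflection exchanges the two ends and keeps the orientation.\<close>

lemma end_exchange:
  assumes card: "CARD('n::finite) \<ge> 2"
  obtains h :: "real ^ 'n \<Rightarrow> real ^ 'n"
  where "smooth_on (- {0}) h" "\<And>y. norm (h y) = inverse (norm y)" "\<And>y. h (h y) = y" "\<And>y. y \<noteq> 0 \<Longrightarrow> jac h y > 0"
proof -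
  obtain u :: "real ^ 'n" where u: "norm u = 1" using vector_choose_size[of 1] by auto
  have uu: "u \<bullet> u = 1" using u by (simp add: norm_eq_1)
  define r where "r = (\<lambda>w. w - (2 * (u \<bullet> w)) *\<^sub>R u)"
  define h where "h = (\<lambda>y. r (inversion y))"
  have lin: "linear r" unfolding r_def
    by (rule linearI) (simp_all add: inner_right_distrib algebra_simps)
  have rr: "r (r w) = w" for w by (simp add: r_def inner_diff_right uu algebra_simps)
  have nr: "norm (r w) = norm w" for w
  proof -
    have "r w \<bullet> r w = w \<bullet> w" by (simp add: r_def inner_diff_left inner_diff_right uu inner_commute algebra_simps)
    then show ?thesis by (simp add: norm_eq_sqrt_inner)
  qed
  have sm: "smooth_on (- {0}) h" unfolding h_def
    by (rule smooth_on_linear[OF _ smooth_on_inversion]) (use lin in \<open>simp add: linear_conv_bounded_linear\<close>)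
  have nh: "norm (h y) = inverse (norm y)" for y by (simp add: h_def nr)
  have hh: "h (h y) = y" for y
  proof -
    have "norm (h y) * norm (h y) = inverse (norm y * norm y)" by (simp add: nh)
    then have "h y \<bullet> h y = inverse (y \<bullet> y)" by (simp add: dot_square_norm power2_eq_square)
    then have "h (h y) = r ((y \<bullet> y) *\<^sub>R r (inverse (y \<bullet> y) *\<^sub>R y))"
      by (simp add: h_def inversion_def)
    also have "\<dots> = ((y \<bullet> y) * inverse (y \<bullet> y)) *\<^sub>R r (r y)"
      using lin by (simp add: linear_scale)
    finally show ?thesis by (cases "y = 0") (simp_all add: rr)
  qed
  have nz: "jac h y \<noteq> 0" if y: "y \<noteq> 0" for y
  proof -
    have hy: "h y \<noteq> 0" using nh[of y] y by auto
    have "jac (\<lambda>y. h (h y)) y = jac h (h y) * jac h y"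
      by (rule jac_compose; rule smooth_on_differentiable[OF sm]) (use y hy in auto)
    then show ?thesis by (auto simp: hh)
  qed
  have ju: "jac h u = 1"
  proof -
    have "((\<lambda>y. y \<bullet> y) has_derivative (\<lambda>v. u \<bullet> v + v \<bullet> u)) (at u)" by (rule has_derivative_inner[OF has_derivative_ident has_derivative_ident])
    then have "((\<lambda>y. inverse (y \<bullet> y)) has_derivative (\<lambda>v. - (inverse (u \<bullet> u) * (u \<bullet> v + v \<bullet> u) * inverse (u \<bullet> u)))) (at u)"
      by (rule Deriv.has_derivative_inverse[rotated]) (simp add: uu)
    from has_derivative_scaleR[OF this has_derivative_ident]
    have inv: "(inversion has_derivative r) (at u)"
      by (simp add: inversion_def[abs_def] r_def uu inner_commute algebra_simps)
    from has_derivative_compose[OF inv linear_imp_has_derivative[OF lin]]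
    have "(h has_derivative (\<lambda>v. r (r v))) (at u)"
      unfolding h_def by blast
    then have "(h has_derivative (\<lambda>v. v)) (at u)" by (simp add: rr)
    from frechet_derivative_eqI[OF this] show ?thesis by (simp add: jac_def matrix_id_mat_1[unfolded id_def])
  qed
  have "jac h y > 0" if y: "y \<noteq> 0" for y
    by (rule jac_sign_const[OF sm connected_punctured[OF card], of u])
       (use nz y u ju in auto)
  then show ?thesis using that sm nh hh by blast
qed

text \<open>The orientation of the collar is already fixed, so the bounded side may turn out to be
  the outer one. Exchanging the ends by an orientation preserving involution then reverses the
  collar and keeps the Jacobian positive.\<close>

lemma bounded_inner_side:
  fixes E :: "real ^ 'n::finite \<Rightarrow> real ^ 'n"
  assumes card: "CARD('n) \<ge> 2" and c: "c > 1" and eps: "0 < \<epsilon>" "\<epsilon> < 1" and sE: "smooth_on (- {0}) E"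
    and jE: "\<And>y. y \<in> ann (1 - \<epsilon>) (1 + \<epsilon>) \<Longrightarrow> jac E y > 0 \<and> E y \<noteq> 0"
    and inj: "inj_on (\<lambda>y. cover_map c (E y)) (ann (1 - \<epsilon>) (1 + \<epsilon>))"
  obtains F \<delta> A B where "0 < \<delta>" "\<delta> < 1" "emb (ann (1 - \<delta>) (1 + \<delta>)) F"
    "\<And>y. y \<in> ann (1 - \<delta>) (1 + \<delta>) \<Longrightarrow> jac F y > 0 \<and> F y \<noteq> 0"
    "inj_on (\<lambda>y. cover_map c (F y)) (ann (1 - \<delta>) (1 + \<delta>))" "F ` sphere 0 1 = E ` sphere 0 1"
    "open A" "open B" "connected A" "connected B" "A \<inter> B = {}"
    "A \<inter> F ` sphere 0 1 = {}" "B \<inter> F ` sphere 0 1 = {}" "A \<union> F ` sphere 0 1 \<union> B = UNIV"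
    "F ` ann (1 - \<delta>) 1 \<subseteq> A" "F ` ann 1 (1 + \<delta>) \<subseteq> B" "bounded A"
proof -
  let ?D = "ann (1 - \<epsilon>) (1 + \<epsilon>) :: (real ^ 'n) set"
  have sD: "smooth_on ?D E" by (rule smooth_on_subset[OF sE]) (use eps in auto)
  have embI: "emb D G" if "smooth_on D G" "\<And>y. y \<in> D \<Longrightarrow> jac G y > 0 \<and> G y \<noteq> 0" "inj_on (\<lambda>y. cover_map c (G y)) D"
    for D :: "(real ^ 'n) set" and G :: "real ^ 'n \<Rightarrow> real ^ 'n"
    using that inj_on_imageI2[of "cover_map c" G D] by (force simp: emb_def o_def)
  have eE: "emb ?D E" by (rule embI[OF sD jE inj])
  obtain A B where AB: "open A" "open B" "connected A" "connected B" "A \<inter> B = {}"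
    "A \<inter> E ` sphere 0 1 = {}" "B \<inter> E ` sphere 0 1 = {}" "A \<union> E ` sphere 0 1 \<union> B = UNIV"
    "E ` ann (1 - \<epsilon>) 1 \<subseteq> A" "E ` ann 1 (1 + \<epsilon>) \<subseteq> B" "bounded A \<or> bounded B"
    by (rule two_sides[OF card eps eE]) blast
  show ?thesis
  proof (cases "bounded A")
    case True
    show ?thesis by (rule that[OF eps eE jE inj refl AB(1-10) True])
  next
    case False
    then have bB: "bounded B" using AB(11) by simp
    obtain h :: "real ^ 'n \<Rightarrow> real ^ 'n" where h: "smooth_on (- {0}) h" "\<And>y. norm (h y) = inverse (norm y)"
      "\<And>y. h (h y) = y" "\<And>y. y \<noteq> 0 \<Longrightarrow> jac h y > 0"
      by (rule end_exchange[OF card]) blast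
    \<comment> \<open>Half the thickness suffices for inverses of radii near 1 to stay within the
      original collar.\<close>
    define \<delta> where "\<delta> = \<epsilon> / 2"
    have d: "0 < \<delta>" "\<delta> < 1" using eps by (auto simp: \<delta>_def)
    have b1: "1 - \<epsilon> < inverse t \<and> inverse t < 1 + \<epsilon>" if "1 - \<delta> < t" "t < 1 + \<delta>" for t
    proof -
      have t: "t > 0" using that d by simp
      have "(1 - \<epsilon>) * t < 1"
      proof -
        have "(1 - \<epsilon>) * t < (1 - \<epsilon>) * (1 + \<delta>)" using that(2) eps by simp
        also have "\<dots> \<le> 1" using eps by (simp add: \<delta>_def algebra_simps)
        finally show ?thesis .
      qed
      moreover have "1 < (1 + \<epsilon>) * t"
      proof -
        have "\<epsilon> * \<epsilon> \<le> \<epsilon> * 1" using eps by (intro mult_left_mono) auto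
        then have "1 \<le> (1 + \<epsilon>) * (1 - \<delta>)" by (simp add: \<delta>_def algebra_simps)
        also have "\<dots> < (1 + \<epsilon>) * t" using that(1) eps by simp
        finally show ?thesis .
      qed
      ultimately show ?thesis using t by (simp add: field_simps)
    qed
    let ?D' = "ann (1 - \<delta>) (1 + \<delta>) :: (real ^ 'n) set"
    define F where "F = (\<lambda>y. E (h y))"
    have hD: "h y \<in> ?D" if "y \<in> ?D'" for y using b1[of "norm y"] that by (simp add: h(2))
    have D0: "?D' \<subseteq> - {0}" using d by auto
    have sh: "smooth_on ?D' h" by (rule smooth_on_subset[OF h(1) _ D0]) simp
    have sF: "smooth_on ?D' F" unfolding F_def
      by (rule smooth_on_compose[OF sh sD]) (use hD in blast)
    have jF: "jac F y > 0 \<and> F y \<noteq> 0" if y: "y \<in> ?D'" for y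
    proof -
      have "jac F y = jac E (h y) * jac h y" unfolding F_def
        by (rule jac_compose[OF smooth_on_differentiable[OF sh y] smooth_on_differentiable[OF sD hD[OF y]]])
      moreover have "y \<noteq> 0" using y D0 by blast
      ultimately show ?thesis using jE[OF hD[OF y]] h(4)[of y] by (simp add: F_def)
    qed
    have injF: "inj_on (\<lambda>y. cover_map c (F y)) ?D'"
    proof (rule inj_onI)
      fix x y assume x: "x \<in> ?D'" and y: "y \<in> ?D'" and eq: "cover_map c (F x) = cover_map c (F y)"
      have "h x = h y" by (rule inj_onD[OF inj _ hD[OF x] hD[OF y]]) (use eq in \<open>simp add: F_def\<close>)
      from arg_cong[OF this, of h] show "x = y" by (simp only: h(3))
    qed
    have "h ` sphere 0 1 = sphere 0 1"
    proof
      show "h ` sphere 0 1 \<subseteq> sphere 0 1" by (auto simp: h(2))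
      show "sphere 0 1 \<subseteq> h ` sphere 0 1"
      proof
        fix y assume "y \<in> sphere (0 :: real ^ 'n) 1"
        then have "h y \<in> sphere 0 1" by (simp add: h(2))
        then show "y \<in> h ` sphere 0 1" using h(3)[of y] by (metis image_eqI)
      qed
    qed
    then have im: "F ` sphere 0 1 = E ` sphere 0 1" by (simp add: F_def image_image[symmetric])
    have iI: "F ` ann (1 - \<delta>) 1 \<subseteq> B"
    proof
      fix w assume "w \<in> F ` ann (1 - \<delta>) 1"
      then obtain y where y: "y \<in> ann (1 - \<delta>) 1" "w = E (h y)" by (auto simp: F_def)
      then have "y \<in> ?D'" using d by auto
      from hD[OF this] have "norm (h y) < 1 + \<epsilon>" by simp
      moreover have "norm y > 0" "norm y < 1" using y d by auto
      then have "norm (h y) > 1" by (simp add: h(2) one_less_inverse_iff del: zero_less_norm_iff)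
      ultimately show "w \<in> B" using AB(10) y(2) by auto
    qed
    have iO: "F ` ann 1 (1 + \<delta>) \<subseteq> A"
    proof
      fix w assume "w \<in> F ` ann 1 (1 + \<delta>)"
      then obtain y where y: "y \<in> ann 1 (1 + \<delta>)" "w = E (h y)" by (auto simp: F_def)
      then have "y \<in> ?D'" using d by auto
      from hD[OF this] have "1 - \<epsilon> < norm (h y)" by simp
      moreover have "norm y > 1" using y d by auto
      then have "norm (h y) < 1" by (simp add: h(2) inverse_less_1_iff del: zero_less_norm_iff)
      ultimately show "w \<in> A" using AB(9) y(2) by auto
    qed
    show ?thesis
      by (rule that[OF d embI[OF sF jF injF] jF injF im AB(2,1,4,3) _ _ _ _ iI iO bB]) (use AB im in auto)
  qed
qed

text \<open>This is where non-separation enters. If 0 were outside, the compact set \<open>K\<close>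
  would miss the origin and all its boundary translates would lie in \<open>B\<close>. Then the
  images of \<open>A\<close> and of the complement of \<open>K\<close> would separate the product
  along the given sphere.\<close>

lemma zero_inside:
  fixes F :: "real ^ 'n::finite \<Rightarrow> real ^ 'n"
  assumes card: "CARD('n) \<ge> 2" and c: "c > 1" and eps: "0 < \<epsilon>" "\<epsilon> < 1" and eF: "emb (ann (1 - \<epsilon>) (1 + \<epsilon>)) F"
    and F0: "\<And>y. y \<in> ann (1 - \<epsilon>) (1 + \<epsilon>) \<Longrightarrow> F y \<noteq> 0"
    and inj: "inj_on (\<lambda>y. cover_map c (F y)) (ann (1 - \<epsilon>) (1 + \<epsilon>))"
    and A: "open A" and B: "open B" and AB: "A \<inter> B = {}" and AS: "A \<inter> F ` sphere 0 1 = {}" and BS: "B \<inter> F ` sphere 0 1 = {}"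
    and cover: "A \<union> F ` sphere 0 1 \<union> B = UNIV" and inner: "F ` ann (1 - \<epsilon>) 1 \<subseteq> A" and outer: "F ` ann 1 (1 + \<epsilon>) \<subseteq> B"
    and bA: "bounded A" and conn: "connected (S1_times_Sn - (\<lambda>y. cover_map c (F y)) ` sphere 0 1)"
  shows "0 \<in> A"
proof (rule ccontr)
  assume nA: "0 \<notin> A"
  let ?D = "ann (1 - \<epsilon>) (1 + \<epsilon>) :: (real ^ 'n) set"
  let ?q = "cover_map c :: real ^ 'n \<Rightarrow> complex \<times> (real ^ 'n)"
  define S where "S = F ` sphere 0 1"
  define K where "K = A \<union> S"
  note e = embD[OF eF]
  have sD: "sphere 0 1 \<subseteq> ?D" using eps by auto
  have cS: "compact S" unfolding S_def
    by (intro compact_continuous_image continuous_on_subset[OF e(5) sD]) auto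
  have connS: "connected S" unfolding S_def
    by (intro connected_continuous_image continuous_on_subset[OF e(5) sD] connected_sphere) (use card in auto)
  have S0: "0 \<notin> S" using F0 sD unfolding S_def by force
  have K: "K = - B" using AB BS cover by (auto simp: K_def S_def)
  have cK: "compact K"
  proof (rule compact_eq_bounded_closed[THEN iffD2], intro conjI)
    show "bounded K" using bA compact_imp_bounded[OF cS] by (simp add: K_def)
    show "closed K" using B by (simp add: K closed_Compl)
  qed
  have K0: "0 \<notin> K" using nA S0 by (simp add: K_def)
  obtain b :: "real ^ 'n" where b: "norm b = 1" using vector_choose_size[of 1] by auto
  have Kne: "K \<noteq> {}" "F b \<in> S" using b by (auto simp: K_def S_def)
  \<comment> \<open>The nontrivial deck transformations; both signs are included, since largest and
    smallest norms are treated separately.\<close>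
  define G where "G = (\<lambda>a. \<exists>k::nat. k > 0 \<and> (a = c ^ k \<or> a = 1 / c ^ k))"
  have G: "a > 0" "a \<noteq> 1" "y \<noteq> 0 \<Longrightarrow> ?q (a *\<^sub>R y) = ?q y" if Ga: "G a" for a y
  proof -
    obtain k :: nat where k: "k > 0" "a = c ^ k \<or> a = 1 / c ^ k" using Ga unfolding G_def by blast
    have ck: "c ^ k > 1" using c k(1) by (simp add: one_less_power)
    show "a > 0" "a \<noteq> 1" using k(2) ck c by auto
    assume y: "y \<noteq> 0"
    from k(2) show "?q (a *\<^sub>R y) = ?q y"
    proof
      assume "a = c ^ k"
      then show ?thesis using cover_map_scale[OF c y] by simp
    next
      assume a: "a = 1 / c ^ k"
      then have "?q (c ^ k *\<^sub>R (a *\<^sub>R y)) = ?q (a *\<^sub>R y)" using cover_map_scale[OF c, of "a *\<^sub>R y" k] y c by simp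
      then show ?thesis using a c by simp
    qed
  qed
  have disj: "a *\<^sub>R F y \<notin> S" if "G a" "y \<in> ?D" for a y
  proof
    assume "a *\<^sub>R F y \<in> S"
    then obtain z where z: "norm z = 1" "a *\<^sub>R F y = F z" by (auto simp: S_def)
    have "?q (F y) = ?q (F z)" using G(3)[OF that(1) F0[OF that(2)]] z(2) by simp
    moreover have "z \<in> ?D" using z(1) sD by auto
    ultimately have "y = z" using inj_onD[OF inj] that(2) by blast
    then have "(a - 1) *\<^sub>R F y = 0" using z(2) by (simp add: algebra_simps)
    then show False using G(2)[OF that(1)] F0[OF that(2)] by simp
  qed
  have toB: "a *\<^sub>R w \<in> B" if a: "G a" and w: "w \<in> S" and p: "p \<in> S" "a *\<^sub>R p \<in> B" for a w p
  proof -
    have "(\<lambda>w. a *\<^sub>R w) ` S \<subseteq> B"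
    proof (rule connected_in_open_cover[OF _ B A])
      show "a *\<^sub>R p \<in> (\<lambda>w. a *\<^sub>R w) ` S" using p(1) by (rule imageI)
      show "a *\<^sub>R p \<in> B" by (rule p(2))
      show "connected ((\<lambda>w. a *\<^sub>R w) ` S)" by (intro connected_continuous_image continuous_intros connS)
      show "B \<inter> A = {}" using AB by blast
      show "(\<lambda>w. a *\<^sub>R w) ` S \<subseteq> B \<union> A"
        using disj[OF a] sD cover unfolding S_def by blast
    qed
    then show ?thesis using w by blast
  qed
  text \<open>The points of \<open>K\<close> of largest and of smallest norm lie on \<open>S\<close>, and scaling them leaves \<open>K\<close>.\<close>
  have nudge: "\<exists>t>0. (1 + t) *\<^sub>R p \<in> A \<and> (1 - t) *\<^sub>R p \<in> A \<and> t < 1" if "p \<in> A" for p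
  proof -
    obtain r where r: "r > 0" "ball p r \<subseteq> A" using A \<open>p \<in> A\<close> open_contains_ball by blast
    define t where "t = min (1 / 2) (r / (2 * (norm p + 1)))"
    have "r / (2 * (norm p + 1)) > 0" using r(1) by (simp add: add_nonneg_pos)
    then have t: "t > 0" "t \<le> 1 / 2" "t \<le> r / (2 * (norm p + 1))"
      by (simp_all only: t_def min.cobounded1 min.cobounded2 min_less_iff_conj) simp
    have "t * norm p \<le> r / (2 * (norm p + 1)) * norm p" using t by (intro mult_right_mono) auto
    also have "\<dots> \<le> r / 2" using r(1) by (simp add: divide_simps add_nonneg_pos)
    also have "\<dots> < r" using r(1) by simp
    finally have "norm (t *\<^sub>R p) < r" using t(1) by simp
    then have "(1 + t) *\<^sub>R p \<in> ball p r" "(1 - t) *\<^sub>R p \<in> ball p r"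
      by (simp_all add: dist_norm algebra_simps)
    then show ?thesis using r(2) t by (intro exI[of _ t]) auto
  qed
  have SB: "a *\<^sub>R w \<in> B" if a: "G a" and w: "w \<in> S" for a w
  proof -
    obtain k :: nat where k: "k > 0" "a = c ^ k \<or> a = 1 / c ^ k" using a unfolding G_def by blast
    have ck: "c ^ k > 1" using c k(1) by (simp add: one_less_power)
    from k(2) show ?thesis
    proof
      assume a': "a = c ^ k"
      obtain p where p: "p \<in> K" "\<And>y. y \<in> K \<Longrightarrow> norm y \<le> norm p"
        using continuous_attains_sup[OF cK Kne(1), of norm] continuous_on_norm_id by blast
      have p0: "norm p > 0" using p K0 by auto
      have "p \<notin> A"
      proof
        assume "p \<in> A"
        then obtain t where t: "t > 0" "(1 + t) *\<^sub>R p \<in> A" using nudge by blast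
        then have "norm ((1 + t) *\<^sub>R p) \<le> norm p" by (intro p(2)) (simp add: K_def)
        then show False using t(1) p0 by (simp add: mult_le_cancel_right1)
      qed
      then have pS: "p \<in> S" using p(1) by (simp add: K_def)
      have "a *\<^sub>R p \<notin> K"
      proof
        assume "a *\<^sub>R p \<in> K"
        then have "norm (a *\<^sub>R p) \<le> norm p" by (rule p(2))
        then show False using a' ck p0 by (simp add: mult_le_cancel_right1)
      qed
      then show ?thesis using toB[OF a w pS] by (simp add: K)
    next
      assume a': "a = 1 / c ^ k"
      obtain p where p: "p \<in> K" "\<And>y. y \<in> K \<Longrightarrow> norm p \<le> norm y"
        using continuous_attains_inf[OF cK Kne(1), of norm] continuous_on_norm_id by blast
      have p0: "norm p > 0" using p K0 by auto
      have "p \<notin> A"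
      proof
        assume "p \<in> A"
        then obtain t where t: "t > 0" "(1 - t) *\<^sub>R p \<in> A" "t < 1" using nudge by blast
        then have "norm p \<le> norm ((1 - t) *\<^sub>R p)" by (intro p(2)) (simp add: K_def)
        then show False using t p0 by (simp add: mult_le_cancel_right2)
      qed
      then have pS: "p \<in> S" using p(1) by (simp add: K_def)
      have a1: "a < 1" "a > 0" using a' ck by auto
      have "a *\<^sub>R p \<notin> K"
      proof
        assume "a *\<^sub>R p \<in> K"
        then have "norm p \<le> norm (a *\<^sub>R p)" by (rule p(2))
        then show False using a1 p0 by (simp add: mult_le_cancel_right2)
      qed
      then show ?thesis using toB[OF a w pS] by (simp add: K)
    qed
  qed
  have collar_B: "a *\<^sub>R F y \<in> B" if a: "G a" and y: "y \<in> ?D" for a y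
  proof -
    have "(\<lambda>y. a *\<^sub>R F y) ` ?D \<subseteq> B"
    proof (rule connected_in_open_cover[OF _ B A])
      show "connected ((\<lambda>y. a *\<^sub>R F y) ` ?D)"
        by (intro connected_continuous_image continuous_intros e(5) connected_ann[OF card])
      show "B \<inter> A = {}" using AB by blast
      show "(\<lambda>y. a *\<^sub>R F y) ` ?D \<subseteq> B \<union> A" using disj[OF a] cover unfolding S_def by blast
      show "a *\<^sub>R F b \<in> (\<lambda>y. a *\<^sub>R F y) ` ?D" using b sD by auto
      show "a *\<^sub>R F b \<in> B" by (rule SB[OF a Kne(2)])
    qed
    then show ?thesis using y by blast
  qed
  \<comment> \<open>A point just outside the sphere and all its translates lie in \<open>B\<close>,
    so its image is not hit by \<open>K\<close>; this makes the second of the two separating sets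
    nonempty.\<close>
  have outer_q: "?q (F y) \<notin> ?q ` K" if y: "y \<in> ann 1 (1 + \<epsilon>)" for y
  proof
    assume "?q (F y) \<in> ?q ` K"
    then obtain v where v: "v \<in> K" "?q v = ?q (F y)" by force
    have yD: "y \<in> ?D" using y eps by auto
    have FB: "F y \<in> B" using outer y by blast
    have v0: "v \<noteq> 0" using v(1) K0 by auto
    have "\<exists>a. (a = 1 \<or> G a) \<and> v = a *\<^sub>R F y"
    proof (rule cover_map_eqD[OF c v0 F0[OF yD] v(2)])
      fix k assume "v = c ^ k *\<^sub>R F y"
      then show ?thesis by (cases "k = 0") (auto simp: G_def)
    next
      fix k assume "F y = c ^ k *\<^sub>R v"
      then have "v = (1 / c ^ k) *\<^sub>R F y" using c by simp
      then show ?thesis by (cases "k = 0") (auto simp: G_def)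
    qed
    then have "v \<in> B" using FB collar_B[OF _ yD] by auto
    then show False using v(1) by (simp add: K)
  qed
  define \<Sigma> where "\<Sigma> = (\<lambda>y. ?q (F y)) ` sphere 0 1"
  have \<Sigma>: "\<Sigma> = ?q ` S" by (simp add: \<Sigma>_def S_def image_image)
  \<comment> \<open>The image of \<open>A\<close> is open only relative to the product;
    \<open>U\<close> collects the ambient open sets whose trace on the product lies in it.\<close>
  define U where "U = \<Union>{V. open V \<and> S1_times_Sn \<inter> V \<subseteq> ?q ` A}"
  define V where "V = - ?q ` K"
  have oU: "open U" by (auto simp: U_def)
  have "compact (?q ` K)"
    by (intro compact_continuous_image continuous_on_subset[OF smooth_on_imp_continuous_on[OF smooth_on_cover_map[OF c]]] cK)
       (use K0 in auto)
  then have oV: "open V" by (simp add: V_def compact_imp_closed open_Compl)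
  have qA: "?q w \<in> U" if w: "w \<in> A" for w
  proof -
    have w0: "w \<noteq> 0" using w nA by auto
    obtain W \<sigma> where W: "?q w \<in> W" "smooth_on W \<sigma>" "\<And>m. m \<in> S1_times_Sn \<inter> W \<Longrightarrow> \<sigma> m \<in> A \<and> \<sigma> m \<noteq> 0 \<and> ?q (\<sigma> m) = m"
      by (rule cover_map_section[OF c A w w0]) blast
    have "S1_times_Sn \<inter> W \<subseteq> ?q ` A"
    proof
      fix m assume "m \<in> S1_times_Sn \<inter> W"
      from W(3)[OF this] show "m \<in> ?q ` A" by force
    qed
    then show ?thesis using W(1) smooth_on_open[OF W(2)] unfolding U_def by blast
  qed
  have notS: "?q (F y) \<notin> \<Sigma>" if "y \<in> ?D" "norm y \<noteq> 1" for y
  proof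
    assume "?q (F y) \<in> \<Sigma>"
    then obtain z where z: "norm z = 1" "?q (F y) = ?q (F z)" by (auto simp: \<Sigma>_def)
    then have "y = z" using inj_onD[OF inj] that(1) sD by auto
    then show False using that(2) z(1) by simp
  qed
  have "U \<inter> (S1_times_Sn - \<Sigma>) = {} \<or> V \<inter> (S1_times_Sn - \<Sigma>) = {}"
  proof (rule connectedD[OF _ oU oV])
    show "connected (S1_times_Sn - \<Sigma>)" using conn by (simp add: \<Sigma>_def)
    show "U \<inter> V \<inter> (S1_times_Sn - \<Sigma>) = {}" by (auto simp: U_def V_def K_def)
    show "S1_times_Sn - \<Sigma> \<subseteq> U \<union> V" using qA by (auto simp: V_def K_def \<Sigma>)
  qed
  moreover have "?q (F ((1 - \<epsilon> / 2) *\<^sub>R b)) \<in> U \<inter> (S1_times_Sn - \<Sigma>)"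
  proof -
    have y: "(1 - \<epsilon> / 2) *\<^sub>R b \<in> ann (1 - \<epsilon>) 1" "(1 - \<epsilon> / 2) *\<^sub>R b \<in> ?D" "norm ((1 - \<epsilon> / 2) *\<^sub>R b) \<noteq> 1"
      using eps b by auto
    show ?thesis using qA[OF subsetD[OF inner imageI[OF y(1)]]] notS[OF y(2,3)] cover_map_in[OF F0[OF y(2)]] by simp
  qed
  moreover have "?q (F ((1 + \<epsilon> / 2) *\<^sub>R b)) \<in> V \<inter> (S1_times_Sn - \<Sigma>)"
  proof -
    have y: "(1 + \<epsilon> / 2) *\<^sub>R b \<in> ann 1 (1 + \<epsilon>)" "(1 + \<epsilon> / 2) *\<^sub>R b \<in> ?D" "norm ((1 + \<epsilon> / 2) *\<^sub>R b) \<noteq> 1"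
      using eps b by auto
    show ?thesis using outer_q[OF y(1)] notS[OF y(2,3)] cover_map_in[OF F0[OF y(2)]] by (simp add: V_def)
  qed
  ultimately show False by (elim disjE) (simp_all only: empty_iff)
qed

lemma lifted_sphere_standard:
  fixes f :: "real ^ 'n::finite \<Rightarrow> real ^ 'n"
  assumes card: "CARD('n) \<ge> 2" and c: "c > 1" and f: "smooth_on (- {0}) f"
    and hom: "\<And>y. y \<noteq> 0 \<Longrightarrow> f y = f ((1 / norm y) *\<^sub>R y)"
    and imm: "\<And>x v. norm x = 1 \<Longrightarrow> v \<bullet> x = 0 \<Longrightarrow> frechet_derivative f (at x) v = 0 \<Longrightarrow> v = 0"
    and f0: "\<And>x. norm x = 1 \<Longrightarrow> f x \<noteq> 0" and inj: "inj_on (\<lambda>x. cover_map c (f x)) (sphere 0 1)"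
    and conn: "connected (S1_times_Sn - (\<lambda>x. cover_map c (f x)) ` sphere 0 1)"
  obtains \<phi> :: "complex \<times> (real ^ 'n) \<Rightarrow> complex \<times> (real ^ 'n)"
  where "diffeomorphism_betw S1_times_Sn S1_times_Sn \<phi>" "\<phi> ` ({1} \<times> unit_sphere) = (\<lambda>x. cover_map c (f x)) ` sphere 0 1"
proof -
  obtain E where E: "smooth_on (- {0}) E" "\<And>y. norm y = 1 \<Longrightarrow> E y = f y" "\<And>y. norm y = 1 \<Longrightarrow> jac E y > 0"
  proof (rule collar_map[OF f])
    show "f y = f ((1 / norm y) *\<^sub>R y)" if "y \<noteq> 0" for y by (rule hom[OF that])
    show "v = 0" if "norm x = 1" "v \<bullet> x = 0" "frechet_derivative f (at x) v = 0" for x v by (rule imm[OF that])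
  qed blast
  have E1: "jac E y > 0 \<and> E y \<noteq> 0" if "norm y = 1" for y using E(2,3)[OF that] f0[OF that] by simp
  have injE: "inj_on (\<lambda>y. cover_map c (E y)) (sphere 0 1)" using inj E(2) by (simp add: inj_on_def)
  obtain \<epsilon> where eps: "0 < \<epsilon>" "\<epsilon> < 1" and jE: "\<And>y. y \<in> ann (1 - \<epsilon>) (1 + \<epsilon>) \<Longrightarrow> jac E y > 0 \<and> E y \<noteq> 0"
    and iE: "inj_on (\<lambda>y. cover_map c (E y)) (ann (1 - \<epsilon>) (1 + \<epsilon>))"
    by (rule thicken_collar[OF c E(1) E1 injE]) (assumption | rule that)+
  obtain F \<delta> A B where d: "0 < \<delta>" "\<delta> < 1" and eF: "emb (ann (1 - \<delta>) (1 + \<delta>)) F"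
    and jF: "\<And>y. y \<in> ann (1 - \<delta>) (1 + \<delta>) \<Longrightarrow> jac F y > 0 \<and> F y \<noteq> 0"
    and iF: "inj_on (\<lambda>y. cover_map c (F y)) (ann (1 - \<delta>) (1 + \<delta>))" and FE: "F ` sphere 0 1 = E ` sphere 0 1"
    and AB: "open A" "open B" "connected A" "connected B" "A \<inter> B = {}"
    "A \<inter> F ` sphere 0 1 = {}" "B \<inter> F ` sphere 0 1 = {}" "A \<union> F ` sphere 0 1 \<union> B = UNIV"
    "F ` ann (1 - \<delta>) 1 \<subseteq> A" "F ` ann 1 (1 + \<delta>) \<subseteq> B" "bounded A"
    by (rule bounded_inner_side[OF card c eps E(1) jE iE]) (assumption | rule that)+
  have img: "(\<lambda>y. cover_map c (F y)) ` sphere 0 1 = (\<lambda>x. cover_map c (f x)) ` sphere 0 1"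
  proof -
    have "(\<lambda>y. cover_map c (F y)) ` sphere 0 1 = cover_map c ` E ` sphere 0 1" by (simp add: FE[symmetric] image_image)
    also have "E ` sphere 0 1 = f ` sphere 0 1" by (rule image_cong) (simp_all add: E(2))
    finally show ?thesis by (simp add: image_image)
  qed
  have F0: "F y \<noteq> 0" if "y \<in> ann (1 - \<delta>) (1 + \<delta>)" for y using jF[OF that] by simp
  have zA: "0 \<in> A"
    by (rule zero_inside[OF card c d eF F0 iF AB(1,2,5-11)]) (use conn img in simp_all)
  interpret deck F \<delta> A B c
  proof
    show "c ^ k *\<^sub>R F y \<noteq> F z" if k: "k > 0" and y: "norm y = 1" and z: "norm z = 1" for k y z
    proof
      assume eq: "c ^ k *\<^sub>R F y = F z"
      have D: "y \<in> ann (1 - \<delta>) (1 + \<delta>)" "z \<in> ann (1 - \<delta>) (1 + \<delta>)" using y z d by auto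
      have "cover_map c (F y) = cover_map c (F z)" using cover_map_scale[OF c F0[OF D(1)], of k] eq by simp
      then have "y = z" using inj_onD[OF iF _ D] by simp
      then have "(c ^ k - 1) *\<^sub>R F y = 0" using eq by (simp add: algebra_simps)
      moreover have "c ^ k > 1" using c k by (simp add: one_less_power)
      ultimately show False using F0[OF D(1)] by simp
    qed
  qed (fact card c d eF AB zA F0 jF[THEN conjunct1])+
  obtain \<phi> :: "complex \<times> (real ^ 'n) \<Rightarrow> complex \<times> (real ^ 'n)"
    where \<phi>: "diffeomorphism_betw S1_times_Sn S1_times_Sn \<phi>" "\<And>y. norm y = 1 \<Longrightarrow> \<phi> (1, y) = cover_map c (F y)"
    by (rule diffeomorphism_onto_sphere) blast
  have "{1} \<times> unit_sphere = (\<lambda>y. (1 :: complex, y)) ` (unit_sphere :: (real ^ 'n) set)" by auto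
  then have "\<phi> ` ({1} \<times> unit_sphere) = (\<lambda>y. \<phi> (1, y)) ` sphere 0 1" by (simp only: image_image)
  also have "\<dots> = (\<lambda>y. cover_map c (F y)) ` sphere 0 1" by (rule image_cong) (simp_all add: \<phi>(2))
  finally show ?thesis using that[OF \<phi>(1)] img by simp
qed

subsection \<open>Smooth maps between subsets\<close>

lemma smooth_map_on_smooth_on:
  assumes "smooth_on U f" "S \<subseteq> U"
  shows "smooth_map_on S f"
  using assms unfolding smooth_map_on_def by blast

lemma smooth_map_onE:
  assumes "smooth_map_on S f" "x \<in> S"
  obtains U g where "x \<in> U" "smooth_on U g" "\<And>y. y \<in> S \<Longrightarrow> y \<in> U \<Longrightarrow> g y = f y"
  using assms unfolding smooth_map_on_def by (metis IntI)

lemma smooth_map_onI: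
  assumes "\<And>x. x \<in> S \<Longrightarrow> \<exists>U g. x \<in> U \<and> smooth_on U g \<and> (\<forall>y\<in>S \<inter> U. g y = f y)"
  shows "smooth_map_on S f"
  using assms unfolding smooth_map_on_def by blast

lemma smooth_map_on_compose:
  fixes f :: "'a::euclidean_space \<Rightarrow> 'b::euclidean_space" and g :: "'b \<Rightarrow> 'c::real_normed_vector"
  assumes f: "smooth_map_on S f" and g: "smooth_map_on T g" and "f ` S \<subseteq> T"
  shows "smooth_map_on S (\<lambda>x. g (f x))"
proof (rule smooth_map_onI)
  fix x assume x: "x \<in> S"
  obtain U F where U: "x \<in> U" "smooth_on U F" "\<And>y. y \<in> S \<Longrightarrow> y \<in> U \<Longrightarrow> F y = f y"
    by (rule smooth_map_onE[OF f x]) (rule that; assumption)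
  have fx: "f x \<in> T" using x assms(3) by blast
  obtain V G where V: "f x \<in> V" "smooth_on V G" "\<And>y. y \<in> T \<Longrightarrow> y \<in> V \<Longrightarrow> G y = g y"
    by (rule smooth_map_onE[OF g fx]) (rule that; assumption)
  define W where "W = U \<inter> F -` V"
  have oW: "open W" unfolding W_def
    by (rule continuous_open_preimage[OF smooth_on_imp_continuous_on[OF U(2)] smooth_on_open[OF U(2)] smooth_on_open[OF V(2)]])
  have "smooth_on W (\<lambda>x. G (F x))"
    by (rule smooth_on_compose[OF smooth_on_subset[OF U(2) oW] V(2)]) (auto simp: W_def)
  moreover have "x \<in> W" using U(1) U(3)[OF x U(1)] V(1) by (simp add: W_def)
  moreover have "G (F y) = g (f y)" if "y \<in> S \<inter> W" for y
  proof -
    have "y \<in> U" "F y \<in> V" "y \<in> S" using that by (auto simp: W_def)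
    moreover from this have "F y = f y" using U(3) by blast
    ultimately show ?thesis using V(3)[of "f y"] assms(3) by auto
  qed
  ultimately show "\<exists>U h. x \<in> U \<and> smooth_on U h \<and> (\<forall>y\<in>S \<inter> U. h y = g (f y))" by blast
qed

lemma smooth_map_on_continuous_on:
  assumes "smooth_map_on S f"
  shows "continuous_on S f"
  unfolding continuous_on_eq_continuous_within
proof
  fix x assume x: "x \<in> S"
  obtain U g where U: "x \<in> U" "smooth_on U g" "\<And>y. y \<in> S \<Longrightarrow> y \<in> U \<Longrightarrow> g y = f y"
    by (rule smooth_map_onE[OF assms x]) (rule that; assumption)
  obtain r where r: "r > 0" "ball x r \<subseteq> U" using smooth_on_open[OF U(2)] U(1) open_contains_ball by blast
  have "isCont g x"
    using smooth_on_imp_continuous_on[OF U(2)] smooth_on_open[OF U(2)] U(1) continuous_on_eq_continuous_at by blast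
  then have "continuous (at x within S) g" by (rule continuous_at_imp_continuous_at_within)
  then show "continuous (at x within S) f"
  proof (rule continuous_transform_within[OF _ r(1) x])
    fix y assume "y \<in> S" "dist y x < r"
    then show "g y = f y" using r(2) by (intro U(3)) (auto simp: dist_commute)
  qed
qed

lemma smooth_map_on_Pair:
  assumes f: "smooth_map_on S f" and g: "smooth_map_on S g"
  shows "smooth_map_on S (\<lambda>x. (f x, g x))"
proof (rule smooth_map_onI)
  fix x assume x: "x \<in> S"
  obtain U F where U: "x \<in> U" "smooth_on U F" "\<And>y. y \<in> S \<Longrightarrow> y \<in> U \<Longrightarrow> F y = f y"
    by (rule smooth_map_onE[OF f x]) (rule that; assumption)
  obtain V G where V: "x \<in> V" "smooth_on V G" "\<And>y. y \<in> S \<Longrightarrow> y \<in> V \<Longrightarrow> G y = g y"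
    by (rule smooth_map_onE[OF g x]) (rule that; assumption)
  have oW: "open (U \<inter> V)" using smooth_on_open[OF U(2)] smooth_on_open[OF V(2)] by (rule open_Int)
  have "smooth_on (U \<inter> V) (\<lambda>x. (F x, G x))"
    by (rule smooth_on_Pair[OF smooth_on_subset[OF U(2) oW] smooth_on_subset[OF V(2) oW]]) auto
  moreover have "(F y, G y) = (f y, g y)" if "y \<in> S \<inter> (U \<inter> V)" for y using U(3) V(3) that by blast
  ultimately show "\<exists>U h. x \<in> U \<and> smooth_on U h \<and> (\<forall>y\<in>S \<inter> U. h y = (f y, g y))" using U(1) V(1) by blast
qed

lemma smooth_map_on_fst: "smooth_map_on S (fst :: 'a::euclidean_space \<times> 'b::euclidean_space \<Rightarrow> 'a)"
  and smooth_map_on_snd: "smooth_map_on S (snd :: 'a \<times> 'b \<Rightarrow> 'b)"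
  by (auto intro!: smooth_map_on_smooth_on[of UNIV] smooth_intros)

section \<open>Diffeomorphisms between subsets\<close>

lemma diffeomorphism_betwE:
  assumes "diffeomorphism_betw S T f"
  obtains g where "smooth_map_on S f" "smooth_map_on T g" "f ` S = T" "g ` T = S"
    "\<And>x. x \<in> S \<Longrightarrow> g (f x) = x" "\<And>y. y \<in> T \<Longrightarrow> f (g y) = y"
proof -
  obtain g where g: "smooth_map_on T g" "g ` T = S" "\<forall>x\<in>S. g (f x) = x" "\<forall>y\<in>T. f (g y) = y"
    using assms unfolding diffeomorphism_betw_def by (elim conjE exE)
  note d = assms[unfolded diffeomorphism_betw_def]
  show ?thesis
    by (rule that[OF d[THEN conjunct1] g(1) d[THEN conjunct2, THEN conjunct1] g(2)]) (simp_all add: g(3,4))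
qed

lemma diffeomorphism_betwI:
  assumes "smooth_map_on S f" "smooth_map_on T g" "\<And>x. x \<in> S \<Longrightarrow> f x \<in> T" "\<And>y. y \<in> T \<Longrightarrow> g y \<in> S"
    "\<And>x. x \<in> S \<Longrightarrow> g (f x) = x" "\<And>y. y \<in> T \<Longrightarrow> f (g y) = y"
  shows "diffeomorphism_betw S T f"
proof -
  have "f ` S = T" "g ` T = S" using assms(3-6) by force+
  moreover have "\<forall>x\<in>S. g (f x) = x" "\<forall>y\<in>T. f (g y) = y" using assms(5,6) by simp_all
  ultimately show ?thesis unfolding diffeomorphism_betw_def using assms(1,2) by (intro conjI exI[of _ g])
qed

lemma diffeomorphism_betw_id: "diffeomorphism_betw S S (\<lambda>x. x)"
  by (rule diffeomorphism_betwI[of _ _ _ "\<lambda>x. x"]) (auto intro!: smooth_map_on_smooth_on[of UNIV] smooth_intros)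

lemma diffeomorphism_betw_compose:
  assumes "diffeomorphism_betw S T f" "diffeomorphism_betw T U g"
  shows "diffeomorphism_betw S U (\<lambda>x. g (f x))"
proof -
  obtain f' where f: "smooth_map_on S f" "smooth_map_on T f'" "f ` S = T" "f' ` T = S"
    "\<And>x. x \<in> S \<Longrightarrow> f' (f x) = x" "\<And>y. y \<in> T \<Longrightarrow> f (f' y) = y"
    by (rule diffeomorphism_betwE[OF assms(1)]) (rule that; assumption)
  obtain g' where g: "smooth_map_on T g" "smooth_map_on U g'" "g ` T = U" "g' ` U = T"
    "\<And>x. x \<in> T \<Longrightarrow> g' (g x) = x" "\<And>y. y \<in> U \<Longrightarrow> g (g' y) = y"
    by (rule diffeomorphism_betwE[OF assms(2)]) (rule that; assumption)
  show ?thesis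
  proof (rule diffeomorphism_betwI[where g = "\<lambda>y. f' (g' y)"])
    show "smooth_map_on S (\<lambda>x. g (f x))" by (rule smooth_map_on_compose[OF f(1) g(1)]) (simp add: f(3))
    show "smooth_map_on U (\<lambda>y. f' (g' y))" by (rule smooth_map_on_compose[OF g(2) f(2)]) (simp add: g(4))
  qed (use f g in auto)
qed

lemma diffeomorphism_betw_inverse:
  assumes "diffeomorphism_betw S T f"
  obtains g where "diffeomorphism_betw T S g" "\<And>x. x \<in> S \<Longrightarrow> g (f x) = x" "\<And>y. y \<in> T \<Longrightarrow> f (g y) = y"
proof -
  obtain g where g: "smooth_map_on S f" "smooth_map_on T g" "f ` S = T" "g ` T = S"
    "\<And>x. x \<in> S \<Longrightarrow> g (f x) = x" "\<And>y. y \<in> T \<Longrightarrow> f (g y) = y"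
    by (rule diffeomorphism_betwE[OF assms]) (rule that; assumption)
  have "diffeomorphism_betw T S g"
    by (rule diffeomorphism_betwI[OF g(2,1)]) (use g in auto)
  then show ?thesis by (rule that[OF _ g(5,6)])
qed

text \<open>Extending constantly along rays gives a smooth map on an open set, to which derivatives
  and the chain rule apply.\<close>

lemma smooth_on_homogeneous_extension:
  fixes e :: "real ^ 'n::finite \<Rightarrow> 'b::real_normed_vector"
  assumes "smooth_map_on unit_sphere e"
  shows "smooth_on (- {0}) (\<lambda>y. e ((1 / norm y) *\<^sub>R y))"
proof (rule smooth_on_local)
  fix y :: "real ^ 'n" assume y: "y \<in> - {0}"
  define n where "n = (\<lambda>y :: real ^ 'n. (1 / norm y) *\<^sub>R y)"
  have sn: "smooth_on (- {0}) n" unfolding n_def by (intro smooth_intros) auto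
  have nn: "n z \<in> unit_sphere" if "z \<in> - {0}" for z using that by (simp add: n_def)
  obtain U g where U: "n y \<in> U" "smooth_on U g" "\<And>z. z \<in> unit_sphere \<Longrightarrow> z \<in> U \<Longrightarrow> g z = e z"
    by (rule smooth_map_onE[OF assms nn[OF y]]) (rule that; assumption)
  define W where "W = (- {0}) \<inter> n -` U"
  have oW: "open W" unfolding W_def
    by (rule continuous_open_preimage[OF smooth_on_imp_continuous_on[OF sn] smooth_on_open[OF sn] smooth_on_open[OF U(2)]])
  have "smooth_on W (\<lambda>z. g (n z))"
    by (rule smooth_on_compose[OF smooth_on_subset[OF sn oW] U(2)]) (auto simp: W_def)
  then have "smooth_on W (\<lambda>z. e ((1 / norm z) *\<^sub>R z))"
  proof (rule smooth_on_cong)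
    fix z assume "z \<in> W"
    then have "n z \<in> unit_sphere" "n z \<in> U" using nn by (auto simp: W_def)
    then show "g (n z) = e ((1 / norm z) *\<^sub>R z)" using U(3) by (simp add: n_def)
  qed
  moreover have "y \<in> W" using y U(1) by (simp add: W_def)
  ultimately show "\<exists>V. y \<in> V \<and> smooth_on V (\<lambda>z. e ((1 / norm z) *\<^sub>R z))" by blast
qed auto

subsection \<open>Lifting embeddings\<close>

text \<open>A real-valued angle for the first component is exactly a lift through the covering:
  exponentiated it gives the radius, and the second component gives the direction. The automorphism
  \<open>\<alpha>\<close> is undone at the end.\<close>

lemma sphere_from_angle:
  fixes e :: "real ^ 'n::finite \<Rightarrow> complex \<times> (real ^ 'n)" and \<alpha> :: "complex \<times> (real ^ 'n) \<Rightarrow> complex \<times> (real ^ 'n)"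
  assumes card: "CARD('n) \<ge> 2" and e: "smooth_sphere_embedding e S1_times_Sn"
    and conn: "connected (S1_times_Sn - e ` unit_sphere)"
    and \<alpha>: "diffeomorphism_betw S1_times_Sn S1_times_Sn \<alpha>"
    and L: "smooth_on (- {0}) L" "\<And>y. y \<noteq> 0 \<Longrightarrow> L y = L ((1 / norm y) *\<^sub>R y)"
    and L_lift: "\<And>x. norm x = 1 \<Longrightarrow> cis (L x) = fst (\<alpha> (e x))"
  obtains \<psi> :: "complex \<times> (real ^ 'n) \<Rightarrow> complex \<times> (real ^ 'n)"
  where "diffeomorphism_betw S1_times_Sn S1_times_Sn \<psi>" "\<psi> ` ({1} \<times> unit_sphere) = e ` unit_sphere"
proof -
  let ?M = "S1_times_Sn :: (complex \<times> (real ^ 'n)) set"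
  \<comment> \<open>With \<open>ln c = 1\<close> the angle divided by \<open>2 * pi\<close> is the
    logarithm of the radius.\<close>
  define c :: real where "c = exp 1"
  have c: "c > 1" and lc: "ln c = 1" by (auto simp: c_def)
  have se: "smooth_map_on unit_sphere e" and eM: "e ` unit_sphere \<subseteq> ?M" and ie: "inj_on e unit_sphere"
    using e by (auto simp: smooth_sphere_embedding_def)
  have e_imm: "v = 0" if "norm x = 1" "x \<in> U" "smooth_on U g" "\<And>y. y \<in> unit_sphere \<Longrightarrow> y \<in> U \<Longrightarrow> g y = e y"
    "v \<bullet> x = 0" "frechet_derivative g (at x) v = 0" for x U g v
  proof -
    have "x \<in> unit_sphere" using that(1) by simp
    moreover have "x \<in> U \<and> smooth_on U g \<and> (\<forall>y\<in>unit_sphere \<inter> U. g y = e y)" using that(2-4) by blast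
    ultimately have "\<forall>v. v \<bullet> x = 0 \<and> frechet_derivative g (at x) v = 0 \<longrightarrow> v = 0"
      using e unfolding smooth_sphere_embedding_def by blast
    then show ?thesis using that(5,6) by blast
  qed
  obtain \<beta> where \<beta>: "smooth_map_on ?M \<alpha>" "smooth_map_on ?M \<beta>" "\<alpha> ` ?M = ?M" "\<beta> ` ?M = ?M"
    "\<And>x. x \<in> ?M \<Longrightarrow> \<beta> (\<alpha> x) = x" "\<And>y. y \<in> ?M \<Longrightarrow> \<alpha> (\<beta> y) = y"
    by (rule diffeomorphism_betwE[OF \<alpha>]) (rule that; assumption)
  have eM': "e x \<in> ?M" if "norm x = 1" for x by (rule subsetD[OF eM]) (use that in simp)
  have ae: "\<alpha> (e x) \<in> ?M" if "norm x = 1" for x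
    using imageI[OF eM'[OF that], of \<alpha>] by (simp only: \<beta>(3))
  define u where "u = (\<lambda>y. snd (\<alpha> (e ((1 / norm y) *\<^sub>R y))))"
  define f where "f = (\<lambda>y. exp (L y / (2 * pi)) *\<^sub>R u y)"
  have "smooth_map_on unit_sphere (\<lambda>x. \<alpha> (e x))" by (rule smooth_map_on_compose[OF se \<beta>(1) eM])
  from smooth_on_homogeneous_extension[OF this]
  have su: "smooth_on (- {0}) u" unfolding u_def by (rule smooth_on_snd)
  have sf: "smooth_on (- {0}) f" unfolding f_def by (intro smooth_intros L su) auto
  have nu: "norm (u y) = 1" if "y \<noteq> 0" for y
    using ae[of "(1 / norm y) *\<^sub>R y"] that by (auto simp: u_def)
  have hom: "f y = f ((1 / norm y) *\<^sub>R y)" if "y \<noteq> 0" for y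
    using L(2)[OF that] that by (simp add: f_def u_def)
  have f0: "f y \<noteq> 0" if "y \<noteq> 0" for y using nu[OF that] by (auto simp: f_def)
  have qf: "cover_map c (f x) = \<alpha> (e x)" if x: "norm x = 1" for x
  proof -
    have x0: "x \<noteq> 0" using x by auto
    have "norm (f x) = exp (L x / (2 * pi))" by (simp add: f_def nu[OF x0])
    then have "cover_map c (f x) = (cis (L x), u x)" by (simp add: cover_map_def lc f_def)
    then show ?thesis using L_lift[OF x] x by (simp add: u_def prod_eq_iff)
  qed
  \<comment> \<open>A smooth extension \<open>g\<close> of the inverse automorphism, composed with
    the covering and the lift, is a local smooth extension of \<open>e\<close>. The immersion
    condition speaks of all such extensions, so it applies to this one, and the chain rule transfers
    it to \<open>f\<close>.\<close>
  have imm: "v = 0" if x: "norm x = 1" and v: "v \<bullet> x = 0" "frechet_derivative f (at x) v = 0" for x v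
  proof -
    have x0: "x \<in> - {0}" using x by auto
    obtain U g where U: "\<alpha> (e x) \<in> U" "smooth_on U g" "\<And>y. y \<in> ?M \<Longrightarrow> y \<in> U \<Longrightarrow> g y = \<beta> y"
      by (rule smooth_map_onE[OF \<beta>(2) ae[OF x]]) (rule that; assumption)
    have sq: "smooth_on (- {0}) (\<lambda>y. cover_map c (f y))"
    proof (rule smooth_on_compose[OF sf smooth_on_cover_map[OF c]])
      show "f ` (- {0}) \<subseteq> - {0}" by (rule image_subsetI) (simp add: f0)
    qed
    define W where "W = (- {0}) \<inter> (\<lambda>y. cover_map c (f y)) -` U"
    have oW: "open W" unfolding W_def
      by (rule continuous_open_preimage[OF smooth_on_imp_continuous_on[OF sq] smooth_on_open[OF sq] smooth_on_open[OF U(2)]])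
    have xW: "x \<in> W" using x0 qf[OF x] U(1) by (simp add: W_def)
    have sg: "smooth_on W (\<lambda>y. g (cover_map c (f y)))"
      by (rule smooth_on_compose[OF smooth_on_subset[OF sq oW] U(2)]) (auto simp: W_def)
    have ge: "g (cover_map c (f y)) = e y" if "y \<in> unit_sphere" "y \<in> W" for y
    proof -
      have "g (cover_map c (f y)) = \<beta> (\<alpha> (e y))" using U(3) qf[of y] ae[of y] that by (simp add: W_def)
      also have "\<dots> = e y" by (rule \<beta>(5)[OF eM']) (use that in simp)
      finally show ?thesis .
    qed
    have fx0: "f x \<in> - {0}" using f0 x0 by simp
    have df: "(f has_derivative frechet_derivative f (at x)) (at x)" by (rule smooth_on_has_derivative[OF sf x0])
    have dq: "(cover_map c has_derivative frechet_derivative (cover_map c) (at (f x))) (at (f x))"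
      by (rule smooth_on_has_derivative[OF smooth_on_cover_map[OF c] fx0])
    have qU: "cover_map c (f x) \<in> U" using U(1) qf[OF x] by simp
    have dg: "(g has_derivative frechet_derivative g (at (cover_map c (f x)))) (at (cover_map c (f x)))"
      by (rule smooth_on_has_derivative[OF U(2) qU])
    have d: "((\<lambda>y. g (cover_map c (f y))) has_derivative (\<lambda>v. frechet_derivative g (at (cover_map c (f x)))
        (frechet_derivative (cover_map c) (at (f x)) (frechet_derivative f (at x) v)))) (at x)"
      by (rule has_derivative_compose[OF has_derivative_compose[OF df dq] dg])
    have "frechet_derivative (\<lambda>y. g (cover_map c (f y))) (at x) v = 0"
      unfolding frechet_derivative_eqI[OF d] v(2)
      using has_derivative_linear[OF dq] has_derivative_linear[OF dg] by (simp add: linear_0)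
    from e_imm[OF x xW sg ge v(1) this] show "v = 0" by (simp only:)
  qed
  have img: "(\<lambda>x. cover_map c (f x)) ` sphere 0 1 = \<alpha> ` e ` unit_sphere"
    unfolding image_image by (rule image_cong) (use qf in auto)
  have inj\<alpha>: "inj_on \<alpha> ?M" using \<beta>(5) by (rule inj_on_inverseI)
  have inj: "inj_on (\<lambda>x. cover_map c (f x)) (sphere 0 1)"
  proof (rule inj_onI)
    fix x y :: "real ^ 'n" assume x: "x \<in> sphere 0 1" and y: "y \<in> sphere 0 1" and eq: "cover_map c (f x) = cover_map c (f y)"
    have "\<alpha> (e x) = \<alpha> (e y)" using qf[of x] qf[of y] x y eq by simp
    then have "e x = e y" by (rule inj_onD[OF inj\<alpha>]) (use eM' x y in simp_all)
    then show "x = y" using inj_onD[OF ie] x y by blast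
  qed
  have cont: "continuous_on ?M \<alpha>" by (rule smooth_map_on_continuous_on[OF \<beta>(1)])
  \<comment> \<open>An automorphism carries the complement of the sphere onto the complement of its
    image, so non-separation is preserved.\<close>
  have "?M - \<alpha> ` e ` unit_sphere = \<alpha> ` (?M - e ` unit_sphere)"
    using inj_on_image_set_diff[OF inj\<alpha>, of ?M "e ` unit_sphere"] eM by (simp add: \<beta>(3) Diff_subset)
  then have conn': "connected (?M - (\<lambda>x. cover_map c (f x)) ` sphere 0 1)"
    unfolding img by (simp only:) (rule connected_continuous_image[OF continuous_on_subset[OF cont] conn], blast)
  have f0': "f x \<noteq> 0" if "norm x = 1" for x by (rule f0) (use that in auto)
  obtain \<phi> :: "complex \<times> (real ^ 'n) \<Rightarrow> complex \<times> (real ^ 'n)"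
    where \<phi>: "diffeomorphism_betw ?M ?M \<phi>" "\<phi> ` ({1} \<times> unit_sphere) = (\<lambda>x. cover_map c (f x)) ` sphere 0 1"
  proof (rule lifted_sphere_standard[OF card c sf _ _ f0' inj conn'])
    show "f y = f ((1 / norm y) *\<^sub>R y)" if "y \<noteq> 0" for y by (rule hom[OF that])
    show "v = 0" if "norm x = 1" "v \<bullet> x = 0" "frechet_derivative f (at x) v = 0" for x v by (rule imm[OF that])
  qed (assumption | blast)+
  obtain \<gamma> where \<gamma>: "diffeomorphism_betw ?M ?M \<gamma>" "\<And>x. x \<in> ?M \<Longrightarrow> \<gamma> (\<alpha> x) = x"
    by (rule diffeomorphism_betw_inverse[OF \<alpha>]) (rule that; assumption)
  have "(\<lambda>x. \<gamma> (\<phi> x)) ` ({1} \<times> unit_sphere) = \<gamma> ` \<alpha> ` e ` unit_sphere"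
    using \<phi>(2) img by (metis image_image)
  also have "\<dots> = e ` unit_sphere"
    unfolding image_image by (rule image_cong) (simp_all add: \<gamma>(2)[OF eM'])
  finally show ?thesis using that[OF diffeomorphism_betw_compose[OF \<phi>(1) \<gamma>(1)]] by blast
qed

subsection \<open>Angle functions\<close>

text \<open>Locally a continuous angle agrees with the smooth arctangent branch up to a multiple of
  \<open>2 * pi\<close>, and on a small neighbourhood continuity leaves only the multiple 0.\<close>

lemma smooth_angle:
  fixes z :: "'a::euclidean_space \<Rightarrow> complex" and \<theta> :: "'a \<Rightarrow> real"
  assumes z: "smooth_on U z" and \<theta>: "continuous_on U \<theta>" and cis: "\<And>y. y \<in> U \<Longrightarrow> cis (\<theta> y) = z y"
  shows "smooth_on U \<theta>"
proof (rule smooth_on_local)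
  show oU: "open U" using z by (rule smooth_on_open)
  fix y0 assume y0: "y0 \<in> U"
  define w where "w = (\<lambda>y. z y * cnj (z y0))"
  have nz: "norm (z y) = 1" if "y \<in> U" for y using cis[OF that] by (metis norm_cis)
  have sw: "smooth_on U w" unfolding w_def by (intro smooth_intros z oU)
  define V where "V = (U \<inter> (\<lambda>y. Re (w y)) -` {0<..}) \<inter> (U \<inter> \<theta> -` ball (\<theta> y0) (pi / 2))"
  have cw: "continuous_on U (\<lambda>y. Re (w y))"
    by (intro continuous_intros smooth_on_imp_continuous_on[OF sw])
  have oV: "open V" unfolding V_def
    by (intro open_Int continuous_open_preimage cw \<theta> oU) auto
  have V: "y \<in> U" "Re (w y) > 0" "\<bar>\<theta> y - \<theta> y0\<bar> < pi / 2" if "y \<in> V" for y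
    using that by (auto simp: V_def dist_real_def abs_minus_commute)
  have "w y0 = 1" using nz[OF y0] by (simp add: w_def complex_norm_square[symmetric])
  then have y0V: "y0 \<in> V" using y0 by (simp add: V_def)
  have "smooth_on V (\<lambda>y. \<theta> y0 + arctan (Im (w y) / Re (w y)))"
  proof (intro smooth_intros smooth_on_subset[OF sw oV] oV)
    show "V \<subseteq> U" "V \<subseteq> U" using V(1) by blast+
    show "Re (w y) \<noteq> 0" if "y \<in> V" for y using V(2)[OF that] by simp
  qed
  then have "smooth_on V \<theta>"
  proof (rule smooth_on_cong)
    fix y assume y: "y \<in> V"
    define t where "t = \<theta> y0 + arctan (Im (w y) / Re (w y))"
    have "cis t = z y" unfolding t_def w_def
      by (rule circle_branch[OF nz[OF y0] nz[OF V(1)[OF y]] _ cis[OF y0]]) (rule V(2)[OF y, unfolded w_def])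
    then have "cis (2 * pi * (t / (2 * pi))) = cis (2 * pi * (\<theta> y / (2 * pi)))" using cis[OF V(1)[OF y]] by simp
    then obtain j :: int where "t / (2 * pi) = \<theta> y / (2 * pi) + of_int j" using cis_2pi_eq_iff by blast
    then have j: "t - \<theta> y = 2 * pi * of_int j" by (simp add: field_simps)
    \<comment> \<open>Both angles are within \<open>pi / 2\<close> of the value at
      \<open>y0\<close>, so they differ by less than \<open>pi\<close>.\<close>
    have "\<bar>t - \<theta> y0\<bar> < pi / 2"
      using arctan_bounded[of "Im (w y) / Re (w y)"] unfolding t_def by linarith
    then have "\<bar>t - \<theta> y\<bar> < pi" using V(3)[OF y] by linarith
    then have "pi * (2 * \<bar>of_int j\<bar>) < pi * 1" using j by (simp add: abs_mult)
    then have "2 * \<bar>real_of_int j\<bar> < 1" by (simp only: mult_less_cancel_left_pos[OF pi_gt_zero])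
    then have "j = 0" by linarith
    then show "\<theta> y0 + arctan (Im (w y) / Re (w y)) = \<theta> y" using j by (simp add: t_def)
  qed
  then show "\<exists>V. y0 \<in> V \<and> smooth_on V \<theta>" using y0V by blast
qed

lemma Im_of_unit_exp:
  assumes "norm (z :: complex) = 1" "z = exp g"
  shows "cis (Im g) = z"
proof -
  have "exp (Re g) = 1" using assms by simp
  then show ?thesis using assms(2) by (simp add: exp_eq_polar)
qed

text \<open>A nowhere vanishing function on a simply connected sphere has a continuous logarithm,
  whose imaginary part is the angle.\<close>

lemma sphere_angle_simply_connected:
  fixes w :: "real ^ 'n::finite \<Rightarrow> complex"
  assumes card: "CARD('n) \<ge> 3" and w: "smooth_map_on unit_sphere w" and nw: "\<And>x. norm x = 1 \<Longrightarrow> norm (w x) = 1"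
  obtains L where "smooth_on (- {0}) L" "\<And>y. y \<noteq> 0 \<Longrightarrow> L y = L ((1 / norm y) *\<^sub>R y)" "\<And>x. norm x = 1 \<Longrightarrow> cis (L x) = w x"
proof -
  let ?n = "\<lambda>y :: real ^ 'n. (1 / norm y) *\<^sub>R y"
  have c: "continuous_on unit_sphere w" using w by (rule smooth_map_on_continuous_on)
  have sc: "simply_connected (unit_sphere :: (real ^ 'n) set)" by (rule simply_connected_sphere) (use card in simp)
  have lp: "locally path_connected (unit_sphere :: (real ^ 'n) set)" by (rule locally_path_connected_sphere)
  have w0: "w x \<noteq> 0" if "x \<in> unit_sphere" for x using nw[of x] that by auto
  obtain g where g: "continuous_on unit_sphere g" "\<And>x. x \<in> unit_sphere \<Longrightarrow> w x = exp (g x)"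
    by (rule continuous_logarithm_on_simply_connected[OF c sc lp w0]) (assumption | rule that)+
  define L where "L = (\<lambda>y. Im (g (?n y)))"
  have cn: "continuous_on (- {0}) ?n" by (intro continuous_intros) auto
  have n1: "?n y \<in> unit_sphere" if "y \<noteq> 0" for y using that by simp
  have cL: "continuous_on (- {0}) L" unfolding L_def
    by (intro continuous_intros continuous_on_compose2[OF g(1) cn] image_subsetI n1) simp
  have cis: "cis (L y) = w (?n y)" if "y \<in> - {0}" for y
    unfolding L_def by (rule Im_of_unit_exp[OF nw g(2)]) (use that in auto)
  show ?thesis
  proof (rule that)
    show "smooth_on (- {0}) L" by (rule smooth_angle[OF smooth_on_homogeneous_extension[OF w] cL cis])
    show "L y = L (?n y)" if "y \<noteq> 0" for y using that by (simp add: L_def)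
    show "cis (L x) = w x" if "norm x = 1" for x
    proof -
      have "x \<in> - {0}" using that by auto
      from cis[OF this] show ?thesis using that by simp
    qed
  qed
qed

text \<open>On the line an angle always exists. Its increment over one period is a continuous
  function with values in integer multiples of \<open>2 * pi\<close>, hence constant;
  \<open>p\<close> is the winding number.\<close>

lemma periodic_angle:
  fixes w :: "real \<Rightarrow> complex"
  assumes w: "smooth_on UNIV w" and nw: "\<And>t. norm (w t) = 1" and per: "\<And>t. w (t + 2 * pi) = w t"
  obtains a and p :: int where "smooth_on UNIV a" "\<And>t. cis (a t) = w t" "\<And>t. a (t + 2 * pi) = a t + 2 * pi * of_int p"
proof -
  have cw: "continuous_on UNIV w" using w by (rule smooth_on_imp_continuous_on)
  have w0: "w t \<noteq> 0" for t using nw[of t] by auto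
  obtain g where g: "continuous_on UNIV g" "\<And>t. w t = exp (g t)"
    using continuous_logarithm_on_contractible[OF cw contractible_UNIV w0] by (metis UNIV_I)
  define a where "a = (\<lambda>t. Im (g t))"
  have ca: "continuous_on UNIV a" unfolding a_def by (intro continuous_intros g(1))
  have cis: "cis (a t) = w t" for t unfolding a_def by (rule Im_of_unit_exp[OF nw g(2)])
  have sa: "smooth_on UNIV a" by (rule smooth_angle[OF w ca cis])
  define h where "h = (\<lambda>t. (a (t + 2 * pi) - a t) / (2 * pi))"
  have ch: "continuous_on UNIV h" unfolding h_def
    by (intro continuous_intros continuous_on_compose2[OF ca]) auto
  have hint: "\<exists>j::int. h t = of_int j" for t
  proof -
    have "cis (2 * pi * (a (t + 2 * pi) / (2 * pi))) = cis (2 * pi * (a t / (2 * pi)))" using cis per by simp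
    then obtain j :: int where "a (t + 2 * pi) / (2 * pi) = a t / (2 * pi) + of_int j" using cis_2pi_eq_iff by blast
    then show ?thesis by (auto simp: h_def diff_divide_distrib)
  qed
  have "h constant_on UNIV"
  proof (rule continuous_discrete_range_constant[OF connected_UNIV ch])
    fix s :: real
    have "1 \<le> norm (h t - h s)" if "h t \<noteq> h s" for t
    proof -
      obtain i j :: int where "h t = of_int i" "h s = of_int j" using hint by blast
      then show ?thesis using that by simp
    qed
    then show "\<exists>e>0. \<forall>t. t \<in> UNIV \<and> h t \<noteq> h s \<longrightarrow> e \<le> norm (h t - h s)" by (intro exI[of _ 1]) auto
  qed
  then obtain k where k: "\<And>t. h t = k" by (auto simp: constant_on_def)
  obtain p :: int where p: "h 0 = of_int p" using hint by blast
  have "a (t + 2 * pi) = a t + 2 * pi * of_int p" for t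
  proof -
    have "h t = of_int p" using k[of t] k[of 0] p by simp
    then show ?thesis by (simp add: h_def field_simps)
  qed
  then show ?thesis using that[OF sa cis] by blast
qed

subsection \<open>Automorphisms of the torus\<close>

text \<open>Negative powers are taken through the conjugate, which is smooth at \<open>0\<close> too.\<close>

definition circle_power :: "int \<Rightarrow> complex \<Rightarrow> complex" where
  "circle_power k z = (if k \<ge> 0 then z ^ nat k else cnj z ^ nat (- k))"

lemma circle_power_cis: "circle_power k (cis t) = cis (of_int k * t)"
  by (cases "k \<ge> 0") (simp_all add: circle_power_def cis_cnj Complex.DeMoivre)

lemma smooth_on_circle_power:
  assumes "smooth_on U f"
  shows "smooth_on U (\<lambda>x. circle_power k (f x))"
  unfolding circle_power_def using assms by (cases "k \<ge> 0") (auto intro!: smooth_intros)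

lemma unit_complex_cis:
  assumes "norm (z :: complex) = 1"
  obtains t where "z = cis t"
proof -
  have "z \<noteq> 0" "sgn z = z" using assms by (auto simp: sgn_div_norm)
  then show ?thesis using that[of "Arg z"] cis_Arg by metis
qed

text \<open>For circles the vectors have two coordinates; naming the two indices identifies the
  vector space with the complex plane, so that powers are available in both factors.\<close>

locale plane_coordinates =
  fixes i j :: "'n::finite"
  assumes ij: "i \<noteq> j" and coords: "(UNIV :: 'n set) = {i, j}"
begin

definition of_cplx :: "complex \<Rightarrow> real ^ 'n" where
  "of_cplx z = (\<chi> k. if k = i then Re z else Im z)"

definition to_cplx :: "real ^ 'n \<Rightarrow> complex" where
  "to_cplx v = Complex (v $ i) (v $ j)"

lemma to_of_cplx [simp]: "to_cplx (of_cplx z) = z"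
  using ij by (simp add: to_cplx_def of_cplx_def)

lemma of_to_cplx [simp]: "of_cplx (to_cplx v) = v"
proof -
  have "of_cplx (to_cplx v) $ k = v $ k" for k
    using coords by (cases "k = i") (auto simp: to_cplx_def of_cplx_def)
  then show ?thesis by (simp add: vec_eq_iff)
qed

lemma norm_to_cplx [simp]: "norm (to_cplx v) = norm v"
  using ij by (simp add: to_cplx_def norm_vec_def L2_set_def coords cmod_def)

lemma norm_of_cplx [simp]: "norm (of_cplx z) = norm z"
  by (metis norm_to_cplx to_of_cplx)

lemma smooth_on_to_cplx:
  assumes "smooth_on U f"
  shows "smooth_on U (\<lambda>x. to_cplx (f x))"
proof -
  have "smooth_on U (\<lambda>x. of_real (f x $ i) + of_real (f x $ j) * \<i>)"
    by (intro smooth_intros assms smooth_on_open[OF assms])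
  then show ?thesis by (rule smooth_on_cong) (simp add: to_cplx_def complex_eq_iff)
qed

lemma smooth_on_of_cplx:
  assumes "smooth_on U f"
  shows "smooth_on U (\<lambda>x. of_cplx (f x))"
  unfolding of_cplx_def
proof (rule smooth_on_vec_lambda[OF smooth_on_open[OF assms]])
  show "smooth_on U (\<lambda>x. if k = i then Re (f x) else Im (f x))" for k
    using assms by (cases "k = i") (auto intro!: smooth_intros)
qed

text \<open>In angle coordinates this is the linear map with rows \<open>(m, k)\<close> and
  \<open>(r, s)\<close>; for determinant 1 the inverse has rows \<open>(s, - k)\<close> and
  \<open>(- r, m)\<close>.\<close>

definition torus_map :: "int \<Rightarrow> int \<Rightarrow> int \<Rightarrow> int \<Rightarrow> complex \<times> (real ^ 'n) \<Rightarrow> complex \<times> (real ^ 'n)" where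
  "torus_map m k r s x = (circle_power m (fst x) * circle_power k (to_cplx (snd x)),
     of_cplx (circle_power r (fst x) * circle_power s (to_cplx (snd x))))"

lemma torus_map_cis:
  "torus_map m k r s (cis a, of_cplx (cis b))
    = (cis (of_int m * a + of_int k * b), of_cplx (cis (of_int r * a + of_int s * b)))"
  by (simp add: torus_map_def circle_power_cis cis_mult)

lemma torus_point:
  assumes "x \<in> S1_times_Sn"
  obtains a b where "x = (cis a, of_cplx (cis b))"
proof -
  have "norm (fst x) = 1" "norm (to_cplx (snd x)) = 1" using assms by auto
  then obtain a b where "fst x = cis a" "to_cplx (snd x) = cis b" using unit_complex_cis by metis
  then have "x = (cis a, of_cplx (cis b))" by (metis of_to_cplx prod.collapse)
  then show ?thesis by (rule that)
qed

lemma torus_map_diffeomorphism: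
  assumes "m * s - k * r = 1"
  shows "diffeomorphism_betw S1_times_Sn S1_times_Sn (torus_map m k r s)"
proof (rule diffeomorphism_betwI)
  have sm: "smooth_map_on S1_times_Sn (torus_map m k r s)" for m k r s
    unfolding torus_map_def
    by (rule smooth_map_on_smooth_on[of UNIV])
       (intro smooth_intros smooth_on_circle_power smooth_on_of_cplx smooth_on_to_cplx open_UNIV, simp)
  show "smooth_map_on S1_times_Sn (torus_map m k r s)" "smooth_map_on S1_times_Sn (torus_map s (- k) (- r) m)"
    by (rule sm)+
  have im: "torus_map m k r s x \<in> S1_times_Sn" if "x \<in> S1_times_Sn" for m k r s x
    by (rule torus_point[OF that]) (simp add: torus_map_cis)
  show "torus_map m k r s x \<in> S1_times_Sn" "torus_map s (- k) (- r) m x \<in> S1_times_Sn" if "x \<in> S1_times_Sn" for x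
    by (rule im[OF that])+
  have inv: "torus_map s (- k) (- r) m (torus_map m k r s x) = x"
    if "x \<in> S1_times_Sn" "m * s - k * r = 1" for m k r s x
  proof -
    obtain a b where x: "x = (cis a, of_cplx (cis b))" by (rule torus_point[OF \<open>x \<in> S1_times_Sn\<close>])
    have d: "real_of_int m * real_of_int s - real_of_int k * real_of_int r = 1"
      using that(2) by (metis of_int_1 of_int_diff of_int_mult)
    have "real_of_int s * (of_int m * a + of_int k * b) - of_int k * (of_int r * a + of_int s * b)
        = (real_of_int m * real_of_int s - real_of_int k * real_of_int r) * a"
      "real_of_int m * (of_int r * a + of_int s * b) - of_int r * (of_int m * a + of_int k * b)
        = (real_of_int m * real_of_int s - real_of_int k * real_of_int r) * b"
      by (simp_all add: algebra_simps)
    then show ?thesis unfolding x torus_map_cis d by (simp add: add.commute)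
  qed
  show "torus_map s (- k) (- r) m (torus_map m k r s x) = x" if "x \<in> S1_times_Sn" for x
    by (rule inv[OF that assms])
  show "torus_map m k r s (torus_map s (- k) (- r) m x) = x" if "x \<in> S1_times_Sn" for x
    using inv[OF that, of s m "- k" "- r"] assms by (simp add: algebra_simps)
qed

text \<open>\<open>Arg\<close> jumps, but by periodicity \<open>A\<close> takes the same value at
  all angles of a point. Locally \<open>Arg\<close> may therefore be replaced by a smooth arctangent
  branch.\<close>

lemma periodic_descends:
  fixes A :: "real \<Rightarrow> real"
  assumes A: "smooth_on UNIV A" and per: "\<And>t. A (t + 2 * pi) = A t"
  obtains L where "smooth_on (- {0 :: real ^ 'n}) L" "\<And>y. y \<noteq> 0 \<Longrightarrow> L y = L ((1 / norm y) *\<^sub>R y)"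
    "\<And>t. L (of_cplx (cis t)) = A t"
proof -
  have pn: "A (t + 2 * pi * real n) = A t" for t n
  proof (induction n)
    case (Suc n)
    have "A (t + 2 * pi * real (Suc n)) = A ((t + 2 * pi * real n) + 2 * pi)" by (simp add: algebra_simps)
    then show ?case using per Suc by simp
  qed simp
  have pj: "A s = A t" if st: "cis s = cis t" for s t
  proof -
    have "cis (2 * pi * (s / (2 * pi))) = cis (2 * pi * (t / (2 * pi)))" using st by simp
    then obtain j :: int where "s / (2 * pi) = t / (2 * pi) + of_int j" using cis_2pi_eq_iff by blast
    then have j: "s = t + 2 * pi * of_int j" by (simp add: field_simps)
    show ?thesis
    proof (cases "j \<ge> 0")
      case True
      then show ?thesis using pn[of t "nat j"] j by simp
    next
      case False
      then show ?thesis using pn[of s "nat (- j)"] j by simp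
    qed
  qed
  define z where "z = (\<lambda>y :: real ^ 'n. to_cplx ((1 / norm y) *\<^sub>R y))"
  define L where "L = (\<lambda>y. A (Arg (z y)))"
  have sz: "smooth_on (- {0}) z" unfolding z_def by (intro smooth_on_to_cplx smooth_intros) auto
  have nz: "norm (z y) = 1" if "y \<noteq> 0" for y using that by (simp add: z_def)
  have cz: "cis (Arg (z y)) = z y" if "y \<noteq> 0" for y
  proof -
    have "z y \<noteq> 0" "sgn (z y) = z y" using nz[OF that] by (auto simp: sgn_div_norm)
    then show ?thesis using cis_Arg by metis
  qed
  have "smooth_on (- {0}) L"
  proof (rule smooth_on_local)
    fix y0 :: "real ^ 'n" assume y0: "y0 \<in> - {0}"
    then have y00: "y0 \<noteq> 0" by simp
    define w where "w = (\<lambda>y. z y * cnj (z y0))"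
    have sw: "smooth_on (- {0}) w" unfolding w_def by (intro smooth_intros sz) auto
    define V where "V = (- {0}) \<inter> (\<lambda>y. Re (w y)) -` {0<..}"
    have oV: "open V" unfolding V_def
      by (intro continuous_open_preimage continuous_intros smooth_on_imp_continuous_on[OF sw])
    have VD: "y \<noteq> 0" "Re (w y) > 0" if "y \<in> V" for y using that by (auto simp: V_def)
    have "w y0 = 1" using nz[OF y00] by (simp add: w_def complex_norm_square[symmetric])
    then have y0V: "y0 \<in> V" using y0 by (simp add: V_def)
    define T where "T = (\<lambda>y. Arg (z y0) + arctan (Im (w y) / Re (w y)))"
    have "smooth_on V T" unfolding T_def
    proof (intro smooth_intros smooth_on_subset[OF sw oV] oV)
      show "V \<subseteq> - {0}" "V \<subseteq> - {0}" using VD by blast+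
      show "Re (w y) \<noteq> 0" if "y \<in> V" for y using VD(2)[OF that] by simp
    qed
    then have "smooth_on V (\<lambda>y. A (T y))" by (rule smooth_on_compose[OF _ A]) simp
    then have "smooth_on V L"
    proof (rule smooth_on_cong)
      fix y assume y: "y \<in> V"
      have "cis (T y) = z y" unfolding T_def w_def
        by (rule circle_branch[OF nz[OF y00] nz[OF VD(1)[OF y]] _ cz[OF y00]]) (rule VD(2)[OF y, unfolded w_def])
      then show "A (T y) = L y" unfolding L_def by (intro pj) (simp only: cz[OF VD(1)[OF y]])
    qed
    then show "\<exists>V. y0 \<in> V \<and> smooth_on V L" using y0V by blast
  qed auto
  moreover have "L y = L ((1 / norm y) *\<^sub>R y)" if "y \<noteq> 0" for y using that by (simp add: L_def z_def)
  moreover have "L (of_cplx (cis t)) = A t" for t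
  proof -
    have n1: "norm (of_cplx (cis t)) = 1" by simp
    then have "of_cplx (cis t) \<noteq> 0" by (metis norm_zero zero_neq_one)
    from cz[OF this] have "cis (Arg (z (of_cplx (cis t)))) = cis t" using n1 by (simp add: z_def)
    then show ?thesis unfolding L_def by (rule pj)
  qed
  ultimately show ?thesis by (rule that)
qed

end

lemma (in plane_coordinates) torus_angle:
  fixes e :: "real ^ 'n \<Rightarrow> complex \<times> (real ^ 'n)"
  assumes e: "smooth_map_on unit_sphere e" and eM: "e ` unit_sphere \<subseteq> S1_times_Sn"
  obtains \<alpha> :: "complex \<times> (real ^ 'n) \<Rightarrow> complex \<times> (real ^ 'n)" and L
  where "diffeomorphism_betw S1_times_Sn S1_times_Sn \<alpha>" "smooth_on (- {0}) L"
    "\<And>y. y \<noteq> 0 \<Longrightarrow> L y = L ((1 / norm y) *\<^sub>R y)" "\<And>x. norm x = 1 \<Longrightarrow> cis (L x) = fst (\<alpha> (e x))"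
proof -
  define x where "x = (\<lambda>t. of_cplx (cis t))"
  have nx: "norm (x t) = 1" for t by (simp add: x_def)
  have x0: "x t \<noteq> 0" for t using nx[of t] by auto
  have sx: "smooth_on UNIV x" unfolding x_def by (intro smooth_on_of_cplx smooth_intros) auto
  have "smooth_on UNIV (\<lambda>t. e ((1 / norm (x t)) *\<^sub>R x t))"
    by (rule smooth_on_compose[OF sx smooth_on_homogeneous_extension[OF e]]) (use x0 in auto)
  then have sex: "smooth_on UNIV (\<lambda>t. e (x t))" by (simp add: nx)
  have exM: "e (x t) \<in> S1_times_Sn" for t by (rule subsetD[OF eM]) (use nx in simp)
  then have nex: "norm (fst (e (x t))) = 1" "norm (to_cplx (snd (e (x t)))) = 1" for t
    using exM[of t, unfolded mem_Times_iff] by simp_all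
  have px: "x (t + 2 * pi) = x t" for t by (simp add: x_def cis.code)
  obtain a p where a: "smooth_on UNIV a" "\<And>t. cis (a t) = fst (e (x t))" "\<And>t. a (t + 2 * pi) = a t + 2 * pi * of_int p"
    by (rule periodic_angle[OF smooth_on_fst[OF sex] nex(1)]) (simp only: px, rule that)
  obtain b q where b: "smooth_on UNIV b" "\<And>t. cis (b t) = to_cplx (snd (e (x t)))" "\<And>t. b (t + 2 * pi) = b t + 2 * pi * of_int q"
    by (rule periodic_angle[OF smooth_on_to_cplx[OF smooth_on_snd[OF sex]] nex(2)]) (simp only: px, rule that)
  have ex: "e (x t) = (cis (a t), of_cplx (cis (b t)))" for t by (simp add: a(2) b(2) prod_eq_iff)
  \<comment> \<open>The row \<open>(m, k)\<close> must annihilate the winding numbers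
    \<open>p\<close> and \<open>q\<close>. Divided by their gcd, \<open>(q, - p)\<close> is
    primitive, and Bezout coefficients complete it to a matrix of determinant 1; if both numbers
    vanish, the identity matrix serves.\<close>
  obtain m k r s where mk: "m * s - k * r = 1" "m * p + k * q = 0"
  proof (cases "p = 0 \<and> q = 0")
    case True
    show ?thesis by (rule that[of 1 1 0 0]) (use True in auto)
  next
    case False
    then have cop: "coprime (q div gcd p q) (- (p div gcd p q))"
      by (metis coprime_minus_right_iff div_gcd_coprime gcd.commute)
    then obtain u v where uv: "u * (q div gcd p q) + v * (- (p div gcd p q)) = 1"
      using bezout_int[of "q div gcd p q" "- (p div gcd p q)"] by (auto simp: coprime_iff_gcd_eq_1)
    show ?thesis
    proof (rule that)
      show "(q div gcd p q) * u - (- (p div gcd p q)) * (- v) = 1" using uv by (simp add: algebra_simps)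
      have "gcd p q * (q div gcd p q * p + - (p div gcd p q) * q) = (gcd p q * (q div gcd p q)) * p - (gcd p q * (p div gcd p q)) * q"
        by (simp add: algebra_simps)
      also have "\<dots> = 0" by simp
      finally show "q div gcd p q * p + - (p div gcd p q) * q = 0" using False by simp
    qed
  qed
  define A where "A = (\<lambda>t. of_int m * a t + of_int k * b t)"
  have sA: "smooth_on UNIV A" unfolding A_def by (intro smooth_intros a b) auto
  \<comment> \<open>The first angle of the transformed curve has winding number
    \<open>m * p + k * q = 0\<close>, so it is periodic and descends to the circle.\<close>
  have perA: "A (t + 2 * pi) = A t" for t
  proof -
    have "A (t + 2 * pi) = A t + 2 * pi * of_int (m * p + k * q)"
      unfolding A_def a(3) b(3) by (simp add: algebra_simps)
    then show ?thesis by (simp add: mk(2))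
  qed
  obtain L where L: "smooth_on (- {0 :: real ^ 'n}) L" "\<And>y. y \<noteq> 0 \<Longrightarrow> L y = L ((1 / norm y) *\<^sub>R y)"
    "\<And>t. L (of_cplx (cis t)) = A t"
    by (rule periodic_descends[OF sA perA]) (rule that; assumption)
  have "cis (L y) = fst (torus_map m k r s (e y))" if "norm y = 1" for y
  proof -
    have "norm (to_cplx y) = 1" using that by simp
    then obtain t where t: "to_cplx y = cis t" by (rule unit_complex_cis)
    then have y: "y = x t" unfolding x_def by (metis of_to_cplx)
    have "L y = A t" unfolding y x_def by (rule L(3))
    then show ?thesis unfolding y ex torus_map_cis A_def by simp
  qed
  with torus_map_diffeomorphism[OF mk(1)] L(1,2) show ?thesis by (rule that)
qed

section \<open>Standard position and the bundle\<close>

lemma standard_sphere: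
  fixes \<Sigma> :: "(complex \<times> (real ^ 'n::finite)) set"
  assumes card: "CARD('n) \<ge> 2" and \<Sigma>: "\<Sigma> \<in> nonsep_spheres"
  obtains \<psi> :: "complex \<times> (real ^ 'n) \<Rightarrow> complex \<times> (real ^ 'n)"
  where "diffeomorphism_betw S1_times_Sn S1_times_Sn \<psi>" "\<psi> ` ({1} \<times> unit_sphere) = \<Sigma>"
proof -
  obtain e :: "real ^ 'n \<Rightarrow> complex \<times> (real ^ 'n)" where e: "smooth_sphere_embedding e S1_times_Sn"
    and \<Sigma>e: "\<Sigma> = e ` unit_sphere" and conn: "connected (S1_times_Sn - \<Sigma>)"
    using \<Sigma> unfolding nonsep_spheres_def by blast
  have se: "smooth_map_on unit_sphere e" and eM: "e ` unit_sphere \<subseteq> S1_times_Sn"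
    using e by (auto simp: smooth_sphere_embedding_def)
  note conn' = conn[unfolded \<Sigma>e]
  have "\<exists>\<alpha> :: complex \<times> (real ^ 'n) \<Rightarrow> complex \<times> (real ^ 'n). \<exists>L. diffeomorphism_betw S1_times_Sn S1_times_Sn \<alpha> \<and>
    smooth_on (- {0}) L \<and> (\<forall>y. y \<noteq> 0 \<longrightarrow> L y = L ((1 / norm y) *\<^sub>R y)) \<and> (\<forall>x. norm x = 1 \<longrightarrow> cis (L x) = fst (\<alpha> (e x)))"
  proof (cases "CARD('n) \<ge> 3")
    case True
    have sw: "smooth_map_on unit_sphere (\<lambda>x. fst (e x))"
      by (rule smooth_map_on_compose[OF se smooth_map_on_fst eM])
    have nw: "norm (fst (e x)) = 1" if "norm x = 1" for x
    proof -
      have "e x \<in> S1_times_Sn" by (rule subsetD[OF eM]) (use that in simp)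
      from this[unfolded mem_Times_iff] show ?thesis by simp
    qed
    obtain L where "smooth_on (- {0}) L" "\<And>y. y \<noteq> 0 \<Longrightarrow> L y = L ((1 / norm y) *\<^sub>R y)" "\<And>x. norm x = 1 \<Longrightarrow> cis (L x) = fst (e x)"
      by (rule sphere_angle_simply_connected[OF True sw nw]) (assumption | rule that)+
    then show ?thesis using diffeomorphism_betw_id[of S1_times_Sn]
      by (intro exI[of _ "\<lambda>x. x"] exI[of _ L] conjI allI impI)
  next
    case False
    then have "card (UNIV :: 'n set) = 2" using card by simp
    then obtain i j :: 'n where ij: "UNIV = {i, j}" "i \<noteq> j" by (auto simp: card_2_iff)
    interpret plane_coordinates i j by unfold_locales (use ij in auto)
    obtain \<alpha> :: "complex \<times> (real ^ 'n) \<Rightarrow> complex \<times> (real ^ 'n)" and L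
      where "diffeomorphism_betw S1_times_Sn S1_times_Sn \<alpha>" "smooth_on (- {0}) L"
        "\<And>y. y \<noteq> 0 \<Longrightarrow> L y = L ((1 / norm y) *\<^sub>R y)" "\<And>x. norm x = 1 \<Longrightarrow> cis (L x) = fst (\<alpha> (e x))"
      by (rule torus_angle[OF se eM]) (rule that; assumption)
    then show ?thesis by (intro exI[of _ \<alpha>] exI[of _ L] conjI allI impI)
  qed
  then obtain \<alpha> :: "complex \<times> (real ^ 'n) \<Rightarrow> complex \<times> (real ^ 'n)" and L
    where \<alpha>: "diffeomorphism_betw S1_times_Sn S1_times_Sn \<alpha>" and L: "smooth_on (- {0}) L"
      "\<forall>y. y \<noteq> 0 \<longrightarrow> L y = L ((1 / norm y) *\<^sub>R y)" "\<forall>x. norm x = 1 \<longrightarrow> cis (L x) = fst (\<alpha> (e x))"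
    by (elim exE conjE)
  obtain \<psi> :: "complex \<times> (real ^ 'n) \<Rightarrow> complex \<times> (real ^ 'n)"
    where "diffeomorphism_betw S1_times_Sn S1_times_Sn \<psi>" "\<psi> ` ({1} \<times> unit_sphere) = e ` unit_sphere"
  proof (rule sphere_from_angle[OF card e conn' \<alpha> L(1)])
    show "L y = L ((1 / norm y) *\<^sub>R y)" if "y \<noteq> 0" for y using L(2) that by blast
    show "cis (L x) = fst (\<alpha> (e x))" if "norm x = 1" for x using L(3) that by blast
  qed (rule that; assumption)
  then show ?thesis by (rule that[unfolded \<Sigma>e])
qed

text \<open>Transporting the first projection by \<open>\<psi>\<close> yields a bundle that is
  trivial over the whole circle, so one trivialisation with \<open>V = circle\<close> serves every
  base point.\<close>

lemma bundle_of_diffeomorphism: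
  fixes \<psi> :: "complex \<times> (real ^ 'n::finite) \<Rightarrow> complex \<times> (real ^ 'n)"
  assumes \<psi>: "diffeomorphism_betw S1_times_Sn S1_times_Sn \<psi>"
  obtains p where "smooth_fiber_bundle_circle S1_times_Sn p"
    "{x \<in> S1_times_Sn. p x = 1} = \<psi> ` ({1} \<times> unit_sphere)"
proof -
  let ?M = "S1_times_Sn :: (complex \<times> (real ^ 'n)) set"
  obtain \<gamma> where \<gamma>: "smooth_map_on ?M \<psi>" "smooth_map_on ?M \<gamma>" "\<psi> ` ?M = ?M" "\<gamma> ` ?M = ?M"
    "\<And>x. x \<in> ?M \<Longrightarrow> \<gamma> (\<psi> x) = x" "\<And>y. y \<in> ?M \<Longrightarrow> \<psi> (\<gamma> y) = y"
    by (rule diffeomorphism_betwE[OF \<psi>]) (rule that; assumption)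
  have \<psi>M: "\<psi> x \<in> ?M" if "x \<in> ?M" for x using imageI[OF that, of \<psi>] by (simp only: \<gamma>(3))
  have \<gamma>M: "\<gamma> x \<in> ?M" if "x \<in> ?M" for x using imageI[OF that, of \<gamma>] by (simp only: \<gamma>(4))
  have \<gamma>1: "fst (\<gamma> x) \<in> circle" "snd (\<gamma> x) \<in> unit_sphere" if "x \<in> ?M" for x
    using \<gamma>M[OF that] by (simp_all add: mem_Times_iff)
  have mk: "(w, v) \<in> ?M" if "w \<in> circle" "v \<in> unit_sphere" for w v using that by simp
  define p where "p = (\<lambda>x. fst (\<gamma> x))"
  have sp: "smooth_map_on ?M p" unfolding p_def
    by (rule smooth_map_on_compose[OF \<gamma>(2) smooth_map_on_fst]) (rule subset_UNIV)
  have s\<gamma>2: "smooth_map_on ?M (\<lambda>x. snd (\<gamma> x))"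
    by (rule smooth_map_on_compose[OF \<gamma>(2) smooth_map_on_snd]) (rule subset_UNIV)
  have pM: "{x \<in> ?M. p x \<in> circle} = ?M" using \<gamma>1 by (auto simp: p_def)
  obtain b :: "real ^ 'n" where b: "norm b = 1" using vector_choose_size[of 1] by auto
  have "p ` ?M = circle"
  proof
    show "p ` ?M \<subseteq> circle" unfolding p_def by (rule image_subsetI) (rule \<gamma>1)
    show "circle \<subseteq> p ` ?M"
    proof
      fix z :: complex assume z: "z \<in> circle"
      have m: "(z, b) \<in> ?M" using z b by simp
      have "p (\<psi> (z, b)) = z" by (simp only: p_def \<gamma>(5)[OF m] fst_conv)
      then show "z \<in> p ` ?M" using \<psi>M[OF m] by (metis image_eqI)
    qed
  qed
  moreover have "\<exists>V \<Phi>. openin (top_of_set circle) V \<and> z \<in> V \<and>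
      diffeomorphism_betw {x \<in> ?M. p x \<in> V} (V \<times> {x \<in> ?M. p x = z}) \<Phi> \<and> (\<forall>x\<in>?M. p x \<in> V \<longrightarrow> fst (\<Phi> x) = p x)"
    if z: "z \<in> circle" for z
  proof -
    let ?F = "{x \<in> ?M. p x = z}"
    \<comment> \<open>The fibre in the local triviality condition is the one over \<open>z\<close>,
      so the second entry moves \<open>x\<close> into it by resetting the circle coordinate to
      \<open>z\<close> and keeping the sphere coordinate.\<close>
    define \<Phi> where "\<Phi> = (\<lambda>x. (p x, \<psi> (z, snd (\<gamma> x))))"
    define \<Psi> where "\<Psi> = (\<lambda>y. \<psi> (fst y, snd (\<gamma> (snd y))))"
    have m: "(z, snd (\<gamma> x)) \<in> ?M" if "x \<in> ?M" for x using mk[OF z \<gamma>1(2)[OF that]] .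
    have m': "(fst y, snd (\<gamma> (snd y))) \<in> ?M" if "y \<in> circle \<times> ?F" for y
      by (rule mk) (use that in auto, use that \<gamma>1 in auto)
    have "diffeomorphism_betw ?M (circle \<times> ?F) \<Phi>"
    proof (rule diffeomorphism_betwI[where g = \<Psi>])
      have "smooth_map_on ?M (\<lambda>x. (z, snd (\<gamma> x)))"
        by (rule smooth_map_on_Pair[OF _ s\<gamma>2]) (auto intro!: smooth_map_on_smooth_on[of UNIV] smooth_intros)
      then have "smooth_map_on ?M (\<lambda>x. \<psi> (z, snd (\<gamma> x)))"
        by (rule smooth_map_on_compose[OF _ \<gamma>(1)]) (rule image_subsetI, rule m)
      then show "smooth_map_on ?M \<Phi>" unfolding \<Phi>_def by (rule smooth_map_on_Pair[OF sp])
      have "smooth_map_on (circle \<times> ?F) (\<lambda>y. snd (\<gamma> (snd y)))"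
        by (rule smooth_map_on_compose[OF smooth_map_on_snd s\<gamma>2]) auto
      then have "smooth_map_on (circle \<times> ?F) (\<lambda>y. (fst y, snd (\<gamma> (snd y))))"
        by (rule smooth_map_on_Pair[OF smooth_map_on_fst])
      then show "smooth_map_on (circle \<times> ?F) \<Psi>" unfolding \<Psi>_def
        by (rule smooth_map_on_compose[OF _ \<gamma>(1)]) (rule image_subsetI, rule m')
      show "\<Phi> x \<in> circle \<times> ?F" if "x \<in> ?M" for x
        using \<gamma>1(1)[OF that] \<psi>M[OF m[OF that]] by (simp only: \<Phi>_def mem_Times_iff fst_conv snd_conv mem_Collect_eq p_def \<gamma>(5)[OF m[OF that]])
      show "\<Psi> y \<in> ?M" if "y \<in> circle \<times> ?F" for y unfolding \<Psi>_def by (rule \<psi>M[OF m'[OF that]])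
      show "\<Psi> (\<Phi> x) = x" if "x \<in> ?M" for x
        by (simp only: \<Psi>_def \<Phi>_def fst_conv snd_conv p_def \<gamma>(5)[OF m[OF that]] prod.collapse \<gamma>(6)[OF that])
      show "\<Phi> (\<Psi> y) = y" if y: "y \<in> circle \<times> ?F" for y
      proof -
        have y2: "snd y \<in> ?M" "fst (\<gamma> (snd y)) = z" using y by (auto simp: p_def)
        have "(z, snd (\<gamma> (snd y))) = \<gamma> (snd y)" by (simp add: y2(2)[symmetric])
        then have "\<psi> (z, snd (\<gamma> (snd y))) = snd y" using \<gamma>(6)[OF y2(1)] by simp
        then show ?thesis by (simp only: \<Psi>_def \<Phi>_def p_def \<gamma>(5)[OF m'[OF y]] fst_conv snd_conv prod.collapse)
      qed
    qed
    then show ?thesis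
      by (intro exI[of _ circle] exI[of _ \<Phi>]) (use z in \<open>simp only: pM openin_subtopology_self \<Phi>_def fst_conv simp_thms ball_triv\<close>)
  qed
  ultimately have "smooth_fiber_bundle_circle ?M p" unfolding smooth_fiber_bundle_circle_def using sp by blast
  moreover have "{x \<in> ?M. p x = 1} = \<psi> ` ({1} \<times> unit_sphere)"
  proof
    show "{x \<in> ?M. p x = 1} \<subseteq> \<psi> ` ({1} \<times> unit_sphere)"
    proof
      fix x assume "x \<in> {x \<in> ?M. p x = 1}"
      then have x: "x \<in> ?M" "fst (\<gamma> x) = 1" by (auto simp: p_def)
      have "\<gamma> x \<in> {1} \<times> unit_sphere" using x(2) \<gamma>1(2)[OF x(1)] by (simp add: mem_Times_iff)
      then show "x \<in> \<psi> ` ({1} \<times> unit_sphere)" using \<gamma>(6)[OF x(1)] by (metis image_eqI)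
    qed
    show "\<psi> ` ({1} \<times> unit_sphere) \<subseteq> {x \<in> ?M. p x = 1}"
    proof (rule image_subsetI)
      fix y :: "complex \<times> (real ^ 'n)" assume y: "y \<in> {1} \<times> unit_sphere"
      then have m: "y \<in> ?M" by auto
      show "\<psi> y \<in> {x \<in> ?M. p x = 1}" using y \<psi>M[OF m] by (simp only: mem_Collect_eq p_def \<gamma>(5)[OF m]) auto
    qed
  qed
  ultimately show ?thesis by (rule that)
qed

text \<open>\<open>CARD('n)\<close> is the dimension of the sphere plus one. Both spheres are
  compared with the standard one \<open>{1} \<times> unit_sphere\<close>, which is also why the
  fibre in the second claim is the one over 1.\<close>

theorem mainTheorem12:
  assumes "CARD('n::finite) \<ge> 2"
  shows "(\<forall>\<Sigma>1 \<in> (nonsep_spheres :: (complex \<times> (real ^ 'n)) set set). \<forall>\<Sigma>2 \<in> (nonsep_spheres :: (complex \<times> (real ^ 'n)) set set).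
            \<exists>\<phi> :: complex \<times> (real ^ 'n) \<Rightarrow> complex \<times> (real ^ 'n). diffeomorphism_betw S1_times_Sn S1_times_Sn \<phi> \<and> \<phi> ` \<Sigma>1 = \<Sigma>2)
       \<and> (\<forall>\<Sigma> \<in> (nonsep_spheres :: (complex \<times> (real ^ 'n)) set set).
            \<exists>p. smooth_fiber_bundle_circle S1_times_Sn p \<and> (\<exists>z\<in>circle. {x\<in>S1_times_Sn. p x = z} = \<Sigma>))"
proof (intro conjI ballI)
  fix \<Sigma>1 \<Sigma>2 :: "(complex \<times> (real ^ 'n)) set"
  assume s: "\<Sigma>1 \<in> nonsep_spheres" "\<Sigma>2 \<in> nonsep_spheres"
  let ?M = "S1_times_Sn :: (complex \<times> (real ^ 'n)) set"
  obtain \<psi>1 where 1: "diffeomorphism_betw ?M ?M \<psi>1" "\<psi>1 ` ({1} \<times> unit_sphere) = \<Sigma>1"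
    by (rule standard_sphere[OF assms s(1)]) (rule that; assumption)
  obtain \<psi>2 where 2: "diffeomorphism_betw ?M ?M \<psi>2" "\<psi>2 ` ({1} \<times> unit_sphere) = \<Sigma>2"
    by (rule standard_sphere[OF assms s(2)]) (rule that; assumption)
  obtain \<gamma> where \<gamma>: "diffeomorphism_betw ?M ?M \<gamma>" "\<And>x. x \<in> ?M \<Longrightarrow> \<gamma> (\<psi>1 x) = x"
    by (rule diffeomorphism_betw_inverse[OF 1(1)]) (rule that; assumption)
  have "(\<lambda>x. \<psi>2 (\<gamma> x)) ` \<Sigma>1 = \<psi>2 ` (\<lambda>x. \<gamma> (\<psi>1 x)) ` ({1} \<times> unit_sphere)"
    unfolding 1(2)[symmetric] image_image ..
  also have "(\<lambda>x. \<gamma> (\<psi>1 x)) ` ({1} \<times> unit_sphere) = (\<lambda>x. x) ` ({1} \<times> unit_sphere)"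
    by (rule image_cong[OF refl], rule \<gamma>(2)) auto
  finally have "(\<lambda>x. \<psi>2 (\<gamma> x)) ` \<Sigma>1 = \<Sigma>2" by (simp add: 2(2))
  with diffeomorphism_betw_compose[OF \<gamma>(1) 2(1)]
  show "\<exists>\<phi> :: complex \<times> (real ^ 'n) \<Rightarrow> complex \<times> (real ^ 'n). diffeomorphism_betw S1_times_Sn S1_times_Sn \<phi> \<and> \<phi> ` \<Sigma>1 = \<Sigma>2"
    by (intro exI[of _ "\<lambda>x. \<psi>2 (\<gamma> x)"] conjI)
next
  fix \<Sigma> :: "(complex \<times> (real ^ 'n)) set"
  assume s: "\<Sigma> \<in> nonsep_spheres"
  let ?M = "S1_times_Sn :: (complex \<times> (real ^ 'n)) set"
  obtain \<psi> where \<psi>: "diffeomorphism_betw ?M ?M \<psi>" "\<psi> ` ({1} \<times> unit_sphere) = \<Sigma>"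
    by (rule standard_sphere[OF assms s]) (rule that; assumption)
  obtain p where p: "smooth_fiber_bundle_circle ?M p" "{x \<in> ?M. p x = 1} = \<psi> ` ({1} \<times> unit_sphere)"
    by (rule bundle_of_diffeomorphism[OF \<psi>(1)]) (rule that; assumption)
  show "\<exists>p. smooth_fiber_bundle_circle S1_times_Sn p \<and> (\<exists>z\<in>circle. {x\<in>S1_times_Sn. p x = z} = \<Sigma>)"
    by (intro exI[of _ p] conjI p(1) bexI[of _ 1]) (simp_all only: p(2) \<psi>(2), simp)
qed


end
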